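(* Let $\Pi=\mathbb{R}/\mathbb{Z}$ be the circle, and let $\sigma,b\in C^2(\Pi)$ with $a:=\sigma^2/2>0$. Assume that $b$ takes both positive and negative values, that $b$ has finitely many zeros $x_1,\dots,x_n$, and that each zero $x_i$ of $b$ is either of finite order $m_i\ge1$ or flat. For $\varepsilon>0$ let $(X^\varepsilon_t)_{t\ge0}$ be the diffusion on $\Pi$ solving $dX^\varepsilon_t=\sqrt{\varepsilon}\,\sigma(X^\varepsilon_t)\,dW_t+b(X^\varepsilon_t)\,dt$ from a given initial point $x\in\Pi$, and let $\mu_T^\varepsilon:=\frac1T\int_0^T\delta_{X^\varepsilon_t}\,dt$ be its empirical measure. Then for every open set $O\subset P(\Pi)$ and every closed set $F\subset P(\Pi)$, $$\liminf_{\varepsilon\to0}\,\liminf_{T\to\infty}\frac1T\ln\mathbb{P}(\mu_T^\varepsilon\in O)\ge-\inf_{\mu\in O}J(\mu),$$ $$\limsup_{\varepsilon\to0}\,\limsup_{T\to\infty}\frac1T\ln\mathbb{P}(\mu_T^\varepsilon\in F)\le-\inf_{\mu\in F}J(\mu).$$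
   Context: A zero $x_i$ of $b$ is of finite order $m_i\ge1$ if $b$ is $C^{m_i}$ in a neighborhood of $x_i$, $b(x_i)=\dots=b^{(m_i-1)}(x_i)=0$ and $b^{(m_i)}(x_i)\ne0$. It is flat if $b$ is $C^\infty$ in a neighborhood of $x_i$ and $b^{(k)}(x_i)=0$ for all $k\in\mathbb{N}$. $P(\Pi)$ is the space of probability measures on $\Pi$ with the weak topology (convergence tested against $C^0(\Pi)$ functions), and $W$ is a standard Brownian motion. For $c\in C^0(\Pi)$ and $\varepsilon>0$, let $\lambda_\varepsilon^c$ be the principal eigenvalue (the eigenvalue with maximal real part) of the operator $u\mapsto\varepsilon\,a\,u''+b\,u'+c\,u$ on $\Pi$. Let $\Lambda(c):=\lim_{\varepsilon\to0}\lambda_\varepsilon^c$ (this limit exists under the present assumptions), and for $\mu\in P(\Pi)$ $$J(\mu):=\sup_{c\in C^0(\Pi)}\Bigl\{\int_\Pi c\,d\mu-\Lambda(c)\Bigr\}.$$ Conventions: $\inf\emptyset=+\infty$ and $\ln0=-\infty$. *)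

theory Defs
  imports "HOL-Probability.Probability" "HOL-Probability.Stopping_Time"
begin

section \<open>The circle\<close>

quotient_type circle = real / "\<lambda>x y. x - y \<in> \<int>"
proof (rule equivpI)
  show "reflp (\<lambda>x y::real. x - y \<in> \<int>)"
    by (simp add: reflp_def)
  show "symp (\<lambda>x y::real. x - y \<in> \<int>)"
  proof (rule sympI)
    fix x y :: real
    assume "x - y \<in> \<int>"
    then have "- (x - y) \<in> \<int>"
      by (rule Ints_minus)
    then show "y - x \<in> \<int>"
      by simp
  qed
  show "transp (\<lambda>x y::real. x - y \<in> \<int>)"
  proof (rule transpI)
    fix x y z :: real
    assume "x - y \<in> \<int>" "y - z \<in> \<int>"
    then have "(x - y) + (y - z) \<in> \<int>"
      by (rule Ints_add)
    then show "x - z \<in> \<int>"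
      by simp
  qed
qed

abbreviation to_circle :: "real \<Rightarrow> circle"
  where "to_circle \<equiv> abs_circle"

text \<open>The circle carries the quotient topology.\<close>

instantiation circle :: topological_space
begin

definition open_circle :: "circle set \<Rightarrow> bool"
  where "open_circle U \<longleftrightarrow> open (to_circle -` U)"

instance
proof
  show "open (UNIV :: circle set)"
    by (simp add: open_circle_def)
next
  fix S T :: "circle set"
  assume "open S" "open T"
  then show "open (S \<inter> T)"
    by (simp add: open_circle_def open_Int)
next
  fix K :: "circle set set"
  assume "\<forall>S\<in>K. open S"
  then have "open (\<Union>S\<in>K. to_circle -` S)"
    by (intro open_UN) (simp add: open_circle_def)
  then show "open (\<Union>K)"
    by (simp only: open_circle_def vimage_Union)
qed

end

text \<open>
  Functions on the circle are differentiated through their 1-periodic lifts; by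
  \<open>circle_deriv_to_circle\<close> below, the representative chosen here is irrelevant.
\<close>

definition circle_differentiable :: "(circle \<Rightarrow> 'a::real_normed_vector) \<Rightarrow> circle \<Rightarrow> bool"
  where "circle_differentiable f p \<longleftrightarrow> (\<lambda>x. f (to_circle x)) differentiable (at (rep_circle p))"

definition circle_deriv :: "(circle \<Rightarrow> 'a::real_normed_vector) \<Rightarrow> circle \<Rightarrow> 'a"
  where "circle_deriv f p = vector_derivative (\<lambda>x. f (to_circle x)) (at (rep_circle p))"

lemma to_circle_eq_iff: "to_circle x = to_circle y \<longleftrightarrow> x - y \<in> \<int>"
  by (rule circle.abs_eq_iff)

lemma has_vector_derivative_lift_cong:
  fixes f :: "circle \<Rightarrow> 'a::real_normed_vector"
  assumes eq: "to_circle x = to_circle y"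
    and D: "((\<lambda>x. f (to_circle x)) has_vector_derivative D) (at x)"
  shows "((\<lambda>x. f (to_circle x)) has_vector_derivative D) (at y)"
proof -
  have k: "x - y \<in> \<int>"
    using eq by (simp add: to_circle_eq_iff)
  have shift: "((\<lambda>z. z + (x - y)) has_vector_derivative 1) (at y)"
    by (auto intro!: derivative_eq_intros)
  have "((\<lambda>x. f (to_circle x)) has_vector_derivative D) (at (y + (x - y)))"
    using D by simp
  from vector_diff_chain_at[OF shift this]
  have "((\<lambda>z. f (to_circle (z + (x - y)))) has_vector_derivative D) (at y)"
    by (simp add: o_def)
  moreover have "to_circle (z + (x - y)) = to_circle z" for z
    using k by (simp add: to_circle_eq_iff)
  ultimately show ?thesis
    by simp
qed

lemma to_circle_rep: "to_circle (rep_circle p) = p"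
  by (rule Quotient3_abs_rep[OF Quotient3_circle])

lemma has_vector_derivative_lift_rep:
  "((\<lambda>x. f (to_circle x)) has_vector_derivative D) (at (rep_circle (to_circle x))) \<longleftrightarrow>
   ((\<lambda>x. f (to_circle x)) has_vector_derivative D) (at x)"
  using has_vector_derivative_lift_cong[of "rep_circle (to_circle x)" x f D]
    has_vector_derivative_lift_cong[of x "rep_circle (to_circle x)" f D]
  by (auto simp: to_circle_rep)

lemma circle_differentiable_to_circle:
  fixes f :: "circle \<Rightarrow> 'a::real_normed_vector"
  shows "circle_differentiable f (to_circle x) \<longleftrightarrow> (\<lambda>x. f (to_circle x)) differentiable (at x)"
proof -
  have iff: "g differentiable (at y) \<longleftrightarrow> (\<exists>D. (g has_vector_derivative D) (at y))"
    for g :: "real \<Rightarrow> 'a" and y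
    using vector_derivative_works differentiableI_vector by blast
  show ?thesis
    unfolding circle_differentiable_def iff has_vector_derivative_lift_rep ..
qed

lemma circle_deriv_to_circle:
  "circle_deriv f (to_circle x) = vector_derivative (\<lambda>x. f (to_circle x)) (at x)"
  by (simp add: circle_deriv_def vector_derivative_def has_vector_derivative_lift_rep)

text \<open>\<open>C_on k S f\<close>: the function \<open>f\<close> is of class $C^k$ on the open set \<open>S\<close>.\<close>

fun C_on :: "nat \<Rightarrow> circle set \<Rightarrow> (circle \<Rightarrow> 'a::real_normed_vector) \<Rightarrow> bool"
  where
    "C_on 0 S f \<longleftrightarrow> continuous_on S f"
  | "C_on (Suc k) S f \<longleftrightarrow> (\<forall>p\<in>S. circle_differentiable f p) \<and> C_on k S (circle_deriv f)"

definition zero_of_order :: "(circle \<Rightarrow> real) \<Rightarrow> nat \<Rightarrow> circle \<Rightarrow> bool"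
  where "zero_of_order b m p \<longleftrightarrow>
    m \<ge> 1 \<and> (\<exists>U. open U \<and> p \<in> U \<and> C_on m U b) \<and>
    (\<forall>k<m. (circle_deriv ^^ k) b p = 0) \<and> (circle_deriv ^^ m) b p \<noteq> 0"

definition flat_zero :: "(circle \<Rightarrow> real) \<Rightarrow> circle \<Rightarrow> bool"
  where "flat_zero b p \<longleftrightarrow>
    (\<exists>U. open U \<and> p \<in> U \<and> (\<forall>k. C_on k U b)) \<and> (\<forall>k. (circle_deriv ^^ k) b p = 0)"

section \<open>Probability measures on the circle\<close>

definition circle_probs :: "circle measure set"
  where "circle_probs = {\<mu>. prob_space \<mu> \<and> sets \<mu> = sets borel}"

text \<open>
  The coarsest topology making \<open>\<mu> \<mapsto> \<integral>c d\<mu>\<close> continuous for every continuous \<open>c\<close>; its underlying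
  set is \<^const>\<open>circle_probs\<close>.
\<close>

definition weak_topology :: "circle measure topology"
  where "weak_topology = topology_generated_by
    {{\<mu> \<in> circle_probs. integral\<^sup>L \<mu> c \<in> U} | (c :: circle \<Rightarrow> real) (U :: real set).
      continuous_on UNIV c \<and> open U}"

lemma topspace_weak_topology: "topspace weak_topology = circle_probs"
proof -
  have "circle_probs \<in> {{\<mu> \<in> circle_probs. integral\<^sup>L \<mu> c \<in> U}
      | (c :: circle \<Rightarrow> real) (U :: real set). continuous_on UNIV c \<and> open U}"
    by (rule CollectI, rule exI[of _ "\<lambda>_. 0"], rule exI[of _ UNIV]) simp
  then show ?thesis
    unfolding weak_topology_def topology_generated_by_topspace by blast
qed

section \<open>Principal eigenvalue and rate function\<close>

text \<open>
  Eigenvalues of \<open>u \<mapsto> \<epsilon> a u'' + b u' + c u\<close> acting on complex-valued $C^2$ functions on the circle.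
\<close>

definition eigenvalues ::
    "real \<Rightarrow> (circle \<Rightarrow> real) \<Rightarrow> (circle \<Rightarrow> real) \<Rightarrow> (circle \<Rightarrow> real) \<Rightarrow> complex set"
  where "eigenvalues \<epsilon> a b c =
    {z. \<exists>u :: circle \<Rightarrow> complex. C_on 2 UNIV u \<and> (\<exists>p. u p \<noteq> 0) \<and>
      (\<forall>p. (\<epsilon> * a p) *\<^sub>R circle_deriv (circle_deriv u) p + b p *\<^sub>R circle_deriv u p + c p *\<^sub>R u p
           = z * u p)}"

definition principal_eigenvalue ::
    "real \<Rightarrow> (circle \<Rightarrow> real) \<Rightarrow> (circle \<Rightarrow> real) \<Rightarrow> (circle \<Rightarrow> real) \<Rightarrow> complex"
  where "principal_eigenvalue \<epsilon> a b c =
    (THE z. z \<in> eigenvalues \<epsilon> a b c \<and> (\<forall>w\<in>eigenvalues \<epsilon> a b c. Re w \<le> Re z))"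

text \<open>The principal eigenvalue is real, so taking the real part only changes its type.\<close>

definition limit_eigenvalue ::
    "(circle \<Rightarrow> real) \<Rightarrow> (circle \<Rightarrow> real) \<Rightarrow> (circle \<Rightarrow> real) \<Rightarrow> real"
  where "limit_eigenvalue a b c = Lim (at_right 0) (\<lambda>\<epsilon>. Re (principal_eigenvalue \<epsilon> a b c))"

definition rate_function ::
    "(circle \<Rightarrow> real) \<Rightarrow> (circle \<Rightarrow> real) \<Rightarrow> circle measure \<Rightarrow> ereal"
  where "rate_function a b \<mu> =
    (SUP c \<in> {c. continuous_on UNIV c}. ereal (integral\<^sup>L \<mu> c - limit_eigenvalue a b c))"

section \<open>Brownian motion and stochastic integral\<close>

text \<open>
  Time is indexed by \<^typ>\<open>real\<close>, but only nonnegative times matter. In a locale instance,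
  \<open>W\<close> is a Brownian motion with respect to the filtration \<open>F\<close>.
\<close>

locale brownian_motion = prob_space M + filtration "space M" F
  for M :: "'w measure" and F :: "real \<Rightarrow> 'w measure" +
  fixes W :: "real \<Rightarrow> 'w \<Rightarrow> real"
  assumes F_subalgebra: "\<And>t. sets (F t) \<subseteq> sets M"
    and adapted: "\<And>t. 0 \<le> t \<Longrightarrow> W t \<in> borel_measurable (F t)"
    and start: "AE \<omega> in M. W 0 \<omega> = 0"
    and continuous_paths: "AE \<omega> in M. continuous_on {0..} (\<lambda>t. W t \<omega>)"
    and normal_increments: "\<And>s t. 0 \<le> s \<Longrightarrow> s < t \<Longrightarrow>
      distributed M lborel (\<lambda>\<omega>. W t \<omega> - W s \<omega>) (normal_density 0 (sqrt (t - s)))"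
    and indep_increments: "\<And>s t. 0 \<le> s \<Longrightarrow> s < t \<Longrightarrow>
      indep_set (sets (F s)) {(\<lambda>\<omega>. W t \<omega> - W s \<omega>) -` A \<inter> space M | A. A \<in> sets borel}"

text \<open>
  A simple integrand on $[0,t]$ takes the bounded, \<open>F (\<tau> j)\<close>-measurable value \<open>e j\<close> on
  $[\tau_j, \tau_{j+1})$, where $0 = \tau_0 \le \dots \le \tau_n = t$. The stochastic integral of a
  square-integrable adapted integrand is the mean-square limit of the integrals of simple ones.
\<close>

definition simple_integrand ::
    "'w measure \<Rightarrow> (real \<Rightarrow> 'w measure) \<Rightarrow> real \<Rightarrow> nat \<Rightarrow> (nat \<Rightarrow> real) \<Rightarrow> (nat \<Rightarrow> 'w \<Rightarrow> real) \<Rightarrow> bool"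
  where "simple_integrand M F t n \<tau> e \<longleftrightarrow>
    \<tau> 0 = 0 \<and> \<tau> n = t \<and> (\<forall>j<n. \<tau> j \<le> \<tau> (Suc j)) \<and>
    (\<forall>j<n. e j \<in> borel_measurable (F (\<tau> j)) \<and> (\<exists>C. \<forall>\<omega>\<in>space M. \<bar>e j \<omega>\<bar> \<le> C))"

definition simple_value ::
    "nat \<Rightarrow> (nat \<Rightarrow> real) \<Rightarrow> (nat \<Rightarrow> 'w \<Rightarrow> real) \<Rightarrow> real \<Rightarrow> 'w \<Rightarrow> real"
  where "simple_value n \<tau> e s \<omega> = (\<Sum>j<n. e j \<omega> * indicator {\<tau> j..<\<tau> (Suc j)} s)"

definition simple_integral ::
    "(real \<Rightarrow> 'w \<Rightarrow> real) \<Rightarrow> nat \<Rightarrow> (nat \<Rightarrow> real) \<Rightarrow> (nat \<Rightarrow> 'w \<Rightarrow> real) \<Rightarrow> 'w \<Rightarrow> real"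
  where "simple_integral W n \<tau> e \<omega> = (\<Sum>j<n. e j \<omega> * (W (\<tau> (Suc j)) \<omega> - W (\<tau> j) \<omega>))"

text \<open>\<open>I\<close> is a version of $\int_0^t H_s\,dW_s$.\<close>

definition has_ito_integral ::
    "'w measure \<Rightarrow> (real \<Rightarrow> 'w measure) \<Rightarrow> (real \<Rightarrow> 'w \<Rightarrow> real) \<Rightarrow> (real \<Rightarrow> 'w \<Rightarrow> real) \<Rightarrow> real
      \<Rightarrow> ('w \<Rightarrow> real) \<Rightarrow> bool"
  where "has_ito_integral M F W H t I \<longleftrightarrow>
    (\<forall>s\<in>{0..t}. H s \<in> borel_measurable (F s)) \<and>
    (\<lambda>(s, \<omega>). H s \<omega>) \<in> borel_measurable (restrict_space borel {0..t} \<Otimes>\<^sub>M M) \<and>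
    I \<in> borel_measurable M \<and>
    (\<exists>n \<tau> e. (\<forall>k. simple_integrand M F t (n k) (\<tau> k) (e k)) \<and>
      (\<lambda>k. \<integral>\<^sup>+\<omega>. (\<integral>\<^sup>+s\<in>{0..t}. ennreal ((H s \<omega> - simple_value (n k) (\<tau> k) (e k) s \<omega>)\<^sup>2) \<partial>lborel) \<partial>M)
        \<longlonglongrightarrow> 0 \<and>
      (\<lambda>k. \<integral>\<^sup>+\<omega>. ennreal ((I \<omega> - simple_integral W (n k) (\<tau> k) (e k) \<omega>)\<^sup>2) \<partial>M) \<longlonglongrightarrow> 0)"

section \<open>Diffusions on the circle and large deviations\<close>

text \<open>
  The process \<open>X\<close> solves $dX_t = \sigma(X_t)\,dW_t + b(X_t)\,dt$, $X_0 = x$, on the circle: it is the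
  projection of a continuous adapted real-valued process \<open>Y\<close> solving the equation whose
  coefficients are the 1-periodic lifts of \<open>\<sigma>\<close> and \<open>b\<close>.
\<close>

definition circle_diffusion ::
    "'w measure \<Rightarrow> (real \<Rightarrow> 'w measure) \<Rightarrow> (real \<Rightarrow> 'w \<Rightarrow> real) \<Rightarrow> (circle \<Rightarrow> real) \<Rightarrow> (circle \<Rightarrow> real)
      \<Rightarrow> circle \<Rightarrow> (real \<Rightarrow> 'w \<Rightarrow> circle) \<Rightarrow> bool"
  where "circle_diffusion M F W \<sigma> b x X \<longleftrightarrow>
    (AE \<omega> in M. X 0 \<omega> = x) \<and>
    (\<exists>Y :: real \<Rightarrow> 'w \<Rightarrow> real.
      (\<forall>t\<ge>0. Y t \<in> borel_measurable (F t)) \<and>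
      (\<forall>\<omega>\<in>space M. continuous_on {0..} (\<lambda>t. Y t \<omega>)) \<and>
      (\<forall>t\<ge>0. \<forall>\<omega>\<in>space M. X t \<omega> = to_circle (Y t \<omega>)) \<and>
      (\<forall>t\<ge>0. \<exists>I. has_ito_integral M F W (\<lambda>s \<omega>. \<sigma> (to_circle (Y s \<omega>))) t I \<and>
        (AE \<omega> in M. Y t \<omega> = Y 0 \<omega> + I \<omega> + integral {0..t} (\<lambda>s. b (to_circle (Y s \<omega>))))))"

text \<open>The empirical measure gives \<open>A\<close> the mass $\frac1T |\{t \in [0,T] : X_t(\omega) \in A\}|$.\<close>

definition empirical_measure :: "(real \<Rightarrow> 'w \<Rightarrow> circle) \<Rightarrow> real \<Rightarrow> 'w \<Rightarrow> circle measure"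
  where "empirical_measure X T \<omega> =
    distr (uniform_measure (restrict_space lborel {0..T}) {0..T}) borel (\<lambda>t. X t \<omega>)"

text \<open>Unlike \<^const>\<open>ln\<close> on the reals, this logarithm satisfies $\ln 0 = -\infty$.\<close>

definition eln :: "real \<Rightarrow> ereal"
  where "eln p = (if p = 0 then -\<infinity> else ereal (ln p))"

end

theory Submission
  imports Defs "HOL-Complex_Analysis.Great_Picard" "HOL-Real_Asymp.Real_Asymp"
begin

text \<open>
  Let $x_1, \dots, x_n$ be the zeros of \<open>b\<close> and $\beta_i = \max(b'(x_i), 0)$. The
  principal eigenvalue of $\epsilon a \partial^2 + b \partial + c$ converges to $\Lambda(c) =
  \max_i (c(x_i) - \beta_i)$: a Gaussian bump at $x_i$ is a subsolution, and a supersolution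
  \<open>exp \<psi>\<close> combines a periodic Lyapunov function for the flow of
  \<open>b\<close>, which exists because \<open>b\<close> changes sign, with logarithmic barriers
  at the unstable zeros. Consequently \<open>J\<close> equals $\sum_i w_i \beta_i$ on mixtures
  $\sum_i w_i \delta_{x_i}$ and is infinite elsewhere.

  If \<open>u > 0\<close> is the principal eigenfunction and \<open>\<lambda>\<close> its
  eigenvalue, then $u(X_t) \exp \int_0^t (c(X_s) - \lambda)\,ds$ is a martingale, so that $E \exp
  \int_s^t c(X_r)\,dr$ equals $e^{\lambda (t-s)}$ up to constants independent of time, also
  conditionally on the past. Only the bound $O(h^{3/2}) + o(1) h$ for increments over time
  \<open>h\<close> is needed for this, hence only second moments of increments of the stochastic
  integral.

  The upper bound is Chebyshev's inequality with $c = K b^2$, which forces the empirical measure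
  to concentrate at the zeros, and with $c = \max(b', 0)$. For the lower bound the diffusion is
  kept near $x_1, \dots, x_n$ in turn, for the times $w_i T$: with the penalty $c = - K \sin^2
  \pi(x - x_i)$ the exponential moment is at least $e^{-(\beta_i + o(1)) w_i T}$, while paths that
  spend a positive fraction of time away from $x_i$ contribute much less to it.
\<close>

section \<open>Periodic equations and the principal eigenfunction\<close>

text \<open>In one dimension the operator factors into two first-order operators, each solvable with
  an integrating factor, so the eigenfunction comes from explicit formulas, a contraction and the
  maximum principle. The stochastic integral is given for each time separately, as a mean-square
  limit; the martingale property is therefore read off a deterministic function: for a fixed event
  of the past, the expectation over it as a function of the final time has increments small compared
  with the time step, hence derivative zero. The order of limits shapes the rest: time tends to
  infinity first, so constants that depend on the noise level drop out and only exponents have to be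
  controlled. \<Lambda> is a maximum over finitely many points, which is why the rate is linear in
  the weights of a mixture and why two test functions decide the upper bound. In the lower bound
  each stay at a zero starts wherever the past has led, which is what the moment bounds conditional
  on the past are for.\<close>

definition periodic :: "(real \<Rightarrow> 'a) \<Rightarrow> bool"
  where "periodic f \<longleftrightarrow> (\<forall>x. f (x + 1) = f x)"

lemma periodicD: "periodic f \<Longrightarrow> f (x + 1) = f x"
  by (simp add: periodic_def)

lemma periodic_add_of_nat: "periodic f \<Longrightarrow> f (x + of_nat n) = f x"
proof (induction n)
  case (Suc n)
  then show ?case
    using periodicD[of f "x + of_nat n"] by (simp add: ac_simps)
qed simp

lemma periodic_add_of_int:
  assumes "periodic f"
  shows "f (x + of_int n) = f x"
proof (cases n)
  case (nonneg k)
  then show ?thesis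
    using periodic_add_of_nat[OF assms, of x k] by simp
next
  case (neg k)
  then show ?thesis
    using periodic_add_of_nat[OF assms, of "x + of_int n" "Suc k"] by simp
qed

lemma periodic_frac: "periodic f \<Longrightarrow> f (frac x) = f x"
  using periodic_add_of_int[of f x "- \<lfloor>x\<rfloor>"] by (simp add: frac_def)

lemma periodic_reduce:
  assumes "periodic f"
  obtains y where "y \<in> {0..1}" "f y = f x" "y \<in> {0..<1}"
  using periodic_frac[OF assms, of x] frac_ge_0[of x] frac_lt_1[of x]
  by (metis atLeastAtMost_iff atLeastLessThan_iff less_eq_real_def)

lemma periodic_attains_max:
  fixes f :: "real \<Rightarrow> real"
  assumes "periodic f" "continuous_on UNIV f"
  obtains x where "x \<in> {0..1}" "\<And>y. f y \<le> f x"
proof -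
  have "\<exists>x\<in>{0..1}. \<forall>y\<in>{0..1}. f y \<le> f x"
    using assms(2) continuous_on_subset by (intro continuous_attains_sup) auto
  then obtain x where "x \<in> {0..1}" "\<forall>y\<in>{0..1}. f y \<le> f x"
    by blast
  then show ?thesis
    using that periodic_reduce[OF assms(1)] by metis
qed

lemma periodic_attains_min:
  fixes f :: "real \<Rightarrow> real"
  assumes "periodic f" "continuous_on UNIV f"
  obtains x where "x \<in> {0..1}" "\<And>y. f x \<le> f y"
proof -
  have "periodic (\<lambda>x. - f x)" "continuous_on UNIV (\<lambda>x. - f x)"
    using assms by (auto simp: periodic_def intro: continuous_on_minus)
  then show ?thesis
    using that by (elim periodic_attains_max) auto
qed

lemma periodic_bounded:
  fixes f :: "real \<Rightarrow> 'a::real_normed_vector"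
  assumes "periodic f" "continuous_on UNIV f"
  obtains B where "B > 0" "\<And>x. norm (f x) \<le> B"
proof -
  have "periodic (\<lambda>x. norm (f x))" "continuous_on UNIV (\<lambda>x. norm (f x))"
    using assms by (auto simp: periodic_def intro: continuous_on_norm)
  then obtain x where x: "\<And>y. norm (f y) \<le> norm (f x)"
    by (elim periodic_attains_max) auto
  have "norm (f x) + 1 > 0"
    using norm_ge_zero[of "f x"] by linarith
  then show ?thesis
    by (rule that) (use x in \<open>simp add: add_increasing2\<close>)
qed

lemma periodic_pos_lower:
  fixes f :: "real \<Rightarrow> real"
  assumes "periodic f" "continuous_on UNIV f" "\<And>x. f x > 0"
  obtains m where "m > 0" "\<And>x. m \<le> f x"
  using periodic_attains_min[OF assms(1,2)] assms(3) by metis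

lemma periodic_deriv:
  fixes f :: "real \<Rightarrow> 'a::real_normed_vector"
  assumes "periodic f" "\<And>x. (f has_vector_derivative f' x) (at x)"
  shows "periodic f'"
  unfolding periodic_def
proof
  fix x
  have "((\<lambda>x. x + 1) has_vector_derivative 1) (at x)"
    by (auto intro!: derivative_eq_intros)
  from vector_diff_chain_at[OF this, of f "f' (x + 1)"] assms(2)
  have "(f \<circ> (\<lambda>x. x + 1) has_vector_derivative f' (x + 1)) (at x)"
    by simp
  moreover have "f \<circ> (\<lambda>x. x + 1) = f"
    using assms(1) by (auto simp: periodic_def)
  ultimately show "f' (x + 1) = f' x"
    using assms(2)[of x] vector_derivative_unique_at by metis
qed

lemma periodic_deriv_real:
  fixes f :: "real \<Rightarrow> real"
  assumes "periodic f" "\<And>x. (f has_real_derivative f' x) (at x)"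
  shows "periodic f'"
  using periodic_deriv[of f f'] assms by (simp add: has_real_derivative_iff_has_vector_derivative)

lemma has_derivative_continuous:
  assumes "\<And>x. (f has_real_derivative f' x) (at x)"
  shows "continuous_on UNIV f"
  using assms by (meson DERIV_continuous_on has_field_derivative_at_within)

lemma deriv_zero_at_max:
  assumes "(f has_real_derivative d) (at x)" "\<And>y. f y \<le> f x"
  shows "d = 0"
  by (rule DERIV_local_max[OF assms(1), of 1]) (use assms(2) in auto)

lemma deriv_zero_at_min:
  assumes "(f has_real_derivative d) (at x)" "\<And>y. f x \<le> f y"
  shows "d = 0"
  by (rule DERIV_local_min[OF assms(1), of 1]) (use assms(2) in auto)

text \<open>If \<open>d\<close> were positive, \<open>f'\<close> would be positive just to the right
  of the critical point, and the mean value theorem would carry \<open>f\<close> above its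
  maximum.\<close>

lemma second_deriv_local_max:
  fixes f :: "real \<Rightarrow> real"
  assumes "open U" "x \<in> U"
    and f: "\<And>y. y \<in> U \<Longrightarrow> (f has_real_derivative f' y) (at y)" "(f' has_real_derivative d) (at x)"
    and "\<And>y. y \<in> U \<Longrightarrow> f y \<le> f x"
  shows "f' x = 0" "d \<le> 0"
proof -
  obtain e where e: "e > 0" "ball x e \<subseteq> U"
    using assms(1,2) open_contains_ball by blast
  show f'x: "f' x = 0"
    by (rule DERIV_local_max[OF f(1)[OF assms(2)] e(1)]) (use e assms(5) in \<open>auto simp: dist_real_def subset_iff\<close>)
  show "d \<le> 0"
  proof (rule ccontr)
    assume "\<not> d \<le> 0"
    then obtain s where s: "s > 0" "\<And>h. h > 0 \<Longrightarrow> h < s \<Longrightarrow> f' x < f' (x + h)"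
      using DERIV_pos_inc_right[OF f(2)] by fastforce
    define t where "t = min e s / 2"
    have t: "t > 0" "t < e" "t < s"
      using e s by (auto simp: t_def min_def)
    have U: "y \<in> U" if "x \<le> y" "y \<le> x + t" for y
      using that t e(2) by (auto simp: subset_iff dist_real_def)
    have "\<exists>z>x. z < x + t \<and> f (x + t) - f x = (x + t - x) * f' z"
      by (rule MVT2) (use t U f(1) in auto)
    then obtain z where z: "z > x" "z < x + t" "f (x + t) - f x = t * f' z"
      by auto
    have "f' z > 0"
      using s(2)[of "z - x"] z t f'x by auto
    then have "f (x + t) > f x"
      using z t by (smt (verit) mult_pos_pos)
    then show False
      using assms(5)[of "x + t"] U[of "x + t"] t by force
  qed
qed

section \<open>Periodic solutions of linear equations of first and second order\<close>

definition C2 :: "(real \<Rightarrow> real) \<Rightarrow> (real \<Rightarrow> real) \<Rightarrow> (real \<Rightarrow> real) \<Rightarrow> bool"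
  where "C2 u u1 u2 \<longleftrightarrow> periodic u \<and> (\<forall>x. (u has_real_derivative u1 x) (at x)) \<and>
    (\<forall>x. (u1 has_real_derivative u2 x) (at x)) \<and> continuous_on UNIV u2"

lemma C2D:
  assumes "C2 u u1 u2"
  shows "periodic u" "periodic u1" "periodic u2"
    "(u has_real_derivative u1 x) (at x)" "(u1 has_real_derivative u2 x) (at x)"
    "continuous_on UNIV u" "continuous_on UNIV u1" "continuous_on UNIV u2"
proof -
  show 1: "periodic u" "(u has_real_derivative u1 x) (at x)" "(u1 has_real_derivative u2 x) (at x)"
    "continuous_on UNIV u2" for x
    using assms by (auto simp: C2_def)
  show 2: "periodic u1"
    using periodic_deriv_real 1 by blast
  then show "periodic u2"
    using periodic_deriv_real 1 by blast
  show "continuous_on UNIV u" "continuous_on UNIV u1"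
    using has_derivative_continuous 1 by blast+
qed

lemma continuous_antiderivative:
  fixes k :: "real \<Rightarrow> real"
  assumes k: "continuous_on UNIV k"
  obtains F where "F 0 = 0" "\<And>x. (F has_real_derivative k x) (at x)"
proof -
  define F where "F x = (if x \<ge> 0 then integral {0..x} k else - integral {x..0} k)" for x
  have "(F has_vector_derivative k x) (at x)" for x
  proof -
    \<comment> \<open>Starting the integral at a point below both 0 and \<open>x\<close> turns
      \<open>F\<close> near \<open>x\<close> into one integral minus a constant, so the case
      distinction at 0 disappears.\<close>
    define A where "A = - \<bar>x\<bar> - 1"
    have A: "A < x" "A < 0"
      by (auto simp: A_def)
    define B where "B = \<bar>x\<bar> + 1"
    have B: "x < B" "0 < B"
      by (auto simp: B_def)
    have k: "continuous_on {s..t} k" for s t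
      using k continuous_on_subset by blast
    have F: "F y = integral {A..y} k - integral {A..0} k" if "y \<in> {A..B}" for y
    proof (cases "y \<ge> 0")
      case True
      then have "integral {A..0} k + integral {0..y} k = integral {A..y} k"
        using A by (intro Henstock_Kurzweil_Integration.integral_combine) (auto intro: integrable_continuous_real k)
      then show ?thesis
        using True by (simp add: F_def)
    next
      case False
      then have "integral {A..y} k + integral {y..0} k = integral {A..0} k"
        using that by (intro Henstock_Kurzweil_Integration.integral_combine) (auto intro: integrable_continuous_real k)
      then show ?thesis
        using False by (simp add: F_def)
    qed
    have "((\<lambda>y. integral {A..y} k) has_vector_derivative k x) (at x within {A..B})"
      by (rule integral_has_vector_derivative[OF k]) (use A B in auto)
    then have "((\<lambda>y. integral {A..y} k - integral {A..0} k) has_vector_derivative k x) (at x within {A..B})"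
      by (auto intro!: derivative_eq_intros)
    then have "(F has_vector_derivative k x) (at x within {A..B})"
      by (rule has_vector_derivative_transform[rotated 2]) (use A B F in auto)
    then show ?thesis
      using A B by (simp add: at_within_Icc_at)
  qed
  then show ?thesis
    using that[of F] by (simp add: F_def has_real_derivative_iff_has_vector_derivative)
qed

text \<open>Variation of constants for \<open>g' + p g = f\<close>. Since \<open>p > 0\<close>, the
  homogeneous solution strictly decays over a period, so a suitable initial value makes the solution
  periodic. If \<open>f\<close> is nonnegative and not identically zero, that value is positive, and
  the formula gives positivity on one period.\<close>

lemma first_order_periodic:
  fixes p f :: "real \<Rightarrow> real"
  assumes p: "periodic p" "continuous_on UNIV p" "\<And>x. p x > 0"
    and f: "periodic f" "continuous_on UNIV f"
  obtains g where "periodic g" "\<And>x. (g has_real_derivative f x - p x * g x) (at x)"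
    "(\<forall>x. f x \<ge> 0) \<longrightarrow> (\<exists>x. f x > 0) \<longrightarrow> (\<forall>x. g x > 0)"
proof -
  obtain P where P: "P 0 = 0" "\<And>x. (P has_real_derivative p x) (at x)"
    by (rule continuous_antiderivative[OF p(2)], rule that)
  have contP: "continuous_on UNIV P"
    using P(2) has_derivative_continuous by blast
  have c: "continuous_on UNIV (\<lambda>x. exp (P x) * f x)"
    by (intro continuous_intros contP f)
  obtain I where I: "I 0 = 0" "\<And>x. (I has_real_derivative exp (P x) * f x) (at x)"
    by (rule continuous_antiderivative[OF c], rule that)
  have "P 0 < P 1"
    by (rule DERIV_pos_imp_increasing) (use P p in auto)
  then have P1: "P 1 > 0"
    by (simp add: P)
  \<comment> \<open>The initial value that solves \<open>g 1 = g 0\<close>; the denominator is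
    nonzero because \<open>P 1 > 0\<close>.\<close>
  define g0 where "g0 = I 1 / (exp (P 1) - 1)"
  define g where "g x = exp (- P x) * (g0 + I x)" for x
  have dg: "(g has_real_derivative f x - p x * g x) (at x)" for x
  proof -
    have "(g has_real_derivative (exp (- P x) * - p x) * (g0 + I x) + exp (- P x) * (exp (P x) * f x)) (at x)"
      unfolding g_def using P(2)[of x] I(2)[of x] by (auto intro!: derivative_eq_intros)
    then show ?thesis
      by (simp add: g_def algebra_simps exp_minus)
  qed
  have g1: "g 1 = g 0"
  proof -
    have "g0 * (exp (P 1) - 1) = I 1"
      using P1 by (simp add: g0_def)
    then have "g0 + I 1 = g0 * exp (P 1)"
      by (simp add: algebra_simps)
    then show ?thesis
      by (simp add: g_def P(1) I(1) exp_minus)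
  qed
  have shift: "((\<lambda>x. h (x + 1)) has_real_derivative d (x + 1)) (at x)"
    if "\<And>x. (h has_real_derivative d x) (at x)" for h d :: "real \<Rightarrow> real" and x
    using that[of "x + 1"] by (simp add: DERIV_shift)
  have per: "periodic g"
    unfolding periodic_def
  proof
    fix x
    \<comment> \<open>The shifted solution solves the same equation, so its difference from
      \<open>g\<close> times the integrating factor is constant. It vanishes at 0 by the choice of
      \<open>g0\<close>.\<close>
    define e where "e x = exp (P x) * (g (x + 1) - g x)" for x
    have "(e has_real_derivative 0) (at x)" for x
    proof -
      have "(e has_real_derivative exp (P x) * p x * (g (x + 1) - g x) +
          exp (P x) * ((f (x + 1) - p (x + 1) * g (x + 1)) - (f x - p x * g x))) (at x)"
        unfolding e_def by (auto intro!: derivative_eq_intros P(2) dg shift[of g])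
      moreover have "exp (P x) * p x * (g (x + 1) - g x) +
          exp (P x) * ((f (x + 1) - p (x + 1) * g (x + 1)) - (f x - p x * g x)) = 0"
        using periodicD[OF p(1), of x] periodicD[OF f(1), of x] by (simp add: algebra_simps)
      ultimately show ?thesis
        by simp
    qed
    then have "e x = e 0"
      by (metis DERIV_isconst_all)
    then show "g (x + 1) = g x"
      using g1 by (simp add: e_def)
  qed
  show ?thesis
  proof (rule that[OF per dg], intro impI allI)
    fix x
    assume f0: "\<forall>x. f x \<ge> 0" and "\<exists>x. f x > 0"
    then obtain y where y: "y \<in> {0..<1}" "f y > 0"
      using periodic_reduce[OF f(1)] by metis
    have mono: "I s \<le> I t" if "s \<le> t" for s t
      by (rule DERIV_nonneg_imp_nondecreasing[OF that]) (use I f0 in \<open>meson exp_ge_zero mult_nonneg_nonneg\<close>)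
    obtain s where s: "s > 0" "\<And>h. h > 0 \<Longrightarrow> h < s \<Longrightarrow> I y < I (y + h)"
      using DERIV_pos_inc_right[OF I(2)[of y]] y by (metis exp_gt_zero mult_pos_pos)
    define h where "h = min s (1 - y) / 2"
    have h: "h > 0" "h < s" "h < 1 - y"
      using s y by (auto simp: h_def min_def)
    have "I 0 \<le> I y" "I y < I (y + h)" "I (y + h) \<le> I 1"
      using y h s(2)[of h] by (auto intro!: mono)
    then have "g0 > 0"
      using P1 I(1) by (simp add: g0_def)
    moreover have "I z \<ge> 0" if "z \<ge> 0" for z
      using mono[OF that] I by simp
    ultimately have "g z > 0" if "z \<ge> 0" for z
      using that by (simp add: g_def add_pos_nonneg)
    then show "g x > 0"
      using periodic_frac[OF per, of x] frac_ge_0[of x] by metis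
  qed
qed


text \<open>At a maximum or a minimum the derivative vanishes, and there \<open>g\<close> equals
  \<open>f / p\<close>.\<close>

lemma first_order_bound:
  fixes p f g :: "real \<Rightarrow> real"
  assumes g: "periodic g" "\<And>x. (g has_real_derivative f x - p x * g x) (at x)"
    and p: "\<And>x. p x > 0" and fb: "\<And>x. \<bar>f x\<bar> \<le> D * p x"
  shows "\<bar>g x\<bar> \<le> D"
proof -
  have c: "continuous_on UNIV g"
    by (rule has_derivative_continuous[OF g(2)])
  obtain y where y: "\<And>x. g x \<le> g y"
    using periodic_attains_max[OF g(1) c] by blast
  have "f y - p y * g y = 0"
    by (rule deriv_zero_at_max[OF g(2)]) (use y in auto)
  then have "p y * g y \<le> p y * D"
    using fb[of y] by (simp add: algebra_simps abs_le_iff)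
  then have 1: "g y \<le> D"
    using p[of y] by simp
  obtain z where z: "\<And>x. g z \<le> g x"
    using periodic_attains_min[OF g(1) c] by blast
  have "f z - p z * g z = 0"
    by (rule deriv_zero_at_min[OF g(2)]) (use z in auto)
  then have "p z * (- D) \<le> p z * g z"
    using fb[of z] by (simp add: algebra_simps abs_le_iff)
  then have "- D \<le> g z"
    using p[of z] by (simp only: mult_le_cancel_left_pos)
  with 1 show ?thesis
    using y[of x] z[of x] by linarith
qed

text \<open>At a maximum of \<open>u\<close> the first derivative vanishes and the second is
  nonpositive, so the equation leaves \<open>q * u \<le> f\<close> there.\<close>

lemma periodic_max_principle:
  fixes u :: "real \<Rightarrow> real"
  assumes u: "C2 u u1 u2"
    and eq: "\<And>x. - u2 x - \<beta> x * u1 x + q x * u x = f x"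
    and q: "\<And>x. q x > 0" and f: "\<And>x. f x \<le> D * q x"
  shows "u x \<le> D"
proof -
  note u = C2D[OF u]
  obtain y where y: "\<And>x. u x \<le> u y"
    using periodic_attains_max[OF u(1,6)] by blast
  have "u1 y = 0" "u2 y \<le> 0"
    using second_deriv_local_max[of UNIV y u u1 "u2 y"] u y by auto
  then have "q y * u y \<le> q y * D"
    using eq[of y] f[of y] by (simp add: mult.commute)
  then show ?thesis
    using q[of y] y[of x] by simp
qed

lemma C2_linear:
  assumes "C2 u u1 u2" "C2 v v1 v2"
  shows "C2 (\<lambda>x. a * u x + b * v x) (\<lambda>x. a * u1 x + b * v1 x) (\<lambda>x. a * u2 x + b * v2 x)"
  unfolding C2_def
proof (intro conjI allI)
  note u = C2D[OF assms(1)] and v = C2D[OF assms(2)]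
  show "periodic (\<lambda>x. a * u x + b * v x)"
    using u(1) v(1) by (simp add: periodic_def)
  show "((\<lambda>x. a * u x + b * v x) has_real_derivative a * u1 x + b * v1 x) (at x)" for x
    by (intro DERIV_add DERIV_cmult u v)
  show "((\<lambda>x. a * u1 x + b * v1 x) has_real_derivative a * u2 x + b * v2 x) (at x)" for x
    by (intro DERIV_add DERIV_cmult u v)
  show "continuous_on UNIV (\<lambda>x. a * u2 x + b * v2 x)"
    using u(8) v(8) by (intro continuous_intros)
qed

lemma periodic_max_principle_abs:
  fixes u :: "real \<Rightarrow> real"
  assumes u: "C2 u u1 u2"
    and eq: "\<And>x. - u2 x - \<beta> x * u1 x + q x * u x = f x"
    and q: "\<And>x. q x > 0" and f: "\<And>x. \<bar>f x\<bar> \<le> D * q x"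
  shows "\<bar>u x\<bar> \<le> D"
proof -
  have "u x \<le> D"
    by (rule periodic_max_principle[OF u eq q]) (use f in \<open>auto simp: abs_le_iff\<close>)
  moreover have "- u x \<le> D"
    by (rule periodic_max_principle[where q = q and \<beta> = \<beta> and f = "\<lambda>x. - f x" and u = "\<lambda>x. - u x"])
      (use C2_linear[OF u u, of "-1" 0] f q eq[symmetric] in \<open>auto simp: abs_le_iff\<close>)
  ultimately show ?thesis
    by auto
qed

text \<open>
  The operator $-\partial^2 - \beta\partial + k(k+\beta)$ factors as
  $(\partial + \beta + k)(k - \partial)$, and both factors have positive periodic inverses.
\<close>

lemma factored_solve:
  fixes \<beta> f :: "real \<Rightarrow> real"
  assumes \<beta>: "periodic \<beta>" "continuous_on UNIV \<beta>" and k: "k > 0" "\<And>x. k + \<beta> x > 0"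
    and f: "periodic f" "continuous_on UNIV f"
  obtains u u1 u2 where "C2 u u1 u2" "\<And>x. - u2 x - \<beta> x * u1 x + (k * (k + \<beta> x)) * u x = f x"
    "(\<forall>x. f x \<ge> 0) \<longrightarrow> (\<exists>x. f x > 0) \<longrightarrow> (\<forall>x. u x > 0)"
proof -
  have 1: "periodic (\<lambda>x. k + \<beta> x)" "continuous_on UNIV (\<lambda>x. k + \<beta> x)"
    using \<beta> by (auto simp: periodic_def intro!: continuous_intros)
  obtain g where g: "periodic g" "\<And>x. (g has_real_derivative f x - (k + \<beta> x) * g x) (at x)"
    "(\<forall>x. f x \<ge> 0) \<longrightarrow> (\<exists>x. f x > 0) \<longrightarrow> (\<forall>x. g x > 0)"
    by (rule first_order_periodic[OF 1 k(2) f], rule that)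
  have cg: "continuous_on UNIV g"
    by (rule has_derivative_continuous[OF g(2)])
  \<comment> \<open>The factor \<open>k u - u' = g\<close> has the opposite sign in front of the
    derivative; for \<open>v x = u (- x)\<close> it becomes \<open>v' + k v = g (- x)\<close>, an
    equation of the kind already solved.\<close>
  have pneg: "periodic (\<lambda>x. h (- x))" if "periodic h" for h :: "real \<Rightarrow> real"
    unfolding periodic_def
  proof
    fix x
    show "h (- (x + 1)) = h (- x)"
      using periodicD[OF that, of "- (x + 1)"] by simp
  qed
  have 2: "continuous_on UNIV (\<lambda>x. g (- x))"
    by (rule continuous_on_compose2[OF cg]) (auto intro!: continuous_intros)
  have 3: "periodic (\<lambda>_::real. k)" "continuous_on UNIV (\<lambda>_::real. k)" "\<And>x::real. k > 0"
    using k(1) by (auto simp: periodic_def)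
  obtain v where v: "periodic v" "\<And>x. (v has_real_derivative g (- x) - k * v x) (at x)"
    "(\<forall>x. g (- x) \<ge> 0) \<longrightarrow> (\<exists>x. g (- x) > 0) \<longrightarrow> (\<forall>x. v x > 0)"
    by (rule first_order_periodic[OF 3 pneg[OF g(1)] 2], rule that)
  define u where "u x = v (- x)" for x
  define u1 where "u1 x = k * u x - g x" for x
  define u2 where "u2 x = k * u1 x - (f x - (k + \<beta> x) * g x)" for x
  have d: "(u has_real_derivative u1 x) (at x)" for x
    unfolding u_def u1_def
    using v(2)[of "- x", unfolded DERIV_mirror] by simp
  have d2: "(u1 has_real_derivative u2 x) (at x)" for x
    unfolding u2_def u1_def[abs_def]
    using d[of x] g(2)[of x] by (auto intro!: derivative_eq_intros simp: u1_def)
  have cu: "continuous_on UNIV u"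
    using d has_derivative_continuous by blast
  have "continuous_on UNIV u2"
    unfolding u2_def u1_def using f(2) \<beta>(2) cu cg by (intro continuous_intros)
  then have "C2 u u1 u2"
    unfolding C2_def using pneg[OF v(1)] d d2 by (simp add: u_def[abs_def])
  moreover have "- u2 x - \<beta> x * u1 x + (k * (k + \<beta> x)) * u x = f x" for x
    by (simp add: u2_def u1_def algebra_simps)
  moreover have "(\<forall>x. f x \<ge> 0) \<longrightarrow> (\<exists>x. f x > 0) \<longrightarrow> (\<forall>x. u x > 0)"
    unfolding u_def using v(3) g(3) by (meson less_imp_le)
  ultimately show ?thesis
    using that by blast
qed

text \<open>The space on which the contraction for the general second-order equation acts;
  periodicity survives uniform limits.\<close>

lemma bcontfun_periodic_complete: "Topological_Spaces.complete {\<phi> :: real \<Rightarrow>\<^sub>C real. periodic (apply_bcontfun \<phi>)}"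
proof -
  have "closed {\<phi> :: real \<Rightarrow>\<^sub>C real. periodic (apply_bcontfun \<phi>)}"
  proof (rule closed_sequential_limits[THEN iffD2, rule_format])
    fix \<Phi> :: "nat \<Rightarrow> real \<Rightarrow>\<^sub>C real" and \<phi>
    assume *: "(\<forall>n. \<Phi> n \<in> {\<phi>. periodic (apply_bcontfun \<phi>)}) \<and> \<Phi> \<longlonglongrightarrow> \<phi>"
    have lim: "(\<lambda>n. \<Phi> n x) \<longlonglongrightarrow> \<phi> x" for x
    proof (rule metric_LIMSEQ_I)
      fix e :: real
      assume "e > 0"
      then obtain N where "\<And>n. n \<ge> N \<Longrightarrow> dist (\<Phi> n) \<phi> < e"
        using * metric_LIMSEQ_D by blast
      then show "\<exists>N. \<forall>n\<ge>N. dist (\<Phi> n x) (\<phi> x) < e"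
        by (meson dist_bounded le_less_trans)
    qed
    have "\<phi> (x + 1) = \<phi> x" for x
      using lim[of "x + 1"] lim[of x] * by (auto simp: periodic_def intro: LIMSEQ_unique)
    then show "\<phi> \<in> {\<phi>. periodic (apply_bcontfun \<phi>)}"
      by (simp add: periodic_def)
  qed
  then show ?thesis
    by (simp add: complete_eq_closed)
qed

text \<open>The coefficient \<open>q\<close> is replaced by
  \<open>r = k (k + \<beta>) \<ge> q\<close>, for which the operator factors, and the difference is
  moved to the right-hand side. By the maximum principle the resulting fixed-point map contracts
  with factor \<open>1 - m\<close>, where \<open>m\<close> is a positive lower bound of
  \<open>q / r\<close>.\<close>

lemma second_order_solve:
  fixes \<beta> f q :: "real \<Rightarrow> real"
  assumes \<beta>: "periodic \<beta>" "continuous_on UNIV \<beta>"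
    and q: "periodic q" "continuous_on UNIV q" "\<And>x. q x > 0"
    and f: "periodic f" "continuous_on UNIV f"
  obtains u u1 u2 where "C2 u u1 u2" "\<And>x. - u2 x - \<beta> x * u1 x + q x * u x = f x"
    "(\<forall>x. f x \<ge> 0) \<longrightarrow> (\<exists>x. f x > 0) \<longrightarrow> (\<forall>x. u x > 0)"
proof -
  obtain B where B: "B > 0" "\<And>x. norm (\<beta> x) \<le> B"
    using periodic_bounded[OF \<beta>] by blast
  obtain Q where Q: "Q > 0" "\<And>x. norm (q x) \<le> Q"
    using periodic_bounded[OF q(1,2)] by blast
  \<comment> \<open>Large enough for \<open>k + \<beta> \<ge> 1\<close> and
    \<open>k \<ge> Q\<close>, so that \<open>r \<ge> k \<ge> Q \<ge> q\<close>.\<close>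
  define k where "k = B + 1 + Q"
  define r where "r x = k * (k + \<beta> x)" for x
  have k: "k > 0" "k + \<beta> x \<ge> 1" for x
    using B(1) Q(1) B(2)[of x] by (auto simp: k_def abs_le_iff)
  then have k': "k + \<beta> x > 0" for x
    using less_le_trans zero_less_one by blast
  have kQ: "k \<ge> Q" using B Q by (simp add: k_def)
  have r: "r x > 0" "q x \<le> r x" for x
  proof -
    show "r x > 0"
      using k' k by (simp add: r_def)
    have "Q * 1 \<le> k * (k + \<beta> x)"
      using k kQ Q by (intro mult_mono) auto
    then show "q x \<le> r x"
      using Q(2)[of x] by (simp add: r_def)
  qed
  have rp: "periodic r" "continuous_on UNIV r"
    using \<beta> by (auto simp: r_def periodic_def intro!: continuous_intros)
  have qr: "periodic (\<lambda>x. q x / r x)" "continuous_on UNIV (\<lambda>x. q x / r x)" "\<And>x. q x / r x > 0"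
    using q rp r(1) by (auto simp: periodic_def less_imp_neq[OF r(1), symmetric] intro!: continuous_intros)
  obtain m where m: "m > 0" "\<And>x. m \<le> q x / r x"
    by (rule periodic_pos_lower[OF qr], rule that)
  have qm: "r x - q x \<le> (1 - m) * r x" for x
    using m(2)[of x] r(1)[of x] by (simp add: field_simps)
  have m1: "m \<le> 1"
    using order_trans[OF m(2)[of 0], of 1] r[of 0] by simp
  let ?S = "{\<phi> :: real \<Rightarrow>\<^sub>C real. periodic (apply_bcontfun \<phi>)}"
  have solve: "\<exists>v v1 v2 u. C2 v v1 v2 \<and> (\<forall>x. - v2 x - \<beta> x * v1 x + r x * v x = f x + (r x - q x) * \<phi> x)
      \<and> u \<in> ?S \<and> apply_bcontfun u = v" if "\<phi> \<in> ?S" for \<phi>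
  proof -
    have "continuous_on UNIV (apply_bcontfun \<phi>)"
      by simp
    then have pc: "periodic (\<lambda>x. f x + (r x - q x) * \<phi> x)" "continuous_on UNIV (\<lambda>x. f x + (r x - q x) * \<phi> x)"
      using that f q rp by (auto simp: periodic_def intro!: continuous_intros)
    obtain v v1 v2 where v: "C2 v v1 v2"
        "\<And>x. - v2 x - \<beta> x * v1 x + (k * (k + \<beta> x)) * v x = f x + (r x - q x) * \<phi> x"
      by (rule factored_solve[OF \<beta> k(1) k' pc], rule that)
    note v = v(1) v(2)[folded r_def]
    note v' = C2D[OF v(1)]
    obtain V where "\<And>x. norm (v x) \<le> V"
      using periodic_bounded[OF v'(1,6)] by blast
    then have "v \<in> bcontfun"
      using v'(6) by (auto simp: bcontfun_def bounded_iff)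
    then have "apply_bcontfun (Bcontfun v) = v"
      by (simp add: Bcontfun_inverse)
    then show ?thesis
      using v v'(1) by (intro exI[of _ v] exI[of _ v1] exI[of _ v2] exI[of _ "Bcontfun v"]) simp
  qed
  define \<Psi> where "\<Psi> \<phi> = (SOME u. \<exists>v v1 v2. C2 v v1 v2 \<and>
      (\<forall>x. - v2 x - \<beta> x * v1 x + r x * v x = f x + (r x - q x) * \<phi> x) \<and> u \<in> ?S \<and> apply_bcontfun u = v)"
    for \<phi> :: "real \<Rightarrow>\<^sub>C real"
  have \<Psi>: "\<exists>v1 v2. C2 (\<Psi> \<phi>) v1 v2 \<and>
      (\<forall>x. - v2 x - \<beta> x * v1 x + r x * \<Psi> \<phi> x = f x + (r x - q x) * \<phi> x) \<and> \<Psi> \<phi> \<in> ?S"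
    if "\<phi> \<in> ?S" for \<phi>
  proof -
    have "\<exists>u v v1 v2. C2 v v1 v2 \<and>
      (\<forall>x. - v2 x - \<beta> x * v1 x + r x * v x = f x + (r x - q x) * \<phi> x) \<and> u \<in> ?S \<and> apply_bcontfun u = v"
      using solve[OF that] by blast
    from someI_ex[OF this] show ?thesis
      unfolding \<Psi>_def by blast
  qed
  have contr: "dist (\<Psi> \<phi>) (\<Psi> \<psi>) \<le> (1 - m) * dist \<phi> \<psi>" if S: "\<phi> \<in> ?S" "\<psi> \<in> ?S" for \<phi> \<psi>
  proof (rule dist_bound)
    fix x
    obtain v1 v2 where v: "C2 (\<Psi> \<phi>) v1 v2"
      "\<And>x. - v2 x - \<beta> x * v1 x + r x * \<Psi> \<phi> x = f x + (r x - q x) * \<phi> x"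
      using \<Psi>[OF S(1)] by blast
    obtain w1 w2 where w: "C2 (\<Psi> \<psi>) w1 w2"
      "\<And>x. - w2 x - \<beta> x * w1 x + r x * \<Psi> \<psi> x = f x + (r x - q x) * \<psi> x"
      using \<Psi>[OF S(2)] by blast
    have "\<bar>1 * \<Psi> \<phi> x + (- 1) * \<Psi> \<psi> x\<bar> \<le> (1 - m) * dist \<phi> \<psi>"
    proof (rule periodic_max_principle_abs[OF C2_linear[OF v(1) w(1)], where q = r and \<beta> = \<beta>
          and f = "\<lambda>x. (r x - q x) * (\<phi> x - \<psi> x)"])
      show "- (1 * v2 x + - 1 * w2 x) - \<beta> x * (1 * v1 x + - 1 * w1 x) +
          r x * (1 * \<Psi> \<phi> x + - 1 * \<Psi> \<psi> x) = (r x - q x) * (\<phi> x - \<psi> x)" for x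
        using v(2)[of x] w(2)[of x] by (simp add: algebra_simps)
      show "\<bar>(r x - q x) * (\<phi> x - \<psi> x)\<bar> \<le> (1 - m) * dist \<phi> \<psi> * r x" for x
      proof -
        have "\<bar>r x - q x\<bar> * \<bar>\<phi> x - \<psi> x\<bar> \<le> ((1 - m) * r x) * dist \<phi> \<psi>"
          using r(2)[of x] qm[of x] dist_bounded[of \<phi> x \<psi>] r(1)[of x] m1
          by (intro mult_mono) (auto simp: dist_real_def)
        then show ?thesis
          by (simp add: abs_mult mult_ac)
      qed
    qed (use r in auto)
    then show "dist (\<Psi> \<phi> x) (\<Psi> \<psi> x) \<le> (1 - m) * dist \<phi> \<psi>"
      by (simp add: dist_real_def)
  qed
  have "\<exists>!\<phi>\<in>?S. \<Psi> \<phi> = \<phi>"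
  proof (rule Banach_fix[OF bcontfun_periodic_complete, where c = "1 - m"])
    show "?S \<noteq> {}"
    proof -
      have "(0 :: real \<Rightarrow>\<^sub>C real) \<in> ?S"
        by (simp add: periodic_def)
      then show ?thesis
        by blast
    qed
    show "\<Psi> ` ?S \<subseteq> ?S"
      using \<Psi> by blast
  qed (use m m1 contr in auto)
  then obtain \<phi> where \<phi>: "\<phi> \<in> ?S" "\<Psi> \<phi> = \<phi>"
    by blast
  then obtain u1 u2 where u: "C2 \<phi> u1 u2"
    "\<And>x. - u2 x - \<beta> x * u1 x + r x * \<phi> x = f x + (r x - q x) * \<phi> x"
    using \<Psi>[OF \<phi>(1)] unfolding \<phi>(2) by blast
  then have eq: "- u2 x - \<beta> x * u1 x + q x * \<phi> x = f x" for x
    by (simp add: algebra_simps)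
  show ?thesis
  proof (rule that[OF u(1) eq], intro impI allI)
    fix x
    assume f0: "\<forall>x. f x \<ge> 0" and "\<exists>x. f x > 0"
    have f0': "\<And>x. f x \<ge> 0"
      using f0 by blast
    \<comment> \<open>The maximum principle yields only \<open>\<phi> \<ge> 0\<close>. Strict
      positivity comes from the factored problem with right-hand side
      \<open>f + (r - q) \<phi> \<ge> f\<close>: its solution \<open>v\<close> is strictly positive
      and coincides with \<open>\<phi>\<close>.\<close>
    have \<phi>0: "- \<phi> y \<le> 0" for y
    proof (rule periodic_max_principle[where q = q and \<beta> = \<beta> and f = "\<lambda>x. - f x" and u = "\<lambda>x. - \<phi> x"])
      show "C2 (\<lambda>x. - \<phi> x) (\<lambda>x. - u1 x) (\<lambda>x. - u2 x)"
        using C2_linear[OF u(1) u(1), of "-1" 0] by simp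
      show "- (- u2 x) - \<beta> x * - u1 x + q x * - \<phi> x = - f x" for x
        using eq[of x] by linarith
      show "- f x \<le> 0 * q x" for x
        using f0' by simp
    qed (rule q)
    have nn: "0 \<le> f y + (r y - q y) * \<phi> y" "f y \<le> f y + (r y - q y) * \<phi> y" for y
    proof -
      have "0 \<le> (r y - q y) * \<phi> y"
        using r(2)[of y] \<phi>0[of y] by simp
      then show "0 \<le> f y + (r y - q y) * \<phi> y" "f y \<le> f y + (r y - q y) * \<phi> y"
        using f0[rule_format, of y] by linarith+
    qed
    have pc: "periodic (\<lambda>x. f x + (r x - q x) * \<phi> x)" "continuous_on UNIV (\<lambda>x. f x + (r x - q x) * \<phi> x)"
      using C2D[OF u(1)] f q rp by (auto simp: periodic_def intro!: continuous_intros)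
    obtain v v1 v2 where v: "C2 v v1 v2"
        "\<And>x. - v2 x - \<beta> x * v1 x + (k * (k + \<beta> x)) * v x = f x + (r x - q x) * \<phi> x"
        "(\<forall>x. 0 \<le> f x + (r x - q x) * \<phi> x) \<longrightarrow> (\<exists>x. 0 < f x + (r x - q x) * \<phi> x) \<longrightarrow> (\<forall>x. v x > 0)"
      by (rule factored_solve[OF \<beta> k(1) k' pc], rule that)
    have "v x > 0" for x
      using v(3) nn \<open>\<exists>x. f x > 0\<close> less_le_trans by blast
    note v = v(1) v(2)[folded r_def] this
    have "\<bar>1 * \<phi> x + (- 1) * v x\<bar> \<le> 0"
    proof (rule periodic_max_principle_abs[OF C2_linear[OF u(1) v(1)], where q = r and \<beta> = \<beta> and f = "\<lambda>x. 0"])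
      show "- (1 * u2 x + - 1 * v2 x) - \<beta> x * (1 * u1 x + - 1 * v1 x) +
          r x * (1 * \<phi> x + - 1 * v x) = 0" for x
        using v(2)[of x] u(2)[of x] by (simp add: algebra_simps)
    qed (use r in auto)
    then show "\<phi> x > 0"
      using v(3)[of x] by simp
  qed
qed


section \<open>Positive operators and the principal eigenfunction\<close>

definition PC :: "(real \<Rightarrow> real) set"
  where "PC = {f. periodic f \<and> continuous_on UNIV f}"

lemma PC_lin: "f \<in> PC \<Longrightarrow> g \<in> PC \<Longrightarrow> (\<lambda>x. a * f x + b * g x) \<in> PC"
  by (auto simp: PC_def periodic_def intro!: continuous_intros)

lemma PC_D:
  assumes "f \<in> PC"
  shows "periodic f" "continuous_on UNIV f"
  using assms by (auto simp: PC_def)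

lemma PC_const: "(\<lambda>_. c) \<in> PC"
  by (auto simp: PC_def periodic_def)

text \<open>Arzela-Ascoli on one period; the limit is extended periodically, and uniform convergence
  extends with it.\<close>

lemma PC_precompact:
  fixes \<U> :: "nat \<Rightarrow> real \<Rightarrow> real"
  assumes \<U>: "\<And>n. periodic (\<U> n)"
    and bd: "\<And>n x. \<bar>\<U> n x\<bar> \<le> B" and lip: "\<And>n x y. \<bar>\<U> n x - \<U> n y\<bar> \<le> L * \<bar>x - y\<bar>"
  obtains h k where "h \<in> PC" "strict_mono (k :: nat \<Rightarrow> nat)"
    "\<And>e. e > 0 \<Longrightarrow> \<exists>N. \<forall>n\<ge>N. \<forall>x. \<bar>\<U> (k n) x - h x\<bar> < e"
proof -
  have L: "L \<ge> 0"
    using lip[of 0 0 1] by simp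
  have equi: "\<exists>d>0. \<forall>n y. y \<in> {0..1} \<and> norm (x - y) < d \<longrightarrow> norm (\<U> n x - \<U> n y) < e"
    if "e > 0" for x e
  proof (intro exI[of _ "e / (L + 1)"] conjI allI impI)
    show "e / (L + 1) > 0"
      using that L by simp
    fix n y
    assume "y \<in> {0..1} \<and> norm (x - y) < e / (L + 1)"
    then have "(L + 1) * \<bar>x - y\<bar> < e"
      using L by (simp add: field_simps)
    moreover have "L * \<bar>x - y\<bar> \<le> (L + 1) * \<bar>x - y\<bar>"
      by (intro mult_right_mono) auto
    ultimately show "norm (\<U> n x - \<U> n y) < e"
      using lip[of n x y] by simp
  qed
  obtain g k where k: "strict_mono (k :: nat \<Rightarrow> nat)"
    and g: "\<And>e. 0 < e \<Longrightarrow> \<exists>N. \<forall>n x. n \<ge> N \<and> x \<in> {0..1} \<longrightarrow> norm (\<U> (k n) x - g x) < e"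
    by (rule Arzela_Ascoli[of "{0..1}" \<U> B]) (use bd equi in auto)
  define h where "h x = g (frac x)" for x
  have conv: "\<exists>N. \<forall>n\<ge>N. \<forall>x. \<bar>\<U> (k n) x - h x\<bar> < e" if "e > 0" for e
  proof -
    obtain N where N: "\<And>n x. n \<ge> N \<Longrightarrow> x \<in> {0..1} \<Longrightarrow> norm (\<U> (k n) x - g x) < e"
      using g[OF \<open>e > 0\<close>] by blast
    have "\<bar>\<U> (k n) x - h x\<bar> < e" if "n \<ge> N" for n x
      using N[OF that, of "frac x"] frac_ge_0[of x] frac_lt_1[of x] periodic_frac[OF \<U>, of "k n" x]
      by (simp add: h_def)
    then show ?thesis
      by blast
  qed
  have "uniform_limit UNIV (\<lambda>n. \<U> (k n)) h sequentially"
    unfolding uniform_limit_iff eventually_sequentially dist_real_def using conv by blast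
  moreover have "continuous_on UNIV (\<U> n)" for n
    by (rule lipschitz_on_continuous_on[of L]) (use lip L in \<open>auto simp: lipschitz_on_def dist_real_def\<close>)
  ultimately have "continuous_on UNIV h"
    by (intro uniform_limit_theorem[of _ "\<lambda>n. \<U> (k n)"]) auto
  moreover have "periodic h"
    by (simp add: periodic_def h_def frac_1_eq)
  ultimately show ?thesis
    using that[of h k] k conv by (auto simp: PC_def)
qed

text \<open>
  A Krein-Rutman theorem for compact, strongly positive operators. The eigenvalue is the largest
  \<open>r\<close> with \<open>r f \<le> G f\<close> for some nonnegative \<open>f \<noteq> 0\<close>.
\<close>

lemma positive_operator_eigenfunction:
  fixes G :: "(real \<Rightarrow> real) \<Rightarrow> real \<Rightarrow> real"
  assumes G: "\<And>f. f \<in> PC \<Longrightarrow> G f \<in> PC"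
    and lin: "\<And>f g a b x. f \<in> PC \<Longrightarrow> g \<in> PC \<Longrightarrow> G (\<lambda>x. a * f x + b * g x) x = a * G f x + b * G g x"
    and pos: "\<And>f x. f \<in> PC \<Longrightarrow> \<forall>x. f x \<ge> 0 \<Longrightarrow> \<exists>x. f x > 0 \<Longrightarrow> G f x > 0"
    and lip: "\<And>f x y. f \<in> PC \<Longrightarrow> \<forall>x. \<bar>f x\<bar> \<le> 1 \<Longrightarrow> \<bar>G f x - G f y\<bar> \<le> L * \<bar>x - y\<bar>"
  obtains r h where "r > 0" "h \<in> PC" "\<And>x. h x > 0" "\<And>x. G h x = r * h x"
proof -
  have cmult: "G (\<lambda>x. a * f x) x = a * G f x" if "f \<in> PC" for f a x
    using lin[OF that that, of a 0] by simp
  have diff: "G (\<lambda>x. f x - a * g x) x = G f x - a * G g x" if "f \<in> PC" "g \<in> PC" for f g a x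
    using lin[OF that, of 1 "-a"] by simp
  have PC_diff: "(\<lambda>x. f x - a * g x) \<in> PC" if "f \<in> PC" "g \<in> PC" for f g a
    using PC_lin[OF that, of 1 "-a"] by simp
  have nonneg: "G f x \<ge> 0" if "f \<in> PC" "\<forall>x. f x \<ge> 0" for f x
  proof (cases "\<exists>x. f x > 0")
    case True
    then show ?thesis
      using pos that less_imp_le by blast
  next
    case False
    then have "f = (\<lambda>x. 0 * f x)"
      using that by (auto simp: fun_eq_iff not_less intro: antisym)
    then show ?thesis
      using cmult[OF that(1), of 0 x] by simp
  qed
  have mono: "G f x \<le> G g x" if "f \<in> PC" "g \<in> PC" "\<forall>x. f x \<le> g x" for f g x
    using nonneg[OF PC_diff[OF that(2,1), of 1], of x] diff[OF that(2,1), of 1 x] that(3) by simp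
  define e1 where "e1 = (\<lambda>_::real. 1::real)"
  have e1: "e1 \<in> PC"
    by (simp add: e1_def PC_const)
  obtain C where C: "C > 0" "\<And>x. G e1 x \<le> C"
  proof -
    obtain C where "C > 0" "\<And>x. norm (G e1 x) \<le> C"
      by (rule periodic_bounded[OF PC_D[OF G[OF e1]]], rule that)
    then show ?thesis
      using that[of C] by (simp add: abs_le_iff)
  qed
  obtain m where m: "m > 0" "\<And>x. m \<le> G e1 x"
  proof -
    have "G e1 x > 0" for x
      using pos[OF e1] by (simp add: e1_def)
    from periodic_pos_lower[OF PC_D[OF G[OF e1]] this] show ?thesis
      using that .
  qed
  have bound: "\<bar>G f x\<bar> \<le> C * D" if "f \<in> PC" "\<forall>x. \<bar>f x\<bar> \<le> D" for f D x
  proof -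
    have *: "(\<lambda>x. D * e1 x) \<in> PC" "(\<lambda>x. (- D) * e1 x) \<in> PC"
      using PC_const[of D] PC_const[of "- D"] by (auto simp: e1_def)
    have D: "D \<ge> 0"
      using that(2) abs_ge_zero order_trans by blast
    have "G f x \<le> D * G e1 x"
      using mono[OF that(1) *(1), of x] cmult[OF e1, of D x] that(2) by (simp add: e1_def abs_le_iff)
    moreover have "(- D) * G e1 x \<le> G f x"
    proof -
      have "\<forall>x. (- D) * e1 x \<le> f x"
        unfolding e1_def using that(2) by (metis abs_le_iff minus_le_iff mult.right_neutral)
      from mono[OF *(2) that(1) this, of x] cmult[OF e1, of "-D" x] show ?thesis
        by linarith
    qed
    ultimately show ?thesis
      using mult_left_mono[OF C(2)[of x] D] by (simp add: abs_le_iff mult.commute)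
  qed
  define R where "R = {r. \<exists>f\<in>PC. (\<forall>x. 0 \<le> f x \<and> f x \<le> 1) \<and> (\<exists>x. f x = 1) \<and> (\<forall>x. r * f x \<le> G f x)}"
  have "m \<in> R"
    unfolding R_def using e1 m(2) by (intro CollectI bexI[of _ e1]) (auto simp: e1_def)
  have R_le: "r \<le> C" if "r \<in> R" for r
  proof -
    obtain f x where f: "f \<in> PC" "\<forall>x. 0 \<le> f x \<and> f x \<le> 1" "f x = 1" "\<forall>x. r * f x \<le> G f x"
      using \<open>r \<in> R\<close> by (auto simp: R_def)
    have "r \<le> G f x"
      using f(3,4) by (metis mult.right_neutral)
    moreover have "G f x \<le> G e1 x"
      using mono[OF f(1) e1] f(2) by (simp add: e1_def)
    ultimately have "r \<le> G f x" "G f x \<le> G e1 x" .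
    then show ?thesis
      using C(2)[of x] by linarith
  qed
  then have bdd: "bdd_above R"
    by (auto simp: bdd_above_def)
  define s where "s = Sup R"
  have s: "s > 0"
    using cSup_upper[OF \<open>m \<in> R\<close> bdd] m by (simp add: s_def)
  \<comment> \<open>Removes the normalisation to maximum 1, by dividing by the maximum of
    \<open>f\<close>.\<close>
  have R_norm: "r \<le> s" if "f \<in> PC" "\<forall>x. 0 \<le> f x" "\<exists>x. 0 < f x" "\<forall>x. r * f x \<le> G f x" for r f
  proof -
    obtain z where z: "\<And>x. f x \<le> f z"
      by (rule periodic_attains_max[OF PC_D[OF \<open>f \<in> PC\<close>]], rule that)
    then have fz: "f z > 0"
      using that(3) less_le_trans by blast
    have "r \<in> R"
      unfolding R_def
    proof (intro CollectI bexI[of _ "\<lambda>x. inverse (f z) * f x"] conjI allI exI[of _ z])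
      show "(\<lambda>x. inverse (f z) * f x) \<in> PC"
        using PC_lin[OF that(1,1), of "inverse (f z)" 0] by simp
      fix x
      show "0 \<le> inverse (f z) * f x" "inverse (f z) * f x \<le> 1" "inverse (f z) * f z = 1"
        using that(2) z[of x] fz by (auto simp: field_simps)
      show "r * (inverse (f z) * f x) \<le> G (\<lambda>x. inverse (f z) * f x) x"
        using mult_left_mono[OF that(4)[rule_format, of x], of "inverse (f z)"] fz
        unfolding cmult[OF that(1)] by (simp add: mult.left_commute)
    qed
    then show ?thesis
      unfolding s_def by (rule cSup_upper[OF _ bdd])
  qed
  have "\<exists>r f. f \<in> PC \<and> (\<forall>x. 0 \<le> f x \<and> f x \<le> 1) \<and> (\<exists>x. f x = 1) \<and> (\<forall>x. r * f x \<le> G f x)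
      \<and> s - 1 / real (Suc n) < r \<and> r \<le> s" for n
  proof -
    have "s - 1 / real (Suc n) < Sup R"
      by (simp add: s_def)
    then obtain r where "r \<in> R" "s - 1 / real (Suc n) < r"
      using less_cSup_iff[OF _ bdd] \<open>m \<in> R\<close> by blast
    moreover have "r \<le> s"
      using \<open>r \<in> R\<close> bdd by (simp add: s_def cSup_upper)
    ultimately show ?thesis
      unfolding R_def by blast
  qed
  then obtain r f where f: "\<And>n. f n \<in> PC" "\<And>n x. 0 \<le> f n x" "\<And>n x. f n x \<le> 1" "\<And>n. \<exists>x. f n x = 1"
    and r: "\<And>n x. r n * f n x \<le> G (f n) x" "\<And>n. s - 1 / real (Suc n) < r n" "\<And>n. r n \<le> s"
    by metis
  have fb: "\<bar>f n x\<bar> \<le> 1" for n x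
    using f(2,3)[of n x] by simp
  \<comment> \<open>The functions \<open>f n\<close> share no modulus of continuity, but their
    images under \<open>G\<close> do. The inequality passes to the images by positivity of
    \<open>G\<close>, so the limit is taken of these.\<close>
  define \<U> where "\<U> n = G (f n)" for n
  have \<U>PC: "\<U> n \<in> PC" for n
    using G f by (simp add: \<U>_def)
  have \<U>b: "periodic (\<U> n)" "\<bar>\<U> n x\<bar> \<le> C" "\<bar>\<U> n x - \<U> n y\<bar> \<le> L * \<bar>x - y\<bar>" for n x y
    using \<U>PC[of n] bound[OF f(1), of n 1 x] lip[OF f(1), of n x y] fb
    by (auto simp: PC_def \<U>_def)
  obtain h k where h: "h \<in> PC" and k: "strict_mono (k :: nat \<Rightarrow> nat)"
    and conv: "\<And>e. e > 0 \<Longrightarrow> \<exists>N. \<forall>n\<ge>N. \<forall>x. \<bar>\<U> (k n) x - h x\<bar> < e"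
    by (rule PC_precompact[OF \<U>b], rule that)
  have lim: "(\<lambda>n. \<U> (k n) x) \<longlonglongrightarrow> h x" for x
    using conv by (auto simp: LIMSEQ_iff) meson
  have limG: "(\<lambda>n. G (\<U> (k n)) x) \<longlonglongrightarrow> G h x" for x
  proof (rule LIMSEQ_I)
    fix e :: real
    assume "e > 0"
    then obtain N where N: "\<And>n x. n \<ge> N \<Longrightarrow> \<bar>\<U> (k n) x - h x\<bar> < e / (2 * C)"
      using conv[of "e / (2 * C)"] C by auto
    have "\<bar>G (\<U> (k n)) x - G h x\<bar> < e" if "n \<ge> N" for n
    proof -
      have "\<bar>G (\<lambda>x. \<U> (k n) x - 1 * h x) x\<bar> \<le> C * (e / (2 * C))"
        by (rule bound) (use PC_diff[OF \<U>PC h, of "k n" 1] N[OF that] in \<open>auto intro: less_imp_le\<close>)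
      then show ?thesis
        using diff[OF \<U>PC h, of "k n" 1 x] C \<open>e > 0\<close> by simp
    qed
    then show "\<exists>N. \<forall>n\<ge>N. norm (G (\<U> (k n)) x - G h x) < e"
      by auto
  qed
  have limr: "(\<lambda>n. r (k n)) \<longlonglongrightarrow> s"
  proof -
    have "(\<lambda>n. s - 1 / real (Suc n)) \<longlonglongrightarrow> s - 0"
      by (intro tendsto_intros LIMSEQ_inverse_real_of_nat[unfolded inverse_eq_divide])
    then have "r \<longlonglongrightarrow> s"
      by (intro tendsto_sandwich[of "\<lambda>n. s - 1 / real (Suc n)" r sequentially "\<lambda>_. s"])
        (use r(2,3) in \<open>auto intro!: eventuallyI less_imp_le simp del: of_nat_Suc\<close>)
    from LIMSEQ_subseq_LIMSEQ[OF this k] show ?thesis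
      by (simp add: o_def)
  qed
  have hs: "s * h x \<le> G h x" for x
  proof (rule LIMSEQ_le[OF tendsto_mult[OF limr lim] limG])
    have "r n * \<U> n x \<le> G (\<U> n) x" for n
    proof -
      have "0 \<le> G (\<lambda>x. \<U> n x - r n * f n x) x"
        using nonneg[OF PC_diff[OF \<U>PC f(1)]] r(1) by (simp add: \<U>_def)
      then show ?thesis
        using diff[OF \<U>PC f(1)] by (simp add: \<U>_def)
    qed
    then show "\<exists>N. \<forall>n\<ge>N. r (k n) * \<U> (k n) x \<le> G (\<U> (k n)) x"
      by blast
  qed
  have h0: "h x \<ge> 0" for x
  proof (rule LIMSEQ_le_const[OF lim])
    show "\<exists>N. \<forall>n\<ge>N. 0 \<le> \<U> (k n) x"
      unfolding \<U>_def using nonneg[OF f(1)] f(2) by blast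
  qed
  \<comment> \<open>Where \<open>f (k n)\<close> equals 1 its image is at least
    \<open>r (k n) > s / 2\<close>, and for large \<open>n\<close> the image is within
    \<open>s / 2\<close> of \<open>h\<close>.\<close>
  have hpos: "\<exists>x. h x > 0"
  proof -
    have "eventually (\<lambda>n. r (k n) > s / 2) sequentially"
      using order_tendstoD(1)[OF limr, of "s / 2"] s by simp
    then obtain N1 where N1: "\<And>n. n \<ge> N1 \<Longrightarrow> r (k n) > s / 2"
      by (auto simp: eventually_sequentially)
    obtain N2 where N2: "\<And>n x. n \<ge> N2 \<Longrightarrow> \<bar>\<U> (k n) x - h x\<bar> < s / 2"
      using conv[of "s / 2"] s by auto
    define n where "n = max N1 N2"
    obtain x where x: "f (k n) x = 1"
      using f(4) by blast
    have "s / 2 < \<U> (k n) x"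
      using r(1)[of "k n" x] x N1[of n] by (simp add: n_def \<U>_def)
    then have "h x > 0"
      using N2[of n x] by (simp add: n_def abs_if split: if_splits)
    then show ?thesis
      by blast
  qed
  \<comment> \<open>If the inequality were strict somewhere, strong positivity would bound
    \<open>G (G h - s h)\<close> away from 0, and \<open>G h\<close> would admit a constant larger
    than the supremum \<open>s\<close>.\<close>
  have eq: "G h x = s * h x" for x
  proof (rule ccontr)
    assume "G h x \<noteq> s * h x"
    define d where "d x = G h x - s * h x" for x
    have d: "d \<in> PC" "\<forall>x. d x \<ge> 0" "\<exists>x. d x > 0"
    proof -
      show "d \<in> PC"
        using PC_diff[OF G[OF h] h] by (simp add: d_def[abs_def])
      show "\<forall>x. d x \<ge> 0"
        using hs by (simp add: d_def)
      show "\<exists>x. d x > 0"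
        using hs[of x] \<open>G h x \<noteq> s * h x\<close> by (intro exI[of _ x]) (simp add: d_def)
    qed
    obtain m' where m': "m' > 0" "\<And>x. m' \<le> G d x"
      by (rule periodic_pos_lower[OF PC_D[OF G[OF d(1)]] pos[OF d]], rule that)
    obtain B where B: "B > 0" "\<And>x. \<bar>G h x\<bar> \<le> B"
      by (rule periodic_bounded[OF PC_D[OF G[OF h]], unfolded real_norm_def], rule that)
    have "s + m' / B \<le> s"
    proof (rule R_norm[OF G[OF h]])
      show "\<forall>x. 0 \<le> G h x" "\<exists>x. 0 < G h x"
        using pos[OF h] h0 hpos less_imp_le by blast+
      show "\<forall>x. (s + m' / B) * G h x \<le> G (G h) x"
      proof
        fix x
        have "m' * G h x \<le> m' * B"
          using B(2)[of x] m' by (intro mult_left_mono) auto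
        then have "m' / B * G h x \<le> m'"
          using B by (simp add: field_simps)
        moreover have "G d x = G (G h) x - s * G h x"
          using diff[OF G[OF h] h] by (simp add: d_def[abs_def])
        ultimately show "(s + m' / B) * G h x \<le> G (G h) x"
          using m'(2)[of x] by (simp add: algebra_simps)
      qed
    qed
    then show False
      using m' B by (simp add: divide_le_0_iff)
  qed
  have "h x > 0" for x
    using pos[OF h _ hpos, of x] h0 eq[of x] s by (simp add: zero_less_mult_iff)
  then show ?thesis
    using that[of s h] s h eq by blast
qed

text \<open>
  The resolvent equation \<open>- \<alpha> u'' - b u' + (M - c) u = f\<close> is divided by \<open>\<alpha>\<close>, with \<open>M\<close> so large
  that the zeroth-order coefficient is positive.
\<close>

lemma principal_eigenfunction:
  fixes \<alpha> b c :: "real \<Rightarrow> real"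
  assumes \<alpha>: "periodic \<alpha>" "continuous_on UNIV \<alpha>" "\<And>x. \<alpha> x > 0"
    and b: "periodic b" "continuous_on UNIV b" and c: "periodic c" "continuous_on UNIV c"
  obtains \<mu> u u1 u2 where "C2 u u1 u2" "\<And>x. u x > 0"
    "\<And>x. \<alpha> x * u2 x + b x * u1 x + c x * u x = \<mu> * u x"
proof -
  obtain K where K: "K > 0" "\<And>x. norm (c x) \<le> K"
    using periodic_bounded[OF c] by blast
  define M where "M = K + 1"
  define \<beta> where "\<beta> x = b x / \<alpha> x" for x
  define q where "q x = (M - c x) / \<alpha> x" for x
  have ne: "\<alpha> x \<noteq> 0" for x
    using \<alpha>(3)[of x] by simp
  have Mc: "M - c x > 0" for x
    using K(2)[of x] by (simp add: M_def abs_le_iff)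
  have \<beta>: "periodic \<beta>" "continuous_on UNIV \<beta>"
    using \<alpha> b ne by (auto simp: \<beta>_def periodic_def intro!: continuous_intros)
  have q: "periodic q" "continuous_on UNIV q" "\<And>x. q x > 0"
    using \<alpha> c ne Mc by (auto simp: q_def periodic_def intro!: continuous_intros)
  have dv: "periodic (\<lambda>x. f x / \<alpha> x)" "continuous_on UNIV (\<lambda>x. f x / \<alpha> x)" if "f \<in> PC" for f
    using \<alpha> that ne by (auto simp: PC_def periodic_def intro!: continuous_intros)
  define S where "S f u u1 u2 \<longleftrightarrow> C2 u u1 u2 \<and> (\<forall>x. - u2 x - \<beta> x * u1 x + q x * u x = f x / \<alpha> x)"
    for f u u1 u2
  have ex: "\<exists>u u1 u2. S f u u1 u2 \<and> ((\<forall>x. f x \<ge> 0) \<longrightarrow> (\<exists>x. f x > 0) \<longrightarrow> (\<forall>x. u x > 0))"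
    if "f \<in> PC" for f
  proof -
    obtain u u1 u2 where "C2 u u1 u2" "\<And>x. - u2 x - \<beta> x * u1 x + q x * u x = f x / \<alpha> x"
      "(\<forall>x. f x / \<alpha> x \<ge> 0) \<longrightarrow> (\<exists>x. f x / \<alpha> x > 0) \<longrightarrow> (\<forall>x. u x > 0)"
      by (rule second_order_solve[OF \<beta> q dv[OF \<open>f \<in> PC\<close>]], rule that)
    moreover from this have "(\<forall>x. f x \<ge> 0) \<longrightarrow> (\<exists>x. f x > 0) \<longrightarrow> (\<forall>x. u x > 0)"
      by (simp add: \<alpha>(3) pos_le_divide_eq pos_less_divide_eq)
    ultimately show ?thesis
      unfolding S_def by blast
  qed
  have uniq: "u x = v x" if "S f u u1 u2" "S f v v1 v2" for f u u1 u2 v v1 v2 x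
  proof -
    have "\<bar>1 * u x + (- 1) * v x\<bar> \<le> 0"
    proof (rule periodic_max_principle_abs[OF C2_linear[of u u1 u2 v v1 v2], where q = q and \<beta> = \<beta> and f = "\<lambda>_. 0"])
      fix x
      show "- (1 * u2 x + - 1 * v2 x) - \<beta> x * (1 * u1 x + - 1 * v1 x) + q x * (1 * u x + - 1 * v x) = 0"
      proof -
        have "- u2 x - \<beta> x * u1 x + q x * u x = - v2 x - \<beta> x * v1 x + q x * v x"
          using that unfolding S_def by simp
        then show ?thesis
          by (simp add: algebra_simps)
      qed
    qed (use that q in \<open>auto simp: S_def\<close>)
    then show ?thesis
      by simp
  qed
  define G where "G f = (SOME u. \<exists>u1 u2. S f u u1 u2 \<and> ((\<forall>x. f x \<ge> 0) \<longrightarrow> (\<exists>x. f x > 0) \<longrightarrow> (\<forall>x. u x > 0)))" for f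
  have GS: "\<exists>u1 u2. S f (G f) u1 u2 \<and> ((\<forall>x. f x \<ge> 0) \<longrightarrow> (\<exists>x. f x > 0) \<longrightarrow> (\<forall>x. G f x > 0))" if "f \<in> PC" for f
    unfolding G_def by (rule someI_ex[OF ex[OF that]])
  obtain Q where Q: "Q > 0" "\<And>x. norm (q x) \<le> Q"
    using periodic_bounded[OF q(1,2)] by blast
  obtain B where B: "B > 0" "\<And>x. norm (\<beta> x) \<le> B"
    using periodic_bounded[OF \<beta>] by blast
  obtain w where w: "w > 0" "\<And>x. w \<le> \<alpha> x"
    using periodic_pos_lower[OF \<alpha>] by blast
  have "periodic (\<lambda>x. q x * \<alpha> x)" "continuous_on UNIV (\<lambda>x. q x * \<alpha> x)" "\<And>x. q x * \<alpha> x > 0"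
    using q \<alpha> by (auto simp: periodic_def intro!: continuous_intros)
  \<comment> \<open>The product is \<open>M - c x\<close>; the summand 1 in \<open>M\<close> is
    chosen so that the maximum principle gives \<open>\<bar>G f x\<bar> \<le> 1\<close> whenever
    \<open>\<bar>f\<bar> \<le> 1\<close>.\<close>
  have qa: "q x * \<alpha> x \<ge> 1" for x
    using ne K(2)[of x] by (simp add: q_def M_def abs_le_iff)
  define k where "k = B + 1"
  define L where "L = k + ((1 / w + (k * (k + B) + Q)))"
  have lip: "\<bar>G f x - G f y\<bar> \<le> L * \<bar>x - y\<bar>" if f: "f \<in> PC" "\<forall>x. \<bar>f x\<bar> \<le> 1" for f x y
  proof -
    obtain u1 u2 where "S f (G f) u1 u2"
      using GS[OF f(1)] by blast
    then have u: "C2 (G f) u1 u2" "\<And>x. - u2 x - \<beta> x * u1 x + q x * G f x = f x / \<alpha> x"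
      by (auto simp: S_def)
    note u' = C2D[OF u(1)]
    have G1: "\<bar>G f x\<bar> \<le> 1" for x
    proof (rule periodic_max_principle_abs[OF u q(3)])
      show "\<bar>f x / \<alpha> x\<bar> \<le> 1 * q x" for x
        using qa[of x] f(2)[rule_format, of x] \<alpha>(3)[of x] by (simp add: field_simps)
    qed
    have kb: "k + \<beta> x \<ge> 1" "k + \<beta> x \<le> k + B" for x
      using B(2)[of x] by (auto simp: k_def abs_le_iff)
    have k0: "k > 0"
      using B by (simp add: k_def)
    \<comment> \<open>The first factor applied to the solution. It satisfies a first-order equation
      with bounded right-hand side, so it is bounded, and with it the derivative \<open>u1\<close>.
      This is the Lipschitz estimate that provides compactness.\<close>
    define g where "g x = k * G f x - u1 x" for x
    define F where "F x = f x / \<alpha> x + (k * (k + \<beta> x) - q x) * G f x" for x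
    have gb: "\<bar>g x\<bar> \<le> 1 / w + (k * (k + B) + Q)" for x
    proof (rule first_order_bound[where g = g and p = "\<lambda>x. k + \<beta> x" and f = F])
      show "periodic g"
        using u' by (simp add: g_def periodic_def)
      show "(g has_real_derivative F x - (k + \<beta> x) * g x) (at x)" for x
      proof -
        have "(g has_real_derivative k * u1 x - u2 x) (at x)"
          unfolding g_def by (intro DERIV_diff DERIV_cmult u')
        moreover have "k * u1 x - u2 x = F x - (k + \<beta> x) * g x"
          unfolding F_def g_def using u(2)[of x] by (simp add: algebra_simps)
        ultimately show ?thesis
          by simp
      qed
      show "k + \<beta> x > 0" for x
        using kb(1)[of x] by simp
      show "\<bar>F x\<bar> \<le> (1 / w + (k * (k + B) + Q)) * (k + \<beta> x)" for x
      proof -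
        have "\<bar>f x / \<alpha> x\<bar> \<le> 1 / w"
          using f(2)[rule_format, of x] w(2)[of x] w(1) \<alpha>(3)[of x] frac_le[of 1 "\<bar>f x\<bar>" w "\<alpha> x"]
          by (simp only: abs_divide) simp
        moreover have "\<bar>(k * (k + \<beta> x) - q x) * G f x\<bar> \<le> (k * (k + B) + Q) * 1"
          unfolding abs_mult
        proof (intro mult_mono G1)
          have "\<bar>k * (k + \<beta> x)\<bar> \<le> k * (k + B)"
            using k0 kb[of x] by (simp add: abs_mult)
          then show "\<bar>k * (k + \<beta> x) - q x\<bar> \<le> k * (k + B) + Q"
            using Q(2)[of x] by simp
          then show "0 \<le> k * (k + B) + Q"
            by simp
        qed simp
        ultimately have "\<bar>F x\<bar> \<le> (1 / w + (k * (k + B) + Q)) * 1"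
          unfolding F_def mult_1_right by (intro order_trans[OF abs_triangle_ineq] add_mono)
        also have "\<dots> \<le> (1 / w + (k * (k + B) + Q)) * (k + \<beta> x)"
          using kb(1)[of x] w(1) k0 B(1) Q(1) by (intro mult_left_mono) auto
        finally show ?thesis .
      qed
    qed
    have Gb: "\<bar>k * G f x\<bar> \<le> k * 1" for x
      unfolding abs_mult using G1[of x] k0 by (intro mult_mono) auto
    have "\<bar>u1 x\<bar> \<le> L" for x
    proof -
      have "u1 x = k * G f x - g x"
        by (simp add: g_def)
      then show ?thesis
        using gb[of x] Gb[of x] abs_triangle_ineq4[of "k * G f x" "g x"] by (simp add: L_def)
    qed
    then show ?thesis
      using field_differentiable_bound[of UNIV "G f" u1 L x y] u'(4)
      by (simp add: has_field_derivative_at_within)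
  qed
  obtain r h where r: "r > 0" "h \<in> PC" "\<And>x. h x > 0" "\<And>x. G h x = r * h x"
  proof (rule positive_operator_eigenfunction[of G L])
    show "G f \<in> PC" if "f \<in> PC" for f
    proof -
      obtain u1 u2 where "C2 (G f) u1 u2"
        using GS[OF \<open>f \<in> PC\<close>] unfolding S_def by blast
      from C2D(1,6)[OF this] show ?thesis
        by (simp add: PC_def)
    qed
    show "G f x > 0" if "f \<in> PC" "\<forall>x. f x \<ge> 0" "\<exists>x. f x > 0" for f x
      using GS[OF that(1)] that by blast
    show "G (\<lambda>x. a * f x + b * g x) x = a * G f x + b * G g x" if fg: "f \<in> PC" "g \<in> PC" for f g a b x
    proof -
      obtain u1 u2 where u: "S f (G f) u1 u2"
        using GS[OF fg(1)] by blast
      obtain v1 v2 where v: "S g (G g) v1 v2"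
        using GS[OF fg(2)] by blast
      obtain w1 w2 where w: "S (\<lambda>x. a * f x + b * g x) (G (\<lambda>x. a * f x + b * g x)) w1 w2"
        using GS[OF PC_lin[OF fg]] by blast
      have "S (\<lambda>x. a * f x + b * g x) (\<lambda>x. a * G f x + b * G g x) (\<lambda>x. a * u1 x + b * v1 x) (\<lambda>x. a * u2 x + b * v2 x)"
        unfolding S_def
      proof (intro conjI allI C2_linear)
        fix x
        have "(a * f x + b * g x) / \<alpha> x = a * (f x / \<alpha> x) + b * (g x / \<alpha> x)"
          by (simp add: add_divide_distrib)
        also have "\<dots> = a * (- u2 x - \<beta> x * u1 x + q x * G f x) + b * (- v2 x - \<beta> x * v1 x + q x * G g x)"
          using u v by (simp add: S_def)
        finally show "- (a * u2 x + b * v2 x) - \<beta> x * (a * u1 x + b * v1 x) + q x * (a * G f x + b * G g x)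
            = (a * f x + b * g x) / \<alpha> x"
          by (simp add: algebra_simps)
      qed (use u v in \<open>auto simp: S_def\<close>)
      from uniq[OF w this] show ?thesis .
    qed
    show "\<bar>G f x - G f y\<bar> \<le> L * \<bar>x - y\<bar>" if "f \<in> PC" "\<forall>x. \<bar>f x\<bar> \<le> 1" for f x y
      by (rule lip[OF that])
  qed (rule that)
  obtain u1 u2 where u: "S h (G h) u1 u2"
    using GS[OF r(2)] by blast
  \<comment> \<open>\<open>G\<close> inverts \<open>M\<close> minus the operator, so its eigenvalue
    \<open>r\<close> corresponds to the eigenvalue \<open>M - 1 / r\<close> of the operator.\<close>
  show ?thesis
  proof (rule that[of "G h" u1 u2 "M - 1 / r"])
    show "C2 (G h) u1 u2"
      using u by (simp add: S_def)
    show "G h x > 0" for x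
      using r by simp
    show "\<alpha> x * u2 x + b x * u1 x + c x * G h x = (M - 1 / r) * G h x" for x
    proof -
      have "\<alpha> x * (- u2 x - \<beta> x * u1 x + q x * G h x) = h x"
        using u ne[of x] by (simp add: S_def)
      then have "- \<alpha> x * u2 x - b x * u1 x + (M - c x) * G h x = h x"
        using ne[of x] by (simp add: \<beta>_def q_def distrib_left right_diff_distrib)
      moreover have "h x = 1 / r * G h x"
        using r by simp
      ultimately show ?thesis
        by (simp add: algebra_simps)
    qed
  qed
qed


section \<open>Functions on the circle and their periodic lifts\<close>

lemma continuous_to_circle: "continuous_on UNIV to_circle"
  by (simp add: continuous_on_open_vimage open_circle_def)

lemma to_circle_add_1: "to_circle (x + 1) = to_circle x"
  by (simp add: to_circle_eq_iff)

lemma periodic_lift: "periodic (\<lambda>x. f (to_circle x))"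
  by (simp add: periodic_def to_circle_add_1)

lemma continuous_lift_iff: "continuous_on UNIV (\<lambda>x. f (to_circle x)) \<longleftrightarrow> continuous_on UNIV f"
proof
  assume "continuous_on UNIV f"
  then show "continuous_on UNIV (\<lambda>x. f (to_circle x))"
    using continuous_on_compose2[OF _ continuous_to_circle] by blast
next
  assume "continuous_on UNIV (\<lambda>x. f (to_circle x))"
  then have "open ((\<lambda>x. f (to_circle x)) -` B)" if "open B" for B
    using that by (simp add: continuous_on_open_vimage)
  then show "continuous_on UNIV f"
    by (simp add: continuous_on_open_vimage open_circle_def vimage_comp o_def)
qed

lemma continuous_lift: "continuous_on UNIV f \<Longrightarrow> continuous_on UNIV (\<lambda>x. f (to_circle x))"
  by (simp add: continuous_lift_iff)

lemma circle_cases: obtains x where "p = to_circle x"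
  using to_circle_rep[of p] by metis

lemma rep_to_circle: "rep_circle (to_circle x) - x \<in> \<int>"
  using to_circle_rep[of "to_circle x"] by (simp add: to_circle_eq_iff)

lemma periodic_rep:
  assumes "periodic f"
  shows "f (rep_circle (to_circle x)) = f x"
proof -
  obtain n where "rep_circle (to_circle x) - x = of_int n"
    using rep_to_circle Ints_cases by blast
  then have "rep_circle (to_circle x) = x + of_int n"
    by simp
  then show ?thesis
    using periodic_add_of_int[OF assms] by simp
qed

lemma circle_deriv_lift:
  assumes "\<And>p. circle_differentiable f p"
  shows "((\<lambda>x. f (to_circle x)) has_vector_derivative circle_deriv f (to_circle x)) (at x)"
  using assms[of "to_circle x"]
  by (simp add: circle_differentiable_to_circle circle_deriv_to_circle vector_derivative_works)

lemma C_on_2_lift: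
  assumes "C_on 2 UNIV f"
  shows "((\<lambda>x. f (to_circle x)) has_vector_derivative circle_deriv f (to_circle x)) (at x)"
    "((\<lambda>x. circle_deriv f (to_circle x)) has_vector_derivative
       circle_deriv (circle_deriv f) (to_circle x)) (at x)"
    "continuous_on UNIV (\<lambda>x. circle_deriv (circle_deriv f) (to_circle x))"
  using assms circle_deriv_lift by (auto simp: numeral_2_eq_2 intro!: continuous_lift)

lemma C_on_2_C2:
  assumes "C_on 2 UNIV (f :: circle \<Rightarrow> real)"
  shows "C2 (\<lambda>x. f (to_circle x)) (\<lambda>x. circle_deriv f (to_circle x))
    (\<lambda>x. circle_deriv (circle_deriv f) (to_circle x))"
  using C_on_2_lift[OF assms]
  by (simp add: C2_def periodic_lift has_real_derivative_iff_has_vector_derivative)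

lemma circle_of_periodic:
  fixes u :: "real \<Rightarrow> 'a::real_normed_vector"
  assumes "periodic u" and u: "\<And>x. (u has_vector_derivative u1 x) (at x)"
  shows "circle_differentiable (\<lambda>p. u (rep_circle p)) p"
    "circle_deriv (\<lambda>p. u (rep_circle p)) = (\<lambda>p. u1 (rep_circle p))"
proof -
  have lift: "(\<lambda>x. u (rep_circle (to_circle x))) = u"
    using periodic_rep[OF assms(1)] by auto
  show "circle_differentiable (\<lambda>p. u (rep_circle p)) p"
    unfolding circle_differentiable_def lift using u differentiableI_vector by blast
  show "circle_deriv (\<lambda>p. u (rep_circle p)) = (\<lambda>p. u1 (rep_circle p))"
    unfolding circle_deriv_def lift using u vector_derivative_at by blast
qed

lemma circle_of_C2:
  assumes "C2 u u1 u2"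
  defines "f \<equiv> \<lambda>p. complex_of_real (u (rep_circle p))"
  shows "C_on 2 UNIV f" "circle_deriv f p = complex_of_real (u1 (rep_circle p))"
    "circle_deriv (circle_deriv f) p = complex_of_real (u2 (rep_circle p))"
proof -
  note u = C2D[OF assms(1)]
  have v: "((\<lambda>x. complex_of_real (g x)) has_vector_derivative complex_of_real (g' x)) (at x)"
    if "\<And>x. (g has_real_derivative g' x) (at x)" for g g' x
    using has_vector_derivative_of_real[OF that] .
  have per: "periodic (\<lambda>x. complex_of_real (g x))" if "periodic g" for g
    using that by (simp add: periodic_def)
  note 1 = circle_of_periodic[OF per[OF u(1)] v[OF u(4)]]
  note 2 = circle_of_periodic[OF per[OF u(2)] v[OF u(5)]]
  have f: "circle_deriv f = (\<lambda>p. complex_of_real (u1 (rep_circle p)))"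
    unfolding f_def by (rule 1(2))
  show "circle_deriv f p = complex_of_real (u1 (rep_circle p))"
    by (simp add: f)
  show "circle_deriv (circle_deriv f) p = complex_of_real (u2 (rep_circle p))"
    by (simp add: f 2(2))
  have "continuous_on UNIV (\<lambda>x. complex_of_real (u2 x))"
    using u(8) by (intro continuous_intros)
  then have "continuous_on UNIV (\<lambda>p. complex_of_real (u2 (rep_circle p)))"
    by (subst continuous_lift_iff[symmetric]) (simp add: periodic_rep[OF u(3)])
  then show "C_on 2 UNIV f"
    unfolding numeral_2_eq_2 C_on.simps f 2(2) by (auto simp: f_def 1(1) 2(1))
qed

section \<open>Quotients of eigenfunctions and comparison of eigenvalues\<close>

lemma C2_mult:
  assumes "C2 u u1 u2" "C2 v v1 v2"
  shows "C2 (\<lambda>x. u x * v x) (\<lambda>x. u1 x * v x + u x * v1 x)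
    (\<lambda>x. u2 x * v x + 2 * u1 x * v1 x + u x * v2 x)"
  unfolding C2_def
proof (intro conjI allI)
  note u = C2D[OF assms(1)] and v = C2D[OF assms(2)]
  show "periodic (\<lambda>x. u x * v x)"
    using u v by (simp add: periodic_def)
  show "((\<lambda>x. u x * v x) has_real_derivative u1 x * v x + u x * v1 x) (at x)" for x
    using DERIV_mult[OF u(4) v(4)] by (simp add: ac_simps)
  show "((\<lambda>x. u1 x * v x + u x * v1 x) has_real_derivative
      u2 x * v x + 2 * u1 x * v1 x + u x * v2 x) (at x)" for x
    using DERIV_add[OF DERIV_mult[OF u(5) v(4)] DERIV_mult[OF u(4) v(5)]]
    by (simp add: algebra_simps)
  show "continuous_on UNIV (\<lambda>x. u2 x * v x + 2 * u1 x * v1 x + u x * v2 x)"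
    using u v by (intro continuous_intros)
qed

lemma C2_add:
  assumes "C2 u u1 u2" "C2 v v1 v2"
  shows "C2 (\<lambda>x. u x + v x) (\<lambda>x. u1 x + v1 x) (\<lambda>x. u2 x + v2 x)"
  using C2_linear[OF assms, of 1 1] by simp

text \<open>The derivatives are solved from \<open>p1 = P1 u + P u1\<close> and
  \<open>p2 = P2 u + 2 P1 u1 + P u2\<close>. In this recursive form they can be inserted directly
  into the equations for \<open>p\<close> and \<open>u\<close>.\<close>

lemma C2_divide:
  fixes p u :: "real \<Rightarrow> real"
  assumes "C2 p p1 p2" "C2 u u1 u2" and pos: "\<And>x. u x > 0"
  defines "P \<equiv> \<lambda>x. p x / u x"
  defines "P1 \<equiv> \<lambda>x. (p1 x - P x * u1 x) / u x"
  shows "C2 P P1 (\<lambda>x. (p2 x - 2 * P1 x * u1 x - P x * u2 x) / u x)"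
  unfolding C2_def
proof (intro conjI allI)
  note p = C2D[OF assms(1)] and u = C2D[OF assms(2)]
  have ne: "u x \<noteq> 0" for x
    using pos[of x] by simp
  show "periodic P"
    using p u by (simp add: P_def periodic_def)
  show d: "(P has_real_derivative P1 x) (at x)" for x
    unfolding P_def P1_def using DERIV_divide[OF p(4) u(4) ne] ne[of x]
    by (simp add: field_simps)
  show "(P1 has_real_derivative (p2 x - 2 * P1 x * u1 x - P x * u2 x) / u x) (at x)" for x
  proof -
    have "((\<lambda>x. p1 x - P x * u1 x) has_real_derivative p2 x - (P1 x * u1 x + u2 x * P x)) (at x)"
      by (intro DERIV_diff DERIV_mult p u d)
    from DERIV_divide[OF this u(4) ne]
    have *: "(P1 has_real_derivative
        ((p2 x - (P1 x * u1 x + u2 x * P x)) * u x - (p1 x - P x * u1 x) * u1 x) / (u x * u x)) (at x)"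
      by (simp add: P1_def)
    have "p1 x - P x * u1 x = u x * P1 x"
      using ne[of x] by (simp add: P1_def)
    then show ?thesis
      using ne[of x] by (intro DERIV_cong[OF *]) (simp add: divide_simps, simp add: algebra_simps)
  qed
  have c: "continuous_on UNIV P" "continuous_on UNIV P1"
    unfolding P1_def P_def using p u ne by (auto intro!: continuous_intros)
  show "continuous_on UNIV (\<lambda>x. (p2 x - 2 * P1 x * u1 x - P x * u2 x) / u x)"
    using p u ne c by (intro continuous_intros) auto
qed

text \<open>With the integrating factor \<open>exp E\<close> the derivative \<open>N1\<close>
  becomes a nondecreasing function. It vanishes at all integer translates of a maximum of
  \<open>N\<close>, and every point lies between two of them.\<close>

lemma periodic_subharmonic_const:
  assumes N: "C2 N N1 N2" and \<beta>: "continuous_on UNIV \<beta>"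
    and sub: "\<And>x. N2 x + \<beta> x * N1 x \<ge> 0"
  shows "N1 x = 0"
proof -
  note N = C2D[OF N]
  obtain E where E: "\<And>x. (E has_real_derivative \<beta> x) (at x)"
    by (rule continuous_antiderivative[OF \<beta>], rule that)
  define h where "h x = exp (E x) * N1 x" for x
  have h: "(h has_real_derivative exp (E x) * (N2 x + \<beta> x * N1 x)) (at x)" for x
    unfolding h_def using E[of x] N(5)[of x]
    by (auto intro!: derivative_eq_intros simp: algebra_simps)
  have mono: "h s \<le> h t" if "s \<le> t" for s t
    by (rule DERIV_nonneg_imp_nondecreasing[OF that]) (use h sub in \<open>meson exp_ge_zero mult_nonneg_nonneg\<close>)
  obtain z where z: "\<And>y. N y \<le> N z"
    using periodic_attains_max[OF N(1,6)] by blast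
  have "N1 z = 0"
    using deriv_zero_at_max[OF N(4)] z by blast
  then have zero: "h (z + of_int n) = 0" for n
    using periodic_add_of_int[OF N(2)] by (simp add: h_def)
  obtain n :: nat where n: "\<bar>x - z\<bar> \<le> of_nat n"
    using real_arch_simple by blast
  then have "h (z + of_int (- int n)) \<le> h x" "h x \<le> h (z + of_int (int n))"
    by (auto intro!: mono)
  then have "h x = 0"
    unfolding zero by simp
  then show ?thesis
    by (simp add: h_def)
qed

text \<open>
  For another eigenfunction \<open>v\<close> the quotient by the positive eigenfunction satisfies an equation
  without zeroth-order term, and the maximum principle applies to its squared modulus.
\<close>

lemma complex_eigenvalue_le:
  fixes \<alpha> b c :: "real \<Rightarrow> real"
  assumes \<alpha>: "periodic \<alpha>" "continuous_on UNIV \<alpha>" "\<And>x. \<alpha> x > 0" and b: "continuous_on UNIV b"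
    and u: "C2 u u1 u2" "\<And>x. u x > 0" "\<And>x. \<alpha> x * u2 x + b x * u1 x + c x * u x = \<mu> * u x"
    and p: "C2 p p1 p2" "\<And>x. \<alpha> x * p2 x + b x * p1 x + c x * p x = s * p x - t * q x"
    and q: "C2 q q1 q2" "\<And>x. \<alpha> x * q2 x + b x * q1 x + c x * q x = s * q x + t * p x"
    and nz: "p z \<noteq> 0 \<or> q z \<noteq> 0"
  shows "s \<le> \<mu>" "s = \<mu> \<Longrightarrow> t = 0"
proof -
  have une: "u x \<noteq> 0" for x
    using u(2)[of x] by simp
  have \<alpha>ne: "\<alpha> x \<noteq> 0" for x
    using \<alpha>(3)[of x] by simp
  \<comment> \<open>Inserting \<open>p = P u\<close> into the equation for \<open>p\<close> and
    subtracting \<open>P\<close> times the equation for \<open>u\<close> leaves an equation for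
    \<open>P\<close> with this drift, the Doob transform of the original one.\<close>
  define B where "B x = b x + 2 * \<alpha> x * u1 x / u x" for x
  have quot: "\<exists>P1 P2. C2 (\<lambda>x. p x / u x) P1 P2 \<and>
      (\<forall>x. \<alpha> x * P2 x + B x * P1 x = (s - \<mu>) * (p x / u x) - t * (q x / u x))"
    if p: "C2 p p1 p2" "\<And>x. \<alpha> x * p2 x + b x * p1 x + c x * p x = s * p x - t * q x" for p p1 p2 q t
  proof -
    define P where "P x = p x / u x" for x
    define P1 where "P1 x = (p1 x - P x * u1 x) / u x" for x
    define P2 where "P2 x = (p2 x - 2 * P1 x * u1 x - P x * u2 x) / u x" for x
    have C: "C2 (\<lambda>x. p x / u x) P1 P2"
      using C2_divide[OF p(1) u(1,2)] by (simp add: P_def[abs_def] P1_def[abs_def] P2_def[abs_def])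
    moreover have "\<alpha> x * P2 x + B x * P1 x = (s - \<mu>) * (p x / u x) - t * (q x / u x)" for x
    proof -
      have 1: "u x * P2 x = p2 x - 2 * P1 x * u1 x - P x * u2 x" "u x * P1 x = p1 x - P x * u1 x"
        "u x * B x = u x * b x + 2 * \<alpha> x * u1 x" "p x = u x * P x"
        using une[of x] by (simp_all add: P2_def P1_def B_def P_def distrib_left)
      have "u x * (\<alpha> x * P2 x + B x * P1 x) = \<alpha> x * (u x * P2 x) + (u x * B x) * P1 x"
        by (simp add: algebra_simps)
      also have "\<dots> = \<alpha> x * p2 x - P x * (\<alpha> x * u2 x) + b x * (u x * P1 x)"
        unfolding 1(1,3) by (simp add: algebra_simps)
      also have "\<dots> = (\<alpha> x * p2 x + b x * p1 x + c x * p x) - P x * (\<alpha> x * u2 x + b x * u1 x + c x * u x)"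
        unfolding 1(2) using 1(4) by (simp add: algebra_simps)
      also have "\<dots> = (s - \<mu>) * p x - t * q x"
        unfolding p(2) u(3) using 1(4) by (simp add: algebra_simps)
      finally have "\<alpha> x * P2 x + B x * P1 x = ((s - \<mu>) * p x - t * q x) / u x"
        using une[of x] by (simp add: field_simps)
      then show ?thesis
        by (simp add: diff_divide_distrib)
    qed
    ultimately show ?thesis
      by blast
  qed
  define P where "P x = p x / u x" for x
  define Q where "Q x = q x / u x" for x
  obtain P1 P2 where P: "C2 P P1 P2" "\<And>x. \<alpha> x * P2 x + B x * P1 x = (s - \<mu>) * P x - t * Q x"
    using quot[OF p] unfolding P_def[abs_def] Q_def by blast
  have "\<alpha> x * q2 x + b x * q1 x + c x * q x = s * q x - (- t) * p x" for x
    using q(2) by simp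
  from quot[OF q(1) this]
  obtain Q1 Q2 where Q: "C2 Q Q1 Q2" "\<And>x. \<alpha> x * Q2 x + B x * Q1 x = (s - \<mu>) * Q x + t * P x"
    unfolding Q_def[abs_def] P_def by auto
  define N where "N x = P x * P x + Q x * Q x" for x
  define N1 where "N1 x = (P1 x * P x + P x * P1 x) + (Q1 x * Q x + Q x * Q1 x)" for x
  define N2 where "N2 x = (P2 x * P x + 2 * P1 x * P1 x + P x * P2 x) + (Q2 x * Q x + 2 * Q1 x * Q1 x + Q x * Q2 x)" for x
  have N: "C2 N N1 N2"
    unfolding N_def[abs_def] N1_def[abs_def] N2_def[abs_def] by (intro C2_add C2_mult P Q)
  note N' = C2D[OF N]
  \<comment> \<open>The terms with \<open>t\<close> rotate the pair \<open>(P, Q)\<close> and cancel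
    in the squared modulus; the gradient terms are nonnegative. At a maximum of \<open>N\<close> the
    left-hand side is nonpositive.\<close>
  have eqN: "\<alpha> x * N2 x + B x * N1 x = 2 * (s - \<mu>) * N x + 2 * \<alpha> x * (P1 x * P1 x + Q1 x * Q1 x)" for x
  proof -
    have "\<alpha> x * N2 x + B x * N1 x = 2 * P x * (\<alpha> x * P2 x + B x * P1 x) + 2 * Q x * (\<alpha> x * Q2 x + B x * Q1 x)
        + 2 * \<alpha> x * (P1 x * P1 x + Q1 x * Q1 x)"
      by (simp add: N1_def N2_def algebra_simps)
    then show ?thesis
      unfolding P(2) Q(2) by (simp add: N_def algebra_simps)
  qed
  obtain y where y: "\<And>x. N x \<le> N y"
    using periodic_attains_max[OF N'(1,6)] by blast
  have "N z > 0"
    using nz une[of z] unfolding N_def sum_squares_gt_zero_iff by (simp add: P_def Q_def)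
  then have Ny: "N y > 0"
    using y[of z] by simp
  have "N1 y = 0" "N2 y \<le> 0"
    using second_deriv_local_max[of UNIV y N N1 "N2 y"] N' y by auto
  then have "\<alpha> y * N2 y + B y * N1 y \<le> 0"
    using \<alpha>(3)[of y] by (simp add: mult_nonneg_nonpos)
  moreover have "2 * \<alpha> y * (P1 y * P1 y + Q1 y * Q1 y) \<ge> 0"
    using \<alpha>(3)[of y] by simp
  ultimately have "2 * (s - \<mu>) * N y \<le> 0"
    unfolding eqN by linarith
  then show "s \<le> \<mu>"
    using Ny by (simp add: mult_le_0_iff)
  \<comment> \<open>In the case of equality \<open>N\<close> is subharmonic, hence constant. Then
    the gradient terms vanish, \<open>P\<close> and \<open>Q\<close> are constant, and their
    equations reduce to \<open>t * Q = 0\<close> and \<open>t * P = 0\<close>.\<close>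
  assume s: "s = \<mu>"
  have "N2 x + (B x / \<alpha> x) * N1 x \<ge> 0" for x
  proof -
    have "N2 x + (B x / \<alpha> x) * N1 x = (\<alpha> x * N2 x + B x * N1 x) / \<alpha> x"
      using \<alpha>ne[of x] by (simp add: field_simps)
    then show ?thesis
      unfolding eqN using s \<alpha>(3)[of x] by simp
  qed
  moreover have "continuous_on UNIV (\<lambda>x. B x / \<alpha> x)"
    unfolding B_def using \<alpha> b C2D[OF u(1)] une \<alpha>ne by (intro continuous_intros) auto
  ultimately have N1: "N1 x = 0" for x
    using periodic_subharmonic_const[OF N] by blast
  have "N2 x = 0" for x
  proof -
    have "N1 = (\<lambda>_. 0)"
      using N1 by blast
    then show ?thesis
      using N'(5)[of x] DERIV_unique[OF _ DERIV_const] by metis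
  qed
  then have 0: "P1 x = 0" "Q1 x = 0" for x
    using eqN[of x] N1[of x] s \<alpha>ne[of x] sum_squares_eq_zero_iff[of "P1 x" "Q1 x"] by auto
  have 00: "P2 x = 0" "Q2 x = 0" for x
  proof -
    have "P1 = (\<lambda>_. 0)" "Q1 = (\<lambda>_. 0)"
      using 0 by blast+
    then show "P2 x = 0" "Q2 x = 0"
      using C2D(5)[OF P(1), of x] C2D(5)[OF Q(1), of x] DERIV_unique[OF _ DERIV_const] by metis+
  qed
  have "t * Q y = 0" "t * P y = 0"
    using P(2)[of y] Q(2)[of y] 0 00 s by simp_all
  then show "t = 0"
    using Ny by (auto simp: N_def)
qed

text \<open>The definite description asks for exactly one eigenvalue of maximal real part. The
  comparison shows that an eigenvalue with the same real part has imaginary part zero, so no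
  conjugate pair competes.\<close>

lemma principal_eigenvalue_eq:
  fixes a b c :: "circle \<Rightarrow> real"
  assumes a: "continuous_on UNIV a" "\<And>p. a p > 0" and b: "continuous_on UNIV b" and \<epsilon>: "\<epsilon> > 0"
    and u: "C2 u u1 u2" "\<And>x. u x > 0"
      "\<And>x. \<epsilon> * a (to_circle x) * u2 x + b (to_circle x) * u1 x + c (to_circle x) * u x = \<mu> * u x"
  shows "principal_eigenvalue \<epsilon> a b c = complex_of_real \<mu>"
proof -
  have mem: "complex_of_real \<mu> \<in> eigenvalues \<epsilon> a b c"
    unfolding eigenvalues_def
  proof (intro CollectI exI[of _ "\<lambda>p. complex_of_real (u (rep_circle p))"] conjI allI)
    show "C_on 2 UNIV (\<lambda>p. complex_of_real (u (rep_circle p)))"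
      by (rule circle_of_C2[OF u(1)])
    show "\<exists>p. complex_of_real (u (rep_circle p)) \<noteq> 0"
      using u(2) by (metis less_irrefl of_real_eq_0_iff)
    fix p
    show "(\<epsilon> * a p) *\<^sub>R circle_deriv (circle_deriv (\<lambda>p. complex_of_real (u (rep_circle p)))) p +
        b p *\<^sub>R circle_deriv (\<lambda>p. complex_of_real (u (rep_circle p))) p + c p *\<^sub>R complex_of_real (u (rep_circle p))
        = complex_of_real \<mu> * complex_of_real (u (rep_circle p))"
      unfolding circle_of_C2(2,3)[OF u(1)] scaleR_conv_of_real of_real_mult[symmetric] of_real_add[symmetric]
      using u(3)[of "rep_circle p"] by (simp add: to_circle_rep)
  qed
  have le: "Re w \<le> \<mu>" "Re w = \<mu> \<Longrightarrow> Im w = 0" if "w \<in> eigenvalues \<epsilon> a b c" for w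
  proof -
    obtain v p0 where v: "C_on 2 UNIV v" "v p0 \<noteq> 0"
      "\<And>p. (\<epsilon> * a p) *\<^sub>R circle_deriv (circle_deriv v) p + b p *\<^sub>R circle_deriv v p + c p *\<^sub>R v p = w * v p"
      using \<open>w \<in> eigenvalues \<epsilon> a b c\<close> unfolding eigenvalues_def by blast
    note l = C_on_2_lift[OF v(1)]
    obtain z where z: "p0 = to_circle z"
      by (rule circle_cases)
    have Re: "C2 (\<lambda>x. Re (v (to_circle x))) (\<lambda>x. Re (circle_deriv v (to_circle x)))
        (\<lambda>x. Re (circle_deriv (circle_deriv v) (to_circle x)))"
      unfolding C2_def has_real_derivative_iff_has_vector_derivative
      using l by (auto intro!: bounded_linear.has_vector_derivative[OF bounded_linear_Re] continuous_intros
          simp: periodic_def to_circle_add_1)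
    have Im: "C2 (\<lambda>x. Im (v (to_circle x))) (\<lambda>x. Im (circle_deriv v (to_circle x)))
        (\<lambda>x. Im (circle_deriv (circle_deriv v) (to_circle x)))"
      unfolding C2_def has_real_derivative_iff_has_vector_derivative
      using l by (auto intro!: bounded_linear.has_vector_derivative[OF bounded_linear_Im] continuous_intros
          simp: periodic_def to_circle_add_1)
    have 1: "\<epsilon> * a (to_circle x) * Re (circle_deriv (circle_deriv v) (to_circle x)) +
        b (to_circle x) * Re (circle_deriv v (to_circle x)) + c (to_circle x) * Re (v (to_circle x)) =
        Re w * Re (v (to_circle x)) - Im w * Im (v (to_circle x))" for x
      using arg_cong[OF v(3)[of "to_circle x"], of Re] by simp
    have 2: "\<epsilon> * a (to_circle x) * Im (circle_deriv (circle_deriv v) (to_circle x)) +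
        b (to_circle x) * Im (circle_deriv v (to_circle x)) + c (to_circle x) * Im (v (to_circle x)) =
        Re w * Im (v (to_circle x)) + Im w * Re (v (to_circle x))" for x
      using arg_cong[OF v(3)[of "to_circle x"], of Im] by simp
    have nz: "Re (v (to_circle z)) \<noteq> 0 \<or> Im (v (to_circle z)) \<noteq> 0"
      using v(2) z by (simp add: complex_eq_iff)
    have \<alpha>: "periodic (\<lambda>x. \<epsilon> * a (to_circle x))" "continuous_on UNIV (\<lambda>x. \<epsilon> * a (to_circle x))"
      "\<And>x. \<epsilon> * a (to_circle x) > 0"
      using a \<epsilon> by (auto simp: periodic_def to_circle_add_1 intro!: continuous_intros continuous_lift)
    note * = complex_eigenvalue_le[OF \<alpha> continuous_lift[OF b] u Re 1 Im 2 nz]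
    show "Re w \<le> \<mu>" "Re w = \<mu> \<Longrightarrow> Im w = 0"
      by (rule *(1)) (rule *(2))
  qed
  show ?thesis
    unfolding principal_eigenvalue_def
  proof (rule the_equality)
    show "complex_of_real \<mu> \<in> eigenvalues \<epsilon> a b c \<and> (\<forall>w\<in>eigenvalues \<epsilon> a b c. Re w \<le> Re (complex_of_real \<mu>))"
      using mem le by simp
    fix z
    assume z: "z \<in> eigenvalues \<epsilon> a b c \<and> (\<forall>w\<in>eigenvalues \<epsilon> a b c. Re w \<le> Re z)"
    then have "\<mu> \<le> Re z"
      using mem by fastforce
    then have "Re z = \<mu>"
      using le(1) z by (intro antisym) auto
    then show "z = complex_of_real \<mu>"
      using le(2) z by (simp add: complex_eq_iff)
  qed
qed

text \<open>At a maximum of \<open>u / exp \<psi>\<close> the first two derivatives of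
  \<open>u\<close> compare with those of \<open>exp \<psi>\<close>, and the equation for
  \<open>u\<close> is evaluated there. The hypothesis is the supersolution inequality for
  \<open>exp \<psi>\<close>, divided by \<open>exp \<psi>\<close>.\<close>

lemma eigenvalue_le_supersolution:
  fixes \<alpha> b c :: "real \<Rightarrow> real"
  assumes u: "C2 u u1 u2" "\<And>x. u x > 0" "\<And>x. \<alpha> x * u2 x + b x * u1 x + c x * u x = \<mu> * u x"
    and \<alpha>: "\<And>x. \<alpha> x > 0"
    and \<psi>: "C2 \<psi> \<psi>1 \<psi>2" "\<And>x. \<alpha> x * (\<psi>2 x + (\<psi>1 x)\<^sup>2) + b x * \<psi>1 x + c x \<le> \<kappa>"
  shows "\<mu> \<le> \<kappa>"
proof -
  note u' = C2D[OF u(1)] and \<psi>' = C2D[OF \<psi>(1)]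
  define R where "R x = u x * exp (- \<psi> x)" for x
  define R1 where "R1 x = (u1 x - u x * \<psi>1 x) * exp (- \<psi> x)" for x
  define R2 where "R2 x = (u2 x - 2 * u1 x * \<psi>1 x - u x * \<psi>2 x + u x * (\<psi>1 x)\<^sup>2) * exp (- \<psi> x)" for x
  have d: "(R has_real_derivative R1 x) (at x)" "(R1 has_real_derivative R2 x) (at x)" for x
    unfolding R_def R1_def R2_def
    by (auto intro!: derivative_eq_intros u' \<psi>' simp: algebra_simps power2_eq_square)
  have "periodic R"
    using u' \<psi>' by (simp add: R_def periodic_def)
  then obtain z where z: "\<And>y. R y \<le> R z"
    using periodic_attains_max[of R] has_derivative_continuous[of R R1] d by metis
  have "R1 z = 0" "R2 z \<le> 0"
    using second_deriv_local_max[of UNIV z R R1 "R2 z"] d z by auto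
  then have 1: "u1 z = u z * \<psi>1 z" and 2: "u2 z - 2 * u1 z * \<psi>1 z - u z * \<psi>2 z + u z * (\<psi>1 z)\<^sup>2 \<le> 0"
    by (auto simp: R1_def R2_def mult_le_0_iff)
  have "u2 z \<le> u z * (\<psi>2 z + (\<psi>1 z)\<^sup>2)"
    using 2 unfolding 1 by (simp add: algebra_simps power2_eq_square)
  then have "\<mu> * u z \<le> \<alpha> z * (u z * (\<psi>2 z + (\<psi>1 z)\<^sup>2)) + b z * (u z * \<psi>1 z) + c z * u z"
    using u(3)[of z] 1 \<alpha>[of z] by (metis add_le_cancel_right mult_le_cancel_left_pos)
  also have "\<dots> = (\<alpha> z * (\<psi>2 z + (\<psi>1 z)\<^sup>2) + b z * \<psi>1 z + c z) * u z"
    by (simp add: algebra_simps)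
  also have "\<dots> \<le> \<kappa> * u z"
    using \<psi>(2)[of z] u(2)[of z] by (intro mult_right_mono) auto
  finally show ?thesis
    using u(2)[of z] by simp
qed

text \<open>The quotient \<open>v / u\<close> is positive at the midpoint and zero at the ends, so
  its maximum over the interval is interior. There the operator applied to \<open>v\<close> is at
  most \<open>\<mu> * v\<close>.\<close>

lemma eigenvalue_ge_subsolution:
  fixes \<alpha> b c :: "real \<Rightarrow> real"
  assumes u: "C2 u u1 u2" "\<And>x. u x > 0" "\<And>x. \<alpha> x * u2 x + b x * u1 x + c x * u x = \<mu> * u x"
    and \<alpha>: "\<And>x. \<alpha> x > 0"
    and v: "\<And>x. (v has_real_derivative v1 x) (at x)" "\<And>x. (v1 has_real_derivative v2 x) (at x)"
    and lr: "l < r" "v l = 0" "v r = 0" "\<And>x. l < x \<Longrightarrow> x < r \<Longrightarrow> v x > 0"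
    and sub: "\<And>x. l < x \<Longrightarrow> x < r \<Longrightarrow> \<alpha> x * v2 x + b x * v1 x + c x * v x \<ge> \<kappa> * v x"
  shows "\<kappa> \<le> \<mu>"
proof -
  note u' = C2D[OF u(1)]
  have ne: "u x \<noteq> 0" for x
    using u(2)[of x] by simp
  define R where "R x = v x / u x" for x
  define R1 where "R1 x = (v1 x - R x * u1 x) / u x" for x
  define R2 where "R2 x = (v2 x - 2 * R1 x * u1 x - R x * u2 x) / u x" for x
  have d1: "(R has_real_derivative R1 x) (at x)" for x
    unfolding R_def R1_def using DERIV_divide[OF v(1) u'(4) ne] ne[of x]
    by (simp add: field_simps)
  have d2: "(R1 has_real_derivative R2 x) (at x)" for x
  proof -
    have "((\<lambda>x. v1 x - R x * u1 x) has_real_derivative v2 x - (R1 x * u1 x + u2 x * R x)) (at x)"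
      by (intro DERIV_diff DERIV_mult v u' d1)
    from DERIV_divide[OF this u'(4) ne]
    have *: "(R1 has_real_derivative
        ((v2 x - (R1 x * u1 x + u2 x * R x)) * u x - (v1 x - R x * u1 x) * u1 x) / (u x * u x)) (at x)"
      by (simp add: R1_def[abs_def])
    have "v1 x - R x * u1 x = u x * R1 x"
      using ne[of x] by (simp add: R1_def)
    then show ?thesis
      unfolding R2_def using ne[of x]
      by (intro DERIV_cong[OF *]) (simp add: divide_simps, simp add: algebra_simps)
  qed
  have "continuous_on {l..r} R"
    using has_derivative_continuous[OF d1] continuous_on_subset by blast
  then obtain z where z: "z \<in> {l..r}" "\<And>y. y \<in> {l..r} \<Longrightarrow> R y \<le> R z"
    using continuous_attains_sup[of "{l..r}" R] lr(1) by auto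
  define m where "m = (l + r) / 2"
  have "l < m" "m < r"
    using lr(1) by (auto simp: m_def)
  then have "R m > 0"
    using lr u(2)[of m] by (simp add: R_def)
  then have Rz: "R z > 0"
    using z(2)[of m] \<open>l < m\<close> \<open>m < r\<close> by simp
  then have zi: "l < z" "z < r"
    using z(1) lr by (auto simp: R_def less_le)
  have "R1 z = 0" "R2 z \<le> 0"
    using second_deriv_local_max[of "{l<..<r}" z R R1 "R2 z"] d1 d2 z zi by auto
  then have 1: "v1 z = R z * u1 z" and 2: "v2 z \<le> R z * u2 z" and 3: "v z = R z * u z"
    using u(2)[of z] ne[of z] by (auto simp: R1_def R2_def R_def divide_le_0_iff)
  have "\<kappa> * v z \<le> \<alpha> z * v2 z + b z * v1 z + c z * v z"
    using sub zi by blast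
  also have "\<dots> \<le> \<alpha> z * (R z * u2 z) + b z * v1 z + c z * v z"
    using 2 \<alpha>[of z] by simp
  also have "\<dots> = R z * (\<alpha> z * u2 z + b z * u1 z + c z * u z)"
    unfolding 1 3 by (simp add: algebra_simps)
  also have "\<dots> = \<mu> * v z"
    unfolding u(3) 3 by simp
  finally show ?thesis
    using lr(4)[OF zi] by simp
qed


section \<open>The principal eigenvalue for small noise\<close>

definition eigenpair ::
    "(real \<Rightarrow> real) \<Rightarrow> (real \<Rightarrow> real) \<Rightarrow> (real \<Rightarrow> real) \<Rightarrow> real \<Rightarrow> (real \<Rightarrow> real) \<Rightarrow> bool"
  where "eigenpair \<alpha> b c \<mu> u \<longleftrightarrow> (\<exists>u1 u2. C2 u u1 u2 \<and> (\<forall>x. u x > 0) \<and>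
    (\<forall>x. \<alpha> x * u2 x + b x * u1 x + c x * u x = \<mu> * u x))"

text \<open>
  Near a zero \<open>z\<close> of \<open>b\<close> the test function is a Gaussian at scale $\sqrt\epsilon$, lowered by a
  constant so that it vanishes at $z \pm \sqrt{\epsilon S}$.
\<close>

lemma eigenvalue_lower_bound:
  fixes a b c :: "real \<Rightarrow> real"
  assumes a: "isCont a z" "\<And>x. a x > 0" and b: "(b has_real_derivative b') (at z)" "b z = 0"
    and c: "isCont c z" and \<delta>: "\<delta> > 0"
  shows "\<forall>\<^sub>F \<epsilon> in at_right 0. \<forall>\<mu> u. eigenpair (\<lambda>x. \<epsilon> * a x) b c \<mu> u \<longrightarrow> c z - max b' 0 - \<delta> \<le> \<mu>"
proof -
  define \<beta> where "\<beta> = max b' 0"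
  have \<beta>: "\<beta> \<ge> 0" "b' \<le> \<beta>"
    by (auto simp: \<beta>_def)
  \<comment> \<open>For \<open>b' > 0\<close> the Gaussian with
    \<open>2 * \<gamma> * a z = b'\<close> is an eigenfunction of the linearised operator with
    eigenvalue \<open>- b'\<close>. The extra \<open>\<delta> / 8\<close> leaves a margin and keeps
    \<open>\<gamma>\<close> positive when \<open>b' \<le> 0\<close>.\<close>
  define \<gamma> where "\<gamma> = (\<beta> + \<delta> / 8) / (2 * a z)"
  have \<gamma>: "\<gamma> > 0" "2 * \<gamma> * a z = \<beta> + \<delta> / 8"
    using \<beta> \<delta> a(2)[of z] by (auto simp: \<gamma>_def)
  have "((\<lambda>x. 2 * \<gamma> * a x) \<longlongrightarrow> 2 * \<gamma> * a z) (nhds z)"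
    using a(1) by (intro tendsto_intros) (simp add: isCont_def tendsto_at_iff_tendsto_nhds)
  then have "\<forall>\<^sub>F x in nhds z. 2 * \<gamma> * a x < \<beta> + \<delta> / 4" "\<forall>\<^sub>F x in nhds z. 2 * \<gamma> * a x > \<beta> + \<delta> / 16"
    using \<delta> unfolding \<gamma>(2) by (auto intro: order_tendstoD)
  moreover have "\<forall>\<^sub>F x in nhds z. c x > c z - \<delta> / 4"
    using c \<delta> by (intro order_tendstoD(1)[of _ "c z"]) (auto simp: isCont_def tendsto_at_iff_tendsto_nhds)
  moreover have "\<forall>\<^sub>F x in nhds z. b x * (x - z) \<le> (\<beta> + \<delta> / 32) * (x - z)\<^sup>2"
  proof -
    have "((\<lambda>x. (b x - b z) / (x - z)) \<longlongrightarrow> b') (at z)"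
      using b(1) by (simp add: has_field_derivative_iff)
    then have "\<forall>\<^sub>F x in at z. (b x - b z) / (x - z) < \<beta> + \<delta> / 32"
      using \<beta> \<delta> by (intro order_tendstoD(2)) auto
    then have "\<forall>\<^sub>F x in at z. b x * (x - z) \<le> (\<beta> + \<delta> / 32) * (x - z)\<^sup>2"
    proof (rule eventually_mono)
      fix x
      assume *: "(b x - b z) / (x - z) < \<beta> + \<delta> / 32"
      have "b x * (x - z) = (b x / (x - z)) * (x - z)\<^sup>2"
        using b(2) by (simp add: power2_eq_square)
      also have "\<dots> \<le> (\<beta> + \<delta> / 32) * (x - z)\<^sup>2"
        using * b(2) by (intro mult_right_mono) auto
      finally show "b x * (x - z) \<le> (\<beta> + \<delta> / 32) * (x - z)\<^sup>2" .
    qed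
    then show ?thesis
      by (simp add: eventually_nhds_conv_at)
  qed
  ultimately have "\<forall>\<^sub>F x in nhds z. 2 * \<gamma> * a x < \<beta> + \<delta> / 4 \<and> 2 * \<gamma> * a x > \<beta> + \<delta> / 16 \<and>
      c x > c z - \<delta> / 4 \<and> b x * (x - z) \<le> (\<beta> + \<delta> / 32) * (x - z)\<^sup>2"
    by (simp add: eventually_conj_iff)
  then obtain r where r: "r > 0" and near: "\<And>x. \<bar>x - z\<bar> < r \<Longrightarrow> 2 * \<gamma> * a x < \<beta> + \<delta> / 4 \<and>
      2 * \<gamma> * a x > \<beta> + \<delta> / 16 \<and> c x > c z - \<delta> / 4 \<and> b x * (x - z) \<le> (\<beta> + \<delta> / 32) * (x - z)\<^sup>2"
    unfolding eventually_nhds_metric dist_real_def by blast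
  \<comment> \<open>Near \<open>z\<close> the diffusion contributes at least
    \<open>\<beta> + \<delta> / 16\<close> and the drift at most
    \<open>\<beta> + \<delta> / 32\<close>; \<open>p\<close> is \<open>2 * \<gamma>\<close> times
    the gap.\<close>
  define p where "p = 2 * \<gamma> * (\<delta> / 32)"
  have p: "p > 0"
    using \<gamma> \<delta> by (simp add: p_def)
  define K where "K = \<beta> + 3 * \<delta> / 4"
  have K: "K > 0"
    using \<beta> \<delta> by (simp add: K_def)
  \<comment> \<open>\<open>S\<close> marks the cut-off in the variable \<open>s\<close>. The
    subtracted constant costs \<open>K * exp (- \<gamma> * S)\<close>; for
    \<open>s \<ge> S / 2\<close> this is paid by \<open>p * s\<close>, for smaller \<open>s\<close>
    by the ratio of exponentials, which is at least \<open>\<gamma> * S / 2\<close>. The two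
    summands serve these two cases.\<close>
  define S where "S = 2 * K / p + 4 * K / (\<delta> * \<gamma>)"
  have S: "S > 0" "p * S / 2 \<ge> K" "\<delta> / 2 * (\<gamma> * S / 2) \<ge> K"
    using K p \<gamma> \<delta> by (auto simp: S_def field_simps add_pos_pos)
  have key: "exp (- \<gamma> * s) * (p * s + \<delta> / 2) \<ge> K * exp (- \<gamma> * S)" if s: "0 \<le> s" "s \<le> S" for s
  proof -
    have "K \<le> exp (\<gamma> * (S - s)) * (p * s + \<delta> / 2)"
    proof (cases "s \<ge> S / 2")
      case True
      have "K \<le> p * (S / 2)"
        using S by simp
      also have "\<dots> \<le> p * s"
        using True p by (intro mult_left_mono) auto
      also have "\<dots> \<le> 1 * (p * s + \<delta> / 2)"
        using \<delta> by simp
      also have "\<dots> \<le> exp (\<gamma> * (S - s)) * (p * s + \<delta> / 2)"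
        using s \<gamma> p \<delta> by (intro mult_right_mono) (auto intro: add_nonneg_nonneg)
      finally show ?thesis .
    next
      case False
      have "K \<le> (\<gamma> * (S / 2)) * (\<delta> / 2)"
        using S by (simp add: mult.commute)
      also have "\<dots> \<le> exp (\<gamma> * (S - s)) * (p * s + \<delta> / 2)"
      proof (rule mult_mono)
        have "\<gamma> * (S / 2) \<le> \<gamma> * (S - s)"
          using False \<gamma> by (intro mult_left_mono) auto
        also have "\<dots> \<le> exp (\<gamma> * (S - s))"
          using exp_ge_add_one_self[of "\<gamma> * (S - s)"] by linarith
        finally show "\<gamma> * (S / 2) \<le> exp (\<gamma> * (S - s))" .
      qed (use s p \<delta> in auto)
      finally show ?thesis .
    qed
    then have "K * exp (- \<gamma> * S) \<le> exp (- \<gamma> * S) * (exp (\<gamma> * (S - s)) * (p * s + \<delta> / 2))"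
      by (simp add: mult.commute)
    also have "\<dots> = exp (- \<gamma> * s) * (p * s + \<delta> / 2)"
    proof -
      have "exp (- \<gamma> * S) * exp (\<gamma> * (S - s)) = exp (- \<gamma> * s)"
        unfolding exp_add[symmetric] by (simp add: algebra_simps)
      then show ?thesis
        by (simp only: mult.assoc[symmetric])
    qed
    finally show ?thesis .
  qed
  have "c z - \<beta> - \<delta> \<le> \<mu>" if \<epsilon>: "0 < \<epsilon>" "S * \<epsilon> < r\<^sup>2" and e: "eigenpair (\<lambda>x. \<epsilon> * a x) b c \<mu> u" for \<epsilon> \<mu> u
  proof -
    obtain u1 u2 where u: "C2 u u1 u2" "\<And>x. u x > 0"
      "\<And>x. \<epsilon> * a x * u2 x + b x * u1 x + c x * u x = \<mu> * u x"
      using e unfolding eigenpair_def by auto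
    define w where "w x = exp (- \<gamma> * ((x - z)\<^sup>2 / \<epsilon>))" for x
    define v where "v x = w x - exp (- \<gamma> * S)" for x
    define v1 where "v1 x = - (2 * \<gamma> * (x - z) / \<epsilon>) * w x" for x
    define v2 where "v2 x = (4 * \<gamma>\<^sup>2 * (x - z)\<^sup>2 / \<epsilon>\<^sup>2 - 2 * \<gamma> / \<epsilon>) * w x" for x
    have dw: "(w has_real_derivative v1 x) (at x)" for x
      unfolding w_def v1_def using \<epsilon>
      by (auto intro!: derivative_eq_intros simp: power2_eq_square field_simps)
    have dv: "(v has_real_derivative v1 x) (at x)" for x
      unfolding v_def using DERIV_diff[OF dw DERIV_const, of _ x] by simp
    have dv1: "(v1 has_real_derivative v2 x) (at x)" for x
      unfolding v1_def v2_def using dw[of x] \<epsilon>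
      by (auto intro!: derivative_eq_intros simp: v1_def power2_eq_square field_simps)
    define \<rho> where "\<rho> = sqrt (S * \<epsilon>)"
    have \<rho>: "\<rho> > 0" "\<rho>\<^sup>2 = S * \<epsilon>"
      using S \<epsilon> by (auto simp: \<rho>_def)
    have "\<rho> < r"
      unfolding \<rho>_def by (rule real_less_lsqrt) (use S \<epsilon> r in auto)
    show ?thesis
    proof (rule eigenvalue_ge_subsolution[OF u _ dv dv1, of "z - \<rho>" "z + \<rho>"])
      show "\<epsilon> * a x > 0" for x
        using \<epsilon> a by simp
      show "z - \<rho> < z + \<rho>" "v (z - \<rho>) = 0" "v (z + \<rho>) = 0"
        using \<rho> \<epsilon> by (auto simp: v_def w_def)
      fix x
      assume x: "z - \<rho> < x" "x < z + \<rho>"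
      define s where "s = (x - z)\<^sup>2 / \<epsilon>"
      have "(x - z)\<^sup>2 < \<rho>\<^sup>2"
        using abs_le_square_iff[of \<rho> "x - z"] x \<rho>(1) by (auto simp: abs_le_iff not_le[symmetric])
      then have s: "0 \<le> s" "s < S"
        using \<epsilon> \<rho>(2) by (auto simp: s_def field_simps)
      have w: "w x = exp (- \<gamma> * s)" "w x > 0"
        by (auto simp: w_def s_def)
      show vpos: "v x > 0"
        unfolding v_def w using s \<gamma> by simp
      have n: "2 * \<gamma> * a x < \<beta> + \<delta> / 4" "2 * \<gamma> * a x > \<beta> + \<delta> / 16" "c x > c z - \<delta> / 4"
        "b x * (x - z) \<le> (\<beta> + \<delta> / 32) * (x - z)\<^sup>2"
        using near[of x] x \<open>\<rho> < r\<close> by (auto simp: abs_less_iff)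
      have n4: "b x * (x - z) / \<epsilon> \<le> (\<beta> + \<delta> / 32) * s"
        using divide_right_mono[OF n(4), of \<epsilon>] \<epsilon> by (simp add: s_def)
      have "\<epsilon> * a x * v2 x + b x * v1 x
          = w x * (2 * \<gamma> * ((2 * \<gamma> * a x) * s - b x * (x - z) / \<epsilon>) - 2 * \<gamma> * a x)"
      proof -
        have "\<epsilon> * (4 * \<gamma>\<^sup>2 * (x - z)\<^sup>2 / \<epsilon>\<^sup>2 - 2 * \<gamma> / \<epsilon>) = 4 * \<gamma>\<^sup>2 * s - 2 * \<gamma>"
        proof -
          have "\<epsilon> * (A / \<epsilon>\<^sup>2 - B / \<epsilon>) = A / \<epsilon> - B" for A B
            using \<epsilon> by (simp add: right_diff_distrib power2_eq_square)
          then show ?thesis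
            by (simp add: s_def)
        qed
        moreover have "\<epsilon> * a x * v2 x = a x * w x * (\<epsilon> * (4 * \<gamma>\<^sup>2 * (x - z)\<^sup>2 / \<epsilon>\<^sup>2 - 2 * \<gamma> / \<epsilon>))"
          unfolding v2_def by (simp only: mult.assoc mult.left_commute mult.commute)
        ultimately have "\<epsilon> * a x * v2 x = a x * w x * (4 * \<gamma>\<^sup>2 * s - 2 * \<gamma>)"
          by simp
        moreover have "b x * v1 x = - (2 * \<gamma> * (b x * (x - z) / \<epsilon>)) * w x"
          by (simp add: v1_def)
        ultimately show ?thesis
          by (simp only: power2_eq_square) (simp add: algebra_simps)
      qed
      also have "\<dots> \<ge> w x * (p * s - (\<beta> + \<delta> / 4))"
      proof (rule mult_left_mono)
        have "(\<beta> + \<delta> / 16) * s \<le> (2 * \<gamma> * a x) * s"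
          using n s by (intro mult_right_mono) auto
        then have "\<delta> / 32 * s \<le> (2 * \<gamma> * a x) * s - b x * (x - z) / \<epsilon>"
          using n4 by (simp add: distrib_right)
        then have "p * s \<le> 2 * \<gamma> * ((2 * \<gamma> * a x) * s - b x * (x - z) / \<epsilon>)"
          unfolding p_def mult.assoc by (intro mult_left_mono) (use \<gamma>(1) in simp_all)
        then show "p * s - (\<beta> + \<delta> / 4) \<le> 2 * \<gamma> * ((2 * \<gamma> * a x) * s - b x * (x - z) / \<epsilon>) - 2 * \<gamma> * a x"
          using n(1) by linarith
      qed (use w in simp)
      finally have 1: "\<epsilon> * a x * v2 x + b x * v1 x \<ge> w x * (p * s - (\<beta> + \<delta> / 4))" .
      have 2: "(c x - (c z - \<beta> - \<delta>)) * v x \<ge> K * v x"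
        using n(3) vpos by (intro mult_right_mono) (auto simp: K_def)
      have "w x * (p * s + \<delta> / 2) \<ge> K * exp (- \<gamma> * S)"
        using key[of s] s w by simp
      have 3: "w x * (p * s - (\<beta> + \<delta> / 4)) + K * v x \<ge> 0"
      proof -
        have "K * v x = K * w x - K * exp (- \<gamma> * S)"
          by (simp add: v_def right_diff_distrib)
        moreover have "w x * (p * s - (\<beta> + \<delta> / 4)) + K * w x = w x * (p * s + \<delta> / 2)"
          by (simp add: K_def algebra_simps)
        ultimately show ?thesis
          using \<open>w x * (p * s + \<delta> / 2) \<ge> K * exp (- \<gamma> * S)\<close> by linarith
      qed
      show "(c z - \<beta> - \<delta>) * v x \<le> \<epsilon> * a x * v2 x + b x * v1 x + c x * v x"
        using 1 2 3 by (simp add: algebra_simps)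
    qed
  qed
  moreover have "\<forall>\<^sub>F \<epsilon> in at_right 0. 0 < \<epsilon> \<and> S * \<epsilon> < r\<^sup>2"
  proof -
    have "\<forall>\<^sub>F \<epsilon> in at_right 0. \<epsilon> < r\<^sup>2 / S"
      using r S by (intro eventually_at_rightI[of 0 "r\<^sup>2 / S"]) auto
    then show ?thesis
      using eventually_at_right_less[of 0]
      by eventually_elim (use S in \<open>auto simp: field_simps\<close>)
  qed
  ultimately show ?thesis
    by (auto simp: \<beta>_def elim!: eventually_mono)
qed

text \<open>Turns estimates that hold near each point for small noise into one that holds on a whole
  period for small noise.\<close>

lemma eventually_compact_prod:
  assumes "compact K" and ev: "\<And>x. x \<in> K \<Longrightarrow> eventually P (F \<times>\<^sub>F nhds x)"
  shows "\<forall>\<^sub>F e in F. \<forall>x\<in>K. P (e, x)"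
proof -
  have "\<forall>x\<in>K. \<exists>Q U. eventually Q F \<and> open U \<and> x \<in> U \<and> (\<forall>e y. Q e \<longrightarrow> y \<in> U \<longrightarrow> P (e, y))"
  proof
    fix x
    assume "x \<in> K"
    from ev[OF this] obtain Q R where "eventually Q F" "eventually R (nhds x)"
      and *: "\<And>e y. Q e \<Longrightarrow> R y \<Longrightarrow> P (e, y)"
      unfolding eventually_prod_filter by blast
    then show "\<exists>Q U. eventually Q F \<and> open U \<and> x \<in> U \<and> (\<forall>e y. Q e \<longrightarrow> y \<in> U \<longrightarrow> P (e, y))"
      unfolding eventually_nhds by blast
  qed
  then obtain Q U where Q: "\<And>x. x \<in> K \<Longrightarrow> eventually (Q x) F"
    and U: "\<And>x. x \<in> K \<Longrightarrow> open (U x)" "\<And>x. x \<in> K \<Longrightarrow> x \<in> U x"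
    and P: "\<And>x e y. x \<in> K \<Longrightarrow> Q x e \<Longrightarrow> y \<in> U x \<Longrightarrow> P (e, y)"
    by metis
  obtain D where D: "D \<subseteq> K" "finite D" "K \<subseteq> (\<Union>x\<in>D. U x)"
    by (rule compactE_image[OF \<open>compact K\<close>, of K U]) (use U in auto)
  have "\<forall>\<^sub>F e in F. \<forall>x\<in>D. Q x e"
    using D Q by (intro eventually_ball_finite) auto
  then show ?thesis
    by (rule eventually_mono) (use D P in blast)
qed


lemma antiderivative_periodic:
  fixes F :: "real \<Rightarrow> real"
  assumes F: "\<And>x. (F has_real_derivative k x) (at x)" and k: "periodic k" and "F 1 = F 0"
  shows "periodic F"
proof -
  have "((\<lambda>x. F (x + 1) - F x) has_real_derivative 0) (at x)" for x
  proof -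
    have "((\<lambda>x. F (x + 1)) has_real_derivative k (x + 1)) (at x)"
      using F[of "x + 1"] by (simp add: DERIV_shift)
    from DERIV_diff[OF this F] show ?thesis
      by (simp add: periodicD[OF k])
  qed
  then have "F (x + 1) - F x = F (0 + 1) - F 0" for x
    using DERIV_isconst_all[of "\<lambda>x. F (x + 1) - F x"] by blast
  then show ?thesis
    using assms(3) by (simp add: periodic_def)
qed

text \<open>A nondecreasing function with equal values at 0 and 1 would be periodic and constant,
  and its derivative could not be positive at \<open>y\<close>.\<close>

lemma antiderivative_increases:
  fixes F :: "real \<Rightarrow> real"
  assumes F: "\<And>x. (F has_real_derivative k x) (at x)" and k: "periodic k" "\<And>x. k x \<ge> 0" "k y > 0"
  shows "F 0 < F 1"
proof (rule ccontr)
  assume "\<not> F 0 < F 1"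
  have mono: "F s \<le> F t" if "s \<le> t" for s t
    by (rule DERIV_nonneg_imp_nondecreasing[OF that]) (use F k in blast)
  then have "F 1 = F 0"
    using \<open>\<not> F 0 < F 1\<close> by (intro antisym) auto
  then have per: "periodic F"
    by (rule antiderivative_periodic[OF F k(1)])
  have "F x = F 0" for x
  proof -
    have "F (frac x) = F 0"
      using mono[of 0 "frac x"] mono[of "frac x" 1] \<open>F 1 = F 0\<close> frac_ge_0[of x] frac_lt_1[of x] by auto
    then show ?thesis
      by (simp add: periodic_frac[OF per])
  qed
  then have "F = (\<lambda>_. F 0)"
    by blast
  then have "k y = 0"
    using F[of y] DERIV_unique[OF _ DERIV_const] by metis
  then show False
    using k(3) by simp
qed

text \<open>Squaring makes the positive part continuously differentiable, as the gradient of the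
  Lyapunov function has to be.\<close>

lemma pos_part_square_deriv: "((\<lambda>y::real. (max y 0)\<^sup>2) has_real_derivative 2 * max y 0) (at y)"
proof -
  consider "y > 0" | "y < 0" | "y = 0"
    by linarith
  then show ?thesis
  proof cases
    case 1
    have "((\<lambda>y. y\<^sup>2) has_real_derivative 2 * max y 0) (at y)"
      using 1 by (auto intro!: derivative_eq_intros)
    then show ?thesis
      by (rule DERIV_cong_ev[THEN iffD1, OF refl _ refl, rotated])
        (use 1 in \<open>auto intro!: eventually_mono[OF eventually_gt_at_top] eventually_mono[OF eventually_nhds_in_open[of "{0<..}"]]\<close>)
  next
    case 2
    have "((\<lambda>y. 0) has_real_derivative 2 * max y 0) (at y)"
      using 2 by (auto intro!: derivative_eq_intros)
    then show ?thesis
      by (rule DERIV_cong_ev[THEN iffD1, OF refl _ refl, rotated])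
        (use 2 in \<open>auto intro!: eventually_mono[OF eventually_nhds_in_open[of "{..<0}"]]\<close>)
  next
    case 3
    have "((\<lambda>h::real. (max h 0)\<^sup>2 / h) \<longlongrightarrow> 0) (at 0)"
    proof (rule tendsto_0_le[of "\<lambda>h. h" _ _ 1])
      have "norm ((max h 0)\<^sup>2 / h) \<le> norm h * 1" for h :: real
        by (cases "h > 0") (auto simp: power2_eq_square)
      then show "\<forall>\<^sub>F h::real in at 0. norm ((max h 0)\<^sup>2 / h) \<le> norm h * 1"
        by (rule always_eventually[OF allI])
    qed (rule tendsto_ident_at)
    then show ?thesis
      using 3 by (simp add: has_field_derivative_iff)
  qed
qed

section \<open>Lyapunov function, barriers and the upper bound for the eigenvalue\<close>

locale circle_drift =
  fixes a b b1 b2 :: "real \<Rightarrow> real"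
  assumes a: "periodic a" "continuous_on UNIV a" "\<And>x. a x > 0"
    and b: "C2 b b1 b2"
    and sign_change: "\<exists>x. b x > 0" "\<exists>x. b x < 0"
    and zeros: "finite {x \<in> {0..<1}. b x = 0}"
begin

text \<open>The gradient is a weighted difference of the squared negative and positive parts of
  \<open>b\<close>, so it points against \<open>b\<close>. The weights \<open>A\<close> and
  \<open>B\<close> are the integrals of these parts over a period, swapped, so that the gradient
  integrates to zero and \<open>\<psi>\<close> is periodic. Both are positive because
  \<open>b\<close> changes sign; along a drift of one sign no periodic function could
  decrease.\<close>

lemma lyapunov_function:
  obtains \<psi> g g1 where "C2 \<psi> g g1" "\<And>x. b x * g x \<le> 0" "\<And>x. b x \<noteq> 0 \<Longrightarrow> b x * g x < 0"
proof -
  note b' = C2D[OF b]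
  define P where "P x = (max (b x) 0)\<^sup>2" for x
  define N where "N x = (max (- b x) 0)\<^sup>2" for x
  have dP: "(P has_real_derivative 2 * max (b x) 0 * b1 x) (at x)" for x
    unfolding P_def by (rule DERIV_chain2[OF pos_part_square_deriv b'(4)])
  have dN: "(N has_real_derivative 2 * max (- b x) 0 * - b1 x) (at x)" for x
    unfolding N_def by (rule DERIV_chain2[OF pos_part_square_deriv DERIV_minus[OF b'(4)]])
  have per: "periodic P" "periodic N"
    using b'(1) by (auto simp: P_def N_def periodic_def)
  obtain FP where FP: "FP 0 = 0" "\<And>x. (FP has_real_derivative P x) (at x)"
    by (rule continuous_antiderivative[OF has_derivative_continuous[OF dP]], rule that)
  obtain FN where FN: "FN 0 = 0" "\<And>x. (FN has_real_derivative N x) (at x)"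
    by (rule continuous_antiderivative[OF has_derivative_continuous[OF dN]], rule that)
  obtain x where "b x > 0"
    using sign_change by blast
  then have "FP 0 < FP 1"
    by (intro antiderivative_increases[OF FP(2) per(1), where y = x]) (auto simp: P_def)
  obtain y where "b y < 0"
    using sign_change by blast
  then have "FN 0 < FN 1"
    by (intro antiderivative_increases[OF FN(2) per(2), where y = y]) (auto simp: N_def)
  define A where "A = FN 1"
  define B where "B = FP 1"
  have AB: "A > 0" "B > 0"
    using \<open>FP 0 < FP 1\<close> \<open>FN 0 < FN 1\<close> FP FN by (auto simp: A_def B_def)
  define \<psi> where "\<psi> x = B * FN x - A * FP x" for x
  define g where "g x = B * N x - A * P x" for x
  define g1 where "g1 x = B * (2 * max (- b x) 0 * - b1 x) - A * (2 * max (b x) 0 * b1 x)" for x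
  have d: "(\<psi> has_real_derivative g x) (at x)" for x
    unfolding \<psi>_def g_def by (intro DERIV_diff DERIV_cmult FP FN)
  have d1: "(g has_real_derivative g1 x) (at x)" for x
    unfolding g_def g1_def by (intro DERIV_diff DERIV_cmult dP dN)
  have "periodic \<psi>"
    by (rule antiderivative_periodic[OF d])
      (use per FP FN in \<open>auto simp: g_def periodic_def \<psi>_def A_def B_def\<close>)
  moreover have "continuous_on UNIV g1"
    unfolding g1_def using b' by (intro continuous_intros)
  ultimately have "C2 \<psi> g g1"
    using d d1 by (simp add: C2_def)
  moreover have neg: "b x * g x < 0" if "b x \<noteq> 0" for x
    using that AB by (cases "b x > 0") (auto simp: g_def P_def N_def mult_less_0_iff)
  moreover have "b x * g x \<le> 0" for x
    using neg[of x] by (cases "b x = 0") auto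
  ultimately show ?thesis
    using that by blast
qed

end

text \<open>A smooth periodic substitute for the squared distance to \<open>p\<close>.\<close>

definition sinsq :: "real \<Rightarrow> real \<Rightarrow> real"
  where "sinsq p x = (sin (pi * (x - p)))\<^sup>2"

definition sinsq1 :: "real \<Rightarrow> real \<Rightarrow> real"
  where "sinsq1 p x = 2 * pi * sin (pi * (x - p)) * cos (pi * (x - p))"

lemma sinsq_range: "0 \<le> sinsq p x" "sinsq p x \<le> 1"
  by (auto simp: sinsq_def power_le_one_iff abs_sin_le_one abs_square_le_1)

lemma sinsq1_square: "(sinsq1 p x)\<^sup>2 = 4 * pi\<^sup>2 * sinsq p x * (1 - sinsq p x)"
proof -
  have "(sinsq1 p x)\<^sup>2 = 4 * pi\<^sup>2 * (sin (pi * (x - p)))\<^sup>2 * (cos (pi * (x - p)))\<^sup>2"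
    by (simp add: sinsq1_def power_mult_distrib)
  then show ?thesis
    by (simp add: sinsq_def cos_squared_eq)
qed

lemma C2_sinsq: "C2 (sinsq p) (sinsq1 p) (\<lambda>x. 2 * pi\<^sup>2 * (1 - 2 * sinsq p x))"
  unfolding C2_def
proof (intro conjI allI)
  have "sin (pi * (x + 1 - p)) = - sin (pi * (x - p))" for x
    using sin_periodic_pi[of "pi * (x - p)"] by (simp add: algebra_simps)
  then show "periodic (sinsq p)"
    by (simp add: periodic_def sinsq_def)
  fix x
  show "(sinsq p has_real_derivative sinsq1 p x) (at x)"
    unfolding sinsq_def sinsq1_def by (auto intro!: derivative_eq_intros)
  have "(sinsq1 p has_real_derivative 2 * pi * (pi * cos (pi * (x - p))) * cos (pi * (x - p))
      + 2 * pi * sin (pi * (x - p)) * (- (pi * sin (pi * (x - p))))) (at x)"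
    unfolding sinsq1_def by (auto intro!: derivative_eq_intros simp: algebra_simps)
  moreover have "2 * pi * (pi * cos (pi * (x - p))) * cos (pi * (x - p))
      + 2 * pi * sin (pi * (x - p)) * (- (pi * sin (pi * (x - p))))
      = 2 * pi\<^sup>2 * ((cos (pi * (x - p)))\<^sup>2 - (sin (pi * (x - p)))\<^sup>2)"
    by (simp add: power2_eq_square right_diff_distrib)
  ultimately show "(sinsq1 p has_real_derivative 2 * pi\<^sup>2 * (1 - 2 * sinsq p x)) (at x)"
    by (simp add: sinsq_def cos_squared_eq)
next
  show "continuous_on UNIV (\<lambda>x. 2 * pi\<^sup>2 * (1 - 2 * sinsq p x))"
    unfolding sinsq_def by (intro continuous_intros)
qed

text \<open>
  For large \<open>C\<close> the barrier $(\epsilon + k \sin^2 \pi(x-p))^{-C/2}$ imitates near \<open>p\<close> the Gaussian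
  eigenfunction of the linearized operator; here are its logarithmic derivatives.
\<close>

definition barrier :: "real \<Rightarrow> real \<Rightarrow> real \<Rightarrow> real \<Rightarrow> real \<Rightarrow> real"
  where "barrier C k p \<epsilon> x = - (C / 2) * ln (\<epsilon> + k * sinsq p x)"

definition barrier1 :: "real \<Rightarrow> real \<Rightarrow> real \<Rightarrow> real \<Rightarrow> real \<Rightarrow> real"
  where "barrier1 C k p \<epsilon> x = - (C / 2) * (k * sinsq1 p x / (\<epsilon> + k * sinsq p x))"

definition barrier2 :: "real \<Rightarrow> real \<Rightarrow> real \<Rightarrow> real \<Rightarrow> real \<Rightarrow> real"
  where "barrier2 C k p \<epsilon> x = - (C / 2) * (k * (2 * pi\<^sup>2 * (1 - 2 * sinsq p x)) / (\<epsilon> + k * sinsq p x)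
    - (k * sinsq1 p x / (\<epsilon> + k * sinsq p x))\<^sup>2)"

lemma C2_barrier:
  assumes "\<epsilon> > 0" "k > 0"
  shows "C2 (barrier C k p \<epsilon>) (barrier1 C k p \<epsilon>) (barrier2 C k p \<epsilon>)"
  unfolding C2_def
proof (intro conjI allI)
  note s = C2D[OF C2_sinsq, of p]
  have pos: "\<epsilon> + k * sinsq p x > 0" for x
    using assms sinsq_range(1)[of p x] by (simp add: add_pos_nonneg)
  then have ne: "\<epsilon> + k * sinsq p x \<noteq> 0" for x
    by (simp add: less_imp_neq[symmetric])
  show "periodic (barrier C k p \<epsilon>)"
    using s(1) by (simp add: periodic_def barrier_def)
  fix x
  show "(barrier C k p \<epsilon> has_real_derivative barrier1 C k p \<epsilon> x) (at x)"
    unfolding barrier_def barrier1_def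
    using DERIV_cmult[OF DERIV_chain2[OF DERIV_ln_divide[OF pos]
        DERIV_add[OF DERIV_const DERIV_cmult[OF s(4)]]], of "- (C / 2)" x] by simp
  have "((\<lambda>x. k * sinsq1 p x / (\<epsilon> + k * sinsq p x)) has_real_derivative
      ((k * (2 * pi\<^sup>2 * (1 - 2 * sinsq p x))) * (\<epsilon> + k * sinsq p x) - (k * sinsq1 p x) * (0 + k * sinsq1 p x))
        / ((\<epsilon> + k * sinsq p x) * (\<epsilon> + k * sinsq p x))) (at x)"
    by (intro DERIV_divide DERIV_cmult DERIV_add DERIV_const s(4,5) ne)
  moreover have "(D * E - G * (0 + G)) / (E * E) = D / E - (G / E)\<^sup>2" if "E \<noteq> 0" for D E G :: real
    using that by (simp add: diff_divide_distrib power2_eq_square)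
  ultimately have "((\<lambda>x. k * sinsq1 p x / (\<epsilon> + k * sinsq p x)) has_real_derivative
      (k * (2 * pi\<^sup>2 * (1 - 2 * sinsq p x)) / (\<epsilon> + k * sinsq p x)
        - (k * sinsq1 p x / (\<epsilon> + k * sinsq p x))\<^sup>2)) (at x)"
    using ne[of x] by simp
  then show "(barrier1 C k p \<epsilon> has_real_derivative barrier2 C k p \<epsilon> x) (at x)"
    unfolding barrier1_def barrier2_def by (rule DERIV_cmult)
next
  have "\<epsilon> + k * sinsq p x \<noteq> 0" for x
    using assms sinsq_range(1)[of p x] by (simp add: add_pos_nonneg less_imp_neq[symmetric])
  then show "continuous_on UNIV (barrier2 C k p \<epsilon>)"
    unfolding barrier2_def sinsq_def sinsq1_def
    by (intro continuous_intros) (auto simp: sinsq_def)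
qed

lemma C2_cmult: "C2 u u1 u2 \<Longrightarrow> C2 (\<lambda>x. r * u x) (\<lambda>x. r * u1 x) (\<lambda>x. r * u2 x)"
  using C2_linear[of u u1 u2 u u1 u2 r 0] by simp

lemma C2_sum:
  assumes "finite I" "\<And>i. i \<in> I \<Longrightarrow> C2 (u i) (u1 i) (u2 i)"
  shows "C2 (\<lambda>x. \<Sum>i\<in>I. u i x) (\<lambda>x. \<Sum>i\<in>I. u1 i x) (\<lambda>x. \<Sum>i\<in>I. u2 i x)"
  using assms
proof (induction I rule: finite_induct)
  case empty
  have "C2 (\<lambda>_. 0) (\<lambda>_. 0) (\<lambda>_. 0)"
    by (auto simp: C2_def periodic_def)
  then show ?case
    by simp
next
  case (insert i I)
  then have "C2 (\<lambda>x. u i x + (\<Sum>i\<in>I. u i x)) (\<lambda>x. u1 i x + (\<Sum>i\<in>I. u1 i x)) (\<lambda>x. u2 i x + (\<Sum>i\<in>I. u2 i x))"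
    by (intro C2_add) auto
  then show ?case
    using insert by simp
qed

text \<open>The denominator is at least \<open>2 * sqrt (\<epsilon> * k * sinsq p x)\<close> by the
  inequality of arithmetic and geometric means. The bound is uniform in \<open>\<epsilon>\<close>
  and \<open>x\<close>, which makes the products of the barrier with other terms negligible.\<close>

lemma barrier1_bound:
  assumes "\<epsilon> > 0" "k > 0" "C > 0"
  shows "\<bar>sqrt \<epsilon> * barrier1 C k p \<epsilon> x\<bar> \<le> C * pi * sqrt k"
proof -
  define D where "D = \<epsilon> + k * sinsq p x"
  have D: "D > 0"
    using assms sinsq_range(1)[of p x] by (simp add: D_def add_pos_nonneg)
  have "(sinsq1 p x)\<^sup>2 \<le> 4 * pi\<^sup>2 * sinsq p x * 1"
    unfolding sinsq1_square using sinsq_range[of p x] by (intro mult_left_mono) auto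
  also have "\<dots> = (2 * pi * sqrt (sinsq p x))\<^sup>2"
    using sinsq_range[of p x] by (simp add: power_mult_distrib)
  finally have 1: "\<bar>sinsq1 p x\<bar> \<le> 2 * pi * sqrt (sinsq p x)"
    using sinsq_range[of p x] by (simp add: abs_le_square_iff[symmetric] abs_mult)
  have "2 * (sqrt \<epsilon> * sqrt (k * sinsq p x)) \<le> D"
    using sum_squares_bound[of "sqrt \<epsilon>" "sqrt (k * sinsq p x)"] assms sinsq_range[of p x]
    by (simp add: D_def)
  then have 2: "2 * sqrt \<epsilon> * sqrt k * sqrt (sinsq p x) \<le> D"
    by (simp add: real_sqrt_mult mult_ac)
  have "\<bar>sqrt \<epsilon> * barrier1 C k p \<epsilon> x\<bar> = (C / 2) * k * sqrt \<epsilon> * \<bar>sinsq1 p x\<bar> / D"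
    using assms D by (simp add: barrier1_def D_def abs_mult)
  also have "\<dots> \<le> (C / 2) * k * sqrt \<epsilon> * (2 * pi * sqrt (sinsq p x)) / D"
    using assms D 1 by (intro divide_right_mono mult_left_mono) auto
  also have "\<dots> = (C / 2) * pi * sqrt k * (2 * sqrt \<epsilon> * sqrt k * sqrt (sinsq p x)) / D"
    using assms by (simp add: mult_ac)
  also have "\<dots> \<le> (C / 2) * pi * sqrt k * D / D"
    using assms D 2 by (intro divide_right_mono mult_left_mono) auto
  also have "\<dots> \<le> C * pi * sqrt k"
    using assms D by simp
  finally show ?thesis .
qed

text \<open>If all three \<open>r\<close> equal \<open>\<beta>\<close>, the left-hand side is
  \<open>\<beta>\<close> times \<open>- (\<epsilon> + \<sigma>)\<^sup>2 + 3 * \<epsilon> * \<sigma>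
  - (C - 1) * \<sigma>\<^sup>2\<close>. Completing the square bounds the last two terms by
  \<open>9 * \<epsilon>\<^sup>2 / (4 * (C - 1))\<close>, which explains the condition on
  \<open>C\<close>. One quarter of \<open>\<delta>\<close> pays for this, another for the deviations
  \<open>\<eta>\<close>.\<close>

lemma barrier_arithmetic:
  fixes \<epsilon> \<sigma> \<beta> \<eta> \<delta> C r1 r2 r3 :: real
  assumes "\<epsilon> > 0" "\<sigma> \<ge> 0" and r: "r1 \<ge> \<beta> - \<eta>" "r2 \<le> \<beta> + \<eta>" "r3 \<ge> \<beta> - \<eta>"
    and \<eta>: "\<eta> \<ge> 0" "\<eta> * (3 + 2 * C) \<le> \<delta> / 4" and C: "C > 1" "9 * \<beta> \<le> \<delta> * (C - 1)" and "\<beta> > 0"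
  shows "- r1 * \<epsilon> * (\<epsilon> + \<sigma>) + (2 + C) * r2 * \<epsilon> * \<sigma> - C * r3 * \<sigma> * (\<epsilon> + \<sigma>) \<le> (- \<beta> + \<delta> / 2) * (\<epsilon> + \<sigma>)\<^sup>2"
proof -
  define D where "D = \<epsilon> + \<sigma>"
  have D: "\<epsilon> * D \<le> D\<^sup>2" "\<epsilon> * \<sigma> \<le> D\<^sup>2" "\<sigma> * D \<le> D\<^sup>2" "\<epsilon>\<^sup>2 \<le> D\<^sup>2" "D > 0"
    using assms(1,2) by (auto simp: D_def power2_eq_square algebra_simps add_pos_nonneg)
  have nn: "\<epsilon> * D \<ge> 0" "\<epsilon> * \<sigma> \<ge> 0" "\<sigma> * D \<ge> 0"
    using assms(1,2) D by auto
  have "- (r1 * (\<epsilon> * D)) \<le> - ((\<beta> - \<eta>) * (\<epsilon> * D))"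
    using mult_right_mono[OF r(1) nn(1)] by simp
  moreover have "(2 + C) * (r2 * (\<epsilon> * \<sigma>)) \<le> (2 + C) * ((\<beta> + \<eta>) * (\<epsilon> * \<sigma>))"
    using mult_right_mono[OF r(2) nn(2)] C by (intro mult_left_mono) auto
  moreover have "- (C * (r3 * (\<sigma> * D))) \<le> - (C * ((\<beta> - \<eta>) * (\<sigma> * D)))"
    using mult_left_mono[OF mult_right_mono[OF r(3) nn(3)], of C] C by simp
  ultimately have "- (r1 * (\<epsilon> * D)) + (2 + C) * (r2 * (\<epsilon> * \<sigma>)) - C * (r3 * (\<sigma> * D))
      \<le> - ((\<beta> - \<eta>) * (\<epsilon> * D)) + (2 + C) * ((\<beta> + \<eta>) * (\<epsilon> * \<sigma>)) - C * ((\<beta> - \<eta>) * (\<sigma> * D))"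
    by linarith
  also have "\<dots> = \<beta> * (- \<epsilon> * D + (2 + C) * \<epsilon> * \<sigma> - C * \<sigma> * D)
      + \<eta> * (\<epsilon> * D + (2 + C) * (\<epsilon> * \<sigma>) + C * (\<sigma> * D))"
    by (simp add: algebra_simps)
  also have "\<dots> \<le> (- \<beta> * D\<^sup>2 + \<delta> / 4 * D\<^sup>2) + \<delta> / 4 * D\<^sup>2"
  proof (rule add_mono)
    have "\<epsilon> * D + (2 + C) * (\<epsilon> * \<sigma>) + C * (\<sigma> * D) \<le> D\<^sup>2 + (2 + C) * D\<^sup>2 + C * D\<^sup>2"
      using D C by (intro add_mono mult_left_mono) auto
    also have "\<dots> = (3 + 2 * C) * D\<^sup>2"
      by (simp add: algebra_simps)
    finally have "\<eta> * (\<epsilon> * D + (2 + C) * (\<epsilon> * \<sigma>) + C * (\<sigma> * D)) \<le> \<eta> * ((3 + 2 * C) * D\<^sup>2)"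
      using \<eta> by (intro mult_left_mono)
    also have "\<dots> \<le> \<delta> / 4 * D\<^sup>2"
      using mult_right_mono[OF \<eta>(2), of "D\<^sup>2"] by (simp add: mult.assoc)
    finally show "\<eta> * (\<epsilon> * D + (2 + C) * (\<epsilon> * \<sigma>) + C * (\<sigma> * D)) \<le> \<delta> / 4 * D\<^sup>2" .
    have "(C - 1) * (3 * \<epsilon> * \<sigma> - (C - 1) * \<sigma>\<^sup>2) \<le> 9 / 4 * \<epsilon>\<^sup>2"
      using zero_le_power2[of "3 / 2 * \<epsilon> - (C - 1) * \<sigma>"] by (simp add: power2_eq_square algebra_simps)
    then have "\<beta> * ((C - 1) * (3 * \<epsilon> * \<sigma> - (C - 1) * \<sigma>\<^sup>2)) \<le> \<beta> * (9 / 4 * \<epsilon>\<^sup>2)"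
      using assms by (intro mult_left_mono) auto
    also have "\<dots> \<le> \<delta> * (C - 1) / 4 * \<epsilon>\<^sup>2"
      using mult_right_mono[OF C(2), of "\<epsilon>\<^sup>2"] by simp
    finally have "(C - 1) * (\<beta> * (3 * \<epsilon> * \<sigma> - (C - 1) * \<sigma>\<^sup>2)) \<le> (C - 1) * (\<delta> / 4 * \<epsilon>\<^sup>2)"
      by (simp add: mult_ac)
    then have "\<beta> * (3 * \<epsilon> * \<sigma> - (C - 1) * \<sigma>\<^sup>2) \<le> \<delta> / 4 * \<epsilon>\<^sup>2"
      by (rule mult_left_le_imp_le) (use C in simp)
    also have "\<dots> \<le> \<delta> / 4 * D\<^sup>2"
    proof (rule mult_left_mono[OF D(4)])
      have "0 < \<delta> * (C - 1)"
        using C \<open>\<beta> > 0\<close> by linarith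
      then show "0 \<le> \<delta> / 4"
        using C by (simp add: zero_less_mult_iff)
    qed
    finally have "\<beta> * (3 * \<epsilon> * \<sigma> - (C - 1) * \<sigma>\<^sup>2) \<le> \<delta> / 4 * D\<^sup>2" .
    moreover have "- \<epsilon> * D + (2 + C) * \<epsilon> * \<sigma> - C * \<sigma> * D = - D\<^sup>2 + (3 * \<epsilon> * \<sigma> - (C - 1) * \<sigma>\<^sup>2)"
      by (simp add: D_def power2_eq_square algebra_simps)
    ultimately show "\<beta> * (- \<epsilon> * D + (2 + C) * \<epsilon> * \<sigma> - C * \<sigma> * D) \<le> - \<beta> * D\<^sup>2 + \<delta> / 4 * D\<^sup>2"
      by (simp only: distrib_left mult_minus_right mult_minus_left)
  qed
  finally show ?thesis
    by (simp add: D_def[symmetric] algebra_simps)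
qed


text \<open>
  In terms of \<open>\<sigma> = k sin\<^sup>2 \<pi>(x-p)\<close> the claim is the inequality of the previous lemma, with
  \<open>r1\<close>, \<open>r2\<close>, \<open>r3\<close> close to \<open>\<beta>\<close>.
\<close>

lemma barrier_supersolution:
  fixes a b :: "real \<Rightarrow> real"
  assumes a: "isCont a z" "\<And>x. a x > 0" and b: "(b has_real_derivative \<beta>) (at z)" "b z = 0" and "\<beta> > 0"
    and p: "sinsq p z = 0"
    and k: "k > 0" "pi\<^sup>2 * k * a z * C = \<beta>" and C: "C > 1" "9 * \<beta> \<le> \<delta> * (C - 1)"
  shows "\<forall>\<^sub>F (\<epsilon>, x) in at_right 0 \<times>\<^sub>F nhds z.
    \<epsilon> * a x * (barrier2 C k p \<epsilon> x + (barrier1 C k p \<epsilon> x)\<^sup>2) + b x * barrier1 C k p \<epsilon> x \<le> - \<beta> + \<delta> / 2"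
proof -
  have "0 < \<delta> * (C - 1)"
    using C \<open>\<beta> > 0\<close> by linarith
  then have \<delta>: "\<delta> > 0"
    using C by (simp add: zero_less_mult_iff)
  define \<eta> where "\<eta> = \<delta> / (4 * (3 + 2 * C))"
  have \<eta>: "\<eta> > 0" "\<eta> * (3 + 2 * C) \<le> \<delta> / 4"
    using \<delta> C by (auto simp: \<eta>_def field_simps)
  have S: "(sinsq p \<longlongrightarrow> 0) (nhds z)"
    using DERIV_isCont[OF C2D(4)[OF C2_sinsq[of p], of z]]
    by (metis isCont_def tendsto_at_iff_tendsto_nhds p)
  have A: "(a \<longlongrightarrow> a z) (nhds z)"
    using a(1) by (simp add: isCont_def tendsto_at_iff_tendsto_nhds)
  have "((\<lambda>x. pi\<^sup>2 * k * a x * C * (1 - 2 * sinsq p x)) \<longlongrightarrow> pi\<^sup>2 * k * a z * C * (1 - 2 * 0)) (nhds z)"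
    by (intro tendsto_intros A S)
  then have ev1: "\<forall>\<^sub>F x in nhds z. pi\<^sup>2 * k * a x * C * (1 - 2 * sinsq p x) > \<beta> - \<eta>"
    by (rule order_tendstoD) (use k \<eta> in simp)
  have "((\<lambda>x. pi\<^sup>2 * k * a x * C * (1 - sinsq p x)) \<longlongrightarrow> pi\<^sup>2 * k * a z * C * (1 - 0)) (nhds z)"
    by (intro tendsto_intros A S)
  then have ev2: "\<forall>\<^sub>F x in nhds z. pi\<^sup>2 * k * a x * C * (1 - sinsq p x) < \<beta> + \<eta>"
    by (rule order_tendstoD) (use k \<eta> in simp)
  \<comment> \<open>Multiplied out because both sides vanish at \<open>z\<close>. Away from
    \<open>z\<close> it says that \<open>b x * pi * cot (pi * (x - z))\<close> is almost at least
    its limit \<open>\<beta>\<close>.\<close>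
  have ev3: "\<forall>\<^sub>F x in nhds z. b x * sinsq1 p x \<ge> 2 * (\<beta> - \<eta>) * sinsq p x"
  proof -
    have "sin (pi * (z - p)) = 0"
      using p by (simp add: sinsq_def)
    then obtain n where n: "pi * (z - p) = of_int n * pi"
      unfolding sin_zero_iff_int2 by blast
    then have "z - p = of_int n"
      by simp
    then have shift: "pi * (x - p) = pi * (x - z) + of_int n * pi" for x
      by (simp add: algebra_simps)
    have cn: "cos (of_int n * pi) \<noteq> 0" "sin (of_int n * pi) = 0"
      using cos_int_times_real[of n] by (auto simp: cos_int_times_real mult.commute)
    have sc: "sin (pi * (x - p)) = sin (pi * (x - z)) * cos (of_int n * pi)"
      "cos (pi * (x - p)) = cos (pi * (x - z)) * cos (of_int n * pi)" for x
      using cn(2) by (auto simp: shift sin_add cos_add)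
    have "((\<lambda>x. (b x - b z) / (x - z)) \<longlongrightarrow> \<beta>) (at z)"
      using b(1) by (simp add: has_field_derivative_iff)
    moreover have "((\<lambda>x. sin (pi * (x - z)) / (x - z)) \<longlongrightarrow> pi) (at z)"
    proof -
      have "((\<lambda>x. sin (pi * (x - z))) has_real_derivative pi) (at z)"
        by (auto intro!: derivative_eq_intros)
      then show ?thesis
        by (simp add: has_field_derivative_iff)
    qed
    moreover have "((\<lambda>x. cos (pi * (x - z))) \<longlongrightarrow> cos (pi * (z - z))) (at z)"
      by (intro tendsto_intros)
    ultimately have "((\<lambda>x. ((b x - b z) / (x - z)) * pi * cos (pi * (x - z)) / (sin (pi * (x - z)) / (x - z)))
        \<longlongrightarrow> \<beta> * pi * cos (pi * (z - z)) / pi) (at z)"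
      by (intro tendsto_intros) auto
    then have "\<forall>\<^sub>F x in at z. ((b x - b z) / (x - z)) * pi * cos (pi * (x - z)) / (sin (pi * (x - z)) / (x - z)) > \<beta> - \<eta>"
      by (rule order_tendstoD) (use \<eta> in simp)
    then have "\<forall>\<^sub>F x in at z. b x * sinsq1 p x \<ge> 2 * (\<beta> - \<eta>) * sinsq p x"
      using eventually_neq_at_within[of z z UNIV]
    proof eventually_elim
      case (elim x)
      define s where "s = sin (pi * (x - z))"
      show ?case
      proof (cases "s = 0")
        case True
        then show ?thesis
          by (simp add: sinsq_def sinsq1_def sc s_def)
      next
        case False
        have "\<beta> - \<eta> \<le> b x * pi * cos (pi * (x - z)) / s"
          using elim b(2) False by (simp add: s_def[symmetric])
        then have "(\<beta> - \<eta>) * (2 * s\<^sup>2) \<le> (b x * pi * cos (pi * (x - z)) / s) * (2 * s\<^sup>2)"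
          by (intro mult_right_mono) auto
        then have "2 * (\<beta> - \<eta>) * s\<^sup>2 \<le> b x * (2 * pi * s * cos (pi * (x - z)))"
          using False by (simp add: power2_eq_square mult_ac)
        then have "2 * (\<beta> - \<eta>) * s\<^sup>2 * (cos (of_int n * pi))\<^sup>2
            \<le> b x * (2 * pi * s * cos (pi * (x - z))) * (cos (of_int n * pi))\<^sup>2"
          by (intro mult_right_mono) auto
        then show ?thesis
          by (simp add: sinsq_def sinsq1_def sc s_def power2_eq_square mult_ac)
      qed
    qed
    then show ?thesis
      using p by (simp add: eventually_nhds_conv_at sinsq_def sinsq1_def)
  qed
  have key: "\<epsilon> * a x * (barrier2 C k p \<epsilon> x + (barrier1 C k p \<epsilon> x)\<^sup>2) + b x * barrier1 C k p \<epsilon> x \<le> - \<beta> + \<delta> / 2"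
    if "\<epsilon> > 0" and x: "pi\<^sup>2 * k * a x * C * (1 - 2 * sinsq p x) > \<beta> - \<eta>"
      "pi\<^sup>2 * k * a x * C * (1 - sinsq p x) < \<beta> + \<eta>" "b x * sinsq1 p x \<ge> 2 * (\<beta> - \<eta>) * sinsq p x" for \<epsilon> x
  proof -
    define \<sigma> where "\<sigma> = k * sinsq p x"
    define D where "D = \<epsilon> + \<sigma>"
    have \<sigma>: "\<sigma> \<ge> 0" and D: "D > 0"
      using sinsq_range[of p x] k that by (auto simp: \<sigma>_def D_def add_pos_nonneg)
    define r1 where "r1 = pi\<^sup>2 * k * a x * C * (1 - 2 * sinsq p x)"
    define r2 where "r2 = pi\<^sup>2 * k * a x * C * (1 - sinsq p x)"
    define y where "y = sinsq1 p x"
    have y2: "k * y\<^sup>2 = 4 * pi\<^sup>2 * \<sigma> * (1 - sinsq p x)"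
      by (simp add: y_def sinsq1_square \<sigma>_def)
    \<comment> \<open>Clearing the denominators leaves a quadratic expression in
      \<open>\<epsilon>\<close> and \<open>\<sigma>\<close>; the relation \<open>y2\<close> and the
      choice of \<open>k\<close> turn its coefficients into \<open>r1\<close> and
      \<open>r2\<close>.\<close>
    have "D\<^sup>2 * (\<epsilon> * a x * (barrier2 C k p \<epsilon> x + (barrier1 C k p \<epsilon> x)\<^sup>2) + b x * barrier1 C k p \<epsilon> x)
        = - r1 * \<epsilon> * D + (\<epsilon> * a x * (C / 2) * (1 + C / 2) * k) * (k * y\<^sup>2) - (C / 2) * k * (b x * y) * D"
    proof -
      have "barrier1 C k p \<epsilon> x = - (C / 2) * (k * y / D)"
        "barrier2 C k p \<epsilon> x = - (C / 2) * (k * (2 * pi\<^sup>2 * (1 - 2 * sinsq p x)) / D - (k * y / D)\<^sup>2)"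
        by (simp_all add: barrier1_def barrier2_def D_def \<sigma>_def y_def)
      moreover have "D\<^sup>2 * (e * (- (C / 2) * (G / D - (H / D)\<^sup>2) + (- (C / 2) * (H / D))\<^sup>2) + B * (- (C / 2) * (H / D)))
          = - (C / 2) * e * G * D + e * (C / 2) * (1 + C / 2) * H\<^sup>2 - (C / 2) * B * H * D" for e G H B
      proof -
        have "D\<^sup>2 * (G / D) = G * D" "D\<^sup>2 * (H / D) = H * D" "D\<^sup>2 * (H / D)\<^sup>2 = H\<^sup>2"
          using D by (simp_all add: power2_eq_square)
        note 1 = this
        have "D\<^sup>2 * (e * (- c * (g - h\<^sup>2) + (- c * h)\<^sup>2) + B * (- c * h))
            = - c * e * (D\<^sup>2 * g) + e * c * (1 + c) * (D\<^sup>2 * h\<^sup>2) - c * B * (D\<^sup>2 * h)" for c g h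
          by (simp add: power2_eq_square algebra_simps)
        from this[of "C / 2" "G / D" "H / D"] show ?thesis
          unfolding 1 by (simp only: mult.assoc)
      qed
      ultimately have "D\<^sup>2 * (\<epsilon> * a x * (barrier2 C k p \<epsilon> x + (barrier1 C k p \<epsilon> x)\<^sup>2) + b x * barrier1 C k p \<epsilon> x)
          = - (C / 2) * (\<epsilon> * a x) * (k * (2 * pi\<^sup>2 * (1 - 2 * sinsq p x))) * D
            + \<epsilon> * a x * (C / 2) * (1 + C / 2) * (k * y)\<^sup>2 - (C / 2) * b x * (k * y) * D"
        by (simp only:)
      moreover have "- (C / 2) * (\<epsilon> * a x) * (k * (2 * pi\<^sup>2 * T)) * D = - (pi\<^sup>2 * k * a x * C * T) * \<epsilon> * D" for T
        by (simp add: mult_ac)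
      moreover have "\<epsilon> * a x * (C / 2) * (1 + C / 2) * (k * y)\<^sup>2 = (\<epsilon> * a x * (C / 2) * (1 + C / 2) * k) * (k * y\<^sup>2)"
        by (simp only: power2_eq_square mult.assoc mult.commute mult.left_commute)
      moreover have "(C / 2) * b x * (k * y) * D = (C / 2) * k * (b x * y) * D"
        by (simp only: mult.assoc mult.commute mult.left_commute)
      ultimately show ?thesis
        unfolding r1_def by (simp only:)
    qed
    also have "\<dots> = - r1 * \<epsilon> * D + (2 + C) * r2 * \<epsilon> * \<sigma> - (C / 2) * k * (b x * y) * D"
    proof -
      have C4: "(C / 2) * (1 + C / 2) * 4 = C * (2 + C)"
        by (simp add: algebra_simps)
      have "(\<epsilon> * a x * (C / 2) * (1 + C / 2) * k) * (4 * pi\<^sup>2 * \<sigma> * T)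
          = ((C / 2) * (1 + C / 2) * 4) * (\<epsilon> * a x * k * pi\<^sup>2 * \<sigma> * T)" for T
        by (simp only: mult.assoc mult.commute mult.left_commute)
      also have "\<dots> T = (2 + C) * (pi\<^sup>2 * k * a x * C * T) * \<epsilon> * \<sigma>" for T
        unfolding C4 by (simp only: mult.assoc mult.commute mult.left_commute)
      finally show ?thesis
        unfolding y2 r2_def by (simp only:)
    qed
    also have "\<dots> \<le> - r1 * \<epsilon> * D + (2 + C) * r2 * \<epsilon> * \<sigma> - C * (\<beta> - \<eta>) * \<sigma> * D"
    proof -
      have "(C / 2) * k * (2 * (\<beta> - \<eta>) * sinsq p x) * D \<le> (C / 2) * k * (b x * y) * D"
        using x(3) C k D unfolding y_def by (intro mult_right_mono mult_left_mono) auto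
      moreover have "(C / 2) * k * (2 * X * sinsq p x) * D = C * X * \<sigma> * D" for X
        by (simp add: \<sigma>_def)
      ultimately show ?thesis
        by (simp only:)
    qed
    also have "\<dots> \<le> (- \<beta> + \<delta> / 2) * D\<^sup>2"
      unfolding D_def
      by (rule barrier_arithmetic[OF \<open>\<epsilon> > 0\<close> \<sigma> _ _ _ _ \<eta>(2) C \<open>\<beta> > 0\<close>])
        (use x \<eta>(1) in \<open>auto simp: r1_def r2_def\<close>)
    finally show ?thesis
      using D by (simp add: mult.commute[of "D\<^sup>2"])
  qed
  have "\<forall>\<^sub>F x in nhds z. pi\<^sup>2 * k * a x * C * (1 - 2 * sinsq p x) > \<beta> - \<eta> \<and>
      pi\<^sup>2 * k * a x * C * (1 - sinsq p x) < \<beta> + \<eta> \<and> b x * sinsq1 p x \<ge> 2 * (\<beta> - \<eta>) * sinsq p x"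
    using ev1 ev2 ev3 by (simp add: eventually_conj_iff)
  moreover have "\<forall>\<^sub>F \<epsilon> in at_right 0. (0::real) < \<epsilon>"
    by (rule eventually_at_right_less)
  ultimately show ?thesis
    unfolding eventually_prod_filter using key by (smt (verit, best) case_prod_conv)
qed


lemma sinsq_eq_0_iff: "sinsq p x = 0 \<longleftrightarrow> x - p \<in> \<int>"
proof -
  have "sinsq p x = 0 \<longleftrightarrow> (\<exists>n. pi * (x - p) = of_int n * pi)"
    unfolding sinsq_def by (simp add: sin_zero_iff_int2)
  also have "\<dots> \<longleftrightarrow> (\<exists>n. x - p = of_int n)"
    by (intro ex_cong1) (metis mult.commute mult_cancel_left pi_neq_zero)
  finally show ?thesis
    by (auto simp: Ints_def)
qed

text \<open>Away from \<open>p\<close> the denominator keeps a positive limit as \<epsilon> tends to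
  0, so the derivatives of the barrier converge and disappear once multiplied by \<epsilon>.\<close>

lemma barrier_bounded_away:
  assumes "sinsq p z \<noteq> 0" and k: "k > 0"
  shows "\<exists>L. ((\<lambda>w. barrier1 C k p (fst w) (snd w)) \<longlongrightarrow> L) (at_right 0 \<times>\<^sub>F nhds z)"
    "\<exists>L. ((\<lambda>w. barrier2 C k p (fst w) (snd w)) \<longlongrightarrow> L) (at_right 0 \<times>\<^sub>F nhds z)"
proof -
  let ?F = "at_right (0::real) \<times>\<^sub>F nhds z"
  have snd: "((\<lambda>w. f (snd w)) \<longlongrightarrow> f z) ?F" if "isCont f z" for f :: "real \<Rightarrow> real"
    by (rule filterlim_compose[OF _ filterlim_snd]) (use that in \<open>simp add: isCont_def tendsto_at_iff_tendsto_nhds\<close>)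
  have fst: "((\<lambda>w. fst w) \<longlongrightarrow> 0) ?F"
    using filterlim_fst[of "at_right (0::real)" "nhds z"] by (rule filterlim_mono) (auto simp: at_within_le_nhds)
  have S: "((\<lambda>w. sinsq p (snd w)) \<longlongrightarrow> sinsq p z) ?F"
    by (rule snd[OF DERIV_isCont[OF C2D(4)[OF C2_sinsq]]])
  have S1: "((\<lambda>w. sinsq1 p (snd w)) \<longlongrightarrow> sinsq1 p z) ?F"
    by (rule snd[OF DERIV_isCont[OF C2D(5)[OF C2_sinsq]]])
  have ne: "0 + k * sinsq p z \<noteq> 0"
    using assms by simp
  have 1: "((\<lambda>w. k * sinsq1 p (snd w) / (fst w + k * sinsq p (snd w))) \<longlongrightarrow> k * sinsq1 p z / (0 + k * sinsq p z)) ?F"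
    by (intro tendsto_intros S S1 fst ne)
  show "\<exists>L. ((\<lambda>w. barrier1 C k p (fst w) (snd w)) \<longlongrightarrow> L) ?F"
    unfolding barrier1_def by (intro exI) (rule tendsto_mult[OF tendsto_const 1])
  have "((\<lambda>w. k * (2 * pi\<^sup>2 * (1 - 2 * sinsq p (snd w))) / (fst w + k * sinsq p (snd w)))
      \<longlongrightarrow> k * (2 * pi\<^sup>2 * (1 - 2 * sinsq p z)) / (0 + k * sinsq p z)) ?F"
    by (intro tendsto_intros S fst ne)
  from tendsto_diff[OF this tendsto_power[OF 1, of 2]]
  show "\<exists>L. ((\<lambda>w. barrier2 C k p (fst w) (snd w)) \<longlongrightarrow> L) ?F"
    unfolding barrier2_def by (intro exI) (rule tendsto_mult[OF tendsto_const])
qed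

lemma tendsto_sum_ex:
  fixes f :: "'i \<Rightarrow> 'a \<Rightarrow> real"
  assumes "\<And>i. i \<in> I \<Longrightarrow> \<exists>L. (f i \<longlongrightarrow> L) F"
  shows "\<exists>L. ((\<lambda>w. \<Sum>i\<in>I. f i w) \<longlongrightarrow> L) F"
proof -
  obtain L where "\<And>i. i \<in> I \<Longrightarrow> (f i \<longlongrightarrow> L i) F"
    using assms by metis
  then show ?thesis
    by (intro exI[of _ "\<Sum>i\<in>I. L i"] tendsto_sum)
qed

context circle_drift
begin

text \<open>The exponent is \<open>K \<epsilon>\<close> times the Lyapunov function plus one barrier
  for each unstable zero. The estimate is local. Where \<open>b\<close> does not vanish, the
  Lyapunov term tends to minus infinity. At a zero with nonpositive derivative that term is
  nonpositive and \<open>c\<close> alone is at most \<open>m\<close> there. At an unstable zero the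
  barrier contributes \<open>- b1 p\<close>.\<close>

lemma eigenvalue_upper_bound:
  assumes c: "periodic c" "continuous_on UNIV c" and \<delta>: "\<delta> > 0"
    and m: "\<And>x. b x = 0 \<Longrightarrow> c x - max (b1 x) 0 \<le> m"
  shows "\<forall>\<^sub>F \<epsilon> in at_right 0. \<forall>\<mu> u. eigenpair (\<lambda>x. \<epsilon> * a x) b c \<mu> u \<longrightarrow> \<mu> \<le> m + \<delta>"
proof -
  note b' = C2D[OF b]
  obtain \<psi> g g1 where \<psi>: "C2 \<psi> g g1" and bg: "\<And>x. b x * g x \<le> 0" "\<And>x. b x \<noteq> 0 \<Longrightarrow> b x * g x < 0"
    by (rule lyapunov_function, rule that)
  note \<psi>' = C2D[OF \<psi>]
  define U where "U = {x \<in> {0..<1}. b x = 0 \<and> b1 x > 0}"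
  have U: "finite U"
    by (rule finite_subset[OF _ zeros]) (auto simp: U_def)
  obtain B where B: "B > 0" "\<And>x. norm (b1 x) \<le> B"
    by (rule periodic_bounded[OF b'(2,7)], rule that)
  \<comment> \<open>Makes \<open>9 * b1 p \<le> \<delta> * (C - 1)\<close> hold at all unstable
    zeros at once; \<open>k p\<close> is then fixed by the relation that the barrier estimate
    requires at \<open>p\<close>.\<close>
  define C where "C = 1 + 9 * B / \<delta>"
  have C: "C > 1" "9 * b1 x \<le> \<delta> * (C - 1)" for x
    using B(1) B(2)[of x] \<delta> by (auto simp: C_def)
  define k where "k p = b1 p / (pi\<^sup>2 * a p * C)" for p
  have k: "k p > 0" "pi\<^sup>2 * k p * a p * C = b1 p" if "p \<in> U" for p
    using that a(3)[of p] C by (auto simp: k_def U_def)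
  \<comment> \<open>The power -1/4 is a compromise: \<open>K \<epsilon>\<close> tends to infinity
    and so beats every bounded term where \<open>b\<close> is nonzero, while
    \<open>sqrt \<epsilon> * K \<epsilon>\<close> tends to 0, so that the square of the Lyapunov
    gradient is negligible in the second-order part.\<close>
  define K where "K \<epsilon> = 1 / sqrt (sqrt \<epsilon>)" for \<epsilon> :: real
  define T1 where "T1 V \<epsilon> x = (\<Sum>p\<in>V. barrier1 C (k p) p \<epsilon> x)" for V \<epsilon> x
  define T2 where "T2 V \<epsilon> x = (\<Sum>p\<in>V. barrier2 C (k p) p \<epsilon> x)" for V \<epsilon> x
  define E where "E \<epsilon> x = \<epsilon> * a x * ((K \<epsilon> * g1 x + T2 U \<epsilon> x) + (K \<epsilon> * g x + T1 U \<epsilon> x)\<^sup>2)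
    + b x * (K \<epsilon> * g x + T1 U \<epsilon> x) + c x" for \<epsilon> x
  have local: "\<forall>\<^sub>F (\<epsilon>, x) in at_right 0 \<times>\<^sub>F nhds z. E \<epsilon> x \<le> m + \<delta>" for z
  proof -
    let ?F = "at_right (0::real) \<times>\<^sub>F nhds z"
    let ?S = "\<lambda>V w. K (fst w) * g (snd w) + T1 V (fst w) (snd w)"
    let ?P = "\<lambda>V w. a (snd w) * (((fst w * K (fst w)) * g1 (snd w) + fst w * T2 V (fst w) (snd w)) + ((sqrt (fst w) * K (fst w)) * g (snd w) + sqrt (fst w) * T1 V (fst w) (snd w))\<^sup>2)"
    let ?Q = "\<lambda>V w. fst w * a (snd w) * ((K (fst w) * g1 (snd w) + T2 V (fst w) (snd w)) + (?S V w)\<^sup>2)"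
    have snd: "((\<lambda>w. f (snd w)) \<longlongrightarrow> f z) ?F" if "continuous_on UNIV f" for f :: "real \<Rightarrow> real"
      by (rule filterlim_compose[OF _ filterlim_snd])
        (use that in \<open>simp add: continuous_on_eq_continuous_at isCont_def tendsto_at_iff_tendsto_nhds\<close>)
    note lim = snd[OF a(2)] snd[OF b'(6)] snd[OF c(2)] snd[OF \<psi>'(7)] snd[OF \<psi>'(8)]
    have fst: "((\<lambda>w. f (fst w)) \<longlongrightarrow> l) ?F" if "(f \<longlongrightarrow> l) (at_right 0)" for f :: "real \<Rightarrow> real" and l
      by (rule filterlim_compose[OF that filterlim_fst])
    have e0: "((\<lambda>\<epsilon>::real. \<epsilon>) \<longlongrightarrow> 0) (at_right 0)" "(sqrt \<longlongrightarrow> 0) (at_right 0)"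
      "((\<lambda>\<epsilon>. \<epsilon> * K \<epsilon>) \<longlongrightarrow> 0) (at_right 0)" "((\<lambda>\<epsilon>. sqrt \<epsilon> * K \<epsilon>) \<longlongrightarrow> 0) (at_right 0)"
      unfolding K_def by real_asymp+
    note e = fst[OF e0(1)] fst[OF e0(2)] fst[OF e0(3)] fst[OF e0(4)]
    have pos: "\<forall>\<^sub>F w in ?F. fst w > 0"
      by (rule eventually_compose_filterlim[OF eventually_at_right_less[of 0] filterlim_fst])
    have Kpos: "K \<epsilon> \<ge> 0" if "\<epsilon> > 0" for \<epsilon>
      using that by (simp add: K_def)
    have away: "\<exists>L. ((\<lambda>w. T1 V (fst w) (snd w)) \<longlongrightarrow> L) ?F" "\<exists>L. ((\<lambda>w. T2 V (fst w) (snd w)) \<longlongrightarrow> L) ?F"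
      if "V \<subseteq> U" "\<And>p. p \<in> V \<Longrightarrow> sinsq p z \<noteq> 0" for V
      unfolding T1_def T2_def using that k(1) by (auto intro!: tendsto_sum_ex barrier_bounded_away)
    \<comment> \<open>The terms that are not singular at \<open>z\<close> drop out of the
      second-order part. The version with the square root is for their product with the singular
      barrier.\<close>
    have small: "((\<lambda>w. ?Q V w) \<longlongrightarrow> 0) ?F"
        "((\<lambda>w. sqrt (fst w) * (?S V w)) \<longlongrightarrow> 0) ?F"
      if V: "V \<subseteq> U" "\<And>p. p \<in> V \<Longrightarrow> sinsq p z \<noteq> 0" for V
    proof -
      obtain L1 where L1: "((\<lambda>w. T1 V (fst w) (snd w)) \<longlongrightarrow> L1) ?F"
        using away(1)[OF V] by blast
      obtain L2 where L2: "((\<lambda>w. T2 V (fst w) (snd w)) \<longlongrightarrow> L2) ?F"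
        using away(2)[OF V] by blast
      have s: "((\<lambda>w. (sqrt (fst w) * K (fst w)) * g (snd w) + sqrt (fst w) * T1 V (fst w) (snd w))
          \<longlongrightarrow> 0 * g z + 0 * L1) ?F"
        by (intro tendsto_intros e lim L1)
      then show "((\<lambda>w. sqrt (fst w) * (?S V w)) \<longlongrightarrow> 0) ?F"
        by (simp add: algebra_simps)
      have "((\<lambda>w. ?P V w)
          \<longlongrightarrow> a z * ((0 * g1 z + 0 * L2) + (0 * g z + 0 * L1)\<^sup>2)) ?F"
        by (intro tendsto_intros e lim L1 L2)
      then have "((\<lambda>w. ?P V w) \<longlongrightarrow> 0) ?F"
        by simp
      then show "((\<lambda>w. ?Q V w) \<longlongrightarrow> 0) ?F"
      proof (rule Lim_transform_eventually)
        show "\<forall>\<^sub>F w in ?F. ?P V w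
          = ?Q V w"
          using pos
        proof eventually_elim
          case (elim w)
          have "?P V w
            = a (snd w) * (fst w * (K (fst w) * g1 (snd w) + T2 V (fst w) (snd w))
              + (sqrt (fst w))\<^sup>2 * (?S V w)\<^sup>2)"
            by (simp only: power_mult_distrib[symmetric] distrib_left mult.assoc)
          then show ?case
            using elim by (simp add: algebra_simps)
        qed
      qed
    qed
    show ?thesis
    proof (cases "\<exists>p\<in>U. sinsq p z = 0")
      case False
      then have V: "U \<subseteq> U" "\<And>p. p \<in> U \<Longrightarrow> sinsq p z \<noteq> 0"
        by auto
      obtain L1 where L1: "((\<lambda>w. T1 U (fst w) (snd w)) \<longlongrightarrow> L1) ?F"
        using away(1)[OF V] by blast
      define R where "R w = ?Q U w + b (snd w) * T1 U (fst w) (snd w) + c (snd w)" for w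
      have R: "(R \<longlongrightarrow> 0 + b z * L1 + c z) ?F"
        unfolding R_def by (intro tendsto_intros small[OF V] lim L1)
      have ER: "E (fst w) (snd w) = R w + K (fst w) * (b (snd w) * g (snd w))" for w
        by (simp add: E_def R_def algebra_simps)
      have "\<forall>\<^sub>F w in ?F. E (fst w) (snd w) \<le> m + \<delta>"
      proof (cases "b z = 0")
        case True
        have "b1 z \<le> 0"
        proof (rule ccontr)
          assume "\<not> b1 z \<le> 0"
          have "frac z \<in> U"
            using True \<open>\<not> b1 z \<le> 0\<close> periodic_frac[OF b'(1), of z] periodic_frac[OF b'(2), of z]
              frac_ge_0[of z] frac_lt_1[of z] by (simp add: U_def)
          moreover have "sinsq (frac z) z = 0"
            by (simp add: sinsq_eq_0_iff frac_def)
          ultimately show False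
            using False by blast
        qed
        then have "c z \<le> m"
          using m[OF True] by simp
        then have "\<forall>\<^sub>F w in ?F. R w < m + \<delta>"
          using True \<delta> by (intro order_tendstoD(2)[OF R]) auto
        then show ?thesis
          using pos
        proof eventually_elim
          case (elim w)
          have "K (fst w) * (b (snd w) * g (snd w)) \<le> 0"
            using Kpos[OF elim(2)] bg(1) by (rule mult_nonneg_nonpos)
          then show ?case
            using elim ER[of w] by linarith
        qed
      next
        case False
        define r where "r = - (b z * g z) / 2"
        have r: "r > 0" "b z * g z < - r"
          using bg(2)[OF False] by (auto simp: r_def)
        define Q where "Q = \<bar>b z * L1 + c z\<bar> + 1 + \<bar>m\<bar>"
        have "Q > 0"
          by (simp add: Q_def add_pos_nonneg)
        have "((\<lambda>w. b (snd w) * g (snd w)) \<longlongrightarrow> b z * g z) ?F"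
          by (intro tendsto_intros lim)
        then have "\<forall>\<^sub>F w in ?F. b (snd w) * g (snd w) < - r"
          using r by (intro order_tendstoD(2)) auto
        moreover have "\<forall>\<^sub>F w in ?F. R w < \<bar>b z * L1 + c z\<bar> + 1"
          by (rule order_tendstoD(2)[OF R]) linarith
        moreover have "\<forall>\<^sub>F w in ?F. K (fst w) \<ge> Q / r"
        proof -
          have "filterlim K at_top (at_right 0)"
            unfolding K_def by real_asymp
          then have "\<forall>\<^sub>F \<epsilon> in at_right 0. Q / r \<le> K \<epsilon>"
            by (simp add: filterlim_at_top)
          then show ?thesis
            by (rule eventually_compose_filterlim[OF _ filterlim_fst])
        qed
        ultimately show ?thesis
        proof eventually_elim
          case (elim w)
          have "K (fst w) * (b (snd w) * g (snd w)) \<le> K (fst w) * (- r)"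
            using elim(1,3) r \<open>Q > 0\<close> by (intro mult_left_mono) (auto intro: order_trans[of 0 "Q / r"])
          also have "\<dots> \<le> - Q"
            using elim(3) r by (simp add: field_simps)
          finally show ?case
            using elim(2) \<delta> ER[of w] by (simp add: Q_def)
        qed
      qed
      then show ?thesis
        by (simp add: case_prod_unfold)
    next
      case True
      then obtain p where p: "p \<in> U" "sinsq p z = 0"
        by blast
      then have p': "b p = 0" "b1 p > 0" "p \<in> {0..<1}"
        by (auto simp: U_def)
      obtain n where n: "z - p = of_int n"
        using p(2) unfolding sinsq_eq_0_iff by (auto simp: Ints_def)
      then have z: "z = p + of_int n"
        by simp
      have bz: "b z = 0" "b1 z = b1 p" "a z = a p"
        unfolding z using periodic_add_of_int[OF b'(1)] periodic_add_of_int[OF b'(2)]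
          periodic_add_of_int[OF a(1)] p' by simp_all
      \<comment> \<open>Points of \<open>{0..<1}\<close> that differ by an integer coincide, so only
        the barrier of \<open>p\<close> is singular at \<open>z\<close>.\<close>
      define V where "V = U - {p}"
      have V: "V \<subseteq> U" "\<And>q. q \<in> V \<Longrightarrow> sinsq q z \<noteq> 0"
      proof -
        show "V \<subseteq> U"
          by (auto simp: V_def)
        fix q
        assume q: "q \<in> V"
        show "sinsq q z \<noteq> 0"
        proof
          assume "sinsq q z = 0"
          then have "(z - q) - (z - p) \<in> \<int>"
            using p(2) unfolding sinsq_eq_0_iff by (rule Ints_diff)
          then have "p - q \<in> \<int>"
            by simp
          then obtain j where j: "p - q = of_int j"
            by (auto simp: Ints_def)
          have "q \<in> {0..<1}"
            using q by (auto simp: V_def U_def)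
          then have "\<bar>of_int j :: real\<bar> < 1"
            using p'(3) unfolding j[symmetric] by auto
          then have "j = 0"
            by linarith
          then show False
            using j q by (simp add: V_def)
        qed
      qed
      have split: "T1 U \<epsilon> x = T1 V \<epsilon> x + barrier1 C (k p) p \<epsilon> x" "T2 U \<epsilon> x = T2 V \<epsilon> x + barrier2 C (k p) p \<epsilon> x" for \<epsilon> x
        unfolding T1_def T2_def V_def using U p(1) by (simp_all add: sum.remove add.commute)
      obtain L1 where L1: "((\<lambda>w. T1 V (fst w) (snd w)) \<longlongrightarrow> L1) ?F"
        using away(1)[OF V] by blast
      define Y where "Y w = sqrt (fst w) * (?S V w)" for w
      define Z where "Z w = sqrt (fst w) * barrier1 C (k p) p (fst w) (snd w)" for w
      define X where "X w = ?Q V w" for w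
      \<comment> \<open>The cross term of the square: one factor tends to 0, the other is bounded
        uniformly by \<open>barrier1_bound\<close>.\<close>
      have YZ: "((\<lambda>w. Y w * Z w) \<longlongrightarrow> 0) ?F"
      proof (rule tendsto_0_le)
        show "(Y \<longlongrightarrow> 0) ?F"
          unfolding Y_def by (rule small(2)[OF V])
        show "\<forall>\<^sub>F w in ?F. norm (Y w * Z w) \<le> norm (Y w) * (C * pi * sqrt (k p))"
          using pos
        proof eventually_elim
          case (elim w)
          have "\<bar>Z w\<bar> \<le> C * pi * sqrt (k p)"
            unfolding Z_def by (rule barrier1_bound) (use elim k[OF p(1)] C in auto)
          then show ?case
            by (simp add: abs_mult mult_left_mono)
        qed
      qed
      have rest: "((\<lambda>w. X w + 2 * a (snd w) * (Y w * Z w) + b (snd w) * T1 V (fst w) (snd w) + c (snd w))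
          \<longlongrightarrow> 0 + 2 * a z * 0 + b z * L1 + c z) ?F"
        unfolding X_def by (intro tendsto_intros YZ small(1)[OF V] lim L1)
      have cz: "c z \<le> m + b1 p"
        using m[OF bz(1)] bz(2) p'(2) by simp
      then have "\<forall>\<^sub>F w in ?F. X w + 2 * a (snd w) * (Y w * Z w) + b (snd w) * T1 V (fst w) (snd w) + c (snd w) < m + b1 p + \<delta> / 2"
        using \<delta> bz(1) by (intro order_tendstoD(2)[OF rest]) auto
      moreover have "\<forall>\<^sub>F (\<epsilon>, x) in ?F.
          \<epsilon> * a x * (barrier2 C (k p) p \<epsilon> x + (barrier1 C (k p) p \<epsilon> x)\<^sup>2) + b x * barrier1 C (k p) p \<epsilon> x \<le> - b1 p + \<delta> / 2"
      proof (rule barrier_supersolution)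
        show "isCont a z"
          using a(2) by (simp add: continuous_on_eq_continuous_at)
        show "(b has_real_derivative b1 p) (at z)"
          using b'(4)[of z] bz by simp
        show "pi\<^sup>2 * k p * a z * C = b1 p"
          using k(2)[OF p(1)] bz by simp
      qed (use a bz p p' k C in auto)
      ultimately have "\<forall>\<^sub>F w in ?F. E (fst w) (snd w) \<le> m + \<delta>"
        using pos
      proof eventually_elim
        case (elim w)
        obtain \<epsilon> x where w: "w = (\<epsilon>, x)"
          by (cases w)
        define s where "s = sqrt \<epsilon>"
        have \<epsilon>: "\<epsilon> = s * s"
          using elim(3) by (simp add: w s_def)
        have "K \<epsilon> * (b x * g x) \<le> 0"
          using elim(3) by (intro mult_nonneg_nonpos[OF Kpos bg(1)]) (simp add: w)
        moreover have "E \<epsilon> x = (X w + 2 * a x * (Y w * Z w) + b x * T1 V \<epsilon> x + c x)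
          + (\<epsilon> * a x * (barrier2 C (k p) p \<epsilon> x + (barrier1 C (k p) p \<epsilon> x)\<^sup>2) + b x * barrier1 C (k p) p \<epsilon> x)
          + K \<epsilon> * (b x * g x)"
        proof -
          define A1 where "A1 = K \<epsilon> * g x + T1 V \<epsilon> x"
          define A2 where "A2 = K \<epsilon> * g1 x + T2 V \<epsilon> x"
          define B1 where "B1 = barrier1 C (k p) p \<epsilon> x"
          define B2 where "B2 = barrier2 C (k p) p \<epsilon> x"
          have "E \<epsilon> x = \<epsilon> * a x * ((A2 + B2) + (A1 + B1)\<^sup>2) + b x * (A1 + B1) + c x"
            unfolding E_def split A1_def A2_def B1_def B2_def by (simp add: add.assoc)
          also have "\<dots> = \<epsilon> * a x * (A2 + A1\<^sup>2) + 2 * a x * (\<epsilon> * A1 * B1) + b x * A1 + c x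
              + (\<epsilon> * a x * (B2 + B1\<^sup>2) + b x * B1)"
            by (simp add: power2_eq_square algebra_simps)
          also have "\<epsilon> * A1 * B1 = Y w * Z w"
          proof -
            have "Y w = s * A1" "Z w = s * B1"
              by (simp_all add: Y_def Z_def w s_def A1_def B1_def)
            then show ?thesis
              by (simp add: \<epsilon>[symmetric] mult.commute mult.left_commute)
          qed
          also have "\<epsilon> * a x * (A2 + A1\<^sup>2) = X w"
            by (simp add: X_def w A1_def A2_def)
          finally show ?thesis
            unfolding B1_def B2_def A1_def by (simp add: algebra_simps)
        qed
        ultimately show ?case
          using elim(1,2) by (simp add: w)
      qed
      then show ?thesis
        by (simp add: case_prod_unfold)
    qed
  qed
  \<comment> \<open>The local estimates become uniform on the compact period, and periodicity
    carries them to the line.\<close>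
  have "\<forall>\<^sub>F \<epsilon> in at_right 0. \<forall>x\<in>{0..1}. case (\<epsilon>, x) of (\<epsilon>, x) \<Rightarrow> E \<epsilon> x \<le> m + \<delta>"
    by (rule eventually_compact_prod[OF compact_Icc]) (rule local)
  then show ?thesis
    using eventually_at_right_less[of 0]
  proof eventually_elim
    case (elim \<epsilon>)
    define \<Psi> where "\<Psi> x = K \<epsilon> * \<psi> x + (\<Sum>p\<in>U. barrier C (k p) p \<epsilon> x)" for x
    have \<Psi>: "C2 \<Psi> (\<lambda>x. K \<epsilon> * g x + T1 U \<epsilon> x) (\<lambda>x. K \<epsilon> * g1 x + T2 U \<epsilon> x)"
      unfolding \<Psi>_def[abs_def] T1_def T2_def
      by (intro C2_add C2_cmult C2_sum \<psi> U C2_barrier elim(2) k)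
    have "E \<epsilon> x \<le> m + \<delta>" for x
    proof -
      have "periodic (E \<epsilon>)"
        using C2D(2,3)[OF \<Psi>] a(1) b'(1) c(1) unfolding E_def periodic_def by simp
      then obtain y where "y \<in> {0..1}" "E \<epsilon> y = E \<epsilon> x"
        by (rule periodic_reduce)
      then show ?thesis
        using elim(1) by fastforce
    qed
    then show ?case
      unfolding eigenpair_def E_def
      using eigenvalue_le_supersolution[OF _ _ _ _ \<Psi>] a(3) elim(2)
      by (meson mult_pos_pos)
  qed
qed

end


section \<open>The limit of the principal eigenvalue on the circle\<close>

locale circle_field =
  fixes \<sigma> b a :: "circle \<Rightarrow> real"
  assumes C2_\<sigma>: "C_on 2 UNIV \<sigma>" and C2_b: "C_on 2 UNIV b"
    and a_def: "\<And>p. a p = (\<sigma> p)\<^sup>2 / 2" and a_pos: "\<And>p. a p > 0"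
    and b_pos: "\<exists>p. b p > 0" and b_neg: "\<exists>p. b p < 0"
    and finite_zeros: "finite {p. b p = 0}"
begin

lemma continuous_a: "continuous_on UNIV a"
proof -
  have "continuous_on UNIV \<sigma>"
    using C2D(6)[OF C_on_2_C2[OF C2_\<sigma>]] by (simp add: continuous_lift_iff)
  then show ?thesis
    unfolding a_def by (intro continuous_intros) auto
qed

lemma continuous_b: "continuous_on UNIV b"
  using C2D(6)[OF C_on_2_C2[OF C2_b]] by (simp add: continuous_lift_iff)

sublocale circle_drift "\<lambda>x. a (to_circle x)" "\<lambda>x. b (to_circle x)" "\<lambda>x. circle_deriv b (to_circle x)"
  "\<lambda>x. circle_deriv (circle_deriv b) (to_circle x)"
proof
  show "\<exists>x. b (to_circle x) > 0" "\<exists>x. b (to_circle x) < 0"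
    using b_pos b_neg circle_cases by metis+
  have "inj_on to_circle {x \<in> {0..<1}. b (to_circle x) = 0}"
  proof (rule inj_onI)
    fix x y
    assume xy: "x \<in> {x \<in> {0..<1}. b (to_circle x) = 0}" "y \<in> {x \<in> {0..<1}. b (to_circle x) = 0}"
      and "to_circle x = to_circle y"
    then obtain n where n: "x - y = of_int n"
      by (auto simp: to_circle_eq_iff Ints_def)
    have "\<bar>of_int n :: real\<bar> < 1"
      unfolding n[symmetric] using xy by auto
    then have "n = 0"
      by linarith
    then show "x = y"
      using n by simp
  qed
  then show "finite {x \<in> {0..<1}. b (to_circle x) = 0}"
    by (rule inj_on_finite[OF _ _ finite_zeros]) auto
  show "C2 (\<lambda>x. b (to_circle x)) (\<lambda>x. circle_deriv b (to_circle x))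
      (\<lambda>x. circle_deriv (circle_deriv b) (to_circle x))"
    by (rule C_on_2_C2[OF C2_b])
qed (use a_pos continuous_a in \<open>auto intro: periodic_lift continuous_lift\<close>)

definition zeros :: "circle set"
  where "zeros = {p. b p = 0}"

text \<open>At a zero of \<open>b\<close>, the limiting exponential rate at which the diffusion
  leaves it, and the value of the rate function at the Dirac measure there.\<close>

definition escape :: "circle \<Rightarrow> real"
  where "escape p = max (circle_deriv b p) 0"

definition \<Lambda> :: "(circle \<Rightarrow> real) \<Rightarrow> real"
  where "\<Lambda> c = (MAX p\<in>zeros. c p - escape p)"

lemma finite_zeros': "finite zeros"
  using finite_zeros by (simp add: zeros_def)

lemma zeros_nonempty: "zeros \<noteq> {}"
proof -
  obtain x y where xy: "b (to_circle x) > 0" "b (to_circle y) < 0"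
    using b_pos b_neg circle_cases by metis
  have c: "continuous_on S (\<lambda>x. b (to_circle x))" for S
    using continuous_lift[OF continuous_b] continuous_on_subset by blast
  have "\<exists>z. b (to_circle z) = 0"
  proof (cases "x \<le> y")
    case True
    then show ?thesis
      using IVT2'[of "\<lambda>x. b (to_circle x)" y 0 x] xy c by force
  next
    case False
    then show ?thesis
      using IVT'[of "\<lambda>x. b (to_circle x)" y 0 x] xy c by force
  qed
  then show ?thesis
    by (auto simp: zeros_def)
qed

lemma \<Lambda>_ge: "p \<in> zeros \<Longrightarrow> c p - escape p \<le> \<Lambda> c"
  unfolding \<Lambda>_def using finite_zeros' by simp

lemma \<Lambda>_le_iff: "\<Lambda> c \<le> r \<longleftrightarrow> (\<forall>p\<in>zeros. c p - escape p \<le> r)"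
  unfolding \<Lambda>_def using finite_zeros' zeros_nonempty by simp

lemma principal_eigenpair:
  assumes c: "continuous_on UNIV c" and "\<epsilon> > 0"
  obtains \<mu> u where "eigenpair (\<lambda>x. \<epsilon> * a (to_circle x)) (\<lambda>x. b (to_circle x)) (\<lambda>x. c (to_circle x)) \<mu> u"
    "Re (principal_eigenvalue \<epsilon> a b c) = \<mu>"
proof -
  have \<alpha>: "periodic (\<lambda>x. \<epsilon> * a (to_circle x))" "continuous_on UNIV (\<lambda>x. \<epsilon> * a (to_circle x))"
      "\<And>x. \<epsilon> * a (to_circle x) > 0"
    using a_pos \<open>\<epsilon> > 0\<close> continuous_a
    by (auto simp: periodic_def to_circle_add_1 intro!: continuous_intros continuous_lift)
  obtain \<mu> u u1 u2 where u: "C2 u u1 u2" "\<And>x. u x > 0"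
    "\<And>x. \<epsilon> * a (to_circle x) * u2 x + b (to_circle x) * u1 x + c (to_circle x) * u x = \<mu> * u x"
    by (rule principal_eigenfunction[OF \<alpha> periodic_lift continuous_lift[OF continuous_b]
          periodic_lift continuous_lift[OF c]], rule that)
  show ?thesis
  proof (rule that)
    show "eigenpair (\<lambda>x. \<epsilon> * a (to_circle x)) (\<lambda>x. b (to_circle x)) (\<lambda>x. c (to_circle x)) \<mu> u"
      unfolding eigenpair_def using u by blast
    show "Re (principal_eigenvalue \<epsilon> a b c) = \<mu>"
      using principal_eigenvalue_eq[OF continuous_a a_pos continuous_b \<open>\<epsilon> > 0\<close> u] by simp
  qed
qed

text \<open>Stated for all positive eigenpairs, so that it serves both the defined limit of
  eigenvalues and the eigenfunction that drives the exponential martingale.\<close>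

lemma eventually_eigenvalue:
  assumes c: "continuous_on UNIV c" and "\<delta> > 0"
  shows "\<forall>\<^sub>F \<epsilon> in at_right 0. \<forall>\<mu> u.
    eigenpair (\<lambda>x. \<epsilon> * a (to_circle x)) (\<lambda>x. b (to_circle x)) (\<lambda>x. c (to_circle x)) \<mu> u \<longrightarrow>
    \<Lambda> c - \<delta> \<le> \<mu> \<and> \<mu> \<le> \<Lambda> c + \<delta>"
proof -
  have cont: "isCont (\<lambda>x. f (to_circle x)) z" if "continuous_on UNIV f" for f :: "circle \<Rightarrow> real" and z
    using continuous_lift[OF that] by (simp add: continuous_on_eq_continuous_at)
  have "\<Lambda> c \<in> (\<lambda>p. c p - escape p) ` zeros"
    unfolding \<Lambda>_def using finite_zeros' zeros_nonempty by (intro Max_in) auto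
  then obtain p where p: "b p = 0" "\<Lambda> c = c p - escape p"
    by (auto simp: zeros_def)
  obtain z where z: "p = to_circle z"
    by (rule circle_cases)
  have low: "\<forall>\<^sub>F \<epsilon> in at_right 0. \<forall>\<mu> u.
      eigenpair (\<lambda>x. \<epsilon> * a (to_circle x)) (\<lambda>x. b (to_circle x)) (\<lambda>x. c (to_circle x)) \<mu> u \<longrightarrow>
      c (to_circle z) - max (circle_deriv b (to_circle z)) 0 - \<delta> \<le> \<mu>"
    by (rule eigenvalue_lower_bound)
      (use a_pos continuous_a c p z \<open>\<delta> > 0\<close> C2D(4)[OF C_on_2_C2[OF C2_b]] in \<open>auto intro: cont\<close>)
  have "\<forall>\<^sub>F \<epsilon> in at_right 0. \<forall>\<mu> u.
      eigenpair (\<lambda>x. \<epsilon> * a (to_circle x)) (\<lambda>x. b (to_circle x)) (\<lambda>x. c (to_circle x)) \<mu> u \<longrightarrow> \<mu> \<le> \<Lambda> c + \<delta>"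
  proof (rule eigenvalue_upper_bound[OF periodic_lift continuous_lift[OF c] \<open>\<delta> > 0\<close>])
    fix x
    assume "b (to_circle x) = 0"
    then show "c (to_circle x) - max (circle_deriv b (to_circle x)) 0 \<le> \<Lambda> c"
      using \<Lambda>_ge[of "to_circle x" c] by (simp add: zeros_def escape_def)
  qed
  then show ?thesis
    using low by eventually_elim (use p z in \<open>auto simp: escape_def\<close>)
qed

lemma limit_eigenvalue_eq:
  assumes c: "continuous_on UNIV c"
  shows "limit_eigenvalue a b c = \<Lambda> c"
proof -
  have "((\<lambda>\<epsilon>. Re (principal_eigenvalue \<epsilon> a b c)) \<longlongrightarrow> \<Lambda> c) (at_right 0)"
  proof (rule tendstoI)
    fix e :: real
    assume "e > 0"
    then have "\<forall>\<^sub>F \<epsilon> in at_right 0. \<forall>\<mu> u.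
        eigenpair (\<lambda>x. \<epsilon> * a (to_circle x)) (\<lambda>x. b (to_circle x)) (\<lambda>x. c (to_circle x)) \<mu> u \<longrightarrow>
        \<Lambda> c - e / 2 \<le> \<mu> \<and> \<mu> \<le> \<Lambda> c + e / 2"
      by (intro eventually_eigenvalue[OF c]) simp
    then show "\<forall>\<^sub>F \<epsilon> in at_right 0. dist (Re (principal_eigenvalue \<epsilon> a b c)) (\<Lambda> c) < e"
      using eventually_at_right_less[of 0]
    proof eventually_elim
      case (elim \<epsilon>)
      obtain \<mu> u where "eigenpair (\<lambda>x. \<epsilon> * a (to_circle x)) (\<lambda>x. b (to_circle x)) (\<lambda>x. c (to_circle x)) \<mu> u"
        "Re (principal_eigenvalue \<epsilon> a b c) = \<mu>"
        by (rule principal_eigenpair[OF c elim(2)], rule that)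
      then have "\<Lambda> c - e / 2 \<le> Re (principal_eigenvalue \<epsilon> a b c)"
        "Re (principal_eigenvalue \<epsilon> a b c) \<le> \<Lambda> c + e / 2"
        using elim(1) by blast+
      then have "\<bar>Re (principal_eigenvalue \<epsilon> a b c) - \<Lambda> c\<bar> \<le> e / 2"
        by linarith
      then show ?case
        using \<open>e > 0\<close> by (simp add: dist_real_def)
    qed
  qed
  then show ?thesis
    unfolding limit_eigenvalue_def by (intro tendsto_Lim) auto
qed

end


section \<open>Increments of the stochastic integral\<close>

context brownian_motion
begin

definition dW :: "real \<Rightarrow> real \<Rightarrow> 'w \<Rightarrow> real"
  where "dW s t \<omega> = W t \<omega> - W s \<omega>"

lemma F_mono_measurable: "f \<in> borel_measurable (F s) \<Longrightarrow> s \<le> t \<Longrightarrow> f \<in> borel_measurable (F t)"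
  using sets_F_mono[of s t] space_F by (auto simp: measurable_def)

lemma F_measurable: "f \<in> borel_measurable (F s) \<Longrightarrow> f \<in> borel_measurable M"
  using F_subalgebra[of s] space_F by (auto simp: measurable_def)

lemma dW_F: "0 \<le> s \<Longrightarrow> s \<le> t \<Longrightarrow> t \<le> u \<Longrightarrow> dW s t \<in> borel_measurable (F u)"
  unfolding dW_def using F_mono_measurable[OF adapted, of s u] F_mono_measurable[OF adapted, of t u]
  by (intro borel_measurable_diff) auto

lemma dW_measurable: "0 \<le> s \<Longrightarrow> s \<le> t \<Longrightarrow> dW s t \<in> borel_measurable M"
  using dW_F[of s t t] F_measurable by auto

lemma dW_moment:
  assumes "0 \<le> s" "s \<le> t"
  shows "integrable M (\<lambda>\<omega>. dW s t \<omega> ^ n)" "expectation (dW s t) = 0"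
    "expectation (\<lambda>\<omega>. (dW s t \<omega>)\<^sup>2) = t - s" "expectation (\<lambda>\<omega>. (dW s t \<omega>) ^ 4) = 3 * (t - s)\<^sup>2"
proof -
  have "integrable M (\<lambda>\<omega>. dW s t \<omega> ^ n) \<and> expectation (dW s t) = 0 \<and>
    expectation (\<lambda>\<omega>. (dW s t \<omega>)\<^sup>2) = t - s \<and> expectation (\<lambda>\<omega>. (dW s t \<omega>) ^ 4) = 3 * (t - s)\<^sup>2"
  proof (cases "s = t")
    case True
    then show ?thesis
      by (simp add: dW_def[abs_def])
  next
    case False
    then have st: "s < t"
      using assms by simp
    define \<tau> where "\<tau> = sqrt (t - s)"
    have \<tau>: "\<tau> > 0" "\<tau>\<^sup>2 = t - s"
      using st by (auto simp: \<tau>_def)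
    have D: "distributed M lborel (dW s t) (normal_density 0 \<tau>)"
      using normal_increments[OF assms(1) st] by (simp add: dW_def[abs_def] \<tau>_def)
    have int: "integrable M (\<lambda>\<omega>. dW s t \<omega> ^ n)"
      using integrable_normal_moment[OF \<tau>(1), of 0 n]
      by (subst distributed_integrable[OF D, symmetric]) auto
    have E: "expectation (\<lambda>\<omega>. dW s t \<omega> ^ n) = (\<integral>x. normal_density 0 \<tau> x * x ^ n \<partial>lborel)" for n
      by (rule distributed_integral[OF D, symmetric]) auto
    have 1: "expectation (dW s t) = 0"
      using E[of 1] integral_normal_moment_odd[OF \<tau>(1), of 0 0] by simp
    have 2: "expectation (\<lambda>\<omega>. (dW s t \<omega>)\<^sup>2) = t - s"
      using E[of 2] integral_normal_moment_even[OF \<tau>(1), of 0 1] \<tau> by simp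
    have 4: "expectation (\<lambda>\<omega>. (dW s t \<omega>) ^ 4) = 3 * (t - s)\<^sup>2"
      using E[of 4] integral_normal_moment_even[OF \<tau>(1), of 0 2] \<tau>(2)[symmetric]
      by (simp add: fact_numeral power2_eq_square field_simps)
    show ?thesis
      using int 1 2 4 by blast
  qed
  then show "integrable M (\<lambda>\<omega>. dW s t \<omega> ^ n)" "expectation (dW s t) = 0"
    "expectation (\<lambda>\<omega>. (dW s t \<omega>)\<^sup>2) = t - s" "expectation (\<lambda>\<omega>. (dW s t \<omega>) ^ 4) = 3 * (t - s)\<^sup>2"
    by auto
qed

text \<open>The preimages under the increment form an Int-stable generator, so independence extends
  to the generated sigma-algebra and thereby to powers of the increment.\<close>

lemma dW_indep:
  assumes st: "0 \<le> s" "s \<le> t" and Z: "Z \<in> borel_measurable (F s)" "integrable M Z"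
  shows "integrable M (\<lambda>\<omega>. Z \<omega> * dW s t \<omega> ^ n)"
    "expectation (\<lambda>\<omega>. Z \<omega> * dW s t \<omega> ^ n) = expectation Z * expectation (\<lambda>\<omega>. dW s t \<omega> ^ n)"
proof -
  have "integrable M (\<lambda>\<omega>. Z \<omega> * dW s t \<omega> ^ n) \<and>
    expectation (\<lambda>\<omega>. Z \<omega> * dW s t \<omega> ^ n) = expectation Z * expectation (\<lambda>\<omega>. dW s t \<omega> ^ n)"
  proof (cases "s = t")
    case True
    then show ?thesis
      using Z(2) by (simp add: dW_def[abs_def] prob_space)
  next
    case False
    then have "s < t"
      using st by simp
    let ?G = "{dW s t -` A \<inter> space M | A. A \<in> sets borel}"
    have ind: "indep_set (sets (F s)) ?G"
      using indep_increments[OF st(1) \<open>s < t\<close>] by (simp add: dW_def[abs_def])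
    have "Int_stable (sets (F s))"
      by (auto simp: Int_stable_def)
    moreover have "Int_stable ?G"
    proof (clarsimp simp: Int_stable_def)
      fix A B :: "real set"
      assume "A \<in> sets borel" "B \<in> sets borel"
      then show "\<exists>Aa. dW s t -` A \<inter> space M \<inter> (dW s t -` B \<inter> space M) = dW s t -` Aa \<inter> space M \<and> Aa \<in> sets borel"
        by (intro exI[of _ "A \<inter> B"]) auto
    qed
    ultimately have "indep_set (sigma_sets (space M) (sets (F s))) (sigma_sets (space M) ?G)"
      by (rule indep_set_sigma_sets[OF ind])
    then have ind2: "indep_set (sets (F s)) (sigma_sets (space M) ?G)"
      using sets.sigma_sets_eq[of "F s"] by (simp add: space_F)
    have "indep_var borel Z borel (\<lambda>\<omega>. dW s t \<omega> ^ n)"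
      unfolding indep_var_eq
    proof (intro conjI F_measurable[OF Z(1)] borel_measurable_power dW_measurable st)
      show "indep_set (sigma_sets (space M) {Z -` A \<inter> space M |A. A \<in> sets borel})
          (sigma_sets (space M) {(\<lambda>\<omega>. dW s t \<omega> ^ n) -` A \<inter> space M |A. A \<in> sets borel})"
        unfolding indep_set_def
      proof (rule indep_sets_mono_sets[OF ind2[unfolded indep_set_def]])
        fix i :: bool
        have "sigma_sets (space M) {Z -` A \<inter> space M |A. A \<in> sets borel} \<subseteq> sets (F s)"
          using measurable_sets[OF Z(1)] space_F[of s] sets.sigma_sets_subset[of "{Z -` A \<inter> space M |A. A \<in> sets borel}" "F s"]
          by auto
        moreover have "sigma_sets (space M) {(\<lambda>\<omega>. dW s t \<omega> ^ n) -` A \<inter> space M |A. A \<in> sets borel}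
            \<subseteq> sigma_sets (space M) ?G"
        proof (rule sigma_sets_mono, safe)
          fix A :: "real set"
          assume "A \<in> sets borel"
          then have "(\<lambda>x. x ^ n) -` A \<inter> space borel \<in> sets (borel :: real measure)"
            by (intro measurable_sets[of _ borel borel]) auto
          then have "(\<lambda>x::real. x ^ n) -` A \<in> sets borel"
            by simp
          moreover have "(\<lambda>\<omega>. dW s t \<omega> ^ n) -` A \<inter> space M = dW s t -` ((\<lambda>x. x ^ n) -` A) \<inter> space M"
            by auto
          ultimately show "(\<lambda>\<omega>. dW s t \<omega> ^ n) -` A \<inter> space M \<in> sigma_sets (space M) ?G"
            by (intro sigma_sets.Basic CollectI exI[of _ "(\<lambda>x. x ^ n) -` A"]) simp
        qed
        ultimately show "case_bool (sigma_sets (space M) {Z -` A \<inter> space M |A. A \<in> sets borel})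
            (sigma_sets (space M) {(\<lambda>\<omega>. dW s t \<omega> ^ n) -` A \<inter> space M |A. A \<in> sets borel}) i
            \<subseteq> case_bool (sets (F s)) (sigma_sets (space M) ?G) i"
          by (cases i) auto
      qed
    qed
    from indep_var_integrable[OF this Z(2)] indep_var_lebesgue_integral[OF this Z(2)] dW_moment(1)[OF st]
    show ?thesis
      by auto
  qed
  then show "integrable M (\<lambda>\<omega>. Z \<omega> * dW s t \<omega> ^ n)"
    "expectation (\<lambda>\<omega>. Z \<omega> * dW s t \<omega> ^ n) = expectation Z * expectation (\<lambda>\<omega>. dW s t \<omega> ^ n)"
    by auto
qed

lemma dW_orthogonal:
  assumes "0 \<le> s" "s \<le> t" "Z \<in> borel_measurable (F s)" "integrable M Z"
  shows "integrable M (\<lambda>\<omega>. Z \<omega> * dW s t \<omega>)" "expectation (\<lambda>\<omega>. Z \<omega> * dW s t \<omega>) = 0"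
  using dW_indep[OF assms, of 1] dW_moment(2)[OF assms(1,2)] by auto

text \<open>
  A piece \<open>(s, t, e)\<close> is the integrand \<open>e\<close> on $[s,t)$; lists of pieces stand for simple integrands
  with arbitrary, possibly overlapping time intervals.
\<close>

definition piece :: "real \<times> real \<times> ('w \<Rightarrow> real) \<Rightarrow> bool"
  where "piece = (\<lambda>(s, t, e). 0 \<le> s \<and> s \<le> t \<and> e \<in> borel_measurable (F s) \<and> (\<exists>C. \<forall>\<omega>\<in>space M. \<bar>e \<omega>\<bar> \<le> C))"

definition pint :: "real \<times> real \<times> ('w \<Rightarrow> real) \<Rightarrow> 'w \<Rightarrow> real"
  where "pint = (\<lambda>(s, t, e) \<omega>. e \<omega> * dW s t \<omega>)"

definition pval :: "real \<times> real \<times> ('w \<Rightarrow> real) \<Rightarrow> real \<Rightarrow> 'w \<Rightarrow> real"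
  where "pval = (\<lambda>(s, t, e) r \<omega>. e \<omega> * indicator {s..<t} r)"

text \<open>The length of the common part of the two time intervals.\<close>

definition overlap :: "real \<times> real \<times> ('w \<Rightarrow> real) \<Rightarrow> real \<times> real \<times> ('w \<Rightarrow> real) \<Rightarrow> real"
  where "overlap = (\<lambda>(s, t, e) (s', t', e'). max 0 (min t t' - max s s'))"

lemma bounded_integrable:
  fixes f :: "'w \<Rightarrow> real"
  assumes "f \<in> borel_measurable M" "\<And>\<omega>. \<omega> \<in> space M \<Longrightarrow> \<bar>f \<omega>\<bar> \<le> C"
  shows "integrable M f"
  by (rule integrable_const_bound[of _ C]) (use assms in auto)

lemma bounded_mult_integrable:
  fixes f g :: "'w \<Rightarrow> real"
  assumes "f \<in> borel_measurable M" "\<And>\<omega>. \<omega> \<in> space M \<Longrightarrow> \<bar>f \<omega>\<bar> \<le> C" "integrable M g"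
  shows "integrable M (\<lambda>\<omega>. f \<omega> * g \<omega>)"
proof (rule Bochner_Integration.integrable_bound[OF integrable_mult_right[OF assms(3), of "\<bar>C\<bar>"]])
  show "(\<lambda>\<omega>. f \<omega> * g \<omega>) \<in> borel_measurable M"
    using assms by auto
  show "AE \<omega> in M. norm (f \<omega> * g \<omega>) \<le> norm (\<bar>C\<bar> * g \<omega>)"
    using assms(2) abs_ge_self[of C] by (auto intro!: AE_I2 mult_right_mono simp: abs_mult intro: order_trans)
qed

lemma square_integrable_mult:
  fixes f g :: "'w \<Rightarrow> real"
  assumes "f \<in> borel_measurable M" "g \<in> borel_measurable M"
    "integrable M (\<lambda>\<omega>. (f \<omega>)\<^sup>2)" "integrable M (\<lambda>\<omega>. (g \<omega>)\<^sup>2)"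
  shows "integrable M (\<lambda>\<omega>. f \<omega> * g \<omega>)"
proof (rule Bochner_Integration.integrable_bound[OF Bochner_Integration.integrable_add[OF assms(3,4)]])
  show "(\<lambda>\<omega>. f \<omega> * g \<omega>) \<in> borel_measurable M"
    using assms by auto
  have "\<bar>x * y\<bar> \<le> \<bar>x\<^sup>2 + y\<^sup>2\<bar>" for x y :: real
  proof -
    have "2 * (\<bar>x\<bar> * \<bar>y\<bar>) \<le> x\<^sup>2 + y\<^sup>2"
      using sum_squares_bound[of "\<bar>x\<bar>" "\<bar>y\<bar>"] by (simp add: mult.assoc)
    moreover have "0 \<le> \<bar>x\<bar> * \<bar>y\<bar>"
      by simp
    ultimately show ?thesis
      unfolding abs_mult by linarith
  qed
  then show "AE \<omega> in M. norm (f \<omega> * g \<omega>) \<le> norm ((f \<omega>)\<^sup>2 + (g \<omega>)\<^sup>2)"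
    by (auto intro!: AE_I2)
qed

lemma pint_square_integrable:
  assumes "piece p"
  shows "pint p \<in> borel_measurable M" "integrable M (\<lambda>\<omega>. (pint p \<omega>)\<^sup>2)"
proof -
  obtain s t e where p: "p = (s, t, e)"
    by (cases p)
  then obtain C where e: "0 \<le> s" "s \<le> t" "e \<in> borel_measurable M" "\<And>\<omega>. \<omega> \<in> space M \<Longrightarrow> \<bar>e \<omega>\<bar> \<le> C"
    using assms F_measurable by (auto simp: piece_def)
  show "pint p \<in> borel_measurable M"
    using e dW_measurable[OF e(1,2)] by (auto simp: p pint_def)
  have "integrable M (\<lambda>\<omega>. (e \<omega>)\<^sup>2 * (dW s t \<omega>)\<^sup>2)"
  proof (rule bounded_mult_integrable)
    show "\<bar>(e \<omega>)\<^sup>2\<bar> \<le> C\<^sup>2" if "\<omega> \<in> space M" for \<omega>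
      using e(4)[OF that] by (simp add: abs_le_square_iff[symmetric])
  qed (use e dW_moment(1)[OF e(1,2)] in auto)
  then show "integrable M (\<lambda>\<omega>. (pint p \<omega>)\<^sup>2)"
    by (simp add: p pint_def power_mult_distrib)
qed

text \<open>The Ito isometry in bilinear form. Both increments are split at the endpoints; products
  over adjacent intervals have mean zero because the earlier factor is known when the later interval
  starts, and only the squared increment over the common part survives.\<close>

lemma pint_product:
  assumes "piece p" "piece q"
  shows "integrable M (\<lambda>\<omega>. pint p \<omega> * pint q \<omega>)"
    "expectation (\<lambda>\<omega>. pint p \<omega> * pint q \<omega>) = expectation (\<lambda>\<omega>. snd (snd p) \<omega> * snd (snd q) \<omega>) * overlap p q"
proof -
  show "integrable M (\<lambda>\<omega>. pint p \<omega> * pint q \<omega>)"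
    by (intro square_integrable_mult pint_square_integrable assms)
  have aux: "expectation (\<lambda>\<omega>. (e \<omega> * dW s t \<omega>) * (e' \<omega> * dW s' t' \<omega>))
      = expectation (\<lambda>\<omega>. e \<omega> * e' \<omega>) * max 0 (min t t' - max s s')"
    if p: "piece (s, t, e)" and q: "piece (s', t', e')" and "s \<le> s'" for s t e s' t' e'
  proof -
    note pq = p q
    have s: "0 \<le> s" "s \<le> t" "0 \<le> s'" "s' \<le> t'"
      using pq by (auto simp: piece_def)
    obtain C where C1: "\<And>\<omega>. \<omega> \<in> space M \<Longrightarrow> \<bar>e \<omega>\<bar> \<le> C"
      using p by (auto simp: piece_def)
    obtain C' where C2: "\<And>\<omega>. \<omega> \<in> space M \<Longrightarrow> \<bar>e' \<omega>\<bar> \<le> C'"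
      using q by (auto simp: piece_def)
    note C = C1 C2
    define f where "f \<omega> = e \<omega> * e' \<omega>" for \<omega>
    have f: "f \<in> borel_measurable (F s')" "\<And>\<omega>. \<omega> \<in> space M \<Longrightarrow> \<bar>f \<omega>\<bar> \<le> \<bar>C\<bar> * \<bar>C'\<bar>"
    proof -
      show "f \<in> borel_measurable (F s')"
      proof -
        have "e \<in> borel_measurable (F s)" "e' \<in> borel_measurable (F s')"
          using pq by (auto simp: piece_def)
        then show ?thesis
          unfolding f_def[abs_def] using F_mono_measurable \<open>s \<le> s'\<close> by (intro borel_measurable_times)
      qed
      show "\<bar>f \<omega>\<bar> \<le> \<bar>C\<bar> * \<bar>C'\<bar>" if "\<omega> \<in> space M" for \<omega>
        unfolding f_def abs_mult using C(1)[OF that] C(2)[OF that] by (intro mult_mono) auto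
    qed
    note fM = F_measurable[OF f(1)]
    have orth: "integrable M (\<lambda>\<omega>. f \<omega> * dW u v \<omega> * dW v w \<omega>) \<and> expectation (\<lambda>\<omega>. f \<omega> * dW u v \<omega> * dW v w \<omega>) = 0"
      if "0 \<le> u" "u \<le> v" "v \<le> w" "s' \<le> v" for u v w
    proof -
      have "(\<lambda>\<omega>. f \<omega> * dW u v \<omega>) \<in> borel_measurable (F v)"
        using F_mono_measurable[OF f(1) that(4)] dW_F[of u v v] that by auto
      moreover have "integrable M (\<lambda>\<omega>. f \<omega> * dW u v \<omega>)"
        using bounded_mult_integrable[OF fM f(2)] dW_moment(1)[of u v 1] that by simp
      ultimately show ?thesis
        using dW_orthogonal[of v w "\<lambda>\<omega>. f \<omega> * dW u v \<omega>"] that by auto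
    qed
    have sq: "integrable M (\<lambda>\<omega>. f \<omega> * (dW s' v \<omega>)\<^sup>2) \<and> expectation (\<lambda>\<omega>. f \<omega> * (dW s' v \<omega>)\<^sup>2) = expectation f * (v - s')"
      if "s' \<le> v" for v
      using dW_indep[OF s(3) that f(1) bounded_integrable[OF fM f(2)], of 2] dW_moment(3)[OF s(3) that] by auto
    have re: "(e \<omega> * dW s t \<omega>) * (e' \<omega> * dW s' t' \<omega>) = f \<omega> * dW s t \<omega> * dW s' t' \<omega>" for \<omega>
      by (simp add: f_def)
    show ?thesis
    proof (cases "t \<le> s'")
      case True
      have "f \<omega> * dW s t \<omega> * dW s' t' \<omega> = f \<omega> * dW s s' \<omega> * dW s' t' \<omega> - f \<omega> * dW t s' \<omega> * dW s' t' \<omega>" for \<omega>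
        by (simp add: dW_def algebra_simps)
      moreover have "max 0 (min t t' - max s s') = 0"
        using True by auto
      ultimately show ?thesis
        unfolding re using orth[of s s' t'] orth[of t s' t'] s True \<open>s \<le> s'\<close> by simp
    next
      case False
      define v where "v = min t t'"
      have v: "s' \<le> v" "v \<le> t" "v \<le> t'" "v = t \<or> v = t'"
        using False s by (auto simp: v_def)
      \<comment> \<open>Since \<open>v\<close> equals \<open>t\<close> or \<open>t'\<close>, one of
        the last two terms vanishes identically; writing both covers the two orders of the right
        endpoints.\<close>
      have split: "f \<omega> * dW s t \<omega> * dW s' t' \<omega> = f \<omega> * dW s s' \<omega> * dW s' t' \<omega> + f \<omega> * (dW s' v \<omega>)\<^sup>2
          + f \<omega> * dW s' v \<omega> * dW v t \<omega> + f \<omega> * dW s' v \<omega> * dW v t' \<omega>" for \<omega>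
        using v(4) by (auto simp: dW_def power2_eq_square algebra_simps)
      have "max 0 (min t t' - max s s') = v - s'"
        using v(1) \<open>s \<le> s'\<close> by (simp add: v_def max_def)
      then show ?thesis
        unfolding re split using orth[of s s' t'] orth[of s' v t] orth[of s' v t'] sq[OF v(1)] s v \<open>s \<le> s'\<close>
        by (simp add: f_def[abs_def])
    qed
  qed
  obtain s t e where p: "p = (s, t, e)"
    by (cases p)
  obtain s' t' e' where q: "q = (s', t', e')"
    by (cases q)
  show "expectation (\<lambda>\<omega>. pint p \<omega> * pint q \<omega>) = expectation (\<lambda>\<omega>. snd (snd p) \<omega> * snd (snd q) \<omega>) * overlap p q"
  proof (cases "s \<le> s'")
    case True
    then show ?thesis
      using aux[of s t e s' t' e'] assms by (simp add: p q pint_def overlap_def)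
  next
    case False
    then have "expectation (\<lambda>\<omega>. (e' \<omega> * dW s' t' \<omega>) * (e \<omega> * dW s t \<omega>))
      = expectation (\<lambda>\<omega>. e' \<omega> * e \<omega>) * max 0 (min t' t - max s' s)"
      using aux[of s' t' e' s t e] assms by (simp add: p q)
    moreover have "(\<lambda>\<omega>. pint p \<omega> * pint q \<omega>) = (\<lambda>\<omega>. (e' \<omega> * dW s' t' \<omega>) * (e \<omega> * dW s t \<omega>))"
      "(\<lambda>\<omega>. snd (snd p) \<omega> * snd (snd q) \<omega>) = (\<lambda>\<omega>. e' \<omega> * e \<omega>)"
      by (auto simp: p q pint_def)
    moreover have "overlap p q = max 0 (min t' t - max s' s)"
      by (simp add: p q overlap_def min.commute max.commute)
    ultimately show ?thesis
      by simp
  qed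
qed

definition ints :: "(real \<times> real \<times> ('w \<Rightarrow> real)) list \<Rightarrow> 'w \<Rightarrow> real"
  where "ints ps \<omega> = (\<Sum>p\<leftarrow>ps. pint p \<omega>)"

definition vals :: "(real \<times> real \<times> ('w \<Rightarrow> real)) list \<Rightarrow> real \<Rightarrow> 'w \<Rightarrow> real"
  where "vals ps r \<omega> = (\<Sum>p\<leftarrow>ps. pval p r \<omega>)"

text \<open>The squared norm in time of the step function \<open>vals ps\<close>, expanded into a
  finite double sum so that its expectation can be compared term by term with that of
  \<open>(ints ps)\<^sup>2\<close>.\<close>

definition energy :: "(real \<times> real \<times> ('w \<Rightarrow> real)) list \<Rightarrow> 'w \<Rightarrow> real"
  where "energy ps \<omega> = (\<Sum>p\<leftarrow>ps. \<Sum>q\<leftarrow>ps. (snd (snd p) \<omega> * snd (snd q) \<omega>) * overlap p q)"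

lemma sum_list_mult_sum_list: "(\<Sum>x\<leftarrow>xs. f x) * (\<Sum>y\<leftarrow>ys. g y) = (\<Sum>x\<leftarrow>xs. \<Sum>y\<leftarrow>ys. f x * g y :: real)"
  by (induction xs) (auto simp: algebra_simps sum_list_const_mult)

lemma has_bochner_integral_sum_list:
  fixes f :: "'i \<Rightarrow> 'b \<Rightarrow> real"
  shows "(\<And>x. x \<in> set xs \<Longrightarrow> has_bochner_integral N (f x) (I x)) \<Longrightarrow>
    has_bochner_integral N (\<lambda>\<omega>. \<Sum>x\<leftarrow>xs. f x \<omega>) (\<Sum>x\<leftarrow>xs. I x)"
  by (induction xs) (auto intro!: has_bochner_integral_add)

lemma piece_product_integrable:
  assumes "piece p" "piece q"
  shows "integrable M (\<lambda>\<omega>. snd (snd p) \<omega> * snd (snd q) \<omega>)"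
proof -
  obtain C where C: "\<And>\<omega>. \<omega> \<in> space M \<Longrightarrow> \<bar>snd (snd p) \<omega>\<bar> \<le> C"
    using assms(1) by (auto simp: piece_def split: prod.splits)
  obtain C' where C': "\<And>\<omega>. \<omega> \<in> space M \<Longrightarrow> \<bar>snd (snd q) \<omega>\<bar> \<le> C'"
    using assms(2) by (auto simp: piece_def split: prod.splits)
  have "snd (snd p) \<in> borel_measurable M" "snd (snd q) \<in> borel_measurable M"
    using assms F_measurable by (auto simp: piece_def split: prod.splits)
  then show ?thesis
    by (intro bounded_mult_integrable[of _ C] bounded_integrable[of _ C']) (use C C' in auto)
qed

lemma ints_isometry:
  assumes "\<forall>p\<in>set ps. piece p"
  shows "integrable M (\<lambda>\<omega>. (ints ps \<omega>)\<^sup>2)" "integrable M (energy ps)"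
    "expectation (\<lambda>\<omega>. (ints ps \<omega>)\<^sup>2) = expectation (energy ps)"
proof -
  define I where "I p q = expectation (\<lambda>\<omega>. snd (snd p) \<omega> * snd (snd q) \<omega>) * overlap p q"
    for p q :: "real \<times> real \<times> ('w \<Rightarrow> real)"
  have sq: "(ints ps \<omega>)\<^sup>2 = (\<Sum>p\<leftarrow>ps. \<Sum>q\<leftarrow>ps. pint p \<omega> * pint q \<omega>)" for \<omega>
    unfolding ints_def power2_eq_square sum_list_mult_sum_list ..
  have hb: "has_bochner_integral M (\<lambda>\<omega>. pint p \<omega> * pint q \<omega>) (I p q)"
    "has_bochner_integral M (\<lambda>\<omega>. (snd (snd p) \<omega> * snd (snd q) \<omega>) * overlap p q) (I p q)"
    if "p \<in> set ps" "q \<in> set ps" for p q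
    using that assms pint_product[of p q] piece_product_integrable[of p q]
    by (auto simp: has_bochner_integral_iff I_def)
  have "has_bochner_integral M (\<lambda>\<omega>. (ints ps \<omega>)\<^sup>2) (\<Sum>p\<leftarrow>ps. \<Sum>q\<leftarrow>ps. I p q)"
    unfolding sq by (rule has_bochner_integral_sum_list, rule has_bochner_integral_sum_list, rule hb(1))
  moreover have "has_bochner_integral M (energy ps) (\<Sum>p\<leftarrow>ps. \<Sum>q\<leftarrow>ps. I p q)"
    unfolding energy_def[abs_def]
    by (rule has_bochner_integral_sum_list, rule has_bochner_integral_sum_list, rule hb(2))
  ultimately show "integrable M (\<lambda>\<omega>. (ints ps \<omega>)\<^sup>2)" "integrable M (energy ps)"
    "expectation (\<lambda>\<omega>. (ints ps \<omega>)\<^sup>2) = expectation (energy ps)"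
    by (auto simp: has_bochner_integral_iff)
qed

lemma vals_energy:
  assumes "\<forall>p\<in>set ps. piece p"
  shows "(\<integral>\<^sup>+r. ennreal ((vals ps r \<omega>)\<^sup>2) \<partial>lborel) = ennreal (energy ps \<omega>)" "energy ps \<omega> \<ge> 0"
proof -
  have sq: "(vals ps r \<omega>)\<^sup>2 = (\<Sum>p\<leftarrow>ps. \<Sum>q\<leftarrow>ps. pval p r \<omega> * pval q r \<omega>)" for r
    unfolding vals_def power2_eq_square sum_list_mult_sum_list ..
  have hb: "has_bochner_integral lborel (\<lambda>r. pval p r \<omega> * pval q r \<omega>) ((snd (snd p) \<omega> * snd (snd q) \<omega>) * overlap p q)"
    for p q
  proof -
    obtain s t e where p: "p = (s, t, e)"
      by (cases p)
    obtain s' t' e' where q: "q = (s', t', e')"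
      by (cases q)
    have eq: "pval p r \<omega> * pval q r \<omega> = (e \<omega> * e' \<omega>) * indicator {max s s'..<min t t'} r" for r
      by (auto simp: p q pval_def indicator_def)
    have m: "emeasure lborel {max s s'..<min t t'} = ennreal (overlap p q)"
    proof (cases "max s s' \<le> min t t'")
      case True
      then have "overlap p q = min t t' - max s s'"
        by (simp add: p q overlap_def)
      then show ?thesis
        using emeasure_lborel_Ico[OF True] by simp
    next
      case False
      then have "overlap p q = 0"
        by (simp only: p q overlap_def prod.case)
      moreover have "{max s s'..<min t t'} = {}"
        using False by (simp only: atLeastLessThan_empty_iff) 
      ultimately show ?thesis
        by (simp only: emeasure_empty ennreal_0)
    qed
    then have "has_bochner_integral lborel (indicator {max s s'..<min t t'} :: real \<Rightarrow> real)
        (measure lborel {max s s'..<min t t'})"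
      by (intro has_bochner_integral_real_indicator) auto
    moreover have "measure lborel {max s s'..<min t t'} = overlap p q"
      unfolding measure_def m by (simp only: p q overlap_def prod.case) (simp only: enn2real_ennreal max.cobounded1)
    ultimately have "has_bochner_integral lborel (\<lambda>r. (e \<omega> * e' \<omega>) * indicator {max s s'..<min t t'} r)
        ((e \<omega> * e' \<omega>) * overlap p q)"
      by (intro has_bochner_integral_mult_right) simp
    then show ?thesis
      unfolding eq by (simp add: p q)
  qed
  have "has_bochner_integral lborel (\<lambda>r. (vals ps r \<omega>)\<^sup>2) (energy ps \<omega>)"
    unfolding sq energy_def by (intro has_bochner_integral_sum_list hb)
  then have int: "integrable lborel (\<lambda>r. (vals ps r \<omega>)\<^sup>2)" and val: "(\<integral>r. (vals ps r \<omega>)\<^sup>2 \<partial>lborel) = energy ps \<omega>"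
    by (auto simp: has_bochner_integral_iff)
  show "(\<integral>\<^sup>+r. ennreal ((vals ps r \<omega>)\<^sup>2) \<partial>lborel) = ennreal (energy ps \<omega>)"
    unfolding val[symmetric] by (rule nn_integral_eq_integral[OF int]) auto
  show "energy ps \<omega> \<ge> 0"
    unfolding val[symmetric] by (rule Bochner_Integration.integral_nonneg) auto
qed

lemma nn_isometry:
  assumes "\<forall>p\<in>set ps. piece p"
  shows "(\<integral>\<^sup>+\<omega>. ennreal ((ints ps \<omega>)\<^sup>2) \<partial>M) = (\<integral>\<^sup>+\<omega>. (\<integral>\<^sup>+r. ennreal ((vals ps r \<omega>)\<^sup>2) \<partial>lborel) \<partial>M)"
  unfolding vals_energy(1)[OF assms]
  using ints_isometry[OF assms] vals_energy(2)[OF assms] by (simp add: nn_integral_eq_integral)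

end


text \<open>Path continuity makes the process a pointwise limit of its discretisations at multiples
  of \<open>1 / Suc n\<close>, which are jointly measurable as countable combinations. Using
  \<open>max 0 s\<close> extends it to negative times.\<close>

lemma continuous_process_measurable:
  fixes X :: "real \<Rightarrow> 'w \<Rightarrow> 'a::{real_normed_vector, second_countable_topology}"
  assumes X: "\<And>t. 0 \<le> t \<Longrightarrow> X t \<in> borel_measurable N"
    and cont: "\<And>\<omega>. \<omega> \<in> space N \<Longrightarrow> continuous_on {0..} (\<lambda>t. X t \<omega>)"
  shows "(\<lambda>(\<omega>, s). X (max 0 s) \<omega>) \<in> borel_measurable (N \<Otimes>\<^sub>M borel)"
proof (rule borel_measurable_LIMSEQ_metric)
  fix n :: nat
  define g where "g z = \<lfloor>real (Suc n) * snd z\<rfloor>" for z :: "'w \<times> real"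
  have f: "(\<lambda>z. X (max 0 (real_of_int i / real (Suc n))) (fst z)) \<in> borel_measurable (N \<Otimes>\<^sub>M borel)" for i
    by (rule measurable_compose[OF measurable_fst X]) simp
  have "g \<in> N \<Otimes>\<^sub>M borel \<rightarrow>\<^sub>M count_space UNIV"
    unfolding g_def by measurable
  from measurable_compose_countable[OF f this]
  show "(\<lambda>z. X (max 0 (real_of_int \<lfloor>real (Suc n) * snd z\<rfloor> / real (Suc n))) (fst z)) \<in> borel_measurable (N \<Otimes>\<^sub>M borel)"
    by (simp add: g_def)
next
  fix z :: "'w \<times> real"
  assume "z \<in> space (N \<Otimes>\<^sub>M borel)"
  then have \<omega>: "fst z \<in> space N"
    by (auto simp: space_pair_measure)
  define s where "s = snd z"
  have "(\<lambda>n. real_of_int \<lfloor>real (Suc n) * s\<rfloor> / real (Suc n)) \<longlonglongrightarrow> s"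
  proof (rule tendsto_sandwich)
    have "(\<lambda>n. s - 1 / real (Suc n)) \<longlonglongrightarrow> s - 0"
      by (intro tendsto_intros LIMSEQ_inverse_real_of_nat[unfolded inverse_eq_divide])
    then show "(\<lambda>n. s - 1 / real (Suc n)) \<longlonglongrightarrow> s"
      by simp
    show "\<forall>\<^sub>F n in sequentially. s - 1 / real (Suc n) \<le> real_of_int \<lfloor>real (Suc n) * s\<rfloor> / real (Suc n)"
    proof (rule always_eventually[OF allI])
      fix n
      have "real (Suc n) * s - 1 \<le> real_of_int \<lfloor>real (Suc n) * s\<rfloor>"
        by linarith
      then have "(real (Suc n) * s - 1) / real (Suc n) \<le> real_of_int \<lfloor>real (Suc n) * s\<rfloor> / real (Suc n)"
        by (intro divide_right_mono) auto
      then show "s - 1 / real (Suc n) \<le> real_of_int \<lfloor>real (Suc n) * s\<rfloor> / real (Suc n)"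
        by (simp add: diff_divide_distrib del: of_nat_Suc)
    qed
    show "\<forall>\<^sub>F n in sequentially. real_of_int \<lfloor>real (Suc n) * s\<rfloor> / real (Suc n) \<le> s"
    proof (rule always_eventually[OF allI])
      fix n
      have "real_of_int \<lfloor>real (Suc n) * s\<rfloor> / real (Suc n) \<le> (real (Suc n) * s) / real (Suc n)"
        by (intro divide_right_mono) auto
      then show "real_of_int \<lfloor>real (Suc n) * s\<rfloor> / real (Suc n) \<le> s"
        by (simp del: of_nat_Suc)
    qed
  qed auto
  then have "(\<lambda>n. max 0 (real_of_int \<lfloor>real (Suc n) * s\<rfloor> / real (Suc n))) \<longlonglongrightarrow> max 0 s"
    by (intro tendsto_max tendsto_const)
  then have "(\<lambda>n. X (max 0 (real_of_int \<lfloor>real (Suc n) * s\<rfloor> / real (Suc n))) (fst z)) \<longlonglongrightarrow> X (max 0 s) (fst z)"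
    by (rule continuous_on_tendsto_compose[OF cont[OF \<omega>]]) auto
  then show "(\<lambda>n. X (max 0 (real_of_int \<lfloor>real (Suc n) * snd z\<rfloor> / real (Suc n))) (fst z)) \<longlonglongrightarrow> (case z of (\<omega>, s) \<Rightarrow> X (max 0 s) \<omega>)"
    by (simp add: s_def case_prod_unfold)
qed

lemma abs_integral_le_AE:
  fixes f g :: "'b \<Rightarrow> real"
  assumes "integrable N f" "integrable N g" "AE \<omega> in N. \<bar>f \<omega>\<bar> \<le> g \<omega>"
  shows "\<bar>\<integral>\<omega>. f \<omega> \<partial>N\<bar> \<le> (\<integral>\<omega>. g \<omega> \<partial>N)"
  by (rule order_trans[OF integral_abs_bound]) (intro integral_mono_AE integrable_abs assms)

lemma nn_integral_iterated_linear:
  fixes d d' :: "'b \<Rightarrow> real \<Rightarrow> ennreal"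
  assumes d: "case_prod d \<in> borel_measurable (N \<Otimes>\<^sub>M lborel)" and d': "case_prod d' \<in> borel_measurable (N \<Otimes>\<^sub>M lborel)"
  shows "(\<integral>\<^sup>+\<omega>. (\<integral>\<^sup>+s. c * d \<omega> s + c' * d' \<omega> s \<partial>lborel) \<partial>N)
      = c * (\<integral>\<^sup>+\<omega>. (\<integral>\<^sup>+s. d \<omega> s \<partial>lborel) \<partial>N) + c' * (\<integral>\<^sup>+\<omega>. (\<integral>\<^sup>+s. d' \<omega> s \<partial>lborel) \<partial>N)"
    "case_prod (\<lambda>\<omega> s. c * d \<omega> s + c' * d' \<omega> s) \<in> borel_measurable (N \<Otimes>\<^sub>M lborel)"
proof -
  have [measurable]: "d \<omega> \<in> borel_measurable lborel" "d' \<omega> \<in> borel_measurable lborel" if "\<omega> \<in> space N" for \<omega>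
    using measurable_Pair2[OF d that] measurable_Pair2[OF d' that] by simp_all
  have [measurable]: "(\<lambda>\<omega>. \<integral>\<^sup>+s. d \<omega> s \<partial>lborel) \<in> borel_measurable N" "(\<lambda>\<omega>. \<integral>\<^sup>+s. d' \<omega> s \<partial>lborel) \<in> borel_measurable N"
    using lborel.borel_measurable_nn_integral[OF d] lborel.borel_measurable_nn_integral[OF d'] by simp_all
  have "(\<integral>\<^sup>+\<omega>. (\<integral>\<^sup>+s. c * d \<omega> s + c' * d' \<omega> s \<partial>lborel) \<partial>N)
      = (\<integral>\<^sup>+\<omega>. c * (\<integral>\<^sup>+s. d \<omega> s \<partial>lborel) + c' * (\<integral>\<^sup>+s. d' \<omega> s \<partial>lborel) \<partial>N)"
    by (intro nn_integral_cong) (simp add: nn_integral_add nn_integral_cmult)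
  also have "\<dots> = c * (\<integral>\<^sup>+\<omega>. (\<integral>\<^sup>+s. d \<omega> s \<partial>lborel) \<partial>N) + c' * (\<integral>\<^sup>+\<omega>. (\<integral>\<^sup>+s. d' \<omega> s \<partial>lborel) \<partial>N)"
    by (simp add: nn_integral_add nn_integral_cmult)
  finally show "(\<integral>\<^sup>+\<omega>. (\<integral>\<^sup>+s. c * d \<omega> s + c' * d' \<omega> s \<partial>lborel) \<partial>N)
      = c * (\<integral>\<^sup>+\<omega>. (\<integral>\<^sup>+s. d \<omega> s \<partial>lborel) \<partial>N) + c' * (\<integral>\<^sup>+\<omega>. (\<integral>\<^sup>+s. d' \<omega> s \<partial>lborel) \<partial>N)" .
  have "case_prod (\<lambda>\<omega> s. c * d \<omega> s + c' * d' \<omega> s) = (\<lambda>z. c * case_prod d z + c' * case_prod d' z)"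
    by auto
  then show "case_prod (\<lambda>\<omega> s. c * d \<omega> s + c' * d' \<omega> s) \<in> borel_measurable (N \<Otimes>\<^sub>M lborel)"
    using d d' by simp
qed

context brownian_motion
begin

section \<open>Approximating integrands as lists of pieces\<close>

definition simple_pieces :: "nat \<Rightarrow> (nat \<Rightarrow> real) \<Rightarrow> (nat \<Rightarrow> 'w \<Rightarrow> real) \<Rightarrow> (real \<times> real \<times> ('w \<Rightarrow> real)) list"
  where "simple_pieces n \<tau> e = map (\<lambda>j. (\<tau> j, \<tau> (Suc j), e j)) [0..<n]"

lemma simple_pieces:
  assumes "simple_integrand M F t n \<tau> e"
  shows "\<forall>p\<in>set (simple_pieces n \<tau> e). piece p"
    "ints (simple_pieces n \<tau> e) = simple_integral W n \<tau> e"
    "vals (simple_pieces n \<tau> e) s \<omega> = simple_value n \<tau> e s \<omega>"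
    "s < 0 \<or> t \<le> s \<Longrightarrow> simple_value n \<tau> e s \<omega> = 0"
proof -
  have \<tau>: "\<tau> 0 = 0" "\<tau> n = t" "\<And>j. j < n \<Longrightarrow> \<tau> j \<le> \<tau> (Suc j)"
    using assms by (auto simp: simple_integrand_def)
  have nonneg: "j \<le> n \<Longrightarrow> 0 \<le> \<tau> j" for j
  proof (induction j)
    case (Suc j)
    then show ?case
      using \<tau>(3)[of j] by auto
  qed (simp add: \<tau>)
  have le: "\<tau> j \<le> t" if "j \<le> n" for j
    using that
  proof (induction rule: inc_induct)
    case (step m)
    then show ?case
      using \<tau>(3)[of m] by auto
  qed (simp add: \<tau>)
  show "\<forall>p\<in>set (simple_pieces n \<tau> e). piece p"
    using assms nonneg by (auto simp: simple_pieces_def piece_def simple_integrand_def)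
  show "ints (simple_pieces n \<tau> e) = simple_integral W n \<tau> e"
    by (simp add: fun_eq_iff ints_def simple_pieces_def o_def pint_def dW_def simple_integral_def
        interv_sum_list_conv_sum_set_nat lessThan_atLeast0)
  show "vals (simple_pieces n \<tau> e) s \<omega> = simple_value n \<tau> e s \<omega>"
    by (simp add: vals_def simple_pieces_def o_def pval_def simple_value_def
        interv_sum_list_conv_sum_set_nat lessThan_atLeast0)
  assume s: "s < 0 \<or> t \<le> s"
  show "simple_value n \<tau> e s \<omega> = 0"
    unfolding simple_value_def
  proof (intro sum.neutral ballI)
    fix j
    assume "j \<in> {..<n}"
    then have "s \<notin> {\<tau> j..<\<tau> (Suc j)}"
      using s nonneg[of j] le[of "Suc j"] by auto
    then show "e j \<omega> * indicator {\<tau> j..<\<tau> (Suc j)} s = 0"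
      by simp
  qed
qed

definition negp :: "(real \<times> real \<times> ('w \<Rightarrow> real)) list \<Rightarrow> (real \<times> real \<times> ('w \<Rightarrow> real)) list"
  where "negp = map (\<lambda>(s, t, e). (s, t, \<lambda>\<omega>. - e \<omega>))"

lemma negp:
  "\<forall>p\<in>set ps. piece p \<Longrightarrow> \<forall>p\<in>set (negp ps). piece p"
  "ints (negp ps) \<omega> = - ints ps \<omega>" "vals (negp ps) r \<omega> = - vals ps r \<omega>"
proof -
  have "piece (s, t, \<lambda>\<omega>. - e \<omega>)" if "piece (s, t, e)" for s t e
    using that by (simp add: piece_def)
  then show "\<forall>p\<in>set (negp ps). piece p" if "\<forall>p\<in>set ps. piece p"
    using that by (auto simp: negp_def)
  show "ints (negp ps) \<omega> = - ints ps \<omega>" "vals (negp ps) r \<omega> = - vals ps r \<omega>"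
    by (induction ps) (auto simp: negp_def ints_def pint_def vals_def pval_def)
qed

lemma vals_append: "vals (ps @ qs) r \<omega> = vals ps r \<omega> + vals qs r \<omega>" "ints (ps @ qs) \<omega> = ints ps \<omega> + ints qs \<omega>"
  by (auto simp: vals_def ints_def)

text \<open>Together with \<open>late1\<close> this cuts a piece at time \<open>t\<close>. For
  \<open>s > t\<close> the integrand is replaced by 0, since \<open>e\<close> need not be known at
  the new starting time \<open>t\<close>.\<close>

definition early1 :: "real \<Rightarrow> real \<times> real \<times> ('w \<Rightarrow> real) \<Rightarrow> real \<times> real \<times> ('w \<Rightarrow> real)"
  where "early1 t = (\<lambda>(s, u, e). (min s t, min u t, if s \<le> t then e else (\<lambda>_. 0)))"

definition late1 :: "real \<Rightarrow> real \<times> real \<times> ('w \<Rightarrow> real) \<Rightarrow> real \<times> real \<times> ('w \<Rightarrow> real)"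
  where "late1 t = (\<lambda>(s, u, e). (max s t, max u t, e))"

lemma early_late1:
  assumes "piece p" "0 \<le> t"
  shows "piece (early1 t p)" "piece (late1 t p)" "t \<le> fst (late1 t p)"
    "pint p \<omega> = pint (early1 t p) \<omega> + pint (late1 t p) \<omega>"
    "pval (early1 t p) r \<omega> = (if r < t then pval p r \<omega> else 0)"
proof -
  obtain s u e where p: "p = (s, u, e)"
    by (cases p)
  obtain C where pp: "0 \<le> s" "s \<le> u" "e \<in> borel_measurable (F s)" and C: "\<forall>\<omega>\<in>space M. \<bar>e \<omega>\<bar> \<le> C"
    using assms by (auto simp: p piece_def)
  have "(if s \<le> t then e else (\<lambda>_. 0)) \<in> borel_measurable (F (min s t))"
    using pp by (auto simp: min_def)
  moreover have "\<forall>\<omega>\<in>space M. \<bar>(if s \<le> t then e else (\<lambda>_. 0)) \<omega>\<bar> \<le> \<bar>C\<bar>"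
    using C by (auto intro: order_trans)
  ultimately show "piece (early1 t p)"
    using pp assms(2) unfolding p early1_def piece_def prod.case by (intro conjI) (auto simp only: min_def split: if_splits)
  have "e \<in> borel_measurable (F (max s t))"
    by (rule F_mono_measurable[OF pp(3)]) simp
  then show "piece (late1 t p)" "t \<le> fst (late1 t p)"
    using pp C unfolding p late1_def piece_def prod.case by (auto intro: max.mono)
  show "pint p \<omega> = pint (early1 t p) \<omega> + pint (late1 t p) \<omega>"
    using pp(2) by (auto simp: p pint_def dW_def early1_def late1_def min_def max_def algebra_simps)
  show "pval (early1 t p) r \<omega> = (if r < t then pval p r \<omega> else 0)"
    using pp(2) by (auto simp: p pval_def early1_def indicator_def)
qed

definition early :: "real \<Rightarrow> (real \<times> real \<times> ('w \<Rightarrow> real)) list \<Rightarrow> (real \<times> real \<times> ('w \<Rightarrow> real)) list"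
  where "early t = map (early1 t)"

definition late :: "real \<Rightarrow> (real \<times> real \<times> ('w \<Rightarrow> real)) list \<Rightarrow> (real \<times> real \<times> ('w \<Rightarrow> real)) list"
  where "late t = map (late1 t)"

lemma early_late:
  assumes "\<forall>p\<in>set ps. piece p" "0 \<le> t"
  shows "\<forall>p\<in>set (early t ps). piece p" "\<forall>p\<in>set (late t ps). piece p \<and> t \<le> fst p"
    "ints ps \<omega> = ints (early t ps) \<omega> + ints (late t ps) \<omega>"
    "vals (early t ps) r \<omega> = (if r < t then vals ps r \<omega> else 0)"
proof -
  show "\<forall>p\<in>set (early t ps). piece p" "\<forall>p\<in>set (late t ps). piece p \<and> t \<le> fst p"
    using assms early_late1(1-3) by (auto simp: early_def late_def)
  show "ints ps \<omega> = ints (early t ps) \<omega> + ints (late t ps) \<omega>"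
    using assms(1) by (induction ps) (auto simp: early_def late_def ints_def early_late1(4)[OF _ assms(2)])
  show "vals (early t ps) r \<omega> = (if r < t then vals ps r \<omega> else 0)"
    using assms(1) by (induction ps) (auto simp: early_def vals_def early_late1(5)[OF _ assms(2)])
qed

text \<open>Each piece starts after \<open>t\<close>, so the product of \<open>Z\<close> with its
  integrand is known when the piece starts and is orthogonal to the increment.\<close>

lemma late_mean_zero:
  assumes "\<forall>p\<in>set ps. piece p \<and> t \<le> fst p" and Z: "Z \<in> borel_measurable (F t)" "\<And>\<omega>. \<omega> \<in> space M \<Longrightarrow> \<bar>Z \<omega>\<bar> \<le> C"
  shows "has_bochner_integral M (\<lambda>\<omega>. Z \<omega> * ints ps \<omega>) 0"
proof -
  have "has_bochner_integral M (\<lambda>\<omega>. \<Sum>p\<leftarrow>ps. Z \<omega> * pint p \<omega>) (\<Sum>p\<leftarrow>ps. 0)"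
  proof (rule has_bochner_integral_sum_list)
    fix p
    assume "p \<in> set ps"
    obtain s u e where p: "p = (s, u, e)"
      by (cases p)
    have "piece (s, u, e)" "t \<le> s"
      using assms(1) \<open>p \<in> set ps\<close> by (auto simp: p)
    then obtain D where pp: "0 \<le> s" "s \<le> u" "e \<in> borel_measurable (F s)" "t \<le> s" and D: "\<And>\<omega>. \<omega> \<in> space M \<Longrightarrow> \<bar>e \<omega>\<bar> \<le> D"
      by (auto simp: piece_def)
    have Ze: "(\<lambda>\<omega>. Z \<omega> * e \<omega>) \<in> borel_measurable (F s)"
      using F_mono_measurable[OF Z(1) pp(4)] pp(3) by (intro borel_measurable_times)
    moreover have "integrable M (\<lambda>\<omega>. Z \<omega> * e \<omega>)"
      by (intro bounded_mult_integrable[of _ C] bounded_integrable[of _ D] F_measurable[OF Z(1)] F_measurable[OF pp(3)] Z(2) D)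
    ultimately show "has_bochner_integral M (\<lambda>\<omega>. Z \<omega> * pint p \<omega>) 0"
      using dW_orthogonal[OF pp(1,2), of "\<lambda>\<omega>. Z \<omega> * e \<omega>"]
      by (simp add: has_bochner_integral_iff p pint_def mult.assoc)
  qed
  moreover have "(\<Sum>p\<leftarrow>ps. Z \<omega> * pint p \<omega>) = Z \<omega> * ints ps \<omega>" for \<omega>
    by (simp add: ints_def sum_list_const_mult)
  ultimately show ?thesis
    by simp
qed

lemma ints_measurable:
  assumes "\<forall>p\<in>set ps. piece p"
  shows "ints ps \<in> borel_measurable M"
  using assms
proof (induction ps)
  case (Cons p ps)
  have "ints (p # ps) = (\<lambda>\<omega>. pint p \<omega> + ints ps \<omega>)"
    by (simp add: ints_def fun_eq_iff)
  then show ?case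
    using Cons by (simp add: borel_measurable_add pint_square_integrable(1))
qed (simp add: ints_def[abs_def])

lemma vals_measurable:
  assumes "\<forall>p\<in>set ps. piece p"
  shows "(\<lambda>(\<omega>, r). vals ps r \<omega>) \<in> borel_measurable (M \<Otimes>\<^sub>M lborel)"
  using assms
proof (induction ps)
  case (Cons p ps)
  obtain s u e where p: "p = (s, u, e)"
    by (cases p)
  have [measurable]: "e \<in> borel_measurable M"
    using Cons.prems F_measurable by (auto simp: p piece_def)
  have [measurable]: "(\<lambda>(\<omega>, r). vals ps r \<omega>) \<in> borel_measurable (M \<Otimes>\<^sub>M lborel)"
    using Cons by auto
  have "(\<lambda>(\<omega>, r). vals (p # ps) r \<omega>) = (\<lambda>z. e (fst z) * indicator {s..<u} (snd z) + (case z of (\<omega>, r) \<Rightarrow> vals ps r \<omega>))"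
    by (auto simp: vals_def p pval_def)
  then show ?case
    by simp
qed (simp add: vals_def)

lemma sum_square_ennreal:
  fixes x y :: real
  shows "ennreal ((x - y)\<^sup>2) \<le> 2 * ennreal (x\<^sup>2) + 2 * ennreal (y\<^sup>2)"
proof -
  have "(x - y)\<^sup>2 \<le> 2 * x\<^sup>2 + 2 * y\<^sup>2"
    using zero_le_power2[of "x + y"] by (simp add: power2_eq_square algebra_simps)
  then have "ennreal ((x - y)\<^sup>2) \<le> ennreal (2 * x\<^sup>2 + 2 * y\<^sup>2)"
    by (rule ennreal_leI)
  then show ?thesis
    by (simp add: ennreal_plus ennreal_mult)
qed

text \<open>
  Since the integrals over $[0,t]$ and $[0,t']$ come with separate approximations, their difference
  is approximated by concatenating the lists of pieces.
\<close>

lemma ito_increment: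
  assumes I: "has_ito_integral M F W H t I" and I': "has_ito_integral M F W H t' I'"
    and t: "0 \<le> t" "t \<le> t'"
    and H: "(\<lambda>(\<omega>, s). H (max 0 s) \<omega>) \<in> borel_measurable (M \<Otimes>\<^sub>M borel)"
    and G: "G \<in> borel_measurable (F t)" "\<And>\<omega>. \<omega> \<in> space M \<Longrightarrow> \<bar>G \<omega>\<bar> \<le> C"
  shows "(\<integral>\<^sup>+\<omega>. ennreal ((I' \<omega> - I \<omega> - G \<omega> * dW t t' \<omega>)\<^sup>2) \<partial>M)
      \<le> 4 * (\<integral>\<^sup>+\<omega>. (\<integral>\<^sup>+s\<in>{t..t'}. ennreal ((H s \<omega> - G \<omega>)\<^sup>2) \<partial>lborel) \<partial>M)" (is ?bound)
    and "integrable M (\<lambda>\<omega>. I' \<omega> - I \<omega>) \<Longrightarrow> expectation (\<lambda>\<omega>. G \<omega> * (I' \<omega> - I \<omega>)) = 0" (is "_ \<Longrightarrow> ?mean")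
proof -
  note [measurable] = H
  have IM[measurable]: "I \<in> borel_measurable M" "I' \<in> borel_measurable M"
    using I I' by (auto simp: has_ito_integral_def)
  have GM[measurable]: "G \<in> borel_measurable M"
    by (rule F_measurable[OF G(1)])
  obtain n \<tau> e where S: "\<And>k. simple_integrand M F t (n k) (\<tau> k) (e k)"
    and B: "(\<lambda>k. \<integral>\<^sup>+\<omega>. (\<integral>\<^sup>+s\<in>{0..t}. ennreal ((H s \<omega> - simple_value (n k) (\<tau> k) (e k) s \<omega>)\<^sup>2) \<partial>lborel) \<partial>M) \<longlonglongrightarrow> 0"
    and b: "(\<lambda>k. \<integral>\<^sup>+\<omega>. ennreal ((I \<omega> - simple_integral W (n k) (\<tau> k) (e k) \<omega>)\<^sup>2) \<partial>M) \<longlonglongrightarrow> 0"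
    using I unfolding has_ito_integral_def by blast
  obtain n' \<tau>' e' where S': "\<And>k. simple_integrand M F t' (n' k) (\<tau>' k) (e' k)"
    and A: "(\<lambda>k. \<integral>\<^sup>+\<omega>. (\<integral>\<^sup>+s\<in>{0..t'}. ennreal ((H s \<omega> - simple_value (n' k) (\<tau>' k) (e' k) s \<omega>)\<^sup>2) \<partial>lborel) \<partial>M) \<longlonglongrightarrow> 0"
    and a: "(\<lambda>k. \<integral>\<^sup>+\<omega>. ennreal ((I' \<omega> - simple_integral W (n' k) (\<tau>' k) (e' k) \<omega>)\<^sup>2) \<partial>M) \<longlonglongrightarrow> 0"
    using I' unfolding has_ito_integral_def by blast
  define ps where "ps k = simple_pieces (n k) (\<tau> k) (e k)" for k
  define ps' where "ps' k = simple_pieces (n' k) (\<tau>' k) (e' k)" for k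
  let ?R = "\<lambda>k \<omega>. (I' \<omega> - I \<omega>) - (ints (ps' k) \<omega> - ints (ps k) \<omega>)"
  note ps = simple_pieces[OF S, folded ps_def] and ps' = simple_pieces[OF S', folded ps'_def]
  have ps0: "vals (ps k) s \<omega> = 0" if "s < 0 \<or> t \<le> s" for k s \<omega>
    using ps(3,4) that by simp
  have ps'0: "vals (ps' k) s \<omega> = 0" if "s < 0 \<or> t' \<le> s" for k s \<omega>
    using ps'(3,4) that by simp
  have [measurable]: "(\<lambda>(\<omega>, r). vals (ps k) r \<omega>) \<in> borel_measurable (M \<Otimes>\<^sub>M lborel)"
    "(\<lambda>(\<omega>, r). vals (ps' k) r \<omega>) \<in> borel_measurable (M \<Otimes>\<^sub>M lborel)" for k
    by (intro vals_measurable ps(1) ps'(1))+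
  have [measurable]: "(\<lambda>(\<omega>, s). H (max 0 s) \<omega>) \<in> borel_measurable (M \<Otimes>\<^sub>M lborel)"
    using H by simp
  have [measurable]: "ints (ps k) \<in> borel_measurable M" "ints (ps' k) \<in> borel_measurable M" for k
    by (intro ints_measurable ps(1) ps'(1))+
  \<comment> \<open>\<open>dA\<close> and \<open>dB\<close> are the errors of the two
    approximations, for the integrals up to \<open>t'\<close> and \<open>t\<close>;
    \<open>dG\<close> compares the integrand with its frozen value \<open>G\<close> after time
    \<open>t\<close>.\<close>
  define dA where "dA k \<omega> s = ennreal ((H (max 0 s) \<omega> - vals (ps' k) s \<omega>)\<^sup>2) * indicator {0..t'} s" for k \<omega> s
  define dB where "dB k \<omega> s = ennreal ((H (max 0 s) \<omega> - vals (ps k) s \<omega>)\<^sup>2) * indicator {0..t} s" for k \<omega> s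
  define dG where "dG \<omega> s = ennreal ((H (max 0 s) \<omega> - G \<omega>)\<^sup>2) * indicator {t..t'} s" for \<omega> s
  have [measurable]: "case_prod (dA k) \<in> borel_measurable (M \<Otimes>\<^sub>M lborel)"
    "case_prod (dB k) \<in> borel_measurable (M \<Otimes>\<^sub>M lborel)" "case_prod dG \<in> borel_measurable (M \<Otimes>\<^sub>M lborel)" for k
    unfolding dA_def[abs_def] dB_def[abs_def] dG_def[abs_def] by measurable
  define NN where "NN d = (\<integral>\<^sup>+\<omega>. (\<integral>\<^sup>+s. d \<omega> s \<partial>lborel) \<partial>M)" for d :: "'w \<Rightarrow> real \<Rightarrow> ennreal"
  have NN_AB: "NN (\<lambda>\<omega> s. 2 * dA k \<omega> s + 2 * dB k \<omega> s) = 2 * NN (dA k) + 2 * NN (dB k)" for k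
    unfolding NN_def by (rule nn_integral_iterated_linear(1)) measurable
  have NN_ABG: "NN (\<lambda>\<omega> s. 1 * (2 * dA k \<omega> s + 2 * dB k \<omega> s) + 2 * dG \<omega> s) = 1 * (2 * NN (dA k) + 2 * NN (dB k)) + 2 * NN dG" for k
    unfolding NN_AB[symmetric] unfolding NN_def
    by (intro nn_integral_iterated_linear) measurable
  have A': "(\<lambda>k. NN (dA k)) \<longlonglongrightarrow> 0"
  proof -
    have "NN (dA k) = (\<integral>\<^sup>+\<omega>. (\<integral>\<^sup>+s\<in>{0..t'}. ennreal ((H s \<omega> - simple_value (n' k) (\<tau>' k) (e' k) s \<omega>)\<^sup>2) \<partial>lborel) \<partial>M)" for k
      unfolding NN_def dA_def ps'(3) by (intro nn_integral_cong) (simp add: indicator_def max_def)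
    then show ?thesis
      using A by simp
  qed
  have B': "(\<lambda>k. NN (dB k)) \<longlonglongrightarrow> 0"
  proof -
    have "NN (dB k) = (\<integral>\<^sup>+\<omega>. (\<integral>\<^sup>+s\<in>{0..t}. ennreal ((H s \<omega> - simple_value (n k) (\<tau> k) (e k) s \<omega>)\<^sup>2) \<partial>lborel) \<partial>M)" for k
      unfolding NN_def dB_def ps(3) by (intro nn_integral_cong) (simp add: indicator_def max_def)
    then show ?thesis
      using B by simp
  qed
  define a' where "a' k = (\<integral>\<^sup>+\<omega>. ennreal ((I' \<omega> - ints (ps' k) \<omega>)\<^sup>2) \<partial>M)" for k
  define b' where "b' k = (\<integral>\<^sup>+\<omega>. ennreal ((I \<omega> - ints (ps k) \<omega>)\<^sup>2) \<partial>M)" for k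
  have ab: "a' \<longlonglongrightarrow> 0" "b' \<longlonglongrightarrow> 0"
    using a b by (auto simp: a'_def[abs_def] b'_def[abs_def] ps(2) ps'(2))
  have diff: "(\<integral>\<^sup>+\<omega>. ennreal ((?R k \<omega>)\<^sup>2) \<partial>M) \<le> 2 * a' k + 2 * b' k" for k
  proof -
    have "(\<integral>\<^sup>+\<omega>. ennreal ((?R k \<omega>)\<^sup>2) \<partial>M)
      \<le> (\<integral>\<^sup>+\<omega>. 2 * ennreal ((I' \<omega> - ints (ps' k) \<omega>)\<^sup>2) + 2 * ennreal ((I \<omega> - ints (ps k) \<omega>)\<^sup>2) \<partial>M)"
    proof (rule nn_integral_mono)
      fix \<omega>
      show "ennreal ((?R k \<omega>)\<^sup>2)
        \<le> 2 * ennreal ((I' \<omega> - ints (ps' k) \<omega>)\<^sup>2) + 2 * ennreal ((I \<omega> - ints (ps k) \<omega>)\<^sup>2)"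
        using sum_square_ennreal[of "I' \<omega> - ints (ps' k) \<omega>" "I \<omega> - ints (ps k) \<omega>"] by (simp add: algebra_simps)
    qed
    also have "\<dots> = 2 * a' k + 2 * b' k"
      unfolding a'_def b'_def by (simp add: nn_integral_add nn_integral_cmult)
    finally show ?thesis .
  qed
  show ?bound
  proof (rule LIMSEQ_le_const)
    have "(\<lambda>k. 2 * (2 * (NN (dA k) + NN (dB k)) + 2 * NN dG) + 2 * (2 * a' k + 2 * b' k))
        \<longlonglongrightarrow> 2 * (2 * (0 + 0) + 2 * NN dG) + 2 * (2 * 0 + 2 * 0)"
      by (intro tendsto_add ennreal_tendsto_cmult tendsto_const A' B' ab) auto
    moreover have "NN dG = (\<integral>\<^sup>+\<omega>. (\<integral>\<^sup>+s\<in>{t..t'}. ennreal ((H s \<omega> - G \<omega>)\<^sup>2) \<partial>lborel) \<partial>M)"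
      unfolding NN_def dG_def using t by (intro nn_integral_cong) (simp add: indicator_def max_def)
    ultimately show "(\<lambda>k. 2 * (2 * (NN (dA k) + NN (dB k)) + 2 * NN dG) + 2 * (2 * a' k + 2 * b' k))
        \<longlonglongrightarrow> 4 * (\<integral>\<^sup>+\<omega>. (\<integral>\<^sup>+s\<in>{t..t'}. ennreal ((H s \<omega> - G \<omega>)\<^sup>2) \<partial>lborel) \<partial>M)"
      by (simp add: mult.assoc[symmetric])
    show "\<exists>N. \<forall>k\<ge>N. (\<integral>\<^sup>+\<omega>. ennreal ((I' \<omega> - I \<omega> - G \<omega> * dW t t' \<omega>)\<^sup>2) \<partial>M)
        \<le> 2 * (2 * (NN (dA k) + NN (dB k)) + 2 * NN dG) + 2 * (2 * a' k + 2 * b' k)"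
    proof (intro exI allI impI)
      fix k :: nat
      \<comment> \<open>One list for the whole difference, so that the isometry applies once. Before
        \<open>t\<close> both approximations are close to \<open>H\<close> and cancel; after
        \<open>t\<close> what remains is close to \<open>H - G\<close>. The factor 4 comes from
        using \<open>(x - y)\<^sup>2 \<le> 2 * x\<^sup>2 + 2 * y\<^sup>2\<close> twice.\<close>
      define qs where "qs = ps' k @ negp (ps k) @ [(t, t', \<lambda>\<omega>. - G \<omega>)]"
      have "\<exists>C. \<forall>\<omega>\<in>space M. \<bar>- G \<omega>\<bar> \<le> C"
        using G(2) by (intro exI[of _ C]) simp
      then have "piece (t, t', \<lambda>\<omega>. - G \<omega>)"
        unfolding piece_def prod.case using t G(1) by (intro conjI borel_measurable_uminus)
      then have qs: "\<forall>p\<in>set qs. piece p"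
        using ps(1)[of k] ps'(1)[of k] negp(1)[of "ps k"] by (auto simp: qs_def)
      have iqs: "ints qs \<omega> = ints (ps' k) \<omega> - ints (ps k) \<omega> - G \<omega> * dW t t' \<omega>" for \<omega>
        by (simp add: qs_def vals_append negp) (simp add: ints_def pint_def)
      have vqs: "vals qs s \<omega> = vals (ps' k) s \<omega> - vals (ps k) s \<omega> - G \<omega> * indicator {t..<t'} s" for s \<omega>
        by (simp add: qs_def vals_append negp) (simp add: vals_def pval_def)
      have [measurable]: "ints qs \<in> borel_measurable M"
        by (rule ints_measurable[OF qs])
      have "(\<integral>\<^sup>+\<omega>. ennreal ((I' \<omega> - I \<omega> - G \<omega> * dW t t' \<omega>)\<^sup>2) \<partial>M)
        \<le> (\<integral>\<^sup>+\<omega>. 2 * ennreal ((ints qs \<omega>)\<^sup>2) + 2 * ennreal ((?R k \<omega>)\<^sup>2) \<partial>M)"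
      proof (rule nn_integral_mono)
        fix \<omega>
        have "I' \<omega> - I \<omega> - G \<omega> * dW t t' \<omega> = ints qs \<omega> - - (?R k \<omega>)"
          by (simp add: iqs)
        then show "ennreal ((I' \<omega> - I \<omega> - G \<omega> * dW t t' \<omega>)\<^sup>2)
          \<le> 2 * ennreal ((ints qs \<omega>)\<^sup>2) + 2 * ennreal ((?R k \<omega>)\<^sup>2)"
          using sum_square_ennreal[of "ints qs \<omega>" "- (?R k \<omega>)"]
          by (simp only: power2_minus)
      qed
      also have "\<dots> = 2 * (\<integral>\<^sup>+\<omega>. ennreal ((ints qs \<omega>)\<^sup>2) \<partial>M)
          + 2 * (\<integral>\<^sup>+\<omega>. ennreal ((?R k \<omega>)\<^sup>2) \<partial>M)"
        by (simp add: nn_integral_add nn_integral_cmult)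
      also have "(\<integral>\<^sup>+\<omega>. ennreal ((ints qs \<omega>)\<^sup>2) \<partial>M) \<le> NN (\<lambda>\<omega> s. 1 * (2 * dA k \<omega> s + 2 * dB k \<omega> s) + 2 * dG \<omega> s)"
        unfolding nn_isometry[OF qs] NN_def
      proof (intro nn_integral_mono)
        fix \<omega> s
        show "ennreal ((vals qs s \<omega>)\<^sup>2) \<le> 1 * (2 * dA k \<omega> s + 2 * dB k \<omega> s) + 2 * dG \<omega> s"
        proof -
          consider "s < 0 \<or> t' \<le> s" | "0 \<le> s" "s < t" "s < t'" | "0 \<le> s" "t \<le> s" "s < t'"
            using t by linarith
          then show ?thesis
          proof cases
            case 1
            then have "vals qs s \<omega> = 0"
              using ps0[of s k \<omega>] ps'0[of s k \<omega>] t by (auto simp: vqs)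
            then show ?thesis
              by simp
          next
            case 2
            then have "vals qs s \<omega> = (H (max 0 s) \<omega> - vals (ps k) s \<omega>) - (H (max 0 s) \<omega> - vals (ps' k) s \<omega>)"
              by (simp add: vqs)
            then have "ennreal ((vals qs s \<omega>)\<^sup>2) \<le> 2 * dB k \<omega> s + 2 * dA k \<omega> s"
              using 2 t sum_square_ennreal[of "H (max 0 s) \<omega> - vals (ps k) s \<omega>" "H (max 0 s) \<omega> - vals (ps' k) s \<omega>"]
              by (simp add: dA_def dB_def)
            also have "\<dots> \<le> 1 * (2 * dA k \<omega> s + 2 * dB k \<omega> s) + 2 * dG \<omega> s"
              by (simp add: distrib_left add.commute)
            finally show ?thesis .
          next
            case 3
            then have "vals qs s \<omega> = (H (max 0 s) \<omega> - G \<omega>) - (H (max 0 s) \<omega> - vals (ps' k) s \<omega>)"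
              using ps0[of s k \<omega>] by (simp add: vqs)
            then have "ennreal ((vals qs s \<omega>)\<^sup>2) \<le> 2 * dG \<omega> s + 2 * dA k \<omega> s"
              using 3 t sum_square_ennreal[of "H (max 0 s) \<omega> - G \<omega>" "H (max 0 s) \<omega> - vals (ps' k) s \<omega>"]
              by (simp add: dA_def dG_def)
            also have "\<dots> \<le> 1 * (2 * dA k \<omega> s + 2 * dB k \<omega> s) + 2 * dG \<omega> s"
              by (simp add: distrib_left add.commute add.left_commute add_left_mono)
            finally show ?thesis .
          qed
        qed
      qed
      also have "\<dots> = 2 * (NN (dA k) + NN (dB k)) + 2 * NN dG"
        unfolding NN_ABG by (simp add: distrib_left)
      also note diff
      finally show "(\<integral>\<^sup>+\<omega>. ennreal ((I' \<omega> - I \<omega> - G \<omega> * dW t t' \<omega>)\<^sup>2) \<partial>M)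
        \<le> 2 * (2 * (NN (dA k) + NN (dB k)) + 2 * NN dG) + 2 * (2 * a' k + 2 * b' k)"
        by (simp add: add_mono mult_left_mono)
    qed
  qed
  assume intN: "integrable M (\<lambda>\<omega>. I' \<omega> - I \<omega>)"
  \<comment> \<open>The approximation of the difference still has a part before \<open>t\<close>.
    For arbitrary \<theta> the increment splits into an approximation error \<open>x\<close>, this
    early part \<open>y\<close>, both of mean square below \<open>\<theta>\<^sup>2\<close>, and a
    late part that has mean zero against \<open>G\<close>.\<close>
  have small: "\<bar>expectation (\<lambda>\<omega>. G \<omega> * (I' \<omega> - I \<omega>))\<bar> \<le> \<bar>C\<bar> * (2 * \<theta>)" if \<theta>: "\<theta> > 0" for \<theta> :: real
  proof -
    have "(\<lambda>k. (2 * a' k + 2 * b' k) + 2 * (NN (dA k) + NN (dB k))) \<longlonglongrightarrow> (2 * 0 + 2 * 0) + 2 * (0 + 0)"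
      by (intro tendsto_add ennreal_tendsto_cmult A' B' ab) auto
    then have "\<forall>\<^sub>F k in sequentially. (2 * a' k + 2 * b' k) + 2 * (NN (dA k) + NN (dB k)) < ennreal (\<theta>\<^sup>2)"
      by (rule order_tendstoD) (use \<theta> in simp)
    then obtain k where k: "(2 * a' k + 2 * b' k) + 2 * (NN (dA k) + NN (dB k)) < ennreal (\<theta>\<^sup>2)"
      using eventually_happens' sequentially_bot by blast
    define qs where "qs = ps' k @ negp (ps k)"
    have qs: "\<forall>p\<in>set qs. piece p"
      using ps(1) ps'(1) negp(1)[of "ps k"] by (auto simp: qs_def)
    note el = early_late[OF qs t(1)]
    define x where "x \<omega> = (I' \<omega> - I \<omega>) - ints qs \<omega>" for \<omega>
    define y where "y = ints (early t qs)"
    have iqs: "ints qs \<omega> = ints (ps' k) \<omega> - ints (ps k) \<omega>" for \<omega>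
      by (simp add: qs_def vals_append negp)
    have vqs: "vals qs s \<omega> = vals (ps' k) s \<omega> - vals (ps k) s \<omega>" for s \<omega>
      by (simp add: qs_def vals_append negp)
    have xM[measurable]: "x \<in> borel_measurable M"
      unfolding x_def iqs by measurable
    have yM[measurable]: "y \<in> borel_measurable M"
      unfolding y_def by (rule ints_measurable[OF el(1)])
    have "(\<integral>\<^sup>+\<omega>. ennreal ((x \<omega>)\<^sup>2) \<partial>M) \<le> 2 * a' k + 2 * b' k"
      unfolding x_def iqs by (rule diff)
    also have "\<dots> \<le> (2 * a' k + 2 * b' k) + 2 * (NN (dA k) + NN (dB k))"
      by simp
    finally have x2: "(\<integral>\<^sup>+\<omega>. ennreal ((x \<omega>)\<^sup>2) \<partial>M) < ennreal (\<theta>\<^sup>2)"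
      using k by (rule le_less_trans)
    have "(\<integral>\<^sup>+\<omega>. ennreal ((y \<omega>)\<^sup>2) \<partial>M) \<le> NN (\<lambda>\<omega> s. 2 * dA k \<omega> s + 2 * dB k \<omega> s)"
      unfolding y_def nn_isometry[OF el(1)] NN_def
    proof (intro nn_integral_mono)
      fix \<omega> s
      show "ennreal ((vals (early t qs) s \<omega>)\<^sup>2) \<le> 2 * dA k \<omega> s + 2 * dB k \<omega> s"
      proof (cases "0 \<le> s \<and> s < t")
        case True
        then have "vals (early t qs) s \<omega> = (H (max 0 s) \<omega> - vals (ps k) s \<omega>) - (H (max 0 s) \<omega> - vals (ps' k) s \<omega>)"
          by (simp add: el(4) vqs)
        then show ?thesis
          using True t sum_square_ennreal[of "H (max 0 s) \<omega> - vals (ps k) s \<omega>" "H (max 0 s) \<omega> - vals (ps' k) s \<omega>"]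
          by (simp add: dA_def dB_def distrib_left add.commute)
      next
        case False
        then have "vals (early t qs) s \<omega> = 0"
          using ps0[of s k \<omega>] ps'0[of s k \<omega>] by (auto simp: el(4) vqs)
        then show ?thesis
          by simp
      qed
    qed
    also have "\<dots> = 2 * (NN (dA k) + NN (dB k))"
      unfolding NN_AB by (simp add: distrib_left)
    also have "\<dots> \<le> (2 * a' k + 2 * b' k) + 2 * (NN (dA k) + NN (dB k))"
      by simp
    finally have y2: "(\<integral>\<^sup>+\<omega>. ennreal ((y \<omega>)\<^sup>2) \<partial>M) < ennreal (\<theta>\<^sup>2)"
      using k by (rule le_less_trans)
    have L1: "integrable M f \<and> \<bar>expectation (\<lambda>\<omega>. G \<omega> * f \<omega>)\<bar> \<le> \<bar>C\<bar> * \<theta>"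
      if [measurable]: "f \<in> borel_measurable M" and f2: "(\<integral>\<^sup>+\<omega>. ennreal ((f \<omega>)\<^sup>2) \<partial>M) < ennreal (\<theta>\<^sup>2)" for f
    proof -
      have sq: "integrable M (\<lambda>\<omega>. (f \<omega>)\<^sup>2)"
        using f2 by (intro integrableI_nonneg) (auto intro: less_trans)
      have "ennreal (expectation (\<lambda>\<omega>. (f \<omega>)\<^sup>2)) < ennreal (\<theta>\<^sup>2)"
        using nn_integral_eq_integral[OF sq] f2 by simp
      then have E2: "expectation (\<lambda>\<omega>. (f \<omega>)\<^sup>2) \<le> \<theta>\<^sup>2"
        using \<theta> by (simp add: ennreal_less_iff)
      \<comment> \<open>Turns a mean square below \<open>\<theta>\<^sup>2\<close> into a first
        absolute moment of at most \<theta>.\<close>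
      have pt: "\<bar>f \<omega>\<bar> \<le> (\<theta> + (f \<omega>)\<^sup>2 / \<theta>) / 2" for \<omega>
        using sum_squares_bound[of \<theta> "\<bar>f \<omega>\<bar>"] \<theta> by (simp add: field_simps power2_eq_square)
      have int: "integrable M (\<lambda>\<omega>. (\<theta> + (f \<omega>)\<^sup>2 / \<theta>) / 2)"
        using sq by auto
      have f: "integrable M f"
        by (rule Bochner_Integration.integrable_bound[OF int]) (use pt \<theta> in \<open>auto intro!: AE_I2 intro: order_trans abs_ge_self\<close>)
      have "\<bar>expectation (\<lambda>\<omega>. G \<omega> * f \<omega>)\<bar> \<le> expectation (\<lambda>\<omega>. \<bar>C\<bar> * ((\<theta> + (f \<omega>)\<^sup>2 / \<theta>) / 2))"
      proof (rule abs_integral_le_AE, rule_tac [3] AE_I2)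
        show "integrable M (\<lambda>\<omega>. G \<omega> * f \<omega>)"
          by (rule bounded_mult_integrable[OF GM G(2) f])
        show "integrable M (\<lambda>\<omega>. \<bar>C\<bar> * ((\<theta> + (f \<omega>)\<^sup>2 / \<theta>) / 2))"
          by (rule integrable_mult_right[OF int])
        show "\<bar>G \<omega> * f \<omega>\<bar> \<le> \<bar>C\<bar> * ((\<theta> + (f \<omega>)\<^sup>2 / \<theta>) / 2)" if "\<omega> \<in> space M" for \<omega>
          unfolding abs_mult using G(2)[OF that] pt[of \<omega>] by (intro mult_mono) auto
      qed
      also have "\<dots> = \<bar>C\<bar> * ((\<theta> + expectation (\<lambda>\<omega>. (f \<omega>)\<^sup>2) / \<theta>) / 2)"
        using sq by (simp add: prob_space)
      also have "\<dots> \<le> \<bar>C\<bar> * \<theta>"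
      proof (rule mult_left_mono)
        have "expectation (\<lambda>\<omega>. (f \<omega>)\<^sup>2) / \<theta> \<le> \<theta>"
          using E2 \<theta> by (simp add: divide_le_eq power2_eq_square)
        then show "(\<theta> + expectation (\<lambda>\<omega>. (f \<omega>)\<^sup>2) / \<theta>) / 2 \<le> \<theta>"
          by simp
      qed simp
      finally show ?thesis
        using f by blast
    qed
    note lx = L1[OF xM x2] and ly = L1[OF yM y2]
    have split: "G \<omega> * (I' \<omega> - I \<omega>) = G \<omega> * x \<omega> + G \<omega> * y \<omega> + G \<omega> * ints (late t qs) \<omega>" for \<omega>
      unfolding x_def y_def el(3)[of \<omega>] by (simp add: algebra_simps)
    have "has_bochner_integral M (\<lambda>\<omega>. G \<omega> * ints (late t qs) \<omega>) 0"
      by (rule late_mean_zero[OF el(2) G])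
    moreover have "integrable M (\<lambda>\<omega>. G \<omega> * x \<omega>)" "integrable M (\<lambda>\<omega>. G \<omega> * y \<omega>)"
      using bounded_mult_integrable[OF GM G(2)] lx ly by auto
    ultimately have "expectation (\<lambda>\<omega>. G \<omega> * (I' \<omega> - I \<omega>)) = expectation (\<lambda>\<omega>. G \<omega> * x \<omega>) + expectation (\<lambda>\<omega>. G \<omega> * y \<omega>)"
      unfolding split by (simp add: has_bochner_integral_iff)
    then show ?thesis
      using lx ly by linarith
  qed
  show ?mean
  proof (rule ccontr)
    assume "\<not> ?mean"
    define m where "m = \<bar>expectation (\<lambda>\<omega>. G \<omega> * (I' \<omega> - I \<omega>))\<bar>"
    have m: "m > 0"
      using \<open>\<not> ?mean\<close> by (simp add: m_def)
    have "m \<le> \<bar>C\<bar> * (2 * (m / (4 * (\<bar>C\<bar> + 1))))"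
      unfolding m_def using m by (intro small) (auto simp: m_def[symmetric] add_nonneg_pos)
    also have "\<dots> = (m / 2) * (\<bar>C\<bar> / (\<bar>C\<bar> + 1))"
      by (simp add: field_simps)
    also have "\<dots> \<le> (m / 2) * 1"
      using m by (intro mult_left_mono) auto
    finally show False
      using m by simp
  qed
qed

end


section \<open>The exponential martingale\<close>

text \<open>Points closer than \<open>e\<close> differ by at most \<eta> by uniform continuity; for
  the others the slope \<open>2 * B / e\<close> covers the full oscillation. A bound linear in the
  distance can be integrated along a path and estimated by moments.\<close>

lemma periodic_modulus:
  fixes f :: "real \<Rightarrow> real"
  assumes f: "periodic f" "continuous_on UNIV f" and "\<eta> > 0"
  obtains K where "K \<ge> 0" "\<And>x y. \<bar>f x - f y\<bar> \<le> \<eta> + K * \<bar>x - y\<bar>"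
proof -
  obtain B where B: "B > 0" "\<And>x. norm (f x) \<le> B"
    by (rule periodic_bounded[OF f], rule that)
  have "uniformly_continuous_on {-1..2} f"
    using f(2) by (intro compact_uniformly_continuous) (auto intro: continuous_on_subset)
  then obtain d where d: "d > 0" "\<And>x y. x \<in> {-1..2} \<Longrightarrow> y \<in> {-1..2} \<Longrightarrow> dist y x < d \<Longrightarrow> dist (f y) (f x) < \<eta>"
    using \<open>\<eta> > 0\<close> unfolding uniformly_continuous_on_def by meson
  define e where "e = min d 1"
  have e: "e > 0" "e \<le> d" "e \<le> 1"
    using d by (auto simp: e_def)
  show ?thesis
  proof (rule that[of "2 * B / e"])
    show "2 * B / e \<ge> 0"
      using B e by simp
    fix x y
    show "\<bar>f x - f y\<bar> \<le> \<eta> + 2 * B / e * \<bar>x - y\<bar>"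
    proof (cases "\<bar>x - y\<bar> < e")
      case True
      \<comment> \<open>A common integer shift moves both points into \<open>{-1..2}\<close>, where
        uniform continuity is available.\<close>
      define n where "n = \<lfloor>x\<rfloor>"
      have "f x = f (x - of_int n)" "f y = f (y - of_int n)"
        using periodic_add_of_int[OF f(1), of x "-n"] periodic_add_of_int[OF f(1), of y "-n"] by simp_all
      moreover have "x - of_int n \<in> {-1..2}" "y - of_int n \<in> {-1..2}"
        using True e floor_correct[of x] by (auto simp: n_def abs_less_iff) linarith+
      then have "dist (f (x - of_int n)) (f (y - of_int n)) < \<eta>"
        using True e by (intro d(2)) (auto simp: dist_real_def)
      ultimately have "\<bar>f x - f y\<bar> \<le> \<eta>"
        by (simp add: dist_real_def)
      also have "\<dots> \<le> \<eta> + 2 * B / e * \<bar>x - y\<bar>"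
        using B e by simp
      finally show ?thesis .
    next
      case False
      have "\<bar>f x - f y\<bar> \<le> 2 * B"
        using B(2)[of x] B(2)[of y] by (simp add: abs_le_iff)
      also have "\<dots> = 2 * B / e * e"
        using e by simp
      also have "\<dots> \<le> 2 * B / e * \<bar>x - y\<bar>"
        using False B e by (intro mult_left_mono) auto
      finally show ?thesis
        using \<open>\<eta> > 0\<close> by simp
    qed
  qed
qed

section \<open>Deterministic estimates for one time step\<close>

lemma derivative_bound_lipschitz:
  fixes f :: "real \<Rightarrow> real"
  assumes "\<And>x. (f has_real_derivative f' x) (at x)" "\<And>x. \<bar>f' x\<bar> \<le> B"
  shows "\<bar>f x - f y\<bar> \<le> B * \<bar>x - y\<bar>"
  using field_differentiable_bound[of UNIV f f' B x y] assms by (simp add: has_field_derivative_at_within)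

lemma amgm:
  fixes p q r :: real
  assumes "r > 0"
  shows "2 * (p * q) \<le> r * p\<^sup>2 + q\<^sup>2 / r"
proof -
  have "0 \<le> (r * p - q)\<^sup>2 / r"
    using assms by simp
  also have "\<dots> = r * p\<^sup>2 - 2 * (p * q) + q\<^sup>2 / r"
    using assms by (simp add: power2_eq_square field_simps)
  finally show ?thesis
    by simp
qed

lemma taylor2:
  fixes U :: "real \<Rightarrow> real"
  assumes U: "\<And>x. (U has_real_derivative U1 x) (at x)" "\<And>x. (U1 has_real_derivative U2 x) (at x)"
  obtains \<xi> where "\<bar>\<xi> - y\<bar> \<le> \<bar>\<Delta>\<bar>" "U (y + \<Delta>) = U y + U1 y * \<Delta> + U2 \<xi> / 2 * \<Delta>\<^sup>2"
proof (cases "\<Delta> = 0")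
  case True
  then show ?thesis
    using that[of y] by simp
next
  case False
  define diff where "diff m = (if m = 0 then U else if m = 1 then U1 else U2)" for m :: nat
  have "\<exists>t. (if y + \<Delta> < y then y + \<Delta> < t \<and> t < y else y < t \<and> t < y + \<Delta>) \<and>
      U (y + \<Delta>) = (\<Sum>m<2. diff m y / fact m * (y + \<Delta> - y) ^ m) + diff 2 t / fact 2 * (y + \<Delta> - y) ^ 2"
  proof (rule Taylor[where a = "y - \<bar>\<Delta>\<bar>" and b = "y + \<bar>\<Delta>\<bar>"])
    show "\<forall>m t. m < 2 \<and> y - \<bar>\<Delta>\<bar> \<le> t \<and> t \<le> y + \<bar>\<Delta>\<bar> \<longrightarrow> (diff m has_real_derivative diff (Suc m) t) (at t)"
      using U by (auto simp: diff_def less_2_cases_iff)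
  qed (use False in \<open>auto simp: diff_def\<close>)
  then obtain t where t: "if y + \<Delta> < y then y + \<Delta> < t \<and> t < y else y < t \<and> t < y + \<Delta>"
    "U (y + \<Delta>) = (\<Sum>m<2. diff m y / fact m * (y + \<Delta> - y) ^ m) + diff 2 t / fact 2 * (y + \<Delta> - y) ^ 2"
    by blast
  show ?thesis
  proof (rule that[of t])
    show "\<bar>t - y\<bar> \<le> \<bar>\<Delta>\<bar>"
      using t(1) by (auto split: if_splits)
    show "U (y + \<Delta>) = U y + U1 y * \<Delta> + U2 t / 2 * \<Delta>\<^sup>2"
      unfolding t(2) by (simp add: diff_def numeral_2_eq_2)
  qed
qed

text \<open>
  \<open>d\<close> plays the increment of the Brownian motion, \<open>\<rho>\<close> the remainder of the increment \<open>s d + \<rho>\<close> of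
  the diffusion, and \<open>r\<close> the square root of the time step.
\<close>

lemma second_order_remainder:
  fixes U :: "real \<Rightarrow> real"
  assumes U: "\<And>x. (U has_real_derivative U1 x) (at x)" "\<And>x. (U1 has_real_derivative U2 x) (at x)"
    and U2: "\<And>x. \<bar>U2 x\<bar> \<le> B" and mod: "\<And>x y. \<bar>U2 x - U2 y\<bar> \<le> \<eta> + K * \<bar>x - y\<bar>"
    and B: "B \<ge> 1" "\<bar>s\<bar> \<le> B" and r: "0 < r" "r \<le> 1" and K: "K \<ge> 0"
  shows "\<bar>U (y + (s * d + \<rho>)) - U y - U1 y * (s * d + \<rho>) - U2 y / 2 * s\<^sup>2 * d\<^sup>2\<bar>
    \<le> B\<^sup>2 * \<eta> * d\<^sup>2 + (B\<^sup>2 * K * (B + 1) + 3 * B + B\<^sup>2) * (r * d\<^sup>2 + d ^ 4 / r + \<rho>\<^sup>2 / r)"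
proof -
  define \<Delta> where "\<Delta> = s * d + \<rho>"
  \<comment> \<open>In the application \<open>d\<^sup>2\<close>, \<open>d ^ 4\<close> and
    \<open>\<rho>\<^sup>2\<close> have expectations of order \<open>r\<^sup>2\<close>,
    \<open>r ^ 4\<close> and \<open>r ^ 4\<close>, so all three terms are of order
    \<open>r ^ 3\<close>.\<close>
  define X where "X = r * d\<^sup>2 + d ^ 4 / r + \<rho>\<^sup>2 / r"
  obtain \<xi> where \<xi>: "\<bar>\<xi> - y\<bar> \<le> \<bar>\<Delta>\<bar>" "U (y + \<Delta>) = U y + U1 y * \<Delta> + U2 \<xi> / 2 * \<Delta>\<^sup>2"
    by (rule taylor2[OF U], rule that)
  have X0: "0 \<le> r * d\<^sup>2" "0 \<le> d ^ 4 / r" "0 \<le> \<rho>\<^sup>2 / r"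
    using r by auto
  have \<rho>X: "\<rho>\<^sup>2 \<le> X"
  proof -
    have "\<rho>\<^sup>2 * r \<le> \<rho>\<^sup>2 * 1"
      using r by (intro mult_left_mono) auto
    then have "\<rho>\<^sup>2 \<le> \<rho>\<^sup>2 / r"
      using r by (simp add: field_simps)
    then show ?thesis
      using X0 by (simp add: X_def)
  qed
  have d3: "\<bar>d\<bar> * d\<^sup>2 \<le> X"
    using amgm[OF r(1), of "\<bar>d\<bar>" "d\<^sup>2"] X0 unfolding X_def by (simp add: power_mult[symmetric])
  have \<rho>d2: "\<bar>\<rho>\<bar> * d\<^sup>2 \<le> X"
  proof -
    have "2 * (d\<^sup>2 * \<bar>\<rho>\<bar>) \<le> r * (d\<^sup>2)\<^sup>2 + \<bar>\<rho>\<bar>\<^sup>2 / r"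
      by (rule amgm[OF r(1)])
    moreover have "r * (d\<^sup>2)\<^sup>2 \<le> d ^ 4 / r"
    proof -
      have "r * r \<le> 1"
        using r by (intro mult_le_one) auto
      then have "r * r * d ^ 4 \<le> 1 * d ^ 4"
        by (intro mult_right_mono) auto
      then show ?thesis
        using r by (simp add: field_simps power_mult[symmetric])
    qed
    ultimately show ?thesis
      using X0 unfolding X_def by (simp add: mult.commute)
  qed
  have d\<rho>: "\<bar>d\<bar> * \<bar>\<rho>\<bar> \<le> X"
    using amgm[OF r(1), of "\<bar>d\<bar>" "\<bar>\<rho>\<bar>"] X0 by (simp add: X_def)
  have s2: "s\<^sup>2 \<le> B\<^sup>2"
    using B by (simp add: abs_le_square_iff[symmetric])
  have \<Delta>2: "\<Delta>\<^sup>2 \<le> 2 * (B\<^sup>2 * d\<^sup>2) + 2 * \<rho>\<^sup>2"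
  proof -
    have "\<Delta>\<^sup>2 \<le> 2 * (s * d)\<^sup>2 + 2 * \<rho>\<^sup>2"
      using zero_le_power2[of "s * d - \<rho>"] by (simp add: \<Delta>_def power2_eq_square algebra_simps)
    moreover have "s\<^sup>2 * d\<^sup>2 \<le> B\<^sup>2 * d\<^sup>2"
      using s2 by (intro mult_right_mono) auto
    ultimately show ?thesis
      by (simp add: power_mult_distrib)
  qed
  \<comment> \<open>Two bounds for the same quantity: the modulus is used against the part of
    \<open>\<Delta>\<^sup>2\<close> that comes from \<open>d\<close>, the crude bound
    \<open>2 * B\<close> against the part that comes from \<rho>, which is already small.\<close>
  define m where "m = \<bar>U2 \<xi> - U2 y\<bar>"
  have m: "0 \<le> m" "m \<le> \<eta> + K * \<bar>\<Delta>\<bar>" "m \<le> 2 * B"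
  proof -
    show "m \<le> \<eta> + K * \<bar>\<Delta>\<bar>"
      using mod[of \<xi> y] mult_left_mono[OF \<xi>(1) K] by (simp add: m_def)
    show "m \<le> 2 * B"
      using U2[of \<xi>] U2[of y] by (simp add: m_def abs_le_iff)
  qed (simp add: m_def)
  have "m * \<Delta>\<^sup>2 \<le> m * (2 * (B\<^sup>2 * d\<^sup>2)) + m * (2 * \<rho>\<^sup>2)"
    using mult_left_mono[OF \<Delta>2 m(1)] by (simp add: distrib_left)
  also have "\<dots> \<le> (\<eta> + K * \<bar>\<Delta>\<bar>) * (2 * (B\<^sup>2 * d\<^sup>2)) + (2 * B) * (2 * \<rho>\<^sup>2)"
    using m by (intro add_mono mult_right_mono) auto
  also have "\<dots> = 2 * (B\<^sup>2 * \<eta> * d\<^sup>2) + 2 * (B\<^sup>2 * K) * (\<bar>\<Delta>\<bar> * d\<^sup>2) + 4 * B * \<rho>\<^sup>2"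
    by (simp add: algebra_simps)
  also have "\<dots> \<le> 2 * (B\<^sup>2 * \<eta> * d\<^sup>2) + 2 * (B\<^sup>2 * K) * ((B + 1) * X) + 4 * B * X"
  proof -
    have "\<bar>\<Delta>\<bar> \<le> B * \<bar>d\<bar> + \<bar>\<rho>\<bar>"
      unfolding \<Delta>_def using mult_right_mono[OF B(2), of "\<bar>d\<bar>"]
      by (intro order_trans[OF abs_triangle_ineq]) (simp add: abs_mult)
    then have "\<bar>\<Delta>\<bar> * d\<^sup>2 \<le> (B * \<bar>d\<bar> + \<bar>\<rho>\<bar>) * d\<^sup>2"
      by (intro mult_right_mono) auto
    also have "\<dots> = B * (\<bar>d\<bar> * d\<^sup>2) + \<bar>\<rho>\<bar> * d\<^sup>2"
      by (simp add: algebra_simps)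
    also have "\<dots> \<le> B * X + X"
      using d3 \<rho>d2 B by (intro add_mono mult_left_mono) auto
    finally have "\<bar>\<Delta>\<bar> * d\<^sup>2 \<le> (B + 1) * X"
      by (simp add: algebra_simps)
    then show ?thesis
      using \<rho>X K B by (intro add_mono mult_left_mono order_refl) auto
  qed
  finally have 1: "m * \<Delta>\<^sup>2 / 2 \<le> B\<^sup>2 * \<eta> * d\<^sup>2 + (B\<^sup>2 * K) * ((B + 1) * X) + 2 * B * X"
    by simp
  have 2: "\<bar>U2 y / 2 * (2 * (s * (d * \<rho>)) + \<rho>\<^sup>2)\<bar> \<le> B\<^sup>2 * X + B * X"
  proof -
    have "\<bar>2 * (s * (d * \<rho>)) + \<rho>\<^sup>2\<bar> \<le> 2 * (\<bar>s\<bar> * (\<bar>d\<bar> * \<bar>\<rho>\<bar>)) + \<rho>\<^sup>2"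
      by (intro order_trans[OF abs_triangle_ineq]) (simp add: abs_mult)
    also have "\<dots> \<le> 2 * (B * X) + 2 * X"
      using B d\<rho> \<rho>X order_trans[OF zero_le_power2 \<rho>X] by (intro add_mono mult_mono mult_left_mono) auto
    finally have "\<bar>U2 y / 2\<bar> * \<bar>2 * (s * (d * \<rho>)) + \<rho>\<^sup>2\<bar> \<le> (B / 2) * (2 * (B * X) + 2 * X)"
      using U2[of y] B by (intro mult_mono) auto
    also have "\<dots> = B\<^sup>2 * X + B * X"
      by (simp add: power2_eq_square algebra_simps)
    finally show ?thesis
      by (simp add: abs_mult)
  qed
  have "U (y + \<Delta>) - U y - U1 y * \<Delta> - U2 y / 2 * s\<^sup>2 * d\<^sup>2
      = (U2 \<xi> - U2 y) / 2 * \<Delta>\<^sup>2 + U2 y / 2 * (\<Delta>\<^sup>2 - s\<^sup>2 * d\<^sup>2)"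
    unfolding \<xi>(2) by (simp add: algebra_simps diff_divide_distrib)
  also have "\<Delta>\<^sup>2 - s\<^sup>2 * d\<^sup>2 = 2 * (s * (d * \<rho>)) + \<rho>\<^sup>2"
    by (simp add: \<Delta>_def power2_eq_square algebra_simps)
  finally have "\<bar>U (y + \<Delta>) - U y - U1 y * \<Delta> - U2 y / 2 * s\<^sup>2 * d\<^sup>2\<bar>
      \<le> \<bar>(U2 \<xi> - U2 y) / 2 * \<Delta>\<^sup>2\<bar> + \<bar>U2 y / 2 * (2 * (s * (d * \<rho>)) + \<rho>\<^sup>2)\<bar>"
    using abs_triangle_ineq by metis
  also have "\<bar>(U2 \<xi> - U2 y) / 2 * \<Delta>\<^sup>2\<bar> = m * \<Delta>\<^sup>2 / 2"
    by (simp add: m_def abs_mult)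
  finally show ?thesis
    using 1 2 unfolding X_def[symmetric] \<Delta>_def[symmetric] by (simp add: algebra_simps)
qed

lemma exp_remainder:
  fixes x B :: real
  assumes "\<bar>x\<bar> \<le> B"
  shows "\<bar>exp x - 1 - x\<bar> \<le> exp B * x\<^sup>2"
proof -
  obtain \<xi> where \<xi>: "\<bar>\<xi> - 0\<bar> \<le> \<bar>x\<bar>" "exp (0 + x) = exp 0 + exp 0 * x + exp \<xi> / 2 * x\<^sup>2"
    by (rule taylor2[of exp exp exp 0 x]) (auto intro!: derivative_eq_intros)
  have "\<bar>exp x - 1 - x\<bar> = exp \<xi> / 2 * x\<^sup>2"
    using \<xi>(2) by simp
  also have "\<dots> \<le> exp B * x\<^sup>2"
  proof (rule mult_right_mono)
    have "exp \<xi> \<le> exp B"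
      using \<xi>(1) assms by simp
    then show "exp \<xi> / 2 \<le> exp B"
      using exp_gt_zero[of \<xi>] by linarith
  qed simp
  finally show ?thesis .
qed


text \<open>\<open>Bi\<close> and \<kappa> play the time integrals of drift and potential over a
  step of length \<open>h\<close>, and \<open>Q\<close> the accumulated squared displacement. The
  subtracted expression is the part that has mean zero given the past. The terms of order
  \<open>h\<close> cancel by the equation for \<open>U\<close>, up to \<eta>; the rest is of order
  \<open>h * r\<close> in expectation.\<close>

lemma step_error:
  fixes U :: "real \<Rightarrow> real"
  assumes U: "\<And>x. (U has_real_derivative U1 x) (at x)" "\<And>x. (U1 has_real_derivative U2 x) (at x)"
    and bd: "\<And>x. \<bar>U x\<bar> \<le> B" "\<And>x. \<bar>U1 x\<bar> \<le> B" "\<And>x. \<bar>U2 x\<bar> \<le> B" "\<bar>s\<bar> \<le> B"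
    and B: "B \<ge> 1" and mod: "\<And>x y. \<bar>U2 x - U2 y\<bar> \<le> \<eta> + K * \<bar>x - y\<bar>"
    and r: "0 < r" "r \<le> 1" "h = r\<^sup>2" and K: "K \<ge> 0" and \<eta>: "\<eta> \<ge> 0" and Q: "Q \<ge> 0"
    and osc: "\<bar>Bi - h * b\<bar> \<le> h * \<eta> + K * (h * r + Q / r)" "\<bar>\<kappa> - h * k\<bar> \<le> h * \<eta> + K * (h * r + Q / r)"
    and \<kappa>: "\<bar>\<kappa>\<bar> \<le> B * h"
    and eq: "s\<^sup>2 / 2 * U2 y + b * U1 y + k * U y = 0"
  shows "\<bar>(U (y + (s * d + \<rho>)) * exp \<kappa> - U y) - (U1 y * (s * d + \<rho> - Bi) + U2 y / 2 * s\<^sup>2 * (d\<^sup>2 - h))\<bar>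
    \<le> \<eta> * (B\<^sup>2 * d\<^sup>2 + 2 * B * h) +
      ((B\<^sup>2 * K * (B + 1) + 3 * B + B\<^sup>2) + 2 * B * K + exp B * B ^ 3 + B ^ 3 + B\<^sup>2) * (h * r + r * d\<^sup>2 + d ^ 4 / r + \<rho>\<^sup>2 / r + Q / r)"
    (is "_ \<le> ?rhs")
proof -
  define Y' where "Y' = y + (s * d + \<rho>)"
  define X where "X = h * r + r * d\<^sup>2 + d ^ 4 / r + \<rho>\<^sup>2 / r + Q / r"
  have h: "0 < h" "h \<le> 1"
    using r by (auto simp: power_le_one)
  have X0: "0 \<le> h * r" "0 \<le> r * d\<^sup>2" "0 \<le> d ^ 4 / r" "0 \<le> \<rho>\<^sup>2 / r" "0 \<le> Q / r"
    using r h Q by auto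
  define e1 where "e1 = U Y' - U y - U1 y * (s * d + \<rho>) - U2 y / 2 * s\<^sup>2 * d\<^sup>2"
  have e1: "\<bar>e1\<bar> \<le> B\<^sup>2 * \<eta> * d\<^sup>2 + (B\<^sup>2 * K * (B + 1) + 3 * B + B\<^sup>2) * X"
  proof -
    have "\<bar>e1\<bar> \<le> B\<^sup>2 * \<eta> * d\<^sup>2 + (B\<^sup>2 * K * (B + 1) + 3 * B + B\<^sup>2) * (r * d\<^sup>2 + d ^ 4 / r + \<rho>\<^sup>2 / r)"
      unfolding e1_def Y'_def by (rule second_order_remainder[OF U bd(3) mod B bd(4) r(1,2) K])
    also have "\<dots> \<le> B\<^sup>2 * \<eta> * d\<^sup>2 + (B\<^sup>2 * K * (B + 1) + 3 * B + B\<^sup>2) * X"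
      using B K X0 by (intro add_mono order_refl mult_left_mono) (auto simp: X_def)
    finally show ?thesis .
  qed
  have \<kappa>2: "\<bar>exp \<kappa> - 1 - \<kappa>\<bar> \<le> exp B * B\<^sup>2 * X"
  proof -
    have "\<bar>exp \<kappa> - 1 - \<kappa>\<bar> \<le> exp B * \<kappa>\<^sup>2"
      using \<kappa> h B by (intro exp_remainder) (smt (verit) mult_left_le)
    also have "\<kappa>\<^sup>2 \<le> B\<^sup>2 * h\<^sup>2"
      using \<kappa> B h by (simp add: abs_le_square_iff[symmetric] power_mult_distrib[symmetric])
    also have "h\<^sup>2 \<le> X"
    proof -
      have "h * (r * r) \<le> h * (r * 1)"
        using r h by (intro mult_left_mono) auto
      then have "h\<^sup>2 \<le> h * r"
        using r(3) by (simp add: power2_eq_square)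
      then show ?thesis
        using X0 by (simp add: X_def)
    qed
    finally show ?thesis
      using B by (simp add: mult_left_mono mult.assoc)
  qed
  have e2: "\<bar>U Y' * (exp \<kappa> - 1 - \<kappa>)\<bar> \<le> exp B * B ^ 3 * X"
  proof -
    have "\<bar>U Y'\<bar> * \<bar>exp \<kappa> - 1 - \<kappa>\<bar> \<le> B * (exp B * B\<^sup>2 * X)"
      using bd(1) \<kappa>2 B by (intro mult_mono) auto
    then show ?thesis
      by (simp add: abs_mult power3_eq_cube power2_eq_square mult_ac)
  qed
  have e3: "\<bar>(U Y' - U y) * \<kappa>\<bar> \<le> (B ^ 3 + B\<^sup>2) * X"
  proof -
    have hd: "h * \<bar>d\<bar> \<le> X"
    proof -
      have "2 * (r * \<bar>d\<bar>) \<le> r\<^sup>2 + d\<^sup>2"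
        using sum_squares_bound[of r "\<bar>d\<bar>"] by (simp add: mult.assoc)
      then have "r * (2 * (r * \<bar>d\<bar>)) \<le> r * (r\<^sup>2 + d\<^sup>2)"
        using r by (intro mult_left_mono) auto
      then have "2 * (h * \<bar>d\<bar>) \<le> h * r + r * d\<^sup>2"
        using r(3) by (simp add: power2_eq_square algebra_simps)
      then show ?thesis
        using X0 by (simp add: X_def)
    qed
    have h\<rho>: "h * \<bar>\<rho>\<bar> \<le> X"
    proof -
      have "2 * (r\<^sup>2 * \<bar>\<rho>\<bar>) \<le> r * (r\<^sup>2)\<^sup>2 + \<bar>\<rho>\<bar>\<^sup>2 / r"
        by (rule amgm[OF r(1)])
      moreover have "r * (r\<^sup>2)\<^sup>2 \<le> h * r"
        using mult_left_mono[of "r\<^sup>2" 1 "h * r"] h r by (simp add: power2_eq_square mult_ac)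
      ultimately show ?thesis
        using X0 r(3) by (simp add: X_def)
    qed
    have "\<bar>U Y' - U y\<bar> \<le> B * \<bar>s * d + \<rho>\<bar>"
      using derivative_bound_lipschitz[OF U(1) bd(2), of Y' y] by (simp add: Y'_def)
    also have "\<dots> \<le> B * (B * \<bar>d\<bar> + \<bar>\<rho>\<bar>)"
    proof (rule mult_left_mono)
      show "\<bar>s * d + \<rho>\<bar> \<le> B * \<bar>d\<bar> + \<bar>\<rho>\<bar>"
        using mult_right_mono[OF bd(4), of "\<bar>d\<bar>"]
        by (intro order_trans[OF abs_triangle_ineq]) (simp add: abs_mult)
    qed (use B in simp)
    finally have "\<bar>U Y' - U y\<bar> * \<bar>\<kappa>\<bar> \<le> (B * (B * \<bar>d\<bar> + \<bar>\<rho>\<bar>)) * (B * h)"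
      using \<kappa> B by (intro mult_mono) auto
    also have "\<dots> = B ^ 3 * (h * \<bar>d\<bar>) + B\<^sup>2 * (h * \<bar>\<rho>\<bar>)"
      by (simp add: power2_eq_square power3_eq_cube algebra_simps)
    also have "\<dots> \<le> B ^ 3 * X + B\<^sup>2 * X"
      using hd h\<rho> B by (intro add_mono mult_left_mono) auto
    finally show ?thesis
      by (simp add: abs_mult distrib_right)
  qed
  have KX: "h * \<eta> + K * (h * r + Q / r) \<le> h * \<eta> + K * X"
    using X0 K by (intro add_mono order_refl mult_left_mono) (auto simp: X_def)
  have e4: "\<bar>U y * (\<kappa> - h * k)\<bar> \<le> B * (h * \<eta> + K * X)"
    unfolding abs_mult using bd(1) order_trans[OF osc(2) KX] B by (intro mult_mono) auto
  have e5: "\<bar>U1 y * (Bi - h * b)\<bar> \<le> B * (h * \<eta> + K * X)"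
    unfolding abs_mult using bd(2) order_trans[OF osc(1) KX] B by (intro mult_mono) auto
  \<comment> \<open>The last summand collects the first-order part in \<open>h\<close> and vanishes
    by \<open>eq\<close>; the other five are the errors estimated above.\<close>
  have "(U Y' * exp \<kappa> - U y) - (U1 y * (s * d + \<rho> - Bi) + U2 y / 2 * s\<^sup>2 * (d\<^sup>2 - h))
    = e1 + U Y' * (exp \<kappa> - 1 - \<kappa>) + (U Y' - U y) * \<kappa> + U y * (\<kappa> - h * k) + U1 y * (Bi - h * b)
      + h * (s\<^sup>2 / 2 * U2 y + b * U1 y + k * U y)"
    by (simp add: e1_def algebra_simps diff_divide_distrib)
  also have "\<bar>\<dots>\<bar> \<le> \<bar>e1\<bar> + \<bar>U Y' * (exp \<kappa> - 1 - \<kappa>)\<bar> + \<bar>(U Y' - U y) * \<kappa>\<bar> + \<bar>U y * (\<kappa> - h * k)\<bar> + \<bar>U1 y * (Bi - h * b)\<bar>"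
    unfolding eq by linarith
  also have "\<dots> \<le> (B\<^sup>2 * \<eta> * d\<^sup>2 + (B\<^sup>2 * K * (B + 1) + 3 * B + B\<^sup>2) * X) + exp B * B ^ 3 * X + (B ^ 3 + B\<^sup>2) * X
      + B * (h * \<eta> + K * X) + B * (h * \<eta> + K * X)"
    by (intro add_mono e1 e2 e3 e4 e5)
  also have "\<dots> = ?rhs"
    unfolding X_def[symmetric] by (simp add: algebra_simps)
  finally show ?thesis
    unfolding Y'_def .
qed

lemma path_integral_measurable:
  fixes X :: "real \<Rightarrow> 'w \<Rightarrow> real"
  assumes X: "\<And>s. 0 \<le> s \<Longrightarrow> X s \<in> borel_measurable N"
    and cont: "\<And>\<omega>. \<omega> \<in> space N \<Longrightarrow> continuous_on {0..} (\<lambda>s. X s \<omega>)" and "0 \<le> t"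
  shows "(\<lambda>\<omega>. integral {t..t'} (\<lambda>s. X s \<omega>)) \<in> borel_measurable N"
proof -
  have [measurable]: "(\<lambda>(\<omega>, s). X (max 0 s) \<omega>) \<in> borel_measurable (N \<Otimes>\<^sub>M borel)"
    by (rule continuous_process_measurable[OF X cont])
  then have [measurable]: "(\<lambda>(\<omega>, s). X (max 0 s) \<omega>) \<in> borel_measurable (N \<Otimes>\<^sub>M lborel)"
    by simp
  have "(\<lambda>(\<omega>, s). indicator {t..t'} s *\<^sub>R X (max 0 s) \<omega>) \<in> borel_measurable (N \<Otimes>\<^sub>M lborel)"
    by measurable
  then have meas: "(\<lambda>\<omega>. \<integral>s. indicator {t..t'} s *\<^sub>R X (max 0 s) \<omega> \<partial>lborel) \<in> borel_measurable N"
    by (rule lborel.borel_measurable_lebesgue_integral)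
  have eq: "(\<integral>s. indicator {t..t'} s *\<^sub>R X (max 0 s) \<omega> \<partial>lborel) = integral {t..t'} (\<lambda>s. X s \<omega>)"
    if "\<omega> \<in> space N" for \<omega>
  proof -
    have c: "continuous_on {t..t'} (\<lambda>s. X (max 0 s) \<omega>)"
      by (rule continuous_on_eq[OF continuous_on_subset[OF cont[OF that]]]) (use \<open>0 \<le> t\<close> in \<open>auto simp: max_def\<close>)
    have "(\<integral>s. indicator {t..t'} s *\<^sub>R X (max 0 s) \<omega> \<partial>lborel) = integral {t..t'} (\<lambda>s. X (max 0 s) \<omega>)"
      using set_borel_integral_eq_integral(2)[OF borel_integrable_atLeastAtMost'[OF c]]
      by (simp add: set_lebesgue_integral_def)
    also have "\<dots> = integral {t..t'} (\<lambda>s. X s \<omega>)"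
      using \<open>0 \<le> t\<close> by (intro Henstock_Kurzweil_Integration.integral_cong) (auto simp: max_def)
    finally show ?thesis .
  qed
  show ?thesis
    using meas by (subst measurable_cong[OF eq[symmetric]])
qed

lemma nn_integral_continuous:
  fixes g :: "real \<Rightarrow> real"
  assumes "continuous_on {t..t'} g" "\<And>s. s \<in> {t..t'} \<Longrightarrow> 0 \<le> g s"
  shows "(\<integral>\<^sup>+s\<in>{t..t'}. ennreal (g s) \<partial>lborel) = ennreal (integral {t..t'} g)"
proof -
  note si = borel_integrable_atLeastAtMost'[OF assms(1)]
  have "(\<integral>\<^sup>+s\<in>{t..t'}. ennreal (g s) \<partial>lborel) = (\<integral>\<^sup>+s. ennreal (indicator {t..t'} s *\<^sub>R g s) \<partial>lborel)"
    by (intro nn_integral_cong) (auto simp: indicator_def)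
  also have "\<dots> = ennreal (\<integral>s. indicator {t..t'} s *\<^sub>R g s \<partial>lborel)"
    using si assms(2) by (intro nn_integral_eq_integral) (auto simp: set_integrable_def indicator_def)
  finally show ?thesis
    using set_borel_integral_eq_integral(2)[OF si] by (simp add: set_lebesgue_integral_def)
qed

section \<open>Moments of the increments of the diffusion\<close>

locale circle_sde = brownian_motion M F W for M :: "'w measure" and F W +
  fixes s s1 s2 b :: "real \<Rightarrow> real" and Y :: "real \<Rightarrow> 'w \<Rightarrow> real"
  assumes s: "C2 s s1 s2" and b: "periodic b" "continuous_on UNIV b"
    and Y_adapted: "\<And>t. 0 \<le> t \<Longrightarrow> Y t \<in> borel_measurable (F t)"
    and Y_cont: "\<And>\<omega>. \<omega> \<in> space M \<Longrightarrow> continuous_on {0..} (\<lambda>t. Y t \<omega>)"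
    and Y_ito: "\<And>t. 0 \<le> t \<Longrightarrow> \<exists>I. has_ito_integral M F W (\<lambda>r \<omega>. s (Y r \<omega>)) t I \<and>
      (AE \<omega> in M. Y t \<omega> = Y 0 \<omega> + I \<omega> + integral {0..t} (\<lambda>r. b (Y r \<omega>)))"
begin

definition path :: "(real \<Rightarrow> real) \<Rightarrow> real \<Rightarrow> real \<Rightarrow> 'w \<Rightarrow> real"
  where "path f t t' \<omega> = integral {t..t'} (\<lambda>r. f (Y r \<omega>))"

lemma f_Y_cont:
  assumes "continuous_on UNIV f" "\<omega> \<in> space M"
  shows "continuous_on {0..} (\<lambda>t. f (Y t \<omega>))"
  by (rule continuous_on_compose2[OF assms(1) Y_cont[OF assms(2)]]) simp

lemma f_Y_measurable:
  assumes "continuous_on UNIV (f :: real \<Rightarrow> real)" "0 \<le> t" "t \<le> t'"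
  shows "(\<lambda>\<omega>. f (Y t \<omega>)) \<in> borel_measurable (F t')"
  using measurable_compose[OF F_mono_measurable[OF Y_adapted[OF assms(2)] assms(3)] borel_measurable_continuous_onI[OF assms(1)]] .

lemma path_integrable:
  fixes f :: "real \<Rightarrow> real"
  assumes "continuous_on UNIV f" "\<omega> \<in> space M" "0 \<le> t"
  shows "(\<lambda>r. f (Y r \<omega>)) integrable_on {t..t'}"
  using f_Y_cont[OF assms(1,2)] assms(3)
  by (intro integrable_continuous_real) (auto intro: continuous_on_subset)

lemma path_measurable:
  assumes f: "continuous_on UNIV f" and t: "0 \<le> t" "t \<le> t'"
  shows "path f t t' \<in> borel_measurable (F t')"
proof -
  \<comment> \<open>Freezing the process at time \<open>t'\<close> makes every value of the
    integrand \<open>F t'\<close>-measurable and leaves the integral over \<open>{t..t'}\<close>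
    unchanged.\<close>
  have "(\<lambda>\<omega>. integral {t..t'} (\<lambda>r. f (Y (min r t') \<omega>))) \<in> borel_measurable (F t')"
  proof (rule path_integral_measurable[OF _ _ t(1)])
    show "(\<lambda>\<omega>. f (Y (min r t') \<omega>)) \<in> borel_measurable (F t')" if "0 \<le> r" for r
      using that t by (intro f_Y_measurable[OF f]) auto
    show "continuous_on {0..} (\<lambda>r. f (Y (min r t') \<omega>))" if "\<omega> \<in> space (F t')" for \<omega>
      using that t by (intro continuous_on_compose2[OF f_Y_cont[OF f]]) (auto simp: space_F intro!: continuous_intros)
  qed
  moreover have "integral {t..t'} (\<lambda>r. f (Y (min r t') \<omega>)) = path f t t' \<omega>" for \<omega>
    unfolding path_def by (intro Henstock_Kurzweil_Integration.integral_cong) (auto simp: min_def)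
  ultimately show ?thesis
    by simp
qed

lemma path_combine:
  assumes "continuous_on UNIV f" "\<omega> \<in> space M" "0 \<le> t" "t \<le> t'" "t' \<le> t''"
  shows "path f t t'' \<omega> = path f t t' \<omega> + path f t' t'' \<omega>"
  unfolding path_def
  by (rule Henstock_Kurzweil_Integration.integral_combine[symmetric]) (use assms path_integrable in auto)

lemma path_bound:
  assumes "continuous_on UNIV f" "\<omega> \<in> space M" "0 \<le> t" "t \<le> t'" "\<And>x. \<bar>f x\<bar> \<le> B"
  shows "\<bar>path f t t' \<omega>\<bar> \<le> B * (t' - t)"
  using integral_bound[of t t' "\<lambda>r. f (Y r \<omega>)" B] assms continuous_on_subset[OF f_Y_cont[OF assms(1,2)], of "{t..t'}"]
  by (auto simp: path_def)

text \<open>Not the quadratic variation, but the accumulated squared displacement from the starting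
  value; its expectation is of the order of the squared time step.\<close>

definition qvar :: "real \<Rightarrow> real \<Rightarrow> 'w \<Rightarrow> real"
  where "qvar t t' \<omega> = integral {t..t'} (\<lambda>r. (Y r \<omega> - Y t \<omega>)\<^sup>2)"

lemma dev_cont:
  assumes "\<omega> \<in> space M" "0 \<le> t"
  shows "continuous_on {t..t'} (\<lambda>r. (Y r \<omega> - Y t \<omega>)\<^sup>2)"
  by (intro continuous_intros continuous_on_subset[OF Y_cont[OF assms(1)]]) (use assms in auto)

lemma qvar_nonneg: "\<omega> \<in> space M \<Longrightarrow> 0 \<le> t \<Longrightarrow> 0 \<le> qvar t t' \<omega>"
  unfolding qvar_def
  by (intro Henstock_Kurzweil_Integration.integral_nonneg integrable_continuous_real dev_cont) auto

lemma Y_M: "0 \<le> t \<Longrightarrow> Y t \<in> borel_measurable M"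
  using F_measurable Y_adapted by blast

lemma qvar_measurable: "0 \<le> t \<Longrightarrow> qvar t t' \<in> borel_measurable M"
  unfolding qvar_def[abs_def]
proof (rule path_integral_measurable)
  fix r :: real
  assume "0 \<le> t" "0 \<le> r"
  then show "(\<lambda>\<omega>. (Y r \<omega> - Y t \<omega>)\<^sup>2) \<in> borel_measurable M"
    using Y_M[of r] Y_M[of t] by measurable
next
  fix \<omega>
  assume "\<omega> \<in> space M"
  then show "continuous_on {0..} (\<lambda>r. (Y r \<omega> - Y t \<omega>)\<^sup>2)"
    by (intro continuous_intros Y_cont)
qed

text \<open>The modulus is integrated along the path, after \<open>z \<le> r + z\<^sup>2 / r\<close>
  has replaced the displacement by its square, for which a moment bound is available.\<close>

lemma path_oscillation:
  assumes f: "continuous_on UNIV f" and mod: "\<And>x y. \<bar>f x - f y\<bar> \<le> \<eta> + K * \<bar>x - y\<bar>" and K: "K \<ge> 0"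
    and \<omega>: "\<omega> \<in> space M" and t: "0 \<le> t" "t \<le> t'" and r: "r > 0"
  shows "\<bar>path f t t' \<omega> - (t' - t) * f (Y t \<omega>)\<bar> \<le> (t' - t) * \<eta> + K * ((t' - t) * r + qvar t t' \<omega> / r)"
proof -
  have int: "(\<lambda>u. f (Y u \<omega>)) integrable_on {t..t'}" "(\<lambda>u. (Y u \<omega> - Y t \<omega>)\<^sup>2) integrable_on {t..t'}"
    using path_integrable[OF f \<omega> t(1)] integrable_continuous_real[OF dev_cont[OF \<omega> t(1)]] by auto
  then have int': "(\<lambda>u. K / r * (Y u \<omega> - Y t \<omega>)\<^sup>2) integrable_on {t..t'}"
    by (intro integrable_on_mult_right)
  have "path f t t' \<omega> - (t' - t) * f (Y t \<omega>) = integral {t..t'} (\<lambda>u. f (Y u \<omega>) - f (Y t \<omega>))"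
    unfolding path_def using int t by (subst Henstock_Kurzweil_Integration.integral_diff) auto
  also have "norm \<dots> \<le> integral {t..t'} (\<lambda>u. (\<eta> + K * r) + (K / r) * (Y u \<omega> - Y t \<omega>)\<^sup>2)"
  proof (rule Henstock_Kurzweil_Integration.integral_norm_bound_integral)
    show "(\<lambda>u. f (Y u \<omega>) - f (Y t \<omega>)) integrable_on {t..t'}"
      using int by (intro Henstock_Kurzweil_Integration.integrable_diff) auto
    show "(\<lambda>u. (\<eta> + K * r) + (K / r) * (Y u \<omega> - Y t \<omega>)\<^sup>2) integrable_on {t..t'}"
      by (intro Henstock_Kurzweil_Integration.integrable_add int') auto
    fix u
    define z where "z = \<bar>Y u \<omega> - Y t \<omega>\<bar>"
    have "z \<le> r + z\<^sup>2 / r"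
    proof -
      have "0 \<le> z\<^sup>2 / r" "0 \<le> z"
        using r by (auto simp: z_def)
      then show ?thesis
        using amgm[OF r, of 1 z] r by simp
    qed
    then have "K * z \<le> K * (r + z\<^sup>2 / r)"
      using K by (intro mult_left_mono)
    then have "K * z \<le> K * r + K / r * (Y u \<omega> - Y t \<omega>)\<^sup>2"
      by (simp add: z_def distrib_left)
    then show "norm (f (Y u \<omega>) - f (Y t \<omega>)) \<le> (\<eta> + K * r) + (K / r) * (Y u \<omega> - Y t \<omega>)\<^sup>2"
      using mod[of "Y u \<omega>" "Y t \<omega>"] unfolding z_def real_norm_def by linarith
  qed
  also have "\<dots> = (t' - t) * (\<eta> + K * r) + (K / r) * qvar t t' \<omega>"
    unfolding qvar_def using int' t
    by (subst Henstock_Kurzweil_Integration.integral_add) (auto simp del: times_divide_eq_left)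
  also have "\<dots> = (t' - t) * \<eta> + K * ((t' - t) * r + qvar t t' \<omega> / r)"
    by (simp add: algebra_simps)
  finally show ?thesis
    by simp
qed

end


text \<open>As \<eta> is arbitrary, with \<open>K\<close> depending on it, increments are small
  compared with the time step at every point, and the derivative vanishes.\<close>

lemma constant_if_superlinear_modulus:
  fixes D :: "real \<Rightarrow> real"
  assumes mod: "\<And>\<eta>. \<eta> > 0 \<Longrightarrow> \<exists>K\<ge>0. \<forall>t t'. u \<le> t \<longrightarrow> t < t' \<longrightarrow> t' \<le> v \<longrightarrow> t' - t \<le> 1 \<longrightarrow>
      \<bar>D t' - D t\<bar> \<le> \<eta> * (t' - t) + K * ((t' - t) * sqrt (t' - t))"
    and "u \<le> v"
  shows "D v = D u"
proof -
  have "(D has_field_derivative 0) (at x within {u..v})" if x: "x \<in> {u..v}" for x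
    unfolding has_field_derivative_iff
  proof (rule tendstoI)
    fix e :: real
    assume "e > 0"
    then obtain K where K: "K \<ge> 0" and *: "\<And>t t'. u \<le> t \<Longrightarrow> t < t' \<Longrightarrow> t' \<le> v \<Longrightarrow> t' - t \<le> 1 \<Longrightarrow>
        \<bar>D t' - D t\<bar> \<le> e / 2 * (t' - t) + K * ((t' - t) * sqrt (t' - t))"
      using mod[of "e / 2"] by auto
    \<comment> \<open>Makes \<open>K * sqrt h\<close> smaller than \<open>e / 2\<close> for all
      \<open>h < d\<close>.\<close>
    define d where "d = min 1 ((e / (2 * (K + 1)))\<^sup>2)"
    have d: "d > 0"
      using \<open>e > 0\<close> K by (auto simp: d_def)
    have bound: "\<bar>D y - D x\<bar> < e * \<bar>y - x\<bar>" if y: "y \<in> {u..v}" "y \<noteq> x" "\<bar>y - x\<bar> < d" for y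
    proof -
      define h where "h = \<bar>y - x\<bar>"
      have h: "0 < h" "h < d"
        using y by (auto simp: h_def)
      have "\<bar>D y - D x\<bar> \<le> e / 2 * h + K * (h * sqrt h)"
      proof (cases "x < y")
        case True
        then show ?thesis
          using *[of x y] x y h by (simp add: h_def d_def)
      next
        case False
        then show ?thesis
          using *[of y x] x y h by (simp add: h_def d_def abs_minus_commute)
      qed
      also have "\<dots> = h * (e / 2 + K * sqrt h)"
        by (simp add: algebra_simps)
      also have "\<dots> < h * e"
      proof (rule mult_strict_left_mono[OF _ h(1)])
        have "sqrt h < e / (2 * (K + 1))"
          by (rule real_less_lsqrt) (use h \<open>e > 0\<close> K in \<open>auto simp: d_def\<close>)
        then have "(K + 1) * sqrt h < e / 2"
          using K by (simp add: field_simps)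
        moreover have "K * sqrt h \<le> (K + 1) * sqrt h"
          using h by (intro mult_right_mono) auto
        ultimately show "e / 2 + K * sqrt h < e"
          by linarith
      qed
      finally show ?thesis
        by (simp add: h_def mult.commute)
    qed
    show "\<forall>\<^sub>F y in at x within {u..v}. dist ((D y - D x) / (y - x)) 0 < e"
      unfolding eventually_at
    proof (intro exI[of _ d] conjI d ballI impI)
      fix y
      assume "y \<in> {u..v}" "y \<noteq> x \<and> dist y x < d"
      then show "dist ((D y - D x) / (y - x)) 0 < e"
        using bound[of y] by (simp add: dist_real_def pos_divide_less_eq)
    qed
  qed
  then obtain c where "\<forall>x\<in>{u..v}. D x = c"
    using has_field_derivative_zero_constant[of "{u..v}" D] by auto
  then show ?thesis
    using \<open>u \<le> v\<close> by simp
qed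

context prob_space
begin

lemma expectation_le_nn:
  assumes "f \<in> borel_measurable M" "\<And>\<omega>. \<omega> \<in> space M \<Longrightarrow> 0 \<le> f \<omega>" "(\<integral>\<^sup>+\<omega>. ennreal (f \<omega>) \<partial>M) \<le> ennreal c" "0 \<le> c"
  shows "integrable M f" "expectation f \<le> c"
proof -
  have "(\<integral>\<^sup>+\<omega>. ennreal (f \<omega>) \<partial>M) < \<infinity>"
    by (rule le_less_trans[OF assms(3)]) simp
  then show int: "integrable M f"
    using assms(1,2) by (intro integrableI_nonneg) auto
  have "ennreal (expectation f) \<le> ennreal c"
    using nn_integral_eq_integral[OF int] assms by simp
  then show "expectation f \<le> c"
    using assms(4) by simp
qed

end

context circle_sde
begin

text \<open>Everything that the martingale argument takes from the stochastic equation: the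
  remainder after freezing the coefficient, the mean displacement, and the centredness of the noise
  against bounded weights from the past. One constant serves all times, since the coefficients are
  periodic and hence bounded.\<close>

lemma increment_moments:
  obtains C where "C \<ge> 0"
    and "\<And>t t'. 0 \<le> t \<Longrightarrow> t \<le> t' \<Longrightarrow> t' \<le> t + 1 \<Longrightarrow>
      (\<integral>\<^sup>+\<omega>. ennreal ((Y t' \<omega> - Y t \<omega> - s (Y t \<omega>) * dW t t' \<omega>)\<^sup>2) \<partial>M) \<le> ennreal (C * (t' - t)\<^sup>2)"
    and "\<And>t t'. 0 \<le> t \<Longrightarrow> t \<le> t' \<Longrightarrow> t' \<le> t + 1 \<Longrightarrow> (\<integral>\<^sup>+\<omega>. ennreal (qvar t t' \<omega>) \<partial>M) \<le> ennreal (C * (t' - t)\<^sup>2)"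
    and "\<And>t t' Z c. 0 \<le> t \<Longrightarrow> t \<le> t' \<Longrightarrow> t' \<le> t + 1 \<Longrightarrow> Z \<in> borel_measurable (F t) \<Longrightarrow>
      (\<And>\<omega>. \<omega> \<in> space M \<Longrightarrow> \<bar>Z \<omega>\<bar> \<le> c) \<Longrightarrow>
      has_bochner_integral M (\<lambda>\<omega>. Z \<omega> * (Y t' \<omega> - Y t \<omega> - path b t t' \<omega>)) 0"
proof -
  note s' = C2D[OF s]
  obtain B1 where B1: "B1 > 0" "\<And>x. norm (s x) \<le> B1"
    by (rule periodic_bounded[OF s'(1,6)], rule that)
  obtain B2 where B2: "B2 > 0" "\<And>x. norm (s1 x) \<le> B2"
    by (rule periodic_bounded[OF s'(2,7)], rule that)
  obtain B3 where B3: "B3 > 0" "\<And>x. norm (b x) \<le> B3"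
    by (rule periodic_bounded[OF b], rule that)
  define B where "B = B1 + B2 + B3"
  have B: "B > 0" "\<bar>s x\<bar> \<le> B" "\<bar>s1 x\<bar> \<le> B" "\<bar>b x\<bar> \<le> B" for x
    using B1(1) B2(1) B3(1) B1(2)[of x] B2(2)[of x] B3(2)[of x] by (auto simp: B_def)
  have lip: "\<bar>s x - s y\<bar> \<le> B * \<bar>x - y\<bar>" for x y
    by (rule derivative_bound_lipschitz[OF s'(4) B(3)])
  have s_joint: "(\<lambda>(\<omega>, r). s (Y (max 0 r) \<omega>)) \<in> borel_measurable (M \<Otimes>\<^sub>M borel)"
    by (rule continuous_process_measurable)
      (use f_Y_cont[OF s'(6)] F_measurable[OF f_Y_measurable[OF s'(6)]] in auto)
  have ito: "\<exists>I I'. has_ito_integral M F W (\<lambda>r \<omega>. s (Y r \<omega>)) t I \<and> has_ito_integral M F W (\<lambda>r \<omega>. s (Y r \<omega>)) t' I' \<and>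
      (AE \<omega> in M. Y t' \<omega> - Y t \<omega> = I' \<omega> - I \<omega> + path b t t' \<omega>)" if t: "0 \<le> t" "t \<le> t'" for t t'
  proof -
    obtain I where I: "has_ito_integral M F W (\<lambda>r \<omega>. s (Y r \<omega>)) t I"
      "AE \<omega> in M. Y t \<omega> = Y 0 \<omega> + I \<omega> + path b 0 t \<omega>"
      using Y_ito[OF t(1)] unfolding path_def by blast
    obtain I' where I': "has_ito_integral M F W (\<lambda>r \<omega>. s (Y r \<omega>)) t' I'"
      "AE \<omega> in M. Y t' \<omega> = Y 0 \<omega> + I' \<omega> + path b 0 t' \<omega>"
      using Y_ito[of t'] t unfolding path_def by auto
    have "AE \<omega> in M. Y t' \<omega> - Y t \<omega> = I' \<omega> - I \<omega> + path b t t' \<omega>"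
      using I(2) I'(2) AE_space
    proof eventually_elim
      case (elim \<omega>)
      then show ?case
        using path_combine[OF b(2) elim(3) order_refl t] by simp
    qed
    then show ?thesis
      using I(1) I'(1) by blast
  qed
  have pb: "\<bar>path b t t' \<omega>\<bar> \<le> B * (t' - t)" if "\<omega> \<in> space M" "0 \<le> t" "t \<le> t'" for \<omega> t t'
    by (rule path_bound[OF b(2) that B(4)])
  have two: "2 * ennreal x = ennreal (2 * x)" for x
    by (simp add: ennreal_mult')
  have add_drift: "(\<integral>\<^sup>+\<omega>. ennreal ((A \<omega>)\<^sup>2) \<partial>M) \<le> ennreal (2 * n + 2 * (B * (t' - t))\<^sup>2)"
    if t: "0 \<le> t" "t \<le> t'" and ae: "AE \<omega> in M. A \<omega> = J \<omega> + path b t t' \<omega>" and [measurable]: "J \<in> borel_measurable M"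
      and N: "(\<integral>\<^sup>+\<omega>. ennreal ((J \<omega>)\<^sup>2) \<partial>M) \<le> ennreal n" and n: "0 \<le> n" for t t' A J n
  proof -
    let ?d = "2 * (B * (t' - t))\<^sup>2"
    have "AE \<omega> in M. ennreal ((A \<omega>)\<^sup>2) \<le> 2 * ennreal ((J \<omega>)\<^sup>2) + ennreal ?d"
      using ae AE_space
    proof eventually_elim
      case (elim \<omega>)
      have "(path b t t' \<omega>)\<^sup>2 \<le> (B * (t' - t))\<^sup>2"
        using pb[OF elim(2) t] B(1) t by (simp add: abs_le_square_iff[symmetric])
      then have "2 * ennreal ((- path b t t' \<omega>)\<^sup>2) \<le> ennreal ?d"
        unfolding two by (intro ennreal_leI) simp
      then have "2 * ennreal ((J \<omega>)\<^sup>2) + 2 * ennreal ((- path b t t' \<omega>)\<^sup>2) \<le> 2 * ennreal ((J \<omega>)\<^sup>2) + ennreal ?d"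
        by (rule add_left_mono)
      then have "ennreal ((J \<omega> - (- path b t t' \<omega>))\<^sup>2) \<le> 2 * ennreal ((J \<omega>)\<^sup>2) + ennreal ?d"
        by (rule order_trans[OF sum_square_ennreal])
      then show ?case
        by (simp add: elim(1))
    qed
    then have "(\<integral>\<^sup>+\<omega>. ennreal ((A \<omega>)\<^sup>2) \<partial>M) \<le> (\<integral>\<^sup>+\<omega>. 2 * ennreal ((J \<omega>)\<^sup>2) + ennreal ?d \<partial>M)"
      by (rule nn_integral_mono_AE)
    also have "\<dots> = 2 * (\<integral>\<^sup>+\<omega>. ennreal ((J \<omega>)\<^sup>2) \<partial>M) + ennreal ?d"
      by (simp add: nn_integral_add nn_integral_cmult emeasure_space_1)
    also have "\<dots> \<le> 2 * ennreal n + ennreal ?d"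
      by (intro add_mono mult_left_mono N) auto
    also have "\<dots> = ennreal (2 * n + ?d)"
      unfolding two using n by (subst ennreal_plus) auto
    finally show ?thesis .
  qed
  \<comment> \<open>The isometry bound \<open>4 * B\<^sup>2\<close> doubled, plus
    \<open>2 * B\<^sup>2\<close> from the drift, for steps of length at most 1.\<close>
  define C1 where "C1 = 10 * B\<^sup>2"
  have C1: "C1 \<ge> 0"
    by (simp add: C1_def)
  have dY: "(\<integral>\<^sup>+\<omega>. ennreal ((Y t' \<omega> - Y t \<omega>)\<^sup>2) \<partial>M) \<le> ennreal (C1 * (t' - t))"
    if t: "0 \<le> t" "t \<le> t'" "t' \<le> t + 1" for t t'
  proof -
    obtain I I' where I: "has_ito_integral M F W (\<lambda>r \<omega>. s (Y r \<omega>)) t I" and I': "has_ito_integral M F W (\<lambda>r \<omega>. s (Y r \<omega>)) t' I'"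
      and ae: "AE \<omega> in M. Y t' \<omega> - Y t \<omega> = I' \<omega> - I \<omega> + path b t t' \<omega>"
      using ito[OF t(1,2)] by blast
    have [measurable]: "I \<in> borel_measurable M" "I' \<in> borel_measurable M"
      using I I' by (auto simp: has_ito_integral_def)
    have "(\<integral>\<^sup>+\<omega>. ennreal ((I' \<omega> - I \<omega> - 0 * dW t t' \<omega>)\<^sup>2) \<partial>M)
        \<le> 4 * (\<integral>\<^sup>+\<omega>. (\<integral>\<^sup>+r\<in>{t..t'}. ennreal ((s (Y r \<omega>) - 0)\<^sup>2) \<partial>lborel) \<partial>M)"
      by (rule ito_increment(1)[OF I I' t(1,2) s_joint, of "\<lambda>_. 0" 0]) auto
    also have "\<dots> \<le> 4 * (\<integral>\<^sup>+\<omega>. ennreal (B\<^sup>2 * (t' - t)) \<partial>M)"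
    proof (intro mult_left_mono nn_integral_mono)
      fix \<omega>
      have "(\<integral>\<^sup>+r\<in>{t..t'}. ennreal ((s (Y r \<omega>) - 0)\<^sup>2) \<partial>lborel) \<le> (\<integral>\<^sup>+r. ennreal (B\<^sup>2) * indicator {t..t'} r \<partial>lborel)"
        using B(2) by (intro nn_integral_mono mult_right_mono ennreal_leI) (auto simp: abs_le_square_iff[symmetric] B(1) less_imp_le)
      also have "\<dots> = ennreal (B\<^sup>2 * (t' - t))"
        using t by (simp add: nn_integral_cmult ennreal_mult)
      finally show "(\<integral>\<^sup>+r\<in>{t..t'}. ennreal ((s (Y r \<omega>) - 0)\<^sup>2) \<partial>lborel) \<le> ennreal (B\<^sup>2 * (t' - t))" .
    qed auto
    also have "\<dots> = ennreal (4 * (B\<^sup>2 * (t' - t)))"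
      using t by (simp add: emeasure_space_1 ennreal_mult)
    finally have N: "(\<integral>\<^sup>+\<omega>. ennreal ((I' \<omega> - I \<omega>)\<^sup>2) \<partial>M) \<le> ennreal (4 * (B\<^sup>2 * (t' - t)))"
      by simp
    have "(\<integral>\<^sup>+\<omega>. ennreal ((Y t' \<omega> - Y t \<omega>)\<^sup>2) \<partial>M) \<le> ennreal (2 * (4 * (B\<^sup>2 * (t' - t))) + 2 * (B * (t' - t))\<^sup>2)"
      by (rule add_drift[OF t(1,2) ae _ N]) (use t in auto)
    also have "\<dots> \<le> ennreal (C1 * (t' - t))"
    proof (rule ennreal_leI)
      have "(B * (t' - t))\<^sup>2 \<le> B\<^sup>2 * (t' - t)"
        using t by (simp add: power_mult_distrib power2_eq_square[of "t' - t"] mult_left_mono mult_left_le)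
      then show "2 * (4 * (B\<^sup>2 * (t' - t))) + 2 * (B * (t' - t))\<^sup>2 \<le> C1 * (t' - t)"
        unfolding C1_def by linarith
    qed
    finally show ?thesis .
  qed
  \<comment> \<open>After exchanging time and expectation, the mean squared displacement is at most
    \<open>C1 * (t' - t)\<close> throughout the interval, whose length supplies the second
    factor.\<close>
  have qv: "(\<integral>\<^sup>+\<omega>. ennreal (qvar t t' \<omega>) \<partial>M) \<le> ennreal (C1 * (t' - t)\<^sup>2)"
    if t: "0 \<le> t" "t \<le> t'" "t' \<le> t + 1" for t t'
  proof -
    define f where "f \<omega> r = ennreal ((Y (max 0 r) \<omega> - Y t \<omega>)\<^sup>2) * indicator {t..t'} r" for \<omega> r
    have [measurable]: "(\<lambda>(\<omega>, r). Y (max 0 r) \<omega>) \<in> borel_measurable (M \<Otimes>\<^sub>M lborel)"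
      using continuous_process_measurable[OF Y_M Y_cont] by simp
    have [measurable]: "Y t \<in> borel_measurable M"
      by (rule Y_M[OF t(1)])
    have fm: "case_prod f \<in> borel_measurable (M \<Otimes>\<^sub>M lborel)"
      unfolding f_def[abs_def] by measurable
    interpret P: pair_sigma_finite M lborel
      by standard
    have "(\<integral>\<^sup>+\<omega>. ennreal (qvar t t' \<omega>) \<partial>M) = (\<integral>\<^sup>+\<omega>. (\<integral>\<^sup>+r. f \<omega> r \<partial>lborel) \<partial>M)"
    proof (rule nn_integral_cong)
      fix \<omega>
      assume \<omega>: "\<omega> \<in> space M"
      have "(\<integral>\<^sup>+r. f \<omega> r \<partial>lborel) = (\<integral>\<^sup>+r\<in>{t..t'}. ennreal ((Y r \<omega> - Y t \<omega>)\<^sup>2) \<partial>lborel)"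
        unfolding f_def using t by (intro nn_integral_cong) (auto simp: indicator_def max_def)
      also have "\<dots> = ennreal (qvar t t' \<omega>)"
        unfolding qvar_def by (rule nn_integral_continuous[OF dev_cont[OF \<omega> t(1)]]) simp
      finally show "ennreal (qvar t t' \<omega>) = (\<integral>\<^sup>+r. f \<omega> r \<partial>lborel)"
        by simp
    qed
    also have "\<dots> = (\<integral>\<^sup>+r. (\<integral>\<^sup>+\<omega>. f \<omega> r \<partial>M) \<partial>lborel)"
      by (rule P.Fubini'[OF fm, symmetric])
    also have "\<dots> \<le> (\<integral>\<^sup>+r. ennreal (C1 * (t' - t)) * indicator {t..t'} r \<partial>lborel)"
    proof (rule nn_integral_mono)
      fix r
      show "(\<integral>\<^sup>+\<omega>. f \<omega> r \<partial>M) \<le> ennreal (C1 * (t' - t)) * indicator {t..t'} r"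
      proof (cases "r \<in> {t..t'}")
        case True
        then have "(\<integral>\<^sup>+\<omega>. f \<omega> r \<partial>M) \<le> ennreal (C1 * (r - t))"
          using dY[of t r] t by (simp add: f_def max_def)
        also have "\<dots> \<le> ennreal (C1 * (t' - t))"
          using True C1 by (intro ennreal_leI mult_left_mono) auto
        finally show ?thesis
          using True by simp
      qed (simp add: f_def)
    qed
    also have "\<dots> = ennreal (C1 * (t' - t)) * ennreal (t' - t)"
      using t by (simp add: nn_integral_cmult)
    also have "\<dots> = ennreal (C1 * (t' - t)\<^sup>2)"
      using t C1 by (simp add: ennreal_mult[symmetric] power2_eq_square mult.assoc)
    finally show ?thesis .
  qed
  \<comment> \<open>The first two summands are for the remainder: the Lipschitz constant of the
    coefficient turns its variation into \<open>qvar\<close>, and the drift adds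
    \<open>2 * B\<^sup>2\<close>. The last covers \<open>qvar\<close> itself.\<close>
  define C where "C = 8 * (B\<^sup>2 * C1) + 2 * B\<^sup>2 + C1"
  have C: "C \<ge> 0" "C1 \<le> C"
    using C1 by (auto simp: C_def)
  show ?thesis
  proof (rule that[OF C(1)])
    fix t t'
    assume t: "0 \<le> t" "t \<le> t'" "t' \<le> t + (1::real)"
    show "(\<integral>\<^sup>+\<omega>. ennreal (qvar t t' \<omega>) \<partial>M) \<le> ennreal (C * (t' - t)\<^sup>2)"
      by (rule order_trans[OF qv[OF t]]) (intro ennreal_leI mult_right_mono C(2) zero_le_power2)
    obtain I I' where I: "has_ito_integral M F W (\<lambda>r \<omega>. s (Y r \<omega>)) t I" and I': "has_ito_integral M F W (\<lambda>r \<omega>. s (Y r \<omega>)) t' I'"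
      and ae: "AE \<omega> in M. Y t' \<omega> - Y t \<omega> = I' \<omega> - I \<omega> + path b t t' \<omega>"
      using ito[OF t(1,2)] by blast
    have [measurable]: "I \<in> borel_measurable M" "I' \<in> borel_measurable M" "Y t \<in> borel_measurable M" "Y t' \<in> borel_measurable M"
      "path b t t' \<in> borel_measurable M" "dW t t' \<in> borel_measurable M" "s \<in> borel_measurable borel"
      using I I' Y_M t F_measurable[OF path_measurable[OF b(2) t(1,2)]] dW_measurable borel_measurable_continuous_onI[OF s'(6)]
      by (auto simp: has_ito_integral_def)
    show "(\<integral>\<^sup>+\<omega>. ennreal ((Y t' \<omega> - Y t \<omega> - s (Y t \<omega>) * dW t t' \<omega>)\<^sup>2) \<partial>M) \<le> ennreal (C * (t' - t)\<^sup>2)"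
    proof -
      have "(\<integral>\<^sup>+\<omega>. ennreal ((I' \<omega> - I \<omega> - s (Y t \<omega>) * dW t t' \<omega>)\<^sup>2) \<partial>M)
          \<le> 4 * (\<integral>\<^sup>+\<omega>. (\<integral>\<^sup>+r\<in>{t..t'}. ennreal ((s (Y r \<omega>) - s (Y t \<omega>))\<^sup>2) \<partial>lborel) \<partial>M)"
        by (rule ito_increment(1)[OF I I' t(1,2) s_joint f_Y_measurable[OF s'(6) t(1) order_refl] B(2)])
      also have "\<dots> \<le> 4 * (\<integral>\<^sup>+\<omega>. ennreal (B\<^sup>2) * ennreal (qvar t t' \<omega>) \<partial>M)"
      proof (intro mult_left_mono nn_integral_mono)
        fix \<omega>
        assume \<omega>: "\<omega> \<in> space M"
        have "(\<integral>\<^sup>+r\<in>{t..t'}. ennreal ((s (Y r \<omega>) - s (Y t \<omega>))\<^sup>2) \<partial>lborel)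
            \<le> (\<integral>\<^sup>+r\<in>{t..t'}. ennreal (B\<^sup>2 * (Y r \<omega> - Y t \<omega>)\<^sup>2) \<partial>lborel)"
        proof (intro nn_integral_mono mult_right_mono ennreal_leI)
          fix r
          have "\<bar>s (Y r \<omega>) - s (Y t \<omega>)\<bar> \<le> \<bar>B * (Y r \<omega> - Y t \<omega>)\<bar>"
            using lip[of "Y r \<omega>" "Y t \<omega>"] B(1) by (simp add: abs_mult)
          then have "(s (Y r \<omega>) - s (Y t \<omega>))\<^sup>2 \<le> (B * (Y r \<omega> - Y t \<omega>))\<^sup>2"
            by (simp only: abs_le_square_iff)
          then show "(s (Y r \<omega>) - s (Y t \<omega>))\<^sup>2 \<le> B\<^sup>2 * (Y r \<omega> - Y t \<omega>)\<^sup>2"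
            by (simp add: power_mult_distrib)
        qed simp
        also have "\<dots> = ennreal (integral {t..t'} (\<lambda>r. B\<^sup>2 * (Y r \<omega> - Y t \<omega>)\<^sup>2))"
          by (intro nn_integral_continuous continuous_intros dev_cont[OF \<omega> t(1)]) simp
        also have "\<dots> = ennreal (B\<^sup>2) * ennreal (qvar t t' \<omega>)"
          by (simp add: qvar_def ennreal_mult' zero_le_power2)
        finally show "(\<integral>\<^sup>+r\<in>{t..t'}. ennreal ((s (Y r \<omega>) - s (Y t \<omega>))\<^sup>2) \<partial>lborel) \<le> ennreal (B\<^sup>2) * ennreal (qvar t t' \<omega>)" .
      qed auto
      also have "\<dots> = 4 * (ennreal (B\<^sup>2) * (\<integral>\<^sup>+\<omega>. ennreal (qvar t t' \<omega>) \<partial>M))"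
        using qvar_measurable[OF t(1)] by (subst nn_integral_cmult) auto
      also have "\<dots> \<le> 4 * (ennreal (B\<^sup>2) * ennreal (C1 * (t' - t)\<^sup>2))"
        by (intro mult_left_mono qv t) auto
      also have "\<dots> = ennreal (4 * (B\<^sup>2 * C1 * (t' - t)\<^sup>2))"
        using C1 by (simp add: ennreal_mult mult.assoc)
      finally have N: "(\<integral>\<^sup>+\<omega>. ennreal ((I' \<omega> - I \<omega> - s (Y t \<omega>) * dW t t' \<omega>)\<^sup>2) \<partial>M) \<le> ennreal (4 * (B\<^sup>2 * C1 * (t' - t)\<^sup>2))" .
      have "AE \<omega> in M. Y t' \<omega> - Y t \<omega> - s (Y t \<omega>) * dW t t' \<omega> = (I' \<omega> - I \<omega> - s (Y t \<omega>) * dW t t' \<omega>) + path b t t' \<omega>"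
        using ae by eventually_elim simp
      from add_drift[OF t(1,2) this _ N]
      have "(\<integral>\<^sup>+\<omega>. ennreal ((Y t' \<omega> - Y t \<omega> - s (Y t \<omega>) * dW t t' \<omega>)\<^sup>2) \<partial>M)
          \<le> ennreal (2 * (4 * (B\<^sup>2 * C1 * (t' - t)\<^sup>2)) + 2 * (B * (t' - t))\<^sup>2)"
        using C1 by auto
      also have "\<dots> \<le> ennreal (C * (t' - t)\<^sup>2)"
        using C1 unfolding C_def power_mult_distrib by (intro ennreal_leI) (simp add: distrib_right)
      finally show ?thesis .
    qed
    fix Z c
    assume Z: "Z \<in> borel_measurable (F t)" "\<And>\<omega>. \<omega> \<in> space M \<Longrightarrow> \<bar>Z \<omega>\<bar> \<le> (c::real)"
    have dYsq: "integrable M (\<lambda>\<omega>. (Y t' \<omega> - Y t \<omega>)\<^sup>2)"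
      by (rule expectation_le_nn(1)[OF _ _ dY[OF t]]) (use C1 t in auto)
    have dYi: "integrable M (\<lambda>\<omega>. Y t' \<omega> - Y t \<omega>)"
      using square_integrable_mult[of "\<lambda>_. 1" "\<lambda>\<omega>. Y t' \<omega> - Y t \<omega>"] dYsq by simp
    have pi: "integrable M (path b t t')"
      by (rule bounded_integrable[of _ "B * (t' - t)"]) (use pb t in auto)
    have int: "integrable M (\<lambda>\<omega>. Y t' \<omega> - Y t \<omega> - path b t t' \<omega>)"
      using dYi pi by auto
    have ae': "AE \<omega> in M. I' \<omega> - I \<omega> = Y t' \<omega> - Y t \<omega> - path b t t' \<omega>"
      using ae by eventually_elim simp
    have intI: "integrable M (\<lambda>\<omega>. I' \<omega> - I \<omega>)"
      by (rule integrable_cong_AE[THEN iffD2, OF _ _ ae' int]) auto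
    have "expectation (\<lambda>\<omega>. Z \<omega> * (I' \<omega> - I \<omega>)) = 0"
      by (rule ito_increment(2)[OF I I' t(1,2) s_joint Z(1)]) (use Z(2) intI in auto)
    moreover have "expectation (\<lambda>\<omega>. Z \<omega> * (I' \<omega> - I \<omega>)) = expectation (\<lambda>\<omega>. Z \<omega> * (Y t' \<omega> - Y t \<omega> - path b t t' \<omega>))"
    proof (rule integral_cong_AE)
      show "AE \<omega> in M. Z \<omega> * (I' \<omega> - I \<omega>) = Z \<omega> * (Y t' \<omega> - Y t \<omega> - path b t t' \<omega>)"
        using ae' by eventually_elim simp
    qed (use F_measurable[OF Z(1)] in auto)
    moreover have "integrable M (\<lambda>\<omega>. Z \<omega> * (Y t' \<omega> - Y t \<omega> - path b t t' \<omega>))"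
      by (rule bounded_mult_integrable[OF F_measurable[OF Z(1)] Z(2) int])
    ultimately show "has_bochner_integral M (\<lambda>\<omega>. Z \<omega> * (Y t' \<omega> - Y t \<omega> - path b t t' \<omega>)) 0"
      by (simp add: has_bochner_integral_iff)
  qed
qed

end


context circle_sde
begin

text \<open>Testing against weights \<open>Z\<close> known at time \<open>t\<close> takes the place
  of a conditional expectation. The centred part of the increment drops out, and
  \<open>step_error\<close> bounds the rest.\<close>

lemma one_step:
  assumes U: "C2 U U1 U2" and k: "periodic k" "continuous_on UNIV k"
    and eq: "\<And>x. (s x)\<^sup>2 / 2 * U2 x + b x * U1 x + k x * U x = 0" and "\<theta> > 0"
  obtains K where "K \<ge> 0" "\<And>t t' Z. 0 \<le> t \<Longrightarrow> t < t' \<Longrightarrow> t' - t \<le> 1 \<Longrightarrow> Z \<in> borel_measurable (F t) \<Longrightarrow>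
    (\<And>\<omega>. \<omega> \<in> space M \<Longrightarrow> \<bar>Z \<omega>\<bar> \<le> 1) \<Longrightarrow>
    \<bar>expectation (\<lambda>\<omega>. Z \<omega> * (U (Y t' \<omega>) * exp (path k t t' \<omega>) - U (Y t \<omega>)))\<bar>
      \<le> \<theta> * (t' - t) + K * ((t' - t) * sqrt (t' - t))"
proof (rule increment_moments, goal_cases)
  case (1 C)
  note C = 1(2) and \<rho>2 = 1(3) and q2 = 1(4) and mean = 1(5)
  note s' = C2D[OF s] and U' = C2D[OF U]
  obtain B0 where B0: "B0 > 0" "\<And>x. norm (U x) \<le> B0" by (rule periodic_bounded[OF U'(1,6)], rule that)
  obtain B1 where B1: "B1 > 0" "\<And>x. norm (U1 x) \<le> B1" by (rule periodic_bounded[OF U'(2,7)], rule that)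
  obtain B2 where B2: "B2 > 0" "\<And>x. norm (U2 x) \<le> B2" by (rule periodic_bounded[OF U'(3,8)], rule that)
  obtain B3 where B3: "B3 > 0" "\<And>x. norm (s x) \<le> B3" by (rule periodic_bounded[OF s'(1,6)], rule that)
  obtain B4 where B4: "B4 > 0" "\<And>x. norm (k x) \<le> B4" by (rule periodic_bounded[OF k], rule that)
  define B where "B = 1 + B0 + B1 + B2 + B3 + B4"
  have B: "B \<ge> 1" "\<bar>U x\<bar> \<le> B" "\<bar>U1 x\<bar> \<le> B" "\<bar>U2 x\<bar> \<le> B" "\<bar>s x\<bar> \<le> B" "\<bar>k x\<bar> \<le> B" for x
    using B0(1) B1(1) B2(1) B3(1) B4(1) B0(2)[of x] B1(2)[of x] B2(2)[of x] B3(2)[of x] B4(2)[of x]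
    by (auto simp: B_def)
  \<comment> \<open>The \<eta>-part of the error has expectation
    \<open>\<eta> * (B\<^sup>2 + 2 * B) * h\<close>, which this choice makes equal to
    \<open>\<theta> * h\<close>.\<close>
  define \<eta> where "\<eta> = \<theta> / (B\<^sup>2 + 2 * B)"
  have BB: "B\<^sup>2 + 2 * B > 0"
    using B(1) by (auto intro: add_nonneg_pos)
  then have \<eta>: "\<eta> > 0"
    using \<open>\<theta> > 0\<close> by (simp add: \<eta>_def)
  obtain K1 where K1: "K1 \<ge> 0" "\<And>x y. \<bar>U2 x - U2 y\<bar> \<le> \<eta> + K1 * \<bar>x - y\<bar>"
    by (rule periodic_modulus[OF U'(3,8) \<eta>], rule that)
  obtain K2 where K2: "K2 \<ge> 0" "\<And>x y. \<bar>b x - b y\<bar> \<le> \<eta> + K2 * \<bar>x - y\<bar>"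
    by (rule periodic_modulus[OF b \<eta>], rule that)
  obtain K3 where K3: "K3 \<ge> 0" "\<And>x y. \<bar>k x - k y\<bar> \<le> \<eta> + K3 * \<bar>x - y\<bar>"
    by (rule periodic_modulus[OF k \<eta>], rule that)
  define K where "K = K1 + K2 + K3"
  have K: "K \<ge> 0"
    using K1 K2 K3 by (simp add: K_def)
  have mod: "\<bar>f x - f y\<bar> \<le> \<eta> + K * \<bar>x - y\<bar>" if "\<bar>f x - f y\<bar> \<le> \<eta> + k' * \<bar>x - y\<bar>" "k' \<le> K" for f :: "real \<Rightarrow> real" and x y k'
    using that(1) mult_right_mono[OF that(2), of "\<bar>x - y\<bar>"] by simp
  have mU: "\<bar>U2 x - U2 y\<bar> \<le> \<eta> + K * \<bar>x - y\<bar>" and mb: "\<bar>b x - b y\<bar> \<le> \<eta> + K * \<bar>x - y\<bar>" and mk: "\<bar>k x - k y\<bar> \<le> \<eta> + K * \<bar>x - y\<bar>" for x y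
    using mod[OF K1(2)[of x y]] mod[OF K2(2)[of x y]] mod[OF K3(2)[of x y]] K1(1) K2(1) K3(1) by (simp_all add: K_def)
  define L where "L = (B\<^sup>2 * K * (B + 1) + 3 * B + B\<^sup>2) + 2 * B * K + exp B * B ^ 3 + B ^ 3 + B\<^sup>2"
  have L: "L \<ge> 0"
    using B(1) K by (auto simp: L_def intro!: add_nonneg_nonneg mult_nonneg_nonneg)
  \<comment> \<open>In the constant, 5 counts \<open>h * r\<close>, \<open>r * h\<close> and the
    fourth moment \<open>3 * h\<^sup>2 / r\<close>; \<open>2 * C\<close> counts the remainder and
    the squared displacement.\<close>
  show ?thesis
  proof (rule that[of "L * (5 + 2 * C)"])
    show "L * (5 + 2 * C) \<ge> 0"
      using L C by simp
    fix t t' :: real and Z :: "'w \<Rightarrow> real"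
    assume t: "0 \<le> t" "t < t'" "t' - t \<le> 1" and Z: "Z \<in> borel_measurable (F t)" "\<And>\<omega>. \<omega> \<in> space M \<Longrightarrow> \<bar>Z \<omega>\<bar> \<le> 1"
    have t1: "t \<le> t'" "t' \<le> t + 1" "0 \<le> t'"
      using t by auto
    define h where "h = t' - t"
    define r where "r = sqrt h"
    have h: "0 < h" "h \<le> 1" and r: "0 < r" "r \<le> 1" "h = r\<^sup>2"
      using t by (auto simp: h_def r_def)
    define d where "d = dW t t'"
    define \<rho> where "\<rho> \<omega> = Y t' \<omega> - Y t \<omega> - s (Y t \<omega>) * d \<omega>" for \<omega>
    define V where "V \<omega> = U (Y t' \<omega>) * exp (path k t t' \<omega>) - U (Y t \<omega>)" for \<omega>
    \<comment> \<open>The part that is centred given the past: the increment without its drift, and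
      \<open>d\<^sup>2 - h\<close>, each with a coefficient known at time \<open>t\<close>.\<close>
    define P where "P \<omega> = U1 (Y t \<omega>) * (s (Y t \<omega>) * d \<omega> + \<rho> \<omega> - path b t t' \<omega>) + U2 (Y t \<omega>) / 2 * (s (Y t \<omega>))\<^sup>2 * ((d \<omega>)\<^sup>2 - h)" for \<omega>
    define E where "E \<omega> = \<eta> * (B\<^sup>2 * (d \<omega>)\<^sup>2 + 2 * B * h) + L * (h * r + r * (d \<omega>)\<^sup>2 + d \<omega> ^ 4 / r + (\<rho> \<omega>)\<^sup>2 / r + qvar t t' \<omega> / r)" for \<omega>
    have fM: "(\<lambda>\<omega>. f (Y u \<omega>)) \<in> borel_measurable M" if "continuous_on UNIV f" "0 \<le> u" for f :: "real \<Rightarrow> real" and u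
      by (rule F_measurable[OF f_Y_measurable[OF that order_refl]])
    have [measurable]: "Y t \<in> borel_measurable M" "Y t' \<in> borel_measurable M" "d \<in> borel_measurable M" "Z \<in> borel_measurable M"
      "path k t t' \<in> borel_measurable M" "path b t t' \<in> borel_measurable M"
      using Y_M t t1 dW_measurable[OF t(1) t1(1)] F_measurable[OF Z(1)] F_measurable[OF path_measurable[OF k(2) t(1) t1(1)]]
        F_measurable[OF path_measurable[OF b(2) t(1) t1(1)]] by (auto simp: d_def)
    have [measurable]: "(\<lambda>\<omega>. U (Y t \<omega>)) \<in> borel_measurable M" "(\<lambda>\<omega>. U (Y t' \<omega>)) \<in> borel_measurable M" "(\<lambda>\<omega>. s (Y t \<omega>)) \<in> borel_measurable M"
      using fM[OF U'(6) t(1)] fM[OF U'(6) t1(3)] fM[OF s'(6) t(1)] by auto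
    have [measurable]: "\<rho> \<in> borel_measurable M" "V \<in> borel_measurable M"
      unfolding \<rho>_def[abs_def] V_def[abs_def] by measurable
    note \<rho>E = expectation_le_nn[OF _ _ \<rho>2[OF t(1) t1(1,2), folded d_def, folded \<rho>_def h_def]]
    have \<rho>i: "integrable M (\<lambda>\<omega>. (\<rho> \<omega>)\<^sup>2)" "expectation (\<lambda>\<omega>. (\<rho> \<omega>)\<^sup>2) \<le> C * h\<^sup>2"
      by (rule \<rho>E; use C in auto)+
    note qE = expectation_le_nn[OF qvar_measurable[OF t(1)] qvar_nonneg[OF _ t(1)] q2[OF t(1) t1(1,2), folded h_def]]
    have qi: "integrable M (qvar t t')" "expectation (qvar t t') \<le> C * h\<^sup>2"
      using qE C by auto
    note dm = dW_moment[OF t(1) t1(1), folded d_def h_def]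
    have Ei: "integrable M E"
      unfolding E_def[abs_def] using \<rho>i qi dm(1)[of 2] dm(1)[of 4] by auto
    have "expectation E = \<eta> * (B\<^sup>2 * h + 2 * B * h) + L * (h * r + r * h + 3 * h\<^sup>2 / r + expectation (\<lambda>\<omega>. (\<rho> \<omega>)\<^sup>2) / r + expectation (qvar t t') / r)"
      unfolding E_def[abs_def] using \<rho>i qi dm(1)[of 2] dm(1)[of 4] dm(3,4) by (simp add: prob_space)
    also have "\<dots> \<le> \<theta> * h + L * (5 + 2 * C) * (h * r)"
    proof (rule add_mono)
      have "\<eta> * (B\<^sup>2 * h + 2 * B * h) = (\<eta> * (B\<^sup>2 + 2 * B)) * h"
        by (simp add: algebra_simps)
      then show "\<eta> * (B\<^sup>2 * h + 2 * B * h) \<le> \<theta> * h"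
        using BB by (simp add: \<eta>_def)
      have hr: "h\<^sup>2 / r = h * r"
        using r by (simp add: power2_eq_square)
      have "x / r \<le> C * (h * r)" if "x \<le> C * h\<^sup>2" for x
        using divide_right_mono[OF that, of r] r(1) unfolding hr[symmetric] by simp
      from this[OF \<rho>i(2)] this[OF qi(2)]
      have "h * r + r * h + 3 * h\<^sup>2 / r + expectation (\<lambda>\<omega>. (\<rho> \<omega>)\<^sup>2) / r + expectation (qvar t t') / r \<le> (5 + 2 * C) * (h * r)"
        using hr by (simp add: algebra_simps)
      then show "L * (h * r + r * h + 3 * h\<^sup>2 / r + expectation (\<lambda>\<omega>. (\<rho> \<omega>)\<^sup>2) / r + expectation (qvar t t') / r) \<le> L * (5 + 2 * C) * (h * r)"
        unfolding mult.assoc using L by (intro mult_left_mono)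
    qed
    finally have EE: "expectation E \<le> \<theta> * h + L * (5 + 2 * C) * (h * r)" .
    have err: "\<bar>V \<omega> - P \<omega>\<bar> \<le> E \<omega>" if \<omega>: "\<omega> \<in> space M" for \<omega>
    proof -
      have "Y t \<omega> + (s (Y t \<omega>) * d \<omega> + \<rho> \<omega>) = Y t' \<omega>"
        by (simp add: \<rho>_def)
      then have "V \<omega> - P \<omega> = (U (Y t \<omega> + (s (Y t \<omega>) * d \<omega> + \<rho> \<omega>)) * exp (path k t t' \<omega>) - U (Y t \<omega>))
        - (U1 (Y t \<omega>) * (s (Y t \<omega>) * d \<omega> + \<rho> \<omega> - path b t t' \<omega>) + U2 (Y t \<omega>) / 2 * (s (Y t \<omega>))\<^sup>2 * ((d \<omega>)\<^sup>2 - h))"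
        by (simp add: V_def P_def)
      also have "\<bar>\<dots>\<bar> \<le> E \<omega>"
        unfolding E_def L_def
      proof (rule step_error[OF U'(4,5)])
        show "\<bar>path b t t' \<omega> - h * b (Y t \<omega>)\<bar> \<le> h * \<eta> + K * (h * r + qvar t t' \<omega> / r)"
          unfolding h_def by (rule path_oscillation[OF b(2) mb K \<omega> t(1) t1(1) r(1)])
        show "\<bar>path k t t' \<omega> - h * k (Y t \<omega>)\<bar> \<le> h * \<eta> + K * (h * r + qvar t t' \<omega> / r)"
          unfolding h_def by (rule path_oscillation[OF k(2) mk K \<omega> t(1) t1(1) r(1)])
        show "\<bar>path k t t' \<omega>\<bar> \<le> B * h"
          unfolding h_def by (rule path_bound[OF k(2) \<omega> t(1) t1(1) B(6)])
        show "(s (Y t \<omega>))\<^sup>2 / 2 * U2 (Y t \<omega>) + b (Y t \<omega>) * U1 (Y t \<omega>) + k (Y t \<omega>) * U (Y t \<omega>) = 0"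
          by (rule eq)
      qed (use B mU r K \<eta> qvar_nonneg[OF \<omega> t(1)] in auto)
      finally show ?thesis .
    qed
    have P: "has_bochner_integral M (\<lambda>\<omega>. Z \<omega> * P \<omega>) 0"
    proof -
      have Z1: "(\<lambda>\<omega>. Z \<omega> * U1 (Y t \<omega>)) \<in> borel_measurable (F t)"
        by (intro borel_measurable_times Z(1) f_Y_measurable[OF U'(7) t(1) order_refl])
      have Z1b: "\<bar>Z \<omega> * U1 (Y t \<omega>)\<bar> \<le> 1 * B" if "\<omega> \<in> space M" for \<omega>
        unfolding abs_mult using Z(2)[OF that] B(3) by (intro mult_mono) auto
      have "has_bochner_integral M (\<lambda>\<omega>. (Z \<omega> * U1 (Y t \<omega>)) * (Y t' \<omega> - Y t \<omega> - path b t t' \<omega>)) 0"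
        by (rule mean[OF t(1) t1(1,2) Z1 Z1b])
      moreover define G where "G \<omega> = Z \<omega> * (U2 (Y t \<omega>) / 2 * (s (Y t \<omega>))\<^sup>2)" for \<omega>
      have G: "G \<in> borel_measurable (F t)"
        unfolding G_def[abs_def]
        by (intro borel_measurable_times borel_measurable_divide borel_measurable_power borel_measurable_const Z(1)
            f_Y_measurable[OF U'(8) t(1) order_refl] f_Y_measurable[OF s'(6) t(1) order_refl])
      have "\<bar>G \<omega>\<bar> \<le> 1 * (B / 2 * B\<^sup>2)" if "\<omega> \<in> space M" for \<omega>
      proof -
        have "\<bar>(s (Y t \<omega>))\<^sup>2\<bar> \<le> B\<^sup>2"
          using B(1) B(5)[of "Y t \<omega>"] by (simp add: abs_le_square_iff[symmetric])
        then show ?thesis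
          unfolding G_def abs_mult using Z(2)[OF that] B(1) B(4)[of "Y t \<omega>"] by (intro mult_mono) auto
      qed
      then have Gi: "integrable M G"
        by (intro bounded_integrable[OF F_measurable[OF G]])
      have "has_bochner_integral M (\<lambda>\<omega>. G \<omega> * ((d \<omega>)\<^sup>2 - h)) 0"
      proof -
        have 1: "integrable M (\<lambda>\<omega>. G \<omega> * (d \<omega>)\<^sup>2)" "expectation (\<lambda>\<omega>. G \<omega> * (d \<omega>)\<^sup>2) = expectation G * h"
          using dW_indep[OF t(1) t1(1) G Gi, of 2, folded d_def] dm(3) by auto
        have "(\<lambda>\<omega>. G \<omega> * ((d \<omega>)\<^sup>2 - h)) = (\<lambda>\<omega>. G \<omega> * (d \<omega>)\<^sup>2 - G \<omega> * h)"
          by (simp add: algebra_simps)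
        then show ?thesis
          using 1 Gi by (simp add: has_bochner_integral_iff)
      qed
      ultimately have "has_bochner_integral M (\<lambda>\<omega>. (Z \<omega> * U1 (Y t \<omega>)) * (Y t' \<omega> - Y t \<omega> - path b t t' \<omega>) + G \<omega> * ((d \<omega>)\<^sup>2 - h)) (0 + 0)"
        by (intro has_bochner_integral_add)
      moreover have "(Z \<omega> * U1 (Y t \<omega>)) * (Y t' \<omega> - Y t \<omega> - path b t t' \<omega>) + G \<omega> * ((d \<omega>)\<^sup>2 - h) = Z \<omega> * P \<omega>" for \<omega>
        by (simp add: P_def G_def \<rho>_def algebra_simps)
      ultimately show ?thesis
        by simp
    qed
    have "\<bar>V \<omega>\<bar> \<le> B * exp (B * h) + B" if \<omega>: "\<omega> \<in> space M" for \<omega>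
    proof -
      have "\<bar>U (Y t' \<omega>) * exp (path k t t' \<omega>)\<bar> \<le> B * exp (B * h)"
        unfolding abs_mult using B(1,2) path_bound[OF k(2) \<omega> t(1) t1(1) B(6)]
        by (intro mult_mono) (auto simp: h_def abs_le_iff)
      then show ?thesis
        using B(2)[of "Y t \<omega>"] unfolding V_def by linarith
    qed
    then have Vi: "integrable M V"
      by (intro bounded_integrable) auto
    have ZV: "integrable M (\<lambda>\<omega>. Z \<omega> * V \<omega>)"
      by (rule bounded_mult_integrable[of _ 1]) (use Z Vi in auto)
    have "expectation (\<lambda>\<omega>. Z \<omega> * V \<omega>) = expectation (\<lambda>\<omega>. Z \<omega> * V \<omega> - Z \<omega> * P \<omega>)"
      using P ZV by (simp add: has_bochner_integral_iff)
    also have "\<bar>\<dots>\<bar> \<le> expectation E"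
    proof (rule abs_integral_le_AE)
      show "integrable M (\<lambda>\<omega>. Z \<omega> * V \<omega> - Z \<omega> * P \<omega>)"
        using P ZV by (auto simp: has_bochner_integral_iff)
      show "AE \<omega> in M. \<bar>Z \<omega> * V \<omega> - Z \<omega> * P \<omega>\<bar> \<le> E \<omega>"
      proof (rule AE_I2)
        fix \<omega>
        assume \<omega>: "\<omega> \<in> space M"
        have "\<bar>Z \<omega>\<bar> * \<bar>V \<omega> - P \<omega>\<bar> \<le> 1 * E \<omega>"
          using Z(2)[OF \<omega>] err[OF \<omega>] by (intro mult_mono) auto
        then show "\<bar>Z \<omega> * V \<omega> - Z \<omega> * P \<omega>\<bar> \<le> E \<omega>"
          by (simp add: abs_mult[symmetric] right_diff_distrib)
      qed
    qed (rule Ei)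
    finally show "\<bar>expectation (\<lambda>\<omega>. Z \<omega> * (U (Y t' \<omega>) * exp (path k t t' \<omega>) - U (Y t \<omega>)))\<bar>
      \<le> \<theta> * (t' - t) + L * (5 + 2 * C) * ((t' - t) * sqrt (t' - t))"
      using EE by (simp add: V_def r_def h_def)
  qed
qed

text \<open>As a function of the final time the expectation has increments controlled by
  \<open>one_step\<close>, the weight being the indicator of \<open>A\<close> times the exponential
  accumulated so far, scaled to be at most 1. So it is constant, and at time \<open>u\<close> the
  exponent is zero.\<close>

lemma exponential_martingale:
  assumes U: "C2 U U1 U2" and k: "periodic k" "continuous_on UNIV k"
    and eq: "\<And>x. (s x)\<^sup>2 / 2 * U2 x + b x * U1 x + k x * U x = 0"
    and t: "0 \<le> u" "u \<le> v" and A: "A \<in> sets (F u)"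
  shows "expectation (\<lambda>\<omega>. indicator A \<omega> * (exp (path k u v \<omega>) * U (Y v \<omega>))) = expectation (\<lambda>\<omega>. indicator A \<omega> * U (Y u \<omega>))"
proof -
  obtain B where B: "B > 0" "\<And>x. norm (k x) \<le> B"
    by (rule periodic_bounded[OF k], rule that)
  obtain B' where B': "B' > 0" "\<And>x. norm (U x) \<le> B'"
    by (rule periodic_bounded[OF C2D(1,6)[OF U]], rule that)
  have [measurable]: "A \<in> sets M"
    using A F_subalgebra by blast
  define D where "D t = expectation (\<lambda>\<omega>. indicator A \<omega> * (exp (path k u t \<omega>) * U (Y t \<omega>)))" for t
  define c where "c = exp (B * (v - u))"
  have c: "c > 0"
    by (simp add: c_def)
  have pk: "\<bar>exp (path k u t \<omega>)\<bar> \<le> c" if "u \<le> t" "t \<le> v" "\<omega> \<in> space M" for t \<omega>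
  proof -
    have "\<bar>path k u t \<omega>\<bar> \<le> B * (t - u)"
      by (rule path_bound[OF k(2) that(3) t(1) that(1)]) (use B(2) in simp)
    also have "\<dots> \<le> B * (v - u)"
      using that B(1) by simp
    finally show ?thesis
      by (simp add: c_def abs_le_iff)
  qed
  define Z0 where "Z0 t \<omega> = indicator A \<omega> * exp (path k u t \<omega>)" for t \<omega>
  have Z0: "Z0 t \<in> borel_measurable (F t)" if "u \<le> t" for t
  proof -
    have "A \<in> sets (F t)"
      using A sets_F_mono[OF that] by blast
    then have "(indicator A :: 'w \<Rightarrow> real) \<in> borel_measurable (F t)"
      by (rule borel_measurable_indicator)
    then show ?thesis
      unfolding Z0_def[abs_def] using path_measurable[OF k(2) t(1) that]
      by (intro borel_measurable_times measurable_compose[OF _ borel_measurable_exp])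
  qed
  have Z0b: "\<bar>Z0 t \<omega>\<bar> \<le> c" if "u \<le> t" "t \<le> v" "\<omega> \<in> space M" for t \<omega>
    using pk[OF that] c by (auto simp: Z0_def indicator_def)
  have Di: "integrable M (\<lambda>\<omega>. Z0 t \<omega> * U (Y t' \<omega>))" if "u \<le> t" "t \<le> v" "0 \<le> t'" for t t'
    by (rule bounded_mult_integrable[OF F_measurable[OF Z0] Z0b bounded_integrable])
      (use that B'(2) F_measurable[OF f_Y_measurable[OF C2D(6)[OF U]]] in auto)
  have "D v = D u"
  proof (rule constant_if_superlinear_modulus[OF _ t(2)])
    fix \<eta> :: real
    assume "\<eta> > 0"
    then have \<eta>c: "\<eta> / c > 0"
      using c by simp
    show "\<exists>K\<ge>0. \<forall>t t'. u \<le> t \<longrightarrow> t < t' \<longrightarrow> t' \<le> v \<longrightarrow> t' - t \<le> 1 \<longrightarrow>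
      \<bar>D t' - D t\<bar> \<le> \<eta> * (t' - t) + K * ((t' - t) * sqrt (t' - t))"
    proof (rule one_step[OF U k eq \<eta>c], goal_cases)
      case (1 K)
      note K = 1
      show ?case
    proof (intro exI[of _ "c * K"] conjI allI impI)
      show "0 \<le> c * K"
        using c K by simp
      fix t1 t2
      assume t12: "u \<le> t1" "t1 < t2" "t2 \<le> v" "t2 - t1 \<le> 1"
      have t0: "0 \<le> t1" "0 \<le> t2"
        using t12 t by auto
      define Z where "Z \<omega> = Z0 t1 \<omega> / c" for \<omega>
      have Z: "Z \<in> borel_measurable (F t1)" "\<And>\<omega>. \<omega> \<in> space M \<Longrightarrow> \<bar>Z \<omega>\<bar> \<le> 1"
        unfolding Z_def[abs_def] using Z0[OF t12(1)] Z0b[OF t12(1)] t12 c by auto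
      have eqD: "indicator A \<omega> * (exp (path k u t2 \<omega>) * U (Y t2 \<omega>)) - indicator A \<omega> * (exp (path k u t1 \<omega>) * U (Y t1 \<omega>))
          = c * (Z \<omega> * (U (Y t2 \<omega>) * exp (path k t1 t2 \<omega>) - U (Y t1 \<omega>)))" if "\<omega> \<in> space M" for \<omega>
      proof -
        have "path k u t2 \<omega> = path k u t1 \<omega> + path k t1 t2 \<omega>"
          by (rule path_combine[OF k(2) that t(1)]) (use t12 in auto)
        then show ?thesis
          using c by (simp add: Z_def Z0_def exp_add algebra_simps)
      qed
      have "integrable M (\<lambda>\<omega>. indicator A \<omega> * (exp (path k u t2 \<omega>) * U (Y t2 \<omega>)))"
        "integrable M (\<lambda>\<omega>. indicator A \<omega> * (exp (path k u t1 \<omega>) * U (Y t1 \<omega>)))"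
        using Di[of t2 t2] Di[of t1 t1] t12 t0 by (auto simp: Z0_def mult.assoc)
      then have "D t2 - D t1 = expectation (\<lambda>\<omega>. indicator A \<omega> * (exp (path k u t2 \<omega>) * U (Y t2 \<omega>))
          - indicator A \<omega> * (exp (path k u t1 \<omega>) * U (Y t1 \<omega>)))"
        unfolding D_def by (rule Bochner_Integration.integral_diff[symmetric])
      also have "\<dots> = expectation (\<lambda>\<omega>. c * (Z \<omega> * (U (Y t2 \<omega>) * exp (path k t1 t2 \<omega>) - U (Y t1 \<omega>))))"
        by (rule Bochner_Integration.integral_cong[OF refl eqD])
      also have "\<dots> = c * expectation (\<lambda>\<omega>. Z \<omega> * (U (Y t2 \<omega>) * exp (path k t1 t2 \<omega>) - U (Y t1 \<omega>)))"
        by simp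
      finally have "\<bar>D t2 - D t1\<bar> = c * \<bar>expectation (\<lambda>\<omega>. Z \<omega> * (U (Y t2 \<omega>) * exp (path k t1 t2 \<omega>) - U (Y t1 \<omega>)))\<bar>"
        using c by (simp add: abs_mult)
      also have "\<dots> \<le> c * (\<eta> / c * (t2 - t1) + K * ((t2 - t1) * sqrt (t2 - t1)))"
        using c by (intro mult_left_mono K(2)[OF t0(1) t12(2,4) Z]) auto
      also have "\<dots> = \<eta> * (t2 - t1) + c * K * ((t2 - t1) * sqrt (t2 - t1))"
        using c by (simp add: distrib_left)
      finally show "\<bar>D t2 - D t1\<bar> \<le> \<eta> * (t2 - t1) + c * K * ((t2 - t1) * sqrt (t2 - t1))" .
      qed
    qed
  qed
  then show ?thesis
    by (simp add: D_def path_def)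
qed

end


section \<open>Exponential moments of occupation integrals\<close>

locale small_noise = circle_field \<sigma> b a + brownian_motion M F W
  for \<sigma> b a :: "circle \<Rightarrow> real" and M :: "'w measure" and F W +
  fixes X :: "real \<Rightarrow> real \<Rightarrow> 'w \<Rightarrow> circle" and x :: circle
  assumes diffusion: "\<And>\<epsilon>. \<epsilon> > 0 \<Longrightarrow> circle_diffusion M F W (\<lambda>p. sqrt \<epsilon> * \<sigma> p) b x (X \<epsilon>)"
begin

text \<open>Expressed through \<open>X\<close>, since a lift to the line is chosen afresh for each
  noise level.\<close>

definition occ :: "real \<Rightarrow> (circle \<Rightarrow> real) \<Rightarrow> real \<Rightarrow> real \<Rightarrow> 'w \<Rightarrow> real"
  where "occ \<epsilon> c s t \<omega> = integral {s..t} (\<lambda>r. c (X \<epsilon> r \<omega>))"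

lemma lifted_sde:
  assumes "\<epsilon> > 0"
  obtains Y where "circle_sde M F W (\<lambda>x. sqrt \<epsilon> * \<sigma> (to_circle x)) (\<lambda>x. sqrt \<epsilon> * circle_deriv \<sigma> (to_circle x))
      (\<lambda>x. sqrt \<epsilon> * circle_deriv (circle_deriv \<sigma>) (to_circle x)) (\<lambda>x. b (to_circle x)) Y"
    and "\<And>t \<omega>. t \<ge> 0 \<Longrightarrow> \<omega> \<in> space M \<Longrightarrow> X \<epsilon> t \<omega> = to_circle (Y t \<omega>)"
proof -
  obtain Y where Y: "\<forall>t\<ge>0. Y t \<in> borel_measurable (F t)"
      "\<forall>\<omega>\<in>space M. continuous_on {0..} (\<lambda>t. Y t \<omega>)"
      "\<forall>t\<ge>0. \<forall>\<omega>\<in>space M. X \<epsilon> t \<omega> = to_circle (Y t \<omega>)"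
      "\<forall>t\<ge>0. \<exists>I. has_ito_integral M F W (\<lambda>s \<omega>. sqrt \<epsilon> * \<sigma> (to_circle (Y s \<omega>))) t I \<and>
        (AE \<omega> in M. Y t \<omega> = Y 0 \<omega> + I \<omega> + integral {0..t} (\<lambda>s. b (to_circle (Y s \<omega>))))"
    using diffusion[OF assms] unfolding circle_diffusion_def by (elim conjE exE)
  show ?thesis
  proof (rule that)
    show "circle_sde M F W (\<lambda>x. sqrt \<epsilon> * \<sigma> (to_circle x)) (\<lambda>x. sqrt \<epsilon> * circle_deriv \<sigma> (to_circle x))
      (\<lambda>x. sqrt \<epsilon> * circle_deriv (circle_deriv \<sigma>) (to_circle x)) (\<lambda>x. b (to_circle x)) Y"
    proof
      show "C2 (\<lambda>x. sqrt \<epsilon> * \<sigma> (to_circle x)) (\<lambda>x. sqrt \<epsilon> * circle_deriv \<sigma> (to_circle x))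
        (\<lambda>x. sqrt \<epsilon> * circle_deriv (circle_deriv \<sigma>) (to_circle x))"
        by (rule C2_cmult[OF C_on_2_C2[OF C2_\<sigma>]])
    qed (use Y in \<open>auto intro: periodic_lift continuous_lift[OF continuous_b]\<close>)
  qed (use Y(3) in auto)
qed

lemma path_eq_occ:
  assumes "circle_sde M F W s s1 s2 b' Y" "\<And>t \<omega>. t \<ge> 0 \<Longrightarrow> \<omega> \<in> space M \<Longrightarrow> X \<epsilon> t \<omega> = to_circle (Y t \<omega>)"
    "0 \<le> u" "\<omega> \<in> space M"
  shows "circle_sde.path Y (\<lambda>x. c (to_circle x)) u v \<omega> = occ \<epsilon> c u v \<omega>"
  unfolding circle_sde.path_def[OF assms(1)] occ_def
  by (rule Henstock_Kurzweil_Integration.integral_cong) (use assms in auto)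

lemma X_continuous:
  assumes "\<epsilon> > 0" "\<omega> \<in> space M"
  shows "continuous_on {0..} (\<lambda>t. X \<epsilon> t \<omega>)"
proof (rule lifted_sde[OF assms(1)], goal_cases)
  case (1 Y)
  have "continuous_on {0..} (\<lambda>t. to_circle (Y t \<omega>))"
    by (rule continuous_on_compose2[OF continuous_to_circle circle_sde.Y_cont[OF 1(1) assms(2)]]) simp
  then show ?case
    by (rule continuous_on_eq) (use 1(2) assms(2) in auto)
qed

lemma c_X_continuous:
  assumes "continuous_on UNIV c" "\<epsilon> > 0" "\<omega> \<in> space M"
  shows "continuous_on {0..} (\<lambda>t. c (X \<epsilon> t \<omega>))"
  by (rule continuous_on_compose2[OF assms(1) X_continuous[OF assms(2,3)]]) simp

lemma c_X_integrable:
  fixes c :: "circle \<Rightarrow> real"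
  assumes "continuous_on UNIV c" "\<epsilon> > 0" "\<omega> \<in> space M" "0 \<le> s"
  shows "(\<lambda>t. c (X \<epsilon> t \<omega>)) integrable_on {s..t}"
  using c_X_continuous[OF assms(1-3)] assms(4)
  by (intro integrable_continuous_real) (auto intro: continuous_on_subset)

lemma occ_measurable:
  assumes "continuous_on UNIV c" "\<epsilon> > 0" "0 \<le> s" "s \<le> t"
  shows "occ \<epsilon> c s t \<in> borel_measurable (F t)"
proof (rule lifted_sde[OF assms(2)], goal_cases)
  case (1 Y)
  have "circle_sde.path Y (\<lambda>x. c (to_circle x)) s t \<in> borel_measurable (F t)"
    by (rule circle_sde.path_measurable[OF 1(1) continuous_lift[OF assms(1)] assms(3,4)])
  then show ?case
    by (subst (asm) measurable_cong[where g = "occ \<epsilon> c s t"]) (use path_eq_occ[OF 1 assms(3)] space_F in auto)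
qed

lemma occ_combine:
  assumes "continuous_on UNIV c" "\<epsilon> > 0" "\<omega> \<in> space M" "0 \<le> s" "s \<le> t" "t \<le> u"
  shows "occ \<epsilon> c s u \<omega> = occ \<epsilon> c s t \<omega> + occ \<epsilon> c t u \<omega>"
  unfolding occ_def
  by (rule Henstock_Kurzweil_Integration.integral_combine[symmetric])
    (use assms c_X_integrable in auto)

lemma occ_mono:
  assumes "continuous_on UNIV c" "continuous_on UNIV d" "\<epsilon> > 0" "\<omega> \<in> space M" "0 \<le> s" "\<And>p. c p \<le> d p"
  shows "occ \<epsilon> c s t \<omega> \<le> occ \<epsilon> d s t \<omega>"
  unfolding occ_def by (intro integral_le c_X_integrable assms)

text \<open>Quantifying over events \<open>A\<close> of the past replaces conditional expectations.
  The constant \<kappa> may depend on the noise level, but one value serves all times, so it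
  disappears from the exponential rates.\<close>

definition exp_moments :: "real \<Rightarrow> (circle \<Rightarrow> real) \<Rightarrow> real \<Rightarrow> real \<Rightarrow> real \<Rightarrow> bool"
  where "exp_moments \<epsilon> c \<kappa> l h \<longleftrightarrow> \<kappa> > 0 \<and> (\<forall>s t. \<forall>A\<in>sets (F s). 0 \<le> s \<longrightarrow> s \<le> t \<longrightarrow>
    integrable M (\<lambda>\<omega>. indicator A \<omega> * exp (occ \<epsilon> c s t \<omega>)) \<and>
    expectation (\<lambda>\<omega>. indicator A \<omega> * exp (occ \<epsilon> c s t \<omega>))
      \<in> {\<kappa> * exp (l * (t - s)) * prob A..exp (h * (t - s)) * prob A / \<kappa>})"

lemma exp_momentsD:
  assumes "exp_moments \<epsilon> c \<kappa> l h" "0 \<le> s" "s \<le> t" "A \<in> sets (F s)"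
  shows "integrable M (\<lambda>\<omega>. indicator A \<omega> * exp (occ \<epsilon> c s t \<omega>))"
    and "\<kappa> * exp (l * (t - s)) * prob A \<le> expectation (\<lambda>\<omega>. indicator A \<omega> * exp (occ \<epsilon> c s t \<omega>))"
    and "expectation (\<lambda>\<omega>. indicator A \<omega> * exp (occ \<epsilon> c s t \<omega>)) \<le> exp (h * (t - s)) * prob A / \<kappa>"
  using assms by (auto simp: exp_moments_def)

text \<open>The martingale is taken with potential \<open>c - \<mu>\<close>. The eigenfunction lies
  between positive constants \<open>m\<close> and \<open>B\<close>, so removing it from the
  expectations costs only the factor \<open>m / B\<close>, whatever the times.\<close>

lemma tilted_expectation:
  assumes c: "continuous_on UNIV c" and "\<epsilon> > 0"
    and ep: "eigenpair (\<lambda>x. \<epsilon> * a (to_circle x)) (\<lambda>x. b (to_circle x)) (\<lambda>x. c (to_circle x)) \<mu> U"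
  shows "\<exists>\<kappa>. exp_moments \<epsilon> c \<kappa> \<mu> \<mu>"
proof (rule lifted_sde[OF \<open>\<epsilon> > 0\<close>], goal_cases)
  case (1 Y)
  note Y = 1(1) and X = 1(2)
  interpret circle_sde M F W "\<lambda>x. sqrt \<epsilon> * \<sigma> (to_circle x)" "\<lambda>x. sqrt \<epsilon> * circle_deriv \<sigma> (to_circle x)"
    "\<lambda>x. sqrt \<epsilon> * circle_deriv (circle_deriv \<sigma>) (to_circle x)" "\<lambda>x. b (to_circle x)" Y
    by (rule Y)
  obtain U1 U2 where U1: "C2 U U1 U2" and U2: "\<forall>x. U x > 0"
    and eq: "\<forall>x. \<epsilon> * a (to_circle x) * U2 x + b (to_circle x) * U1 x + c (to_circle x) * U x = \<mu> * U x"
    using ep unfolding eigenpair_def by (elim exE conjE)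
  note U = U1 U2[rule_format]
  obtain m where m: "m > 0" "\<And>x. m \<le> U x"
    by (rule periodic_pos_lower[OF C2D(1,6)[OF U(1)] U(2)], rule that)
  obtain B where B: "B > 0" "\<And>x. norm (U x) \<le> B"
    by (rule periodic_bounded[OF C2D(1,6)[OF U(1)]], rule that)
  have B': "U x \<le> B" for x
    using B(2)[of x] by simp
  obtain C where C: "C > 0" "\<And>x. norm (c (to_circle x)) \<le> C"
    by (rule periodic_bounded[OF periodic_lift continuous_lift[OF c]], rule that)
  define k where "k x = c (to_circle x) - \<mu>" for x
  have k: "periodic k" "continuous_on UNIV k"
    unfolding k_def[abs_def] by (auto simp: periodic_def to_circle_add_1 intro!: continuous_intros continuous_lift[OF c])
  have eq': "(sqrt \<epsilon> * \<sigma> (to_circle x))\<^sup>2 / 2 * U2 x + b (to_circle x) * U1 x + k x * U x = 0" for x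
    using eq[rule_format, of x] \<open>\<epsilon> > 0\<close> by (simp add: k_def a_def power_mult_distrib algebra_simps)
  show ?case
    unfolding exp_moments_def
  proof (intro exI[of _ "m / B"] conjI allI ballI impI)
    fix s t :: real and A
    assume st: "0 \<le> s" "s \<le> t" and A: "A \<in> sets (F s)"
    have A': "A \<in> sets M"
      using A F_subalgebra by blast
    define E where "E \<omega> = indicator A \<omega> * exp (occ \<epsilon> c s t \<omega>)" for \<omega>
    define e where "e = exp (\<mu> * (t - s))"
    have path: "path k s t \<omega> = occ \<epsilon> c s t \<omega> - \<mu> * (t - s)" if "\<omega> \<in> space M" for \<omega>
    proof -
      have "path k s t \<omega> = integral {s..t} (\<lambda>r. c (X \<epsilon> r \<omega>) - \<mu>)"
        unfolding path_def by (rule Henstock_Kurzweil_Integration.integral_cong) (use st X that in \<open>auto simp: k_def\<close>)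
      also have "\<dots> = occ \<epsilon> c s t \<omega> - integral {s..t} (\<lambda>r. \<mu>)"
        unfolding occ_def by (rule Henstock_Kurzweil_Integration.integral_diff) (use c_X_integrable[OF c \<open>\<epsilon> > 0\<close> that st(1)] in auto)
      finally show ?thesis
        using st by simp
    qed
    have occ_M: "occ \<epsilon> c s t \<in> borel_measurable M"
      by (rule F_measurable[OF occ_measurable[OF c \<open>\<epsilon> > 0\<close> st]])
    have occ_b: "\<bar>occ \<epsilon> c s t \<omega>\<bar> \<le> C * (t - s)" if "\<omega> \<in> space M" for \<omega>
      using path_bound[OF continuous_lift[OF c] that st, of C] C(2) path_eq_occ[OF Y X st(1) that] by simp
    have Ei: "integrable M E"
    proof (rule bounded_integrable)
      show "E \<in> borel_measurable M"
        unfolding E_def[abs_def] using occ_M A' by measurable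
      show "\<bar>E \<omega>\<bar> \<le> exp (C * (t - s))" if "\<omega> \<in> space M" for \<omega>
        using occ_b[OF that] by (auto simp: E_def indicator_def abs_le_iff)
    qed
    have UY: "(\<lambda>\<omega>. U (Y r \<omega>)) \<in> borel_measurable M" if "0 \<le> r" for r
      by (rule F_measurable[OF f_Y_measurable[OF C2D(6)[OF U(1)] that order_refl]])
    have Ui: "integrable M (\<lambda>\<omega>. indicator A \<omega> * U (Y s \<omega>))"
    proof (rule bounded_integrable)
      show "(\<lambda>\<omega>. indicator A \<omega> * U (Y s \<omega>)) \<in> borel_measurable M"
        using UY[OF st(1)] A' by measurable
      show "\<bar>indicator A \<omega> * U (Y s \<omega>)\<bar> \<le> B" for \<omega>
        using B(1) B(2)[of "Y s \<omega>"] by (auto simp: indicator_def)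
    qed
    have EUi: "integrable M (\<lambda>\<omega>. E \<omega> * U (Y t \<omega>))"
      by (subst mult.commute, rule bounded_mult_integrable[of _ B]) (use UY[of t] st B(2) Ei in auto)
    have "expectation (\<lambda>\<omega>. indicator A \<omega> * (exp (path k s t \<omega>) * U (Y t \<omega>))) = expectation (\<lambda>\<omega>. indicator A \<omega> * U (Y s \<omega>))"
      by (rule exponential_martingale[OF U(1) k eq' st A])
    moreover have "expectation (\<lambda>\<omega>. indicator A \<omega> * (exp (path k s t \<omega>) * U (Y t \<omega>))) = expectation (\<lambda>\<omega>. E \<omega> * U (Y t \<omega>) / e)"
      by (rule Bochner_Integration.integral_cong) (auto simp: E_def e_def path exp_diff)
    ultimately have id: "expectation (\<lambda>\<omega>. E \<omega> * U (Y t \<omega>)) = e * expectation (\<lambda>\<omega>. indicator A \<omega> * U (Y s \<omega>))"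
      by (simp add: e_def field_simps)
    have ind: "expectation (\<lambda>\<omega>. indicator A \<omega> * d) = prob A * d" "integrable M (\<lambda>\<omega>. indicator A \<omega> * d)" for d :: real
      using A' by (simp_all add: less_top[symmetric])
    have E0: "E \<omega> \<ge> 0" for \<omega>
      by (simp add: E_def)
    have 1: "expectation (\<lambda>\<omega>. E \<omega> * U (Y t \<omega>)) \<le> expectation (\<lambda>\<omega>. E \<omega> * B)"
      by (rule integral_mono) (use EUi Ei E0 B' in \<open>auto intro: mult_left_mono\<close>)
    have 2: "expectation (\<lambda>\<omega>. E \<omega> * m) \<le> expectation (\<lambda>\<omega>. E \<omega> * U (Y t \<omega>))"
      by (rule integral_mono) (use EUi Ei E0 m in \<open>auto intro: mult_left_mono\<close>)
    have 3: "prob A * m \<le> expectation (\<lambda>\<omega>. indicator A \<omega> * U (Y s \<omega>))"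
      unfolding ind(1)[symmetric] by (rule integral_mono) (use Ui ind(2) m in \<open>auto intro: mult_left_mono\<close>)
    have 4: "expectation (\<lambda>\<omega>. indicator A \<omega> * U (Y s \<omega>)) \<le> prob A * B"
      unfolding ind(1)[symmetric] by (rule integral_mono) (use Ui ind(2) B' in \<open>auto intro: mult_left_mono\<close>)
    have e: "e > 0"
      by (simp add: e_def)
    have "e * (prob A * m) \<le> expectation E * B"
      using order_trans[OF mult_left_mono[OF 3, of e] 1[unfolded id]] e by simp
    then have low: "m / B * e * prob A \<le> expectation E"
      using B(1) by (simp add: pos_divide_le_eq mult_ac)
    have "expectation E * m \<le> e * (prob A * B)"
      using order_trans[OF 2[unfolded id] mult_left_mono[OF 4, of e]] e by simp
    then have up: "expectation E \<le> e * prob A / (m / B)"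
      using m(1) by (simp add: pos_le_divide_eq mult_ac)
    show "integrable M (\<lambda>\<omega>. indicator A \<omega> * exp (occ \<epsilon> c s t \<omega>))"
      "expectation (\<lambda>\<omega>. indicator A \<omega> * exp (occ \<epsilon> c s t \<omega>))
        \<in> {m / B * exp (\<mu> * (t - s)) * prob A..exp (\<mu> * (t - s)) * prob A / (m / B)}"
      using Ei low up unfolding E_def[symmetric] e_def[symmetric] by auto
  qed (use m B in simp)
qed

lemma eventually_tilted:
  assumes c: "continuous_on UNIV c" and "\<delta> > 0"
  shows "\<forall>\<^sub>F \<epsilon> in at_right 0. \<exists>\<kappa>. exp_moments \<epsilon> c \<kappa> (\<Lambda> c - \<delta>) (\<Lambda> c + \<delta>)"
  using eventually_eigenvalue[OF assms] eventually_at_right_less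
proof eventually_elim
  case (elim \<epsilon>)
  show ?case
  proof (rule principal_eigenpair[OF c elim(2)], goal_cases)
    case (1 \<mu> U)
    have \<mu>: "\<Lambda> c - \<delta> \<le> \<mu>" "\<mu> \<le> \<Lambda> c + \<delta>"
      using elim(1) 1(1) by auto
    obtain \<kappa> where \<kappa>: "exp_moments \<epsilon> c \<kappa> \<mu> \<mu>"
      using tilted_expectation[OF c elim(2) 1(1)] ..
    then have "\<kappa> > 0"
      by (simp add: exp_moments_def)
    have "exp_moments \<epsilon> c \<kappa> (\<Lambda> c - \<delta>) (\<Lambda> c + \<delta>)"
      unfolding exp_moments_def
    proof (intro conjI allI ballI impI)
      fix s t :: real and A
      assume A: "A \<in> sets (F s)" and st: "0 \<le> s" "s \<le> t"
      note * = exp_momentsD[OF \<kappa> st A]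
      show "integrable M (\<lambda>\<omega>. indicator A \<omega> * exp (occ \<epsilon> c s t \<omega>))"
        by (rule *(1))
      have "\<kappa> * exp ((\<Lambda> c - \<delta>) * (t - s)) * prob A \<le> \<kappa> * exp (\<mu> * (t - s)) * prob A"
        using mult_right_mono[OF \<mu>(1), of "t - s"] st \<open>\<kappa> > 0\<close> by (intro mult_right_mono mult_left_mono) auto
      moreover have "exp (\<mu> * (t - s)) * prob A / \<kappa> \<le> exp ((\<Lambda> c + \<delta>) * (t - s)) * prob A / \<kappa>"
        using \<mu> st \<open>\<kappa> > 0\<close> by (intro divide_right_mono mult_right_mono) (auto intro: mult_right_mono)
      ultimately show "expectation (\<lambda>\<omega>. indicator A \<omega> * exp (occ \<epsilon> c s t \<omega>))
          \<in> {\<kappa> * exp ((\<Lambda> c - \<delta>) * (t - s)) * prob A..exp ((\<Lambda> c + \<delta>) * (t - s)) * prob A / \<kappa>}"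
        using *(2,3) by simp
    qed fact
    then show ?case ..
  qed
qed

end


section \<open>Weak convergence on the circle\<close>

text \<open>The denominator of \<open>h\<close> is positive: where \<open>g\<close> vanishes so does
  \<open>f\<close>, and the second argument of the maximum is \<eta>. Hence \<open>h\<close> is
  continuous and bounded. Where \<open>\<bar>f\<bar>\<close> exceeds \<eta> the denominator is
  \<open>g\<close>, and the bound on \<open>h\<close> is the claim.\<close>

lemma dominated_near_zeros:
  fixes f g :: "'a::topological_space \<Rightarrow> real"
  assumes K: "compact K" and f: "continuous_on K f" and g: "continuous_on K g" "\<And>x. x \<in> K \<Longrightarrow> g x \<ge> 0"
    and zero: "\<And>x. x \<in> K \<Longrightarrow> g x = 0 \<Longrightarrow> f x = 0" and "\<eta> > 0"
  obtains C where "C \<ge> 0" "\<And>x. x \<in> K \<Longrightarrow> \<bar>f x\<bar> \<le> \<eta> + C * g x"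
proof -
  define h where "h x = max 0 (\<bar>f x\<bar> - \<eta>) / max (g x) (\<eta> - \<bar>f x\<bar>)" for x
  have pos: "max (g x) (\<eta> - \<bar>f x\<bar>) > 0" if "x \<in> K" for x
    using g(2)[OF that] zero[OF that] \<open>\<eta> > 0\<close> by (cases "g x = 0") (auto simp: less_max_iff_disj)
  have "continuous_on K h"
    unfolding h_def[abs_def] using f g(1) by (intro continuous_intros ballI less_imp_neq[OF pos, THEN not_sym])
  then have "compact (h ` K)"
    by (rule compact_continuous_image[OF _ K])
  then obtain C where C: "\<forall>x\<in>K. norm (h x) \<le> C"
    by (auto dest!: compact_imp_bounded simp: bounded_iff)
  show ?thesis
  proof (rule that[of "max C 0"])
    fix x
    assume x: "x \<in> K"
    show "\<bar>f x\<bar> \<le> \<eta> + max C 0 * g x"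
    proof (cases "\<bar>f x\<bar> \<le> \<eta>")
      case True
      then show ?thesis
        using g(2)[OF x] by (smt (verit) mult_nonneg_nonneg)
    next
      case False
      then have gx: "g x > 0" and "h x = (\<bar>f x\<bar> - \<eta>) / g x"
        using g(2)[OF x] zero[OF x] \<open>\<eta> > 0\<close> by (cases "g x = 0"; simp add: h_def)+
      then have "(\<bar>f x\<bar> - \<eta>) / g x \<le> max C 0"
        using order_trans[OF abs_ge_self bspec[OF C x, unfolded real_norm_def]] by (simp add: le_max_iff_disj)
      then show ?thesis
        using gx by (simp add: pos_divide_le_eq)
    qed
  qed simp
qed

lemma circle_cases_unit:
  obtains x where "0 \<le> x" "x < 1" "p = to_circle x"
proof -
  obtain z where "p = to_circle z"
    by (rule circle_cases)
  then have "p = to_circle (frac z)"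
    by (simp add: to_circle_eq_iff frac_def)
  then show ?thesis
    using that frac_ge_0 frac_lt_1 by blast
qed

lemma compact_circle: "compact (UNIV :: circle set)"
proof -
  have "p \<in> to_circle ` {0..1}" for p
  proof -
    obtain x where "0 \<le> x" "x < 1" "p = to_circle x"
      by (rule circle_cases_unit)
    then show ?thesis
      by auto
  qed
  then have "UNIV = to_circle ` {0..1::real}"
    by blast
  then show ?thesis
    using compact_continuous_image[OF continuous_on_subset[OF continuous_to_circle subset_UNIV] compact_Icc, of 0 1] by simp
qed

lemma circle_bounded:
  fixes c :: "circle \<Rightarrow> real"
  assumes "continuous_on UNIV c"
  obtains B where "B > 0" "\<And>p. \<bar>c p\<bar> \<le> B"
proof -
  have "bounded (range c)"
    by (rule compact_imp_bounded[OF compact_continuous_image[OF assms compact_circle]])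
  then show ?thesis
    using that by (auto simp: bounded_pos)
qed

text \<open>Plays the role of a squared distance on the circle.\<close>

definition circle_sinsq :: "circle \<Rightarrow> circle \<Rightarrow> real"
  where "circle_sinsq p q = sinsq (rep_circle p) (rep_circle q)"

lemma circle_sinsq_lift: "circle_sinsq (to_circle x) (to_circle y) = sinsq x y"
proof -
  have sym: "sinsq u v = sinsq v u" for u v
    by (simp add: sinsq_def minus_diff_eq[of v u, symmetric] del: minus_diff_eq)
  have per: "sinsq u (v + of_int n) = sinsq u v" for u v and n :: int
    by (rule periodic_add_of_int[OF C2D(1)[OF C2_sinsq]])
  obtain n m :: int where "rep_circle (to_circle x) = x + of_int n" "rep_circle (to_circle y) = y + of_int m"
    using rep_to_circle[of x] rep_to_circle[of y] by (auto elim!: Ints_cases simp: algebra_simps)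
  then show ?thesis
    by (simp add: circle_sinsq_def per sym[of "x + of_int n" "y + of_int m"] sym[of _ x] sym[of "x + of_int n"])
qed

lemma circle_sinsq_range: "0 \<le> circle_sinsq p q" "circle_sinsq p q \<le> 1"
  by (auto simp: circle_sinsq_def sinsq_range)

lemma circle_sinsq_eq_0_iff: "circle_sinsq p q = 0 \<longleftrightarrow> p = q"
proof -
  obtain x y where "p = to_circle x" "q = to_circle y"
    using circle_cases[of p] circle_cases[of q] by metis
  then show ?thesis
    using Ints_minus[of "x - y"] Ints_minus[of "y - x"]
    by (auto simp: circle_sinsq_lift sinsq_eq_0_iff to_circle_eq_iff)
qed

lemma continuous_circle_sinsq: "continuous_on UNIV (circle_sinsq p)"
proof -
  obtain x where "p = to_circle x"
    by (rule circle_cases)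
  then show ?thesis
    using C2D(6)[OF C2_sinsq[of x]] by (simp add: circle_sinsq_lift flip: continuous_lift_iff)
qed

lemma modulus_at_point:
  fixes c :: "circle \<Rightarrow> real"
  assumes c: "continuous_on UNIV c" and "\<eta> > 0"
  obtains K where "K \<ge> 0" "\<And>q. \<bar>c q - c p\<bar> \<le> \<eta> + K * circle_sinsq p q"
  by (rule dominated_near_zeros[OF compact_circle, of "\<lambda>q. c q - c p" "circle_sinsq p" \<eta>])
    (use c continuous_circle_sinsq circle_sinsq_range circle_sinsq_eq_0_iff \<open>\<eta> > 0\<close> that in
      \<open>auto intro!: continuous_intros\<close>)

text \<open>Domination on the compact square of pairs of lifts, where \<open>sinsq\<close> vanishes
  exactly at pairs representing the same point.\<close>

lemma uniform_modulus:
  fixes c :: "circle \<Rightarrow> real"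
  assumes c: "continuous_on UNIV c" and "\<eta> > 0"
  obtains K where "K \<ge> 0" "\<And>p q. \<bar>c q - c p\<bar> \<le> \<eta> + K * circle_sinsq p q"
proof -
  define K where "K = {0..1::real} \<times> {0..1::real}"
  have lift: "continuous_on K (\<lambda>z. c (to_circle (fst z)))" "continuous_on K (\<lambda>z. c (to_circle (snd z)))"
    by (auto intro!: continuous_on_compose2[OF continuous_lift[OF c]] continuous_intros)
  have cont: "continuous_on K (\<lambda>z. sinsq (fst z) (snd z))"
    unfolding sinsq_def by (intro continuous_intros)
  have "compact K"
    by (simp add: K_def compact_Times)
  then obtain C where C: "C \<ge> 0" "\<And>z. z \<in> K \<Longrightarrow> \<bar>c (to_circle (snd z)) - c (to_circle (fst z))\<bar> \<le> \<eta> + C * sinsq (fst z) (snd z)"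
    by (rule dominated_near_zeros[of K "\<lambda>z. c (to_circle (snd z)) - c (to_circle (fst z))" "\<lambda>z. sinsq (fst z) (snd z)"])
      (use \<open>\<eta> > 0\<close> sinsq_range lift cont circle_sinsq_eq_0_iff[of "to_circle _" "to_circle _", unfolded circle_sinsq_lift] that in
        \<open>auto intro!: continuous_intros\<close>)
  show ?thesis
  proof (rule that[OF C(1)])
    fix p q
    obtain x where x: "0 \<le> x" "x < 1" "p = to_circle x"
      by (rule circle_cases_unit)
    obtain y where y: "0 \<le> y" "y < 1" "q = to_circle y"
      by (rule circle_cases_unit)
    show "\<bar>c q - c p\<bar> \<le> \<eta> + C * circle_sinsq p q"
      using C(2)[of "(x, y)"] x y by (simp add: K_def circle_sinsq_lift)
  qed
qed

text \<open>
  The normalised functions \<open>hat n k\<close>, supported near $k/n$, form a partition of unity; their integrals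
  against a measure determine the weak topology by countably many coordinates.
\<close>

definition bump :: "nat \<Rightarrow> nat \<Rightarrow> circle \<Rightarrow> real"
  where "bump n k p = max 0 (16 / real n ^ 2 - circle_sinsq (to_circle (real k / real n)) p)"

definition hat :: "nat \<Rightarrow> nat \<Rightarrow> circle \<Rightarrow> real"
  where "hat n k p = bump n k p / (\<Sum>j<n. bump n j p)"

lemma bump_nonneg: "0 \<le> bump n k p"
  by (simp add: bump_def)

text \<open>Some grid point lies less than \<open>1 / n\<close> below the lift of \<open>p\<close>,
  and \<open>pi < 4\<close> bounds the sine of the scaled distance by \<open>4 / n\<close>. This is
  the origin of the threshold \<open>16 / n\<^sup>2\<close>.\<close>

lemma bump_sum_pos:
  assumes "n > 0"
  shows "0 < (\<Sum>j<n. bump n j p)"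
proof -
  obtain x where x: "0 \<le> x" "x < 1" "p = to_circle x"
    by (rule circle_cases_unit)
  define k where "k = nat \<lfloor>real n * x\<rfloor>"
  have k: "real k \<le> real n * x" "real n * x < real k + 1"
    using x by (auto simp: k_def)
  have "real k < real n"
    using k(1) x \<open>n > 0\<close> by (smt (verit) mult_less_cancel_left2 of_nat_0_less_iff)
  then have kn: "k < n"
    by simp
  have d: "0 \<le> x - real k / real n" "x - real k / real n < 1 / real n"
    using k \<open>n > 0\<close> by (auto simp: diff_less_eq add_divide_distrib[symmetric] pos_divide_le_eq pos_less_divide_eq mult.commute)
  have "\<bar>sin (pi * (x - real k / real n))\<bar> \<le> \<bar>pi * (x - real k / real n)\<bar>"
    by (rule abs_sin_x_le_abs_x)
  also have "\<dots> < 4 * (1 / real n)"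
    using d pi_less_4 pi_gt_zero unfolding abs_mult by (intro mult_strict_mono) auto
  finally have "\<bar>sin (pi * (x - real k / real n))\<bar>\<^sup>2 < (4 * (1 / real n))\<^sup>2"
    by (rule power_strict_mono) auto
  then have "bump n k p > 0"
    by (simp add: bump_def x(3) circle_sinsq_lift sinsq_def power_divide)
  then show ?thesis
    using kn bump_nonneg by (intro sum_pos2[of _ k]) auto
qed

lemma continuous_hat:
  assumes "n > 0"
  shows "continuous_on UNIV (hat n k)"
  unfolding hat_def[abs_def] bump_def[abs_def]
  using bump_sum_pos[OF assms] continuous_circle_sinsq
  by (intro continuous_intros) (auto simp: bump_def less_imp_neq[THEN not_sym])

lemma hat_approximation:
  fixes c :: "circle \<Rightarrow> real"
  assumes c: "continuous_on UNIV c" and "\<eta> > 0"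
  obtains n v where "n > 0" "\<And>p. \<bar>c p - (\<Sum>k<n. v k * hat n k p)\<bar> \<le> \<eta>"
proof -
  obtain K where K: "K \<ge> 0" "\<And>p q. \<bar>c q - c p\<bar> \<le> \<eta> / 2 + K * circle_sinsq p q"
    by (rule uniform_modulus[OF c, of "\<eta> / 2"]) (use \<open>\<eta> > 0\<close> that in auto)
  \<comment> \<open>On the support of a bump \<open>circle_sinsq\<close> is at most
    \<open>16 / n\<^sup>2\<close>, so for this \<open>n\<close> the second half of \<eta> covers the
    oscillation of \<open>c\<close> there.\<close>
  obtain n :: nat where n: "32 * K / \<eta> + 1 < real n"
    using reals_Archimedean2 by blast
  have n1: "real n \<ge> 1"
    using n K \<open>\<eta> > 0\<close> by (smt (verit) divide_nonneg_nonneg)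
  have "32 * K < \<eta> * real n"
    using n \<open>\<eta> > 0\<close> by (simp add: field_simps)
  also have "\<dots> \<le> \<eta> * real n ^ 2"
    using n1 \<open>\<eta> > 0\<close> by (simp add: power2_eq_square)
  finally have Kn: "K * (16 / real n ^ 2) \<le> \<eta> / 2"
    using n1 by (simp add: divide_simps)
  define v where "v k = c (to_circle (real k / real n))" for k
  show ?thesis
  proof (rule that[of n v])
    show "n > 0"
      using n1 by simp
    fix p
    define S where "S = (\<Sum>j<n. bump n j p)"
    have S: "S > 0"
      unfolding S_def by (rule bump_sum_pos) fact
    have "\<bar>c p - v k\<bar> * bump n k p \<le> \<eta> * bump n k p" for k
    proof (cases "circle_sinsq (to_circle (real k / real n)) p \<le> 16 / real n ^ 2")
      case True
      have "\<bar>c p - v k\<bar> \<le> \<eta>"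
        using K(2)[of p "to_circle (real k / real n)"] mult_left_mono[OF True K(1)] Kn by (simp add: v_def)
      then show ?thesis
        using bump_nonneg by (intro mult_right_mono) auto
    qed (simp add: bump_def)
    then have "(\<Sum>k<n. \<bar>(c p - v k) * bump n k p\<bar>) \<le> \<eta> * S"
      unfolding S_def sum_distrib_left by (intro sum_mono) (auto simp: abs_mult bump_nonneg)
    then have "\<bar>\<Sum>k<n. (c p - v k) * bump n k p\<bar> \<le> \<eta> * S"
      by (rule order_trans[OF sum_abs])
    moreover have "(\<Sum>k<n. (c p - v k) * bump n k p) = (c p - (\<Sum>k<n. v k * hat n k p)) * S"
    proof -
      have "(\<Sum>k<n. v k * hat n k p) * S = (\<Sum>k<n. v k * bump n k p)"
        unfolding sum_distrib_right using S by (intro sum.cong) (auto simp: hat_def S_def[symmetric])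
      then show ?thesis
        by (simp add: left_diff_distrib sum_subtractf S_def sum_distrib_left)
    qed
    ultimately have "\<bar>c p - (\<Sum>k<n. v k * hat n k p)\<bar> * S \<le> \<eta> * S"
      using S by (simp add: abs_mult)
    then show "\<bar>c p - (\<Sum>k<n. v k * hat n k p)\<bar> \<le> \<eta>"
      using S by simp
  qed
qed

section \<open>The weak topology through integrals of test functions\<close>

lemma circle_integrable:
  fixes c :: "circle \<Rightarrow> real"
  assumes \<mu>: "\<mu> \<in> circle_probs" and c: "continuous_on UNIV c"
  shows "integrable \<mu> c"
proof -
  interpret prob_space \<mu>
    using \<mu> by (simp add: circle_probs_def)
  obtain B where "B > 0" "\<And>p. \<bar>c p\<bar> \<le> B"
    by (rule circle_bounded[OF c], rule that)
  moreover have "c \<in> borel_measurable \<mu>"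
    using borel_measurable_continuous_onI[OF c] \<mu> by (simp add: circle_probs_def cong: measurable_cong_sets)
  ultimately show ?thesis
    by (intro integrable_const_bound[of _ B]) auto
qed

lemma circle_integral_bound:
  fixes c d :: "circle \<Rightarrow> real"
  assumes \<mu>: "\<mu> \<in> circle_probs" and c: "continuous_on UNIV c" and d: "continuous_on UNIV d" and le: "\<And>p. \<bar>c p\<bar> \<le> \<eta> + K * d p"
  shows "\<bar>integral\<^sup>L \<mu> c\<bar> \<le> \<eta> + K * integral\<^sup>L \<mu> d"
proof -
  interpret prob_space \<mu>
    using \<mu> by (simp add: circle_probs_def)
  note ci = circle_integrable[OF \<mu> c] and di = circle_integrable[OF \<mu> d]
  have "\<bar>integral\<^sup>L \<mu> c\<bar> \<le> integral\<^sup>L \<mu> (\<lambda>p. \<eta> + K * d p)"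
    by (rule abs_integral_le_AE[OF ci]) (use di le in auto)
  then show ?thesis
    using di by (simp add: prob_space)
qed

text \<open>\<open>Suc n\<close> excludes the index 0, for which there is no partition of
  unity.\<close>

definition coordinates :: "circle measure \<Rightarrow> nat \<times> nat \<Rightarrow> real"
  where "coordinates \<mu> = (\<lambda>(n, k). integral\<^sup>L \<mu> (hat (Suc n) k))"

text \<open>The integral of \<open>c\<close> lies in \<open>U\<close> exactly if, for some linear
  combination of coordinates approximating it within \<eta>, the closed \<eta>-ball around the
  approximate value lies in \<open>U\<close> with room to spare. \<open>V\<close> collects all such
  approximations; taking interiors makes it open. The description by countably many coordinates is
  what makes events about the empirical measure measurable.\<close>

lemma weak_open_subbase_coordinates:
  assumes c: "continuous_on UNIV (c :: circle \<Rightarrow> real)" and U: "open U"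
  shows "\<exists>V. open V \<and> {\<mu> \<in> circle_probs. integral\<^sup>L \<mu> c \<in> U} = {\<mu> \<in> circle_probs. coordinates \<mu> \<in> V}"
proof -
  define I where "I = {(n, v, \<eta>). \<eta> > 0 \<and> (\<forall>p. \<bar>c p - (\<Sum>k<Suc n. v k * hat (Suc n) k p)\<bar> \<le> \<eta>)}"
  define V where "V = (\<Union>(n, v, \<eta>)\<in>I. (\<lambda>x. \<Sum>k<Suc n. v k * x (n, k)) -` interior {y. cball y \<eta> \<subseteq> U})"
  have "open ((\<lambda>x :: nat \<times> nat \<Rightarrow> real. \<Sum>k<Suc n. v k * x (n, k)) -` interior B)" for n B and v :: "nat \<Rightarrow> real"
    by (intro open_vimage open_interior continuous_intros continuous_on_product_coordinates)
  then have "open V"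
    unfolding V_def by auto
  moreover have approx: "\<bar>integral\<^sup>L \<mu> c - (\<Sum>k<Suc n. v k * coordinates \<mu> (n, k))\<bar> \<le> \<eta>"
    if \<mu>: "\<mu> \<in> circle_probs" and "(n, v, \<eta>) \<in> I" for \<mu> n v \<eta>
  proof -
    have hc: "continuous_on UNIV (hat (Suc n) k)" for k
      by (rule continuous_hat) simp
    have cont: "continuous_on UNIV (\<lambda>p. c p - (\<Sum>k<Suc n. v k * hat (Suc n) k p))"
      by (intro continuous_intros c hc)
    have "\<bar>integral\<^sup>L \<mu> (\<lambda>p. c p - (\<Sum>k<Suc n. v k * hat (Suc n) k p))\<bar> \<le> \<eta> + 0 * integral\<^sup>L \<mu> c"
      by (rule circle_integral_bound[OF \<mu> cont c]) (use that(2) in \<open>simp add: I_def\<close>)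
    then show ?thesis
      using circle_integrable[OF \<mu> c] circle_integrable[OF \<mu> hc]
      by (simp add: coordinates_def del: sum.lessThan_Suc)
  qed
  have "coordinates \<mu> \<in> V \<longleftrightarrow> integral\<^sup>L \<mu> c \<in> U" if \<mu>: "\<mu> \<in> circle_probs" for \<mu>
  proof
    assume "coordinates \<mu> \<in> V"
    then obtain n v \<eta> where I: "(n, v, \<eta>) \<in> I" and "(\<Sum>k<Suc n. v k * coordinates \<mu> (n, k)) \<in> interior {y. cball y \<eta> \<subseteq> U}"
      unfolding V_def by auto
    then have "cball (\<Sum>k<Suc n. v k * coordinates \<mu> (n, k)) \<eta> \<subseteq> U"
      using interior_subset by blast
    moreover have "integral\<^sup>L \<mu> c \<in> cball (\<Sum>k<Suc n. v k * coordinates \<mu> (n, k)) \<eta>"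
      using approx[OF \<mu> I] by (simp only: mem_cball dist_real_def abs_minus_commute)
    ultimately show "integral\<^sup>L \<mu> c \<in> U"
      by blast
  next
    assume "integral\<^sup>L \<mu> c \<in> U"
    then obtain e where e: "e > 0" "ball (integral\<^sup>L \<mu> c) e \<subseteq> U"
      using U by (auto simp: open_contains_ball)
    \<comment> \<open>A third each for the approximation error, the ball that witnesses the
      interior, and the closed ball inside \<open>U\<close>.\<close>
    define \<eta> where "\<eta> = e / 3"
    obtain m v where m: "m > 0" "\<And>p. \<bar>c p - (\<Sum>k<m. v k * hat m k p)\<bar> \<le> \<eta>"
      by (rule hat_approximation[OF c, of \<eta>]) (use e that in \<open>auto simp: \<eta>_def\<close>)
    obtain n where n: "m = Suc n"
      using m(1) gr0_implies_Suc by blast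
    have I: "(n, v, \<eta>) \<in> I"
      using m(2) e by (simp add: I_def n \<eta>_def)
    define y where "y = (\<Sum>k<Suc n. v k * coordinates \<mu> (n, k))"
    have y: "\<bar>integral\<^sup>L \<mu> c - y\<bar> \<le> \<eta>"
      unfolding y_def by (rule approx[OF \<mu> I])
    have "ball y \<eta> \<subseteq> {y. cball y \<eta> \<subseteq> U}"
    proof (intro subsetI CollectI)
      fix z w
      assume "z \<in> ball y \<eta>" "w \<in> cball z \<eta>"
      then have "\<bar>y - z\<bar> < \<eta>" "\<bar>z - w\<bar> \<le> \<eta>"
        by (auto simp: dist_real_def)
      then have "\<bar>integral\<^sup>L \<mu> c - w\<bar> < e"
        using y e(1) unfolding \<eta>_def by linarith
      then have "w \<in> ball (integral\<^sup>L \<mu> c) e"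
        by (simp add: dist_real_def)
      then show "w \<in> U"
        using e by blast
    qed
    then have "y \<in> interior {y. cball y \<eta> \<subseteq> U}"
      by (rule interiorI[rotated 2]) (use e in \<open>auto simp: \<eta>_def\<close>)
    then show "coordinates \<mu> \<in> V"
      unfolding V_def y_def using I by blast
  qed
  ultimately show ?thesis
    by blast
qed

lemma weak_open_coordinates:
  assumes "openin weak_topology S"
  shows "\<exists>V. open V \<and> S = {\<mu> \<in> circle_probs. coordinates \<mu> \<in> V}"
proof -
  have "generate_topology_on {{\<mu> \<in> circle_probs. integral\<^sup>L \<mu> c \<in> U} | (c :: circle \<Rightarrow> real) (U :: real set).
      continuous_on UNIV c \<and> open U} S"
    using assms unfolding weak_topology_def by (simp add: openin_topology_generated_by)
  then show ?thesis
  proof induction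
    case Empty
    then show ?case
      by (intro exI[of _ "{}"]) auto
  next
    case (Int A B)
    then obtain V V' where "open V" "open V'" "A = {\<mu> \<in> circle_probs. coordinates \<mu> \<in> V}" "B = {\<mu> \<in> circle_probs. coordinates \<mu> \<in> V'}"
      by (elim exE conjE) (rule that)
    then show ?case
      by (intro exI[of _ "V \<inter> V'"]) auto
  next
    case (UN \<A>)
    define V where "V A = (SOME V. open V \<and> A = {\<mu> \<in> circle_probs. coordinates \<mu> \<in> V})" for A
    have V: "open (V A)" "A = {\<mu> \<in> circle_probs. coordinates \<mu> \<in> V A}" if "A \<in> \<A>" for A
      using someI_ex[OF UN.IH[OF that]] unfolding V_def by (rule conjunct1, rule conjunct2)
    have "\<Union>\<A> = (\<Union>A\<in>\<A>. {\<mu> \<in> circle_probs. coordinates \<mu> \<in> V A})"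
      using SUP_cong[OF refl V(2), of \<A> id] by simp
    also have "\<dots> = {\<mu> \<in> circle_probs. coordinates \<mu> \<in> (\<Union>A\<in>\<A>. V A)}"
      by blast
    finally show ?case
      using V(1) by (intro exI[of _ "\<Union>A\<in>\<A>. V A"]) auto
  next
    case (Basis A)
    then show ?case
      using weak_open_subbase_coordinates by auto
  qed
qed

text \<open>Induction over the generation of \<open>S\<close> from subbasic sets, on which the claim
  is convergence of one integral. It lets the later compactness arguments run along
  sequences.\<close>

lemma weak_open_sequentially:
  fixes \<nu> :: "nat \<Rightarrow> circle measure"
  assumes "openin weak_topology S" "\<mu> \<in> S" and \<nu>: "\<And>n. \<nu> n \<in> circle_probs"
    and lim: "\<And>c :: circle \<Rightarrow> real. continuous_on UNIV c \<Longrightarrow> (\<lambda>n. integral\<^sup>L (\<nu> n) c) \<longlonglongrightarrow> integral\<^sup>L \<mu> c"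
  shows "\<forall>\<^sub>F n in sequentially. \<nu> n \<in> S"
proof -
  have "generate_topology_on {{\<mu> \<in> circle_probs. integral\<^sup>L \<mu> c \<in> U} | (c :: circle \<Rightarrow> real) (U :: real set).
      continuous_on UNIV c \<and> open U} S"
    using assms(1) unfolding weak_topology_def by (simp add: openin_topology_generated_by)
  then show ?thesis
    using \<open>\<mu> \<in> S\<close>
  proof induction
    case (Int A B)
    then show ?case
      by (auto intro: eventually_conj)
  next
    case (UN \<A>)
    then obtain A where "A \<in> \<A>" "\<mu> \<in> A"
      by blast
    then show ?case
      using UN.IH by (blast intro: eventually_mono)
  next
    case (Basis A)
    then obtain c :: "circle \<Rightarrow> real" and U where A: "A = {\<mu> \<in> circle_probs. integral\<^sup>L \<mu> c \<in> U}" "continuous_on UNIV c" "open U"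
      by auto
    then have "\<forall>\<^sub>F n in sequentially. integral\<^sup>L (\<nu> n) c \<in> U"
      using Basis topological_tendstoD[OF lim] by auto
    then show ?case
      using \<nu> by (simp add: A)
  qed simp
qed


section \<open>Large deviation bounds\<close>

lemma convergent_subsequence_finite:
  fixes f :: "'i \<Rightarrow> nat \<Rightarrow> real"
  assumes "finite I" "\<And>i n. i \<in> I \<Longrightarrow> \<bar>f i n\<bar> \<le> B i"
  shows "\<exists>r w. strict_mono (r :: nat \<Rightarrow> nat) \<and> (\<forall>i\<in>I. (\<lambda>n. f i (r n)) \<longlonglongrightarrow> w i)"
  using assms
proof induction
  case empty
  then show ?case
    using strict_mono_id by auto
next
  case (insert j I)
  then obtain r w where r: "strict_mono (r :: nat \<Rightarrow> nat)" "\<forall>i\<in>I. (\<lambda>n. f i (r n)) \<longlonglongrightarrow> w i"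
    by auto
  have "f j (r n) \<in> {- B j..B j}" for n
    using insert.prems[of j "r n"] by (simp add: abs_le_iff)
  then obtain l s where s: "strict_mono (s :: nat \<Rightarrow> nat)" "((\<lambda>n. f j (r n)) \<circ> s) \<longlonglongrightarrow> l"
    using compact_imp_seq_compact[OF compact_Icc, of "- B j" "B j"] unfolding seq_compact_def by meson
  have "(\<lambda>n. f i (r (s n))) \<longlonglongrightarrow> w i" if "i \<in> I" for i
    using LIMSEQ_subseq_LIMSEQ[OF bspec[OF r(2) that] s(1)] by (simp add: o_def)
  then have "\<forall>i\<in>insert j I. (\<lambda>n. f i ((r \<circ> s) n)) \<longlonglongrightarrow> (w(j := l)) i"
    using s(2) insert.hyps by (auto simp: o_def)
  then show ?case
    using strict_mono_o[OF r(1) s(1)] by blast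
qed

section \<open>The rate function and mixtures of Dirac measures\<close>

context circle_field
begin

lemma continuous_escape: "continuous_on UNIV escape"
proof -
  have "continuous_on UNIV (circle_deriv b)"
    using C2D(7)[OF C_on_2_C2[OF C2_b]] by (simp add: continuous_lift_iff)
  then show ?thesis
    unfolding escape_def[abs_def] by (intro continuous_intros)
qed

lemma escape_nonneg: "0 \<le> escape p"
  by (simp add: escape_def)

text \<open>Expressed through integrals of continuous functions, since the weak topology and the
  rate function see a measure only through these.\<close>

definition mixture :: "(circle \<Rightarrow> real) \<Rightarrow> circle measure \<Rightarrow> bool"
  where "mixture w \<mu> \<longleftrightarrow> (\<forall>p\<in>zeros. 0 \<le> w p) \<and> (\<Sum>p\<in>zeros. w p) = 1 \<and>
    (\<forall>c :: circle \<Rightarrow> real. continuous_on UNIV c \<longrightarrow> integral\<^sup>L \<mu> c = (\<Sum>p\<in>zeros. w p * c p))"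

lemma mixtureD:
  fixes c :: "circle \<Rightarrow> real"
  assumes "mixture w \<mu>"
  shows "p \<in> zeros \<Longrightarrow> 0 \<le> w p" "(\<Sum>p\<in>zeros. w p) = 1"
    "continuous_on UNIV c \<Longrightarrow> integral\<^sup>L \<mu> c = (\<Sum>p\<in>zeros. w p * c p)"
  using assms by (auto simp: mixture_def)

lemma mixture_exists:
  assumes w: "\<And>p. p \<in> zeros \<Longrightarrow> 0 \<le> w p" "(\<Sum>p\<in>zeros. w p) = 1"
  obtains \<mu> where "\<mu> \<in> circle_probs" "mixture w \<mu>"
proof -
  define N where "N = point_measure zeros (\<lambda>p. ennreal (w p))"
  have "prob_space N"
    unfolding N_def by (rule prob_space_point_measure) (use w finite_zeros' in auto)
  then interpret prob_space N .
  have id: "(\<lambda>p. p) \<in> N \<rightarrow>\<^sub>M borel"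
    by (simp add: N_def)
  show ?thesis
  proof (rule that)
    show "distr N borel (\<lambda>p. p) \<in> circle_probs"
      using prob_space_distr[OF id] by (simp add: circle_probs_def)
    have "integral\<^sup>L (distr N borel (\<lambda>p. p)) c = (\<Sum>p\<in>zeros. w p * c p)" if "continuous_on UNIV c" for c :: "circle \<Rightarrow> real"
      using that finite_zeros' w(1)
      by (subst integral_distr[OF id borel_measurable_continuous_onI]) (simp_all add: N_def lebesgue_integral_point_measure_finite)
    then show "mixture w (distr N borel (\<lambda>p. p))"
      using w by (simp add: mixture_def)
  qed
qed

lemma rate_function_ge:
  assumes "continuous_on UNIV c"
  shows "ereal (integral\<^sup>L \<mu> c - \<Lambda> c) \<le> rate_function a b \<mu>"
  unfolding rate_function_def limit_eigenvalue_eq[OF assms, symmetric] by (rule SUP_upper) (use assms in simp)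

text \<open>\<open>\<Lambda> c\<close> is a maximum over the zeros and hence at least the weighted
  average of \<open>c p - escape p\<close>; the integral of \<open>c\<close> cancels.\<close>

lemma rate_function_mixture_le:
  assumes "mixture w \<mu>"
  shows "rate_function a b \<mu> \<le> ereal (\<Sum>p\<in>zeros. w p * escape p)"
  unfolding rate_function_def
proof (rule SUP_least)
  fix c :: "circle \<Rightarrow> real"
  assume "c \<in> {c. continuous_on UNIV c}"
  then have c: "continuous_on UNIV c"
    by simp
  have "(\<Sum>p\<in>zeros. w p * (c p - escape p)) \<le> (\<Sum>p\<in>zeros. w p * \<Lambda> c)"
    by (intro sum_mono mult_left_mono \<Lambda>_ge mixtureD(1)[OF assms])
  also have "\<dots> = \<Lambda> c"
    using mixtureD(2)[OF assms] by (simp flip: sum_distrib_right)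
  finally show "ereal (integral\<^sup>L \<mu> c - limit_eigenvalue a b c) \<le> ereal (\<Sum>p\<in>zeros. w p * escape p)"
    by (simp add: limit_eigenvalue_eq[OF c] mixtureD(3)[OF assms c] right_diff_distrib sum_subtractf)
qed

text \<open>A nonnegative analogue of the Lagrange interpolation functions for the zeros of
  \<open>b\<close>.\<close>

definition zero_bump :: "circle \<Rightarrow> circle \<Rightarrow> real"
  where "zero_bump p q = (\<Prod>r\<in>zeros - {p}. circle_sinsq r q / circle_sinsq r p)"

lemma continuous_zero_bump: "continuous_on UNIV (zero_bump p)"
  unfolding zero_bump_def[abs_def] using continuous_circle_sinsq
  by (intro continuous_on_prod continuous_on_divide) (auto simp: circle_sinsq_eq_0_iff)

lemma zero_bump_nonneg: "0 \<le> zero_bump p q"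
  unfolding zero_bump_def by (intro prod_nonneg) (simp add: circle_sinsq_range)

lemma zero_bump_at_zeros:
  assumes "q \<in> zeros"
  shows "zero_bump p q = (if p = q then 1 else 0)"
proof (cases "p = q")
  case True
  have "zero_bump p q = (\<Prod>r\<in>zeros - {p}. 1)"
    unfolding zero_bump_def by (intro prod.cong) (auto simp: True circle_sinsq_eq_0_iff)
  then show ?thesis
    by (simp add: True)
next
  case False
  have "\<exists>r\<in>zeros - {p}. circle_sinsq r q / circle_sinsq r p = 0"
    by (rule bexI[of _ q]) (use False assms circle_sinsq_eq_0_iff in auto)
  then show ?thesis
    using False finite_zeros' by (simp add: zero_bump_def prod_zero_iff)
qed

text \<open>The interpolation error vanishes at the zeros of \<open>b\<close>, so up to \<eta> it is
  dominated by a multiple of the square of \<open>b\<close>.\<close>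

lemma zero_expansion:
  assumes c: "continuous_on UNIV c" and "\<eta> > 0"
  obtains C where "C \<ge> 0" "\<And>q. \<bar>c q - (\<Sum>p\<in>zeros. c p * zero_bump p q)\<bar> \<le> \<eta> + C * (b q)\<^sup>2"
proof (rule dominated_near_zeros[OF compact_circle, of "\<lambda>q. c q - (\<Sum>p\<in>zeros. c p * zero_bump p q)" "\<lambda>q. (b q)\<^sup>2" \<eta>])
  show "continuous_on UNIV (\<lambda>q. c q - (\<Sum>p\<in>zeros. c p * zero_bump p q))"
    by (intro continuous_intros c continuous_zero_bump)
  show "continuous_on UNIV (\<lambda>q. (b q)\<^sup>2)"
    by (intro continuous_intros continuous_b)
  show "c q - (\<Sum>p\<in>zeros. c p * zero_bump p q) = 0" if "(b q)\<^sup>2 = 0" for q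
  proof -
    have q: "q \<in> zeros"
      using that by (simp add: zeros_def)
    have "(\<Sum>p\<in>zeros. c p * zero_bump p q) = (\<Sum>p\<in>zeros. if p = q then c p else 0)"
      by (rule sum.cong) (simp_all add: zero_bump_at_zeros[OF q])
    then show ?thesis
      using q finite_zeros' by simp
  qed
qed (use \<open>\<eta> > 0\<close> that in auto)

text \<open>Once the integral of the square of \<open>b\<close> tends to 0, the expansion reduces
  the limit of any integral to those of the finitely many functions \<open>zero_bump p\<close>. A
  subsequence along which these converge supplies the weights.\<close>

lemma accumulation_at_zeros:
  assumes \<nu>: "\<And>n :: nat. \<nu> n \<in> circle_probs" and b2: "(\<lambda>n. integral\<^sup>L (\<nu> n) (\<lambda>p. (b p)\<^sup>2)) \<longlonglongrightarrow> 0"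
  obtains r w where "strict_mono r" "\<And>p. p \<in> zeros \<Longrightarrow> 0 \<le> w p" "(\<Sum>p\<in>zeros. w p) = 1"
    "\<And>c :: circle \<Rightarrow> real. continuous_on UNIV c \<Longrightarrow> (\<lambda>n. integral\<^sup>L (\<nu> (r n)) c) \<longlonglongrightarrow> (\<Sum>p\<in>zeros. w p * c p)"
proof -
  define u where "u p n = integral\<^sup>L (\<nu> n) (zero_bump p)" for p n
  have "\<exists>B. \<forall>n. \<bar>u p n\<bar> \<le> B" for p
  proof -
    obtain B where B: "B > 0" "\<And>q. \<bar>zero_bump p q\<bar> \<le> B"
      by (rule circle_bounded[OF continuous_zero_bump], rule that)
    have "\<bar>u p n\<bar> \<le> B + 0 * integral\<^sup>L (\<nu> n) (zero_bump p)" for n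
      unfolding u_def by (rule circle_integral_bound[OF \<nu> continuous_zero_bump continuous_zero_bump]) (use B in auto)
    then show ?thesis
      by auto
  qed
  then obtain B where B: "\<And>p n. \<bar>u p n\<bar> \<le> B p"
    by metis
  obtain r w where r: "strict_mono (r :: nat \<Rightarrow> nat)" and w: "\<forall>p\<in>zeros. (\<lambda>n. u p (r n)) \<longlonglongrightarrow> w p"
    using convergent_subsequence_finite[OF finite_zeros', of u B] B by auto
  have lim: "(\<lambda>n. integral\<^sup>L (\<nu> (r n)) c) \<longlonglongrightarrow> (\<Sum>p\<in>zeros. w p * c p)" if c: "continuous_on UNIV c" for c :: "circle \<Rightarrow> real"
  proof -
    have "(\<lambda>n. integral\<^sup>L (\<nu> n) c - (\<Sum>p\<in>zeros. c p * u p n)) \<longlonglongrightarrow> 0"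
    proof (rule LIMSEQ_I)
      fix e :: real
      assume "e > 0"
      then have "e / 2 > 0"
        by simp
      then obtain C where C: "C \<ge> 0" "\<And>q. \<bar>c q - (\<Sum>p\<in>zeros. c p * zero_bump p q)\<bar> \<le> e / 2 + C * (b q)\<^sup>2"
        by (rule zero_expansion[OF c]) (rule that)
      have "(\<lambda>n. e / 2 + C * integral\<^sup>L (\<nu> n) (\<lambda>p. (b p)\<^sup>2)) \<longlonglongrightarrow> e / 2 + C * 0"
        by (intro tendsto_intros b2)
      then have "\<forall>\<^sub>F n in sequentially. e / 2 + C * integral\<^sup>L (\<nu> n) (\<lambda>p. (b p)\<^sup>2) < e"
        by (rule order_tendstoD(2)) (use \<open>e > 0\<close> in simp)
      then obtain m where m: "\<And>n. n \<ge> m \<Longrightarrow> e / 2 + C * integral\<^sup>L (\<nu> n) (\<lambda>p. (b p)\<^sup>2) < e"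
        by (auto simp: eventually_sequentially)
      show "\<exists>m. \<forall>n\<ge>m. norm (integral\<^sup>L (\<nu> n) c - (\<Sum>p\<in>zeros. c p * u p n) - 0) < e"
      proof (intro exI[of _ m] allI impI)
        fix n
        assume "n \<ge> m"
        have cont: "continuous_on UNIV (\<lambda>q. c q - (\<Sum>p\<in>zeros. c p * zero_bump p q))"
          by (intro continuous_intros c continuous_zero_bump)
        have b2c: "continuous_on UNIV (\<lambda>q. (b q)\<^sup>2)"
          by (intro continuous_intros continuous_b)
        have "integral\<^sup>L (\<nu> n) c - (\<Sum>p\<in>zeros. c p * u p n) = integral\<^sup>L (\<nu> n) (\<lambda>q. c q - (\<Sum>p\<in>zeros. c p * zero_bump p q))"
          using circle_integrable[OF \<nu> c] circle_integrable[OF \<nu> continuous_zero_bump] by (simp add: u_def)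
        then show "norm (integral\<^sup>L (\<nu> n) c - (\<Sum>p\<in>zeros. c p * u p n) - 0) < e"
          using circle_integral_bound[OF \<nu>[of n] cont b2c C(2)] m[OF \<open>n \<ge> m\<close>] by simp
      qed
    qed
    from LIMSEQ_subseq_LIMSEQ[OF this r]
    have "(\<lambda>n. integral\<^sup>L (\<nu> (r n)) c - (\<Sum>p\<in>zeros. c p * u p (r n))) \<longlonglongrightarrow> 0"
      by (simp add: o_def)
    moreover have "(\<lambda>n. \<Sum>p\<in>zeros. c p * u p (r n)) \<longlonglongrightarrow> (\<Sum>p\<in>zeros. c p * w p)"
      using w by (intro tendsto_sum tendsto_mult_left) auto
    ultimately have "(\<lambda>n. (integral\<^sup>L (\<nu> (r n)) c - (\<Sum>p\<in>zeros. c p * u p (r n))) + (\<Sum>p\<in>zeros. c p * u p (r n))) \<longlonglongrightarrow> 0 + (\<Sum>p\<in>zeros. c p * w p)"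
      by (rule tendsto_add)
    then show ?thesis
      by (simp add: mult.commute)
  qed
  show ?thesis
  proof (rule that[OF r _ _ lim])
    show "0 \<le> w p" if "p \<in> zeros" for p
      by (rule LIMSEQ_le_const[OF bspec[OF w that]]) (auto simp: u_def zero_bump_nonneg)
    have "integral\<^sup>L (\<nu> n) (\<lambda>_. 1) = (1 :: real)" for n
      using \<nu>[of n] by (simp add: circle_probs_def prob_space.prob_space)
    moreover have "(\<lambda>n. integral\<^sup>L (\<nu> (r n)) (\<lambda>_. 1 :: real)) \<longlonglongrightarrow> (\<Sum>p\<in>zeros. w p * 1)"
      by (rule lim) (rule continuous_on_const)
    ultimately have "(\<lambda>n :: nat. 1 :: real) \<longlonglongrightarrow> (\<Sum>p\<in>zeros. w p)"
      by simp
    then show "(\<Sum>p\<in>zeros. w p) = 1"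
      by (rule LIMSEQ_unique[OF _ tendsto_const])
  qed
qed

text \<open>For \<open>c = K * b\<^sup>2\<close> the limit eigenvalue is at most 0, so a finite rate
  for all \<open>K\<close> forces the integral of the square of \<open>b\<close> to vanish.
  Accumulation along the constant sequence then yields the weights, and the test function
  \<open>escape\<close>, whose limit eigenvalue is at most 0 as well, gives the lower bound.\<close>

lemma mixture_if_rate_finite:
  assumes \<mu>: "\<mu> \<in> circle_probs" and fin: "rate_function a b \<mu> \<noteq> \<infinity>"
  obtains w where "mixture w \<mu>" "ereal (\<Sum>p\<in>zeros. w p * escape p) \<le> rate_function a b \<mu>"
proof -
  have b2c: "continuous_on UNIV (\<lambda>q. K * (b q)\<^sup>2)" for K
    by (intro continuous_intros continuous_b)
  have \<Lambda>0: "\<Lambda> (\<lambda>q. K * (b q)\<^sup>2) \<le> 0" for K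
    by (auto simp: \<Lambda>_le_iff zeros_def escape_nonneg)
  define I where "I = integral\<^sup>L \<mu> (\<lambda>q. (b q)\<^sup>2)"
  have I: "I \<ge> 0"
    by (simp add: I_def)
  have le: "ereal (K * I) \<le> rate_function a b \<mu>" for K
  proof -
    have "ereal (K * I) \<le> ereal (integral\<^sup>L \<mu> (\<lambda>q. K * (b q)\<^sup>2) - \<Lambda> (\<lambda>q. K * (b q)\<^sup>2))"
      using \<Lambda>0[of K] by (simp add: I_def)
    also have "\<dots> \<le> rate_function a b \<mu>"
      by (rule rate_function_ge[OF b2c])
    finally show ?thesis .
  qed
  have "rate_function a b \<mu> \<noteq> -\<infinity>"
    using le[of 0] by auto
  then obtain R where R: "rate_function a b \<mu> = ereal R"
    using fin by (cases "rate_function a b \<mu>") auto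
  have "I = 0"
  proof (rule ccontr)
    assume "I \<noteq> 0"
    then have "(R + 1) / I * I = R + 1"
      by simp
    then show False
      using le[of "(R + 1) / I"] by (simp add: R)
  qed
  then have lim0: "(\<lambda>n :: nat. integral\<^sup>L \<mu> (\<lambda>p. (b p)\<^sup>2)) \<longlonglongrightarrow> 0"
    by (simp add: I_def)
  show ?thesis
  proof (rule accumulation_at_zeros[OF \<mu> lim0], goal_cases)
    case (1 r w)
    have mix: "mixture w \<mu>"
      using 1(2,3) LIMSEQ_unique[OF tendsto_const 1(4)] by (simp add: mixture_def)
    have "\<Lambda> escape \<le> 0"
      by (simp add: \<Lambda>_le_iff)
    then have "ereal (\<Sum>p\<in>zeros. w p * escape p) \<le> ereal (integral\<^sup>L \<mu> escape - \<Lambda> escape)"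
      by (simp add: mixtureD(3)[OF mix continuous_escape])
    then show ?case
      using that[OF mix] order_trans[OF _ rate_function_ge[OF continuous_escape]] by blast
  qed
qed

text \<open>Reduces membership in a closed set to two scalar inequalities. Were this to fail for
  every \<eta>, measures in \<open>Cl\<close> would accumulate at a mixture; it lies in
  \<open>Cl\<close> by closedness, yet its rate is at most its integral of \<open>escape\<close>,
  which is at most \<alpha>.\<close>

lemma closed_separation:
  assumes Cl: "closedin weak_topology Cl" and \<alpha>: "ereal \<alpha> < (INF \<mu>\<in>Cl. rate_function a b \<mu>)"
  shows "\<exists>\<eta>>0. \<forall>\<mu>\<in>Cl. \<eta> < integral\<^sup>L \<mu> (\<lambda>p. (b p)\<^sup>2) \<or> \<alpha> < integral\<^sup>L \<mu> escape"
proof (rule ccontr)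
  assume "\<not> ?thesis"
  then have "\<exists>\<mu>\<in>Cl. integral\<^sup>L \<mu> (\<lambda>p. (b p)\<^sup>2) \<le> \<eta> \<and> integral\<^sup>L \<mu> escape \<le> \<alpha>" if "\<eta> > 0" for \<eta>
    using that by (force simp: not_less)
  then have "\<forall>n :: nat. \<exists>\<mu>. \<mu> \<in> Cl \<and> integral\<^sup>L \<mu> (\<lambda>p. (b p)\<^sup>2) \<le> 1 / (real n + 1) \<and> integral\<^sup>L \<mu> escape \<le> \<alpha>"
    by (simp add: Bex_def)
  then obtain \<nu> where \<nu>: "\<And>n :: nat. \<nu> n \<in> Cl" "\<And>n. integral\<^sup>L (\<nu> n) (\<lambda>p. (b p)\<^sup>2) \<le> 1 / (real n + 1)" "\<And>n. integral\<^sup>L (\<nu> n) escape \<le> \<alpha>"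
    by metis
  have \<nu>P: "\<nu> n \<in> circle_probs" for n
    using closedin_subset[OF Cl] \<nu>(1) by (auto simp: topspace_weak_topology)
  have "(\<lambda>n. 1 / (real n + 1)) \<longlonglongrightarrow> 0"
    by real_asymp
  then have lim0: "(\<lambda>n. integral\<^sup>L (\<nu> n) (\<lambda>p. (b p)\<^sup>2)) \<longlonglongrightarrow> 0"
    by (rule tendsto_sandwich[OF _ _ tendsto_const, rotated 2]) (auto intro!: always_eventually \<nu>(2))
  show False
  proof (rule accumulation_at_zeros[OF \<nu>P lim0], goal_cases)
    case (1 r w)
    show False
    proof (rule mixture_exists[OF 1(2,3)])
      fix \<mu>
      assume \<mu>: "\<mu> \<in> circle_probs" and mix: "mixture w \<mu>"
      have lim: "(\<lambda>n. integral\<^sup>L (\<nu> (r n)) c) \<longlonglongrightarrow> integral\<^sup>L \<mu> c" if "continuous_on UNIV c" for c :: "circle \<Rightarrow> real"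
        using 1(4)[OF that] by (simp add: mixtureD(3)[OF mix that])
      have "\<mu> \<notin> Cl"
      proof
        assume "\<mu> \<in> Cl"
        then have "ereal \<alpha> < rate_function a b \<mu>"
          by (rule less_le_trans[OF \<alpha> INF_lower])
        also have "\<dots> \<le> ereal (\<Sum>p\<in>zeros. w p * escape p)"
          by (rule rate_function_mixture_le[OF mix])
        also have "(\<Sum>p\<in>zeros. w p * escape p) = integral\<^sup>L \<mu> escape"
          by (simp add: mixtureD(3)[OF mix continuous_escape])
        also have "integral\<^sup>L \<mu> escape \<le> \<alpha>"
          by (rule LIMSEQ_le_const2[OF lim[OF continuous_escape]]) (use \<nu>(3) in auto)
        finally show False
          by simp
      qed
      have "openin weak_topology (circle_probs - Cl)"
        using Cl by (simp add: closedin_def topspace_weak_topology)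
      then have "\<forall>\<^sub>F n in sequentially. \<nu> (r n) \<in> circle_probs - Cl"
        using \<mu> \<open>\<mu> \<notin> Cl\<close> by (intro weak_open_sequentially[where \<mu> = \<mu>] \<nu>P lim) auto
      then show False
        using \<nu>(1) by simp
    qed
  qed
qed

end


lemma Limsup_log_probability_le:
  fixes q :: "real \<Rightarrow> real"
  assumes le: "\<And>T. T > 0 \<Longrightarrow> q T \<le> C * exp (r * T)" and q: "\<And>T. q T \<ge> 0" and "C > 0"
  shows "Limsup at_top (\<lambda>T. ereal (1 / T) * eln (q T)) \<le> ereal r"
proof -
  have "((\<lambda>T. ereal (ln C / T + r)) \<longlongrightarrow> ereal (0 + r)) at_top"
    by (intro tendsto_intros tendsto_ereal) real_asymp
  then have "Limsup at_top (\<lambda>T. ereal (ln C / T + r)) = ereal r"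
    by (intro lim_imp_Limsup) auto
  moreover have "\<forall>\<^sub>F T in at_top. ereal (1 / T) * eln (q T) \<le> ereal (ln C / T + r)"
    using eventually_gt_at_top[of 0]
  proof eventually_elim
    case (elim T)
    show ?case
    proof (cases "q T = 0")
      case False
      then have "ln (q T) \<le> ln (C * exp (r * T))"
        using le[of T] q[of T] elim \<open>C > 0\<close> by (subst ln_le_cancel_iff) auto
      also have "\<dots> = ln C + r * T"
        using \<open>C > 0\<close> by (simp add: ln_mult)
      finally have "1 / T * ln (q T) \<le> 1 / T * (ln C + r * T)"
        using elim by (intro mult_left_mono) auto
      also have "\<dots> = ln C / T + r"
        using elim by (simp add: field_simps)
      finally show ?thesis
        using False by (simp add: eln_def)
    qed (use elim in \<open>simp add: eln_def\<close>)
  qed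
  ultimately show ?thesis
    using Limsup_mono by metis
qed

lemma Liminf_log_probability_ge:
  fixes q :: "real \<Rightarrow> real"
  assumes ge: "\<And>T. T \<ge> T0 \<Longrightarrow> C * exp (r * T) \<le> q T" and "C > 0"
  shows "ereal r \<le> Liminf at_top (\<lambda>T. ereal (1 / T) * eln (q T))"
proof -
  have "((\<lambda>T. ereal (ln C / T + r)) \<longlongrightarrow> ereal (0 + r)) at_top"
    by (intro tendsto_intros tendsto_ereal) real_asymp
  then have "Liminf at_top (\<lambda>T. ereal (ln C / T + r)) = ereal r"
    by (intro lim_imp_Liminf) auto
  moreover have "\<forall>\<^sub>F T in at_top. ereal (ln C / T + r) \<le> ereal (1 / T) * eln (q T)"
    using eventually_gt_at_top[of 0] eventually_ge_at_top[of T0]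
  proof eventually_elim
    case (elim T)
    have pos: "0 < C * exp (r * T)"
      using \<open>C > 0\<close> by simp
    have "ln C + r * T = ln (C * exp (r * T))"
      using \<open>C > 0\<close> by (simp add: ln_mult)
    also have "\<dots> \<le> ln (q T)"
      using pos ge[OF elim(2)] by (subst ln_le_cancel_iff) auto
    finally have "1 / T * (ln C + r * T) \<le> 1 / T * ln (q T)"
      using elim by (intro mult_left_mono) auto
    moreover have "1 / T * (ln C + r * T) = ln C / T + r"
      using elim by (simp add: field_simps)
    moreover have "q T \<noteq> 0"
      using pos ge[OF elim(2)] by linarith
    ultimately show ?case
      by (simp add: eln_def)
  qed
  ultimately show ?thesis
    using Liminf_mono by metis
qed

section \<open>Empirical measures and the upper bound\<close>

context small_noise
begin

lemma uniform_time:
  fixes T :: real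
  assumes "T > 0"
  shows "prob_space (uniform_measure (restrict_space lborel {0..T}) {0..T})"
proof -
  have "emeasure (restrict_space lborel {0..T}) {0..T} = ennreal T"
    using assms by (simp add: emeasure_restrict_space)
  then show ?thesis
    using assms by (intro prob_space_uniform_measure) simp_all
qed

lemma X_uniform_measurable:
  assumes "\<epsilon> > 0" "\<omega> \<in> space M"
  shows "(\<lambda>t. X \<epsilon> t \<omega>) \<in> uniform_measure (restrict_space lborel {0..T}) {0..T} \<rightarrow>\<^sub>M borel"
proof -
  have "(\<lambda>t. X \<epsilon> t \<omega>) \<in> restrict_space borel {0..T} \<rightarrow>\<^sub>M borel"
    by (rule borel_measurable_continuous_on_restrict[OF continuous_on_subset[OF X_continuous[OF assms]]]) auto
  then show ?thesis
    by (simp cong: measurable_cong_sets sets_restrict_space_cong)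
qed

lemma empirical_probability:
  assumes "\<epsilon> > 0" "\<omega> \<in> space M" "T > 0"
  shows "empirical_measure (X \<epsilon>) T \<omega> \<in> circle_probs"
  using prob_space.prob_space_distr[OF uniform_time[OF assms(3)] X_uniform_measurable[OF assms(1,2)]]
  by (simp add: empirical_measure_def circle_probs_def)

lemma empirical_integral:
  assumes "\<epsilon> > 0" "\<omega> \<in> space M" "T > 0" and c: "continuous_on UNIV c"
  shows "integral\<^sup>L (empirical_measure (X \<epsilon>) T \<omega>) c = occ \<epsilon> c 0 T \<omega> / T"
proof -
  let ?N = "restrict_space lborel {0..T}"
  have N: "emeasure ?N {0..T} = ennreal T"
    using assms(3) by (simp add: emeasure_restrict_space)
  have cont: "continuous_on {0..T} (\<lambda>t. c (X \<epsilon> t \<omega>))"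
    by (rule continuous_on_subset[OF c_X_continuous[OF c assms(1,2)]]) auto
  then have meas: "(\<lambda>t. c (X \<epsilon> t \<omega>)) \<in> borel_measurable ?N"
    using borel_measurable_continuous_on_restrict[OF cont] by (simp cong: measurable_cong_sets sets_restrict_space_cong)
  have "{0..T} \<in> sets ?N"
    by (simp add: sets_restrict_space_iff)
  then have ind: "(indicator {0..T} :: real \<Rightarrow> ennreal) \<in> borel_measurable ?N"
    by (rule borel_measurable_indicator)
  have unif: "uniform_measure ?N {0..T} = density ?N (\<lambda>t. ennreal (1 / T))"
    unfolding uniform_measure_def N
  proof (rule density_cong)
    show "AE t in ?N. indicator {0..T} t / ennreal T = ennreal (1 / T)"
      using assms(3) by (intro AE_I2) (auto simp: space_restrict_space simp flip: divide_ennreal)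
  qed (use ind in auto)
  have "integral\<^sup>L (empirical_measure (X \<epsilon>) T \<omega>) c = integral\<^sup>L (uniform_measure ?N {0..T}) (\<lambda>t. c (X \<epsilon> t \<omega>))"
    unfolding empirical_measure_def
    by (rule integral_distr[OF X_uniform_measurable[OF assms(1,2)] borel_measurable_continuous_onI[OF c]])
  also have "\<dots> = integral\<^sup>L ?N (\<lambda>t. 1 / T * c (X \<epsilon> t \<omega>))"
    unfolding unif by (subst integral_density) (use meas assms(3) in auto)
  also have "\<dots> = (LINT t:{0..T}|lborel. c (X \<epsilon> t \<omega>) / T)"
    by (subst integral_restrict_space) (auto simp: set_lebesgue_integral_def)
  also have "\<dots> = integral {0..T} (\<lambda>t. c (X \<epsilon> t \<omega>) / T)"
    using cont assms(3) by (intro set_borel_integral_eq_integral(2) borel_integrable_atLeastAtMost' continuous_intros) auto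
  finally show ?thesis
    by (simp add: occ_def)
qed

text \<open>The coordinates of the empirical measure are occupation integrals divided by
  \<open>T\<close>, hence random variables, and a weakly open set is the preimage of an open set
  under countably many of them.\<close>

lemma empirical_event:
  assumes "\<epsilon> > 0" "T > 0" "openin weak_topology S"
  shows "{\<omega> \<in> space M. empirical_measure (X \<epsilon>) T \<omega> \<in> S} \<in> sets M"
proof -
  obtain V where V: "open V" "S = {\<mu> \<in> circle_probs. coordinates \<mu> \<in> V}"
    using weak_open_coordinates[OF assms(3)] by blast
  have "(\<lambda>\<omega>. coordinates (empirical_measure (X \<epsilon>) T \<omega>)) \<in> borel_measurable M"
  proof (rule measurable_coordinatewise_then_product)
    fix i :: "nat \<times> nat"
    obtain n k where i: "i = (n, k)"
      by (cases i)
    have h: "continuous_on UNIV (hat (Suc n) k)"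
      by (rule continuous_hat) simp
    have "occ \<epsilon> (hat (Suc n) k) 0 T \<in> borel_measurable M"
      by (rule F_measurable[OF occ_measurable[OF h assms(1)]]) (use assms in auto)
    then have "(\<lambda>\<omega>. occ \<epsilon> (hat (Suc n) k) 0 T \<omega> / T) \<in> borel_measurable M"
      by measurable
    then show "(\<lambda>\<omega>. coordinates (empirical_measure (X \<epsilon>) T \<omega>) i) \<in> borel_measurable M"
      by (subst measurable_cong[where g = "\<lambda>\<omega>. occ \<epsilon> (hat (Suc n) k) 0 T \<omega> / T"])
        (use assms h in \<open>auto simp: i coordinates_def empirical_integral\<close>)
  qed
  from measurable_sets[OF this borel_open[OF V(1)]]
  have "(\<lambda>\<omega>. coordinates (empirical_measure (X \<epsilon>) T \<omega>)) -` V \<inter> space M \<in> sets M" .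
  also have "(\<lambda>\<omega>. coordinates (empirical_measure (X \<epsilon>) T \<omega>)) -` V \<inter> space M = {\<omega> \<in> space M. empirical_measure (X \<epsilon>) T \<omega> \<in> S}"
    using empirical_probability[OF assms(1) _ assms(2)] by (auto simp: V(2))
  finally show ?thesis .
qed

text \<open>Exponential Chebyshev inequality; as \<open>\<Lambda> c \<le> 0\<close>, the exponential
  moment grows at most at rate \<delta>.\<close>

lemma eventually_occ_tail:
  assumes c: "continuous_on UNIV c" and "\<Lambda> c \<le> 0" and "\<delta> > 0"
  shows "\<forall>\<^sub>F \<epsilon> in at_right 0. \<exists>C>0. \<forall>T\<ge>0. \<forall>\<gamma>.
    prob {\<omega> \<in> space M. \<gamma> * T \<le> occ \<epsilon> c 0 T \<omega>} \<le> C * exp ((\<delta> - \<gamma>) * T)"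
  using eventually_tilted[OF c assms(3)] eventually_at_right_less
proof eventually_elim
  case (elim \<epsilon>)
  then obtain \<kappa> where \<kappa>: "exp_moments \<epsilon> c \<kappa> (\<Lambda> c - \<delta>) (\<Lambda> c + \<delta>)"
    by blast
  then have "\<kappa> > 0"
    by (simp add: exp_moments_def)
  show ?case
  proof (intro exI[of _ "1 / \<kappa>"] conjI allI impI)
    fix T \<gamma> :: real
    assume T: "T \<ge> 0"
    let ?B = "{\<omega> \<in> space M. \<gamma> * T \<le> occ \<epsilon> c 0 T \<omega>}"
    have sp: "space M \<in> sets (F 0)"
      using sets.top[of "F 0"] by (simp add: space_F)
    note * = exp_momentsD[OF \<kappa> order_refl T sp]
    have B: "?B \<in> sets M"
      using F_measurable[OF occ_measurable[OF c elim(2) order_refl T]] by measurable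
    have "prob ?B * exp (\<gamma> * T) = expectation (\<lambda>\<omega>. indicator ?B \<omega> * exp (\<gamma> * T))"
      using B by simp
    also have "\<dots> \<le> expectation (\<lambda>\<omega>. indicator (space M) \<omega> * exp (occ \<epsilon> c 0 T \<omega>))"
    proof (rule integral_mono)
      show "integrable M (\<lambda>\<omega>. indicator ?B \<omega> * exp (\<gamma> * T))"
        using B by (simp add: less_top[symmetric])
    qed (use *(1) in \<open>auto simp: indicator_def\<close>)
    also have "\<dots> \<le> exp ((\<Lambda> c + \<delta>) * (T - 0)) * prob (space M) / \<kappa>"
      by (rule *(3))
    also have "\<dots> \<le> exp (\<delta> * T) / \<kappa>"
      using \<open>\<Lambda> c \<le> 0\<close> \<open>\<kappa> > 0\<close> T by (auto simp: prob_space intro!: divide_right_mono mult_right_mono)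
    finally have "prob ?B \<le> exp (\<delta> * T) / \<kappa> / exp (\<gamma> * T)"
      by (subst pos_le_divide_eq) auto
    also have "\<dots> = 1 / \<kappa> * exp ((\<delta> - \<gamma>) * T)"
      by (simp add: left_diff_distrib exp_diff)
    finally show "prob ?B \<le> 1 / \<kappa> * exp ((\<delta> - \<gamma>) * T)" .
  qed (use \<open>\<kappa> > 0\<close> in simp)
qed

lemma upper_bound:
  assumes Cl: "closedin weak_topology Cl"
  shows "Limsup (at_right 0) (\<lambda>\<epsilon>. Limsup at_top (\<lambda>T::real.
        ereal (1 / T) * eln (prob {\<omega>\<in>space M. empirical_measure (X \<epsilon>) T \<omega> \<in> Cl})))
      \<le> - (INF \<mu>\<in>Cl. rate_function a b \<mu>)"
    (is "?L \<le> - ?I")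
proof -
  have main: "?L \<le> ereal (\<delta> - \<alpha>)" if \<alpha>: "ereal \<alpha> < ?I" and "\<delta> > 0" for \<alpha> \<delta> :: real
  proof -
    obtain \<eta> where "\<eta> > 0" and \<eta>: "\<And>\<mu>. \<mu> \<in> Cl \<Longrightarrow> \<eta> < integral\<^sup>L \<mu> (\<lambda>p. (b p)\<^sup>2) \<or> \<alpha> < integral\<^sup>L \<mu> escape"
      using closed_separation[OF Cl \<alpha>] by blast
    \<comment> \<open>Makes an excess over \<eta> of the mean square drift cost the rate
      \<open>\<bar>\<alpha>\<bar> \<ge> \<alpha>\<close>, so that this event decays at least as fast
      as the other one. The absolute value keeps \<open>K\<close> nonnegative when \<alpha> is
      negative.\<close>
    define K where "K = \<bar>\<alpha>\<bar> / \<eta>"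
    have K: "K \<ge> 0" "K * \<eta> = \<bar>\<alpha>\<bar>"
      using \<open>\<eta> > 0\<close> by (auto simp: K_def)
    have b2: "continuous_on UNIV (\<lambda>p. K * (b p)\<^sup>2)" "continuous_on UNIV (\<lambda>p. (b p)\<^sup>2)"
      by (intro continuous_intros continuous_b)+
    have "\<Lambda> (\<lambda>p. K * (b p)\<^sup>2) \<le> 0" "\<Lambda> escape \<le> 0"
      by (auto simp: \<Lambda>_le_iff zeros_def escape_nonneg)
    note tails = eventually_occ_tail[OF b2(1) this(1) \<open>\<delta> > 0\<close>] eventually_occ_tail[OF continuous_escape this(2) \<open>\<delta> > 0\<close>]
    show ?thesis
    proof (rule Limsup_bounded)
      show "\<forall>\<^sub>F \<epsilon> in at_right 0. Limsup at_top (\<lambda>T::real.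
        ereal (1 / T) * eln (prob {\<omega>\<in>space M. empirical_measure (X \<epsilon>) T \<omega> \<in> Cl})) \<le> ereal (\<delta> - \<alpha>)"
        using tails eventually_at_right_less
      proof eventually_elim
        case (elim \<epsilon>)
        obtain C1 where C1: "C1 > 0" "\<forall>T\<ge>0. \<forall>\<gamma>. prob {\<omega> \<in> space M. \<gamma> * T \<le> occ \<epsilon> (\<lambda>p. K * (b p)\<^sup>2) 0 T \<omega>} \<le> C1 * exp ((\<delta> - \<gamma>) * T)"
          using elim(1) by (elim exE conjE)
        obtain C2 where C2: "C2 > 0" "\<forall>T\<ge>0. \<forall>\<gamma>. prob {\<omega> \<in> space M. \<gamma> * T \<le> occ \<epsilon> escape 0 T \<omega>} \<le> C2 * exp ((\<delta> - \<gamma>) * T)"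
          using elim(2) by (elim exE conjE)
        show ?case
        proof (rule Limsup_log_probability_le)
          show "C1 + C2 > 0"
            using C1 C2 by simp
          fix T :: real
          assume T: "T > 0"
          then have "T \<ge> 0"
            by simp
          let ?A = "{\<omega>\<in>space M. empirical_measure (X \<epsilon>) T \<omega> \<in> Cl}"
          let ?B = "{\<omega> \<in> space M. \<bar>\<alpha>\<bar> * T \<le> occ \<epsilon> (\<lambda>p. K * (b p)\<^sup>2) 0 T \<omega>}"
          let ?D = "{\<omega> \<in> space M. \<alpha> * T \<le> occ \<epsilon> escape 0 T \<omega>}"
          have BD: "?B \<in> sets M" "?D \<in> sets M"
            using F_measurable[OF occ_measurable[OF b2(1) elim(3) order_refl \<open>T \<ge> 0\<close>]]
              F_measurable[OF occ_measurable[OF continuous_escape elim(3) order_refl \<open>T \<ge> 0\<close>]] by measurable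
          have sub: "?A \<subseteq> ?B \<union> ?D"
          proof
            fix \<omega>
            assume "\<omega> \<in> ?A"
            then have \<omega>: "\<omega> \<in> space M" and "\<eta> < occ \<epsilon> (\<lambda>p. (b p)\<^sup>2) 0 T \<omega> / T \<or> \<alpha> < occ \<epsilon> escape 0 T \<omega> / T"
              using \<eta>[of "empirical_measure (X \<epsilon>) T \<omega>"] elim(3) T b2 continuous_escape by (auto simp: empirical_integral)
            then have "\<eta> * T \<le> occ \<epsilon> (\<lambda>p. (b p)\<^sup>2) 0 T \<omega> \<or> \<alpha> * T \<le> occ \<epsilon> escape 0 T \<omega>"
              using T by (auto simp: pos_less_divide_eq)
            moreover have "\<bar>\<alpha>\<bar> * T \<le> occ \<epsilon> (\<lambda>p. K * (b p)\<^sup>2) 0 T \<omega>" if "\<eta> * T \<le> occ \<epsilon> (\<lambda>p. (b p)\<^sup>2) 0 T \<omega>"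
              using mult_left_mono[OF that K(1)] by (simp add: occ_def K(2) flip: mult.assoc)
            ultimately show "\<omega> \<in> ?B \<union> ?D"
              using \<omega> by blast
          qed
          \<comment> \<open>Monotonicity asks for measurability of the larger set, which is a union
            of two events about occupation integrals.\<close>
          have "prob ?A \<le> prob (?B \<union> ?D)"
            by (rule finite_measure_mono[OF sub]) (use BD in auto)
          also have "\<dots> \<le> prob ?B + prob ?D"
            by (rule measure_Un_le[OF BD])
          also have "\<dots> \<le> C1 * exp ((\<delta> - \<bar>\<alpha>\<bar>) * T) + C2 * exp ((\<delta> - \<alpha>) * T)"
            using C1(2) C2(2) \<open>T \<ge> 0\<close> by (intro add_mono) auto
          also have "\<dots> \<le> C1 * exp ((\<delta> - \<alpha>) * T) + C2 * exp ((\<delta> - \<alpha>) * T)"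
            using C1(1) T by (intro add_mono mult_left_mono order_refl) auto
          also have "\<dots> \<le> (C1 + C2) * exp ((\<delta> - \<alpha>) * T)"
            by (simp add: distrib_right)
          finally show "prob ?A \<le> (C1 + C2) * exp ((\<delta> - \<alpha>) * T)" .
        qed simp
      qed
    qed
  qed
  \<comment> \<open>The infimum may be infinite, so the bound is first proved for all real \<alpha>
    below it and then passed to the limit in the extended reals.\<close>
  have "?I \<le> - ?L"
  proof (rule dense_le)
    fix z :: ereal
    assume z: "z < ?I"
    show "z \<le> - ?L"
    proof (cases z)
      case (real \<alpha>)
      have "?L \<le> ereal (- \<alpha>)"
      proof (rule ereal_le_epsilon2)
        fix e :: real
        assume "e > 0"
        then show "?L \<le> ereal (- \<alpha>) + ereal e"
          using main[of \<alpha> e] z real by simp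
      qed
      then show ?thesis
        by (subst ereal_minus_le_minus[symmetric]) (simp add: real)
    qed (use z in auto)
  qed
  then show ?thesis
    by (subst ereal_minus_le_minus[symmetric]) simp
qed

end


section \<open>The lower bound\<close>

context circle_field
begin

text \<open>A single pair of constants for all zeros, so that an estimate can be uniform over the
  class of functions sharing it.\<close>

definition modulus :: "(circle \<Rightarrow> real) \<Rightarrow> real \<Rightarrow> real \<Rightarrow> bool"
  where "modulus c \<eta> K \<longleftrightarrow> continuous_on UNIV c \<and> 0 \<le> K \<and>
    (\<forall>p\<in>zeros. \<forall>q. \<bar>c q - c p\<bar> \<le> \<eta> + K * circle_sinsq p q)"

text \<open>Quantifies over all test functions at once: a single event will keep the empirical
  measure near the mixture for every one of them.\<close>

definition near :: "(circle \<Rightarrow> real) \<Rightarrow> real \<Rightarrow> circle measure \<Rightarrow> bool"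
  where "near w \<delta> \<nu> \<longleftrightarrow> \<nu> \<in> circle_probs \<and>
    (\<forall>c \<eta> K. modulus c \<eta> K \<longrightarrow> \<bar>integral\<^sup>L \<nu> c - (\<Sum>p\<in>zeros. w p * c p)\<bar> \<le> \<eta> + K * \<delta>)"

text \<open>Measures outside \<open>S\<close> that are near with \<delta> = 1/(n+1) would converge
  weakly to \<mu>, because each continuous function has a modulus with arbitrarily small first
  constant.\<close>

lemma open_neighbourhood:
  assumes S: "openin weak_topology S" "\<mu> \<in> S" and mix: "mixture w \<mu>"
  obtains \<delta> where "\<delta> > 0" "\<And>\<nu>. near w \<delta> \<nu> \<Longrightarrow> \<nu> \<in> S"
proof -
  have "\<exists>n :: nat. \<forall>\<nu>. near w (1 / (real n + 1)) \<nu> \<longrightarrow> \<nu> \<in> S"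
  proof (rule ccontr)
    assume "\<not> ?thesis"
    then have "\<forall>n :: nat. \<exists>\<nu>. near w (1 / (real n + 1)) \<nu> \<and> \<nu> \<notin> S"
      by auto
    then obtain \<nu> where \<nu>: "\<forall>n :: nat. near w (1 / (real n + 1)) (\<nu> n) \<and> \<nu> n \<notin> S"
      by (auto dest!: choice)
    have "\<forall>\<^sub>F n in sequentially. \<nu> n \<in> S"
    proof (rule weak_open_sequentially[OF S])
      fix c :: "circle \<Rightarrow> real"
      assume c: "continuous_on UNIV c"
      show "(\<lambda>n. integral\<^sup>L (\<nu> n) c) \<longlonglongrightarrow> integral\<^sup>L \<mu> c"
      proof (rule LIMSEQ_I)
        fix e :: real
        assume "e > 0"
        have "\<forall>p. \<exists>K\<ge>0. \<forall>q. \<bar>c q - c p\<bar> \<le> e / 2 + K * circle_sinsq p q"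
        proof
          fix p
          show "\<exists>K\<ge>0. \<forall>q. \<bar>c q - c p\<bar> \<le> e / 2 + K * circle_sinsq p q"
            by (rule modulus_at_point[OF c, of "e / 2" p]) (use \<open>e > 0\<close> in auto)
        qed
        then obtain k where k: "\<forall>p. k p \<ge> 0 \<and> (\<forall>q. \<bar>c q - c p\<bar> \<le> e / 2 + k p * circle_sinsq p q)"
          by (auto dest!: choice)
        define K where "K = (\<Sum>p\<in>zeros. k p)"
        have kK: "k p \<le> K" if "p \<in> zeros" for p
          unfolding K_def using that k finite_zeros' by (intro member_le_sum) auto
        have K: "K \<ge> 0"
          unfolding K_def using k by (intro sum_nonneg) auto
        have "\<bar>c q - c p\<bar> \<le> e / 2 + K * circle_sinsq p q" if "p \<in> zeros" for p q
          using spec[OF conjunct2[OF spec[OF k, of p]], of q] mult_right_mono[OF kK[OF that] circle_sinsq_range(1), of p q] by linarith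
        then have modulus: "modulus c (e / 2) K"
          using c K by (simp add: modulus_def)
        have "(\<lambda>n. e / 2 + K * (1 / (real n + 1))) \<longlonglongrightarrow> e / 2"
          by real_asymp
        then have "\<forall>\<^sub>F n in sequentially. e / 2 + K * (1 / (real n + 1)) < e"
          by (rule order_tendstoD(2)) (use \<open>e > 0\<close> in simp)
        then obtain m where m: "\<forall>n\<ge>m. e / 2 + K * (1 / (real n + 1)) < e"
          by (auto simp: eventually_sequentially)
        have "norm (integral\<^sup>L (\<nu> n) c - integral\<^sup>L \<mu> c) \<le> e / 2 + K * (1 / (real n + 1))" for n
          using \<nu>[rule_format, of n, unfolded near_def] modulus mixtureD(3)[OF mix c] by simp
        then show "\<exists>m. \<forall>n\<ge>m. norm (integral\<^sup>L (\<nu> n) c - integral\<^sup>L \<mu> c) < e"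
          using m by (meson le_less_trans)
      qed
    qed (use \<nu> in \<open>auto simp: near_def\<close>)
    then show False
      using \<nu> by simp
  qed
  then obtain n :: nat where "\<forall>\<nu>. near w (1 / (real n + 1)) \<nu> \<longrightarrow> \<nu> \<in> S"
    by blast
  then show ?thesis
    by (intro that[of "1 / (real n + 1)"]) auto
qed

end

context small_noise
begin

lemma occ_affine:
  assumes "continuous_on UNIV g" "\<epsilon> > 0" "\<omega> \<in> space M" "0 \<le> s" "0 \<le> l"
  shows "occ \<epsilon> (\<lambda>q. r + K * g q) s (s + l) \<omega> = r * l + K * occ \<epsilon> g s (s + l) \<omega>"
proof -
  have "integral {s..s + l} (\<lambda>t. r + K * g (X \<epsilon> t \<omega>)) = integral {s..s + l} (\<lambda>t. r) + integral {s..s + l} (\<lambda>t. K * g (X \<epsilon> t \<omega>))"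
    by (rule Henstock_Kurzweil_Integration.integral_add)
      (use c_X_integrable[OF assms(1-4), of "s + l"] in \<open>auto intro: integrable_on_mult_right\<close>)
  then show ?thesis
    using assms(5) by (simp add: occ_def mult.commute)
qed

lemma occ_deviation:
  assumes c: "continuous_on UNIV c" and g: "continuous_on UNIV g" and le: "\<And>q. \<bar>c q - \<gamma>\<bar> \<le> \<eta> + K * g q"
    and st: "\<epsilon> > 0" "\<omega> \<in> space M" "0 \<le> s" "0 \<le> l"
  shows "\<bar>occ \<epsilon> c s (s + l) \<omega> - \<gamma> * l\<bar> \<le> \<eta> * l + K * occ \<epsilon> g s (s + l) \<omega>"
proof -
  have cont: "continuous_on UNIV (\<lambda>q. r + k * g q)" for r k
    by (intro continuous_intros g)
  have "occ \<epsilon> c s (s + l) \<omega> \<le> occ \<epsilon> (\<lambda>q. (\<gamma> + \<eta>) + K * g q) s (s + l) \<omega>"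
    by (rule occ_mono[OF c cont st(1-3)]) (use le in \<open>simp add: abs_le_iff algebra_simps\<close>)
  moreover have "occ \<epsilon> (\<lambda>q. (\<gamma> - \<eta>) + (- K) * g q) s (s + l) \<omega> \<le> occ \<epsilon> c s (s + l) \<omega>"
    by (rule occ_mono[OF cont c st(1-3)]) (use le in \<open>simp add: abs_le_iff algebra_simps\<close>)
  ultimately show ?thesis
    unfolding occ_affine[OF g st] by (simp add: abs_le_iff algebra_simps)
qed

text \<open>
  Penalising the distance to \<open>p\<close> costs at most the rate \<open>escape p\<close>; a strong enough penalty then
  forces the occupation of the complement of \<open>p\<close> to be small at essentially no further cost.
\<close>

lemma eventually_stay:
  assumes p: "p \<in> zeros" and "\<theta> > 0" "\<delta> > 0"
  shows "\<forall>\<^sub>F \<epsilon> in at_right 0. \<exists>\<kappa>>0. \<exists>T0\<ge>0. \<forall>T\<ge>T0. \<forall>s l :: real. \<forall>A. 0 \<le> s \<longrightarrow> 0 \<le> l \<longrightarrow> l \<le> T \<longrightarrow> A \<in> sets (F s) \<longrightarrow>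
    \<kappa> * exp (- ((escape p + \<theta>) * l)) * prob A \<le>
      prob (A \<inter> {\<omega> \<in> space M. occ \<epsilon> (circle_sinsq p) s (s + l) \<omega> \<le> \<delta> * T})"
proof -
  define g where "g = circle_sinsq p"
  have g: "continuous_on UNIV g" "\<And>q. 0 \<le> g q"
    unfolding g_def by (rule continuous_circle_sinsq, rule circle_sinsq_range)
  define \<beta> where "\<beta> = escape p + \<theta>"
  have \<beta>: "\<beta> > 0"
    using escape_nonneg[of p] \<open>\<theta> > 0\<close> by (simp add: \<beta>_def)
  \<comment> \<open>A path that exceeds the allowed occupation \<open>\<delta> * T\<close>
    contributes at most \<open>exp (- ((\<beta> + 1) * T))\<close> to the moment. The lower bound
    has the factor \<open>exp (- (\<beta> * l))\<close> with \<open>l \<le> T\<close>, hence a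
    surplus of \<open>exp T\<close>. The allowance is measured in \<open>T\<close>, not
    \<open>l\<close>, because a zero of small weight is visited only briefly.\<close>
  define K where "K = (\<beta> + 1) / \<delta>"
  have K: "K \<ge> 0" "K * \<delta> = \<beta> + 1"
    using \<beta> \<open>\<delta> > 0\<close> by (auto simp: K_def)
  define c where "c q = 0 + (- K) * g q" for q
  have c: "continuous_on UNIV c"
    unfolding c_def[abs_def] by (intro continuous_intros g)
  have \<Lambda>: "- \<beta> \<le> \<Lambda> c - \<theta>"
    using \<Lambda>_ge[OF p, of c] circle_sinsq_eq_0_iff[of p p] by (simp add: c_def g_def \<beta>_def)
  show ?thesis
    using eventually_tilted[OF c \<open>\<theta> > 0\<close>] eventually_at_right_less
  proof eventually_elim
    case (elim \<epsilon>)
    obtain \<kappa> where \<kappa>: "exp_moments \<epsilon> c \<kappa> (\<Lambda> c - \<theta>) (\<Lambda> c + \<theta>)"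
      using elim(1) by blast
    then have "\<kappa> > 0"
      by (simp add: exp_moments_def)
    \<comment> \<open>From \<open>T \<ge> ln (2 / \<kappa>)\<close> on, the surplus makes the bad
      paths contribute at most half of the lower bound; the other half remains as the constant
      \<open>\<kappa> / 2\<close>.\<close>
    show ?case
    proof (rule exI[of _ "\<kappa> / 2"], rule conjI[rotated], rule exI[of _ "max 0 (ln (2 / \<kappa>))"], intro conjI allI impI)
      fix T s l :: real and A
      assume T: "max 0 (ln (2 / \<kappa>)) \<le> T" and s: "0 \<le> s" and l: "0 \<le> l" "l \<le> T" and A: "A \<in> sets (F s)"
      have A': "A \<in> sets M"
        using A F_subalgebra by blast
      have sl: "s \<le> s + l"
        using l by simp
      define G where "G = {\<omega> \<in> space M. occ \<epsilon> g s (s + l) \<omega> \<le> \<delta> * T}"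
      have G: "G \<in> sets M"
        using F_measurable[OF occ_measurable[OF g(1) elim(2) s sl]] unfolding G_def by measurable
      have AG: "A \<inter> G \<in> sets M"
        using A' G by blast
      note * = exp_momentsD[OF \<kappa> s sl A]
      have int: "integrable M (indicator B :: 'w \<Rightarrow> real)" if "B \<in> sets M" for B
        using that by (simp add: less_top[symmetric])
      have pt: "indicator A \<omega> * exp (occ \<epsilon> c s (s + l) \<omega>) \<le> indicator (A \<inter> G) \<omega> + indicator A \<omega> * exp (- ((\<beta> + 1) * T))"
        if \<omega>: "\<omega> \<in> space M" for \<omega>
      proof -
        have occ: "occ \<epsilon> c s (s + l) \<omega> = - (K * occ \<epsilon> g s (s + l) \<omega>)"
          unfolding c_def[abs_def] using occ_affine[OF g(1) elim(2) \<omega> s l(1), of 0 "- K"] by simp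
        have "0 \<le> occ \<epsilon> g s (s + l) \<omega>"
          unfolding occ_def by (intro integral_nonneg c_X_integrable g elim \<omega> s)
        then have 1: "exp (occ \<epsilon> c s (s + l) \<omega>) \<le> 1"
          using K(1) by (simp add: occ)
        have 2: "exp (occ \<epsilon> c s (s + l) \<omega>) \<le> exp (- ((\<beta> + 1) * T))" if "\<omega> \<notin> G"
        proof -
          have "K * (\<delta> * T) \<le> K * occ \<epsilon> g s (s + l) \<omega>"
            using that \<omega> K(1) by (intro mult_left_mono) (auto simp: G_def)
          then show ?thesis
            by (simp add: occ K(2) flip: mult.assoc)
        qed
        show ?thesis
          using 1 2 by (cases "\<omega> \<in> A"; cases "\<omega> \<in> G") (auto simp: add_increasing2)
      qed
      have "expectation (\<lambda>\<omega>. indicator A \<omega> * exp (occ \<epsilon> c s (s + l) \<omega>))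
          \<le> expectation (\<lambda>\<omega>. indicator (A \<inter> G) \<omega> + indicator A \<omega> * exp (- ((\<beta> + 1) * T)))"
        by (rule integral_mono) (use *(1) pt int[OF A'] int[OF AG] in auto)
      also have "\<dots> = prob (A \<inter> G) + prob A * exp (- ((\<beta> + 1) * T))"
        using int[OF A'] int[OF AG] A' AG by simp
      finally have up: "expectation (\<lambda>\<omega>. indicator A \<omega> * exp (occ \<epsilon> c s (s + l) \<omega>)) \<le> prob (A \<inter> G) + prob A * exp (- ((\<beta> + 1) * T))" .
      have "\<kappa> * exp (- (\<beta> * l)) * prob A \<le> \<kappa> * exp ((\<Lambda> c - \<theta>) * (s + l - s)) * prob A"
        using \<open>\<kappa> > 0\<close> mult_right_mono[OF \<Lambda> l(1)] by (intro mult_right_mono mult_left_mono) auto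
      also have "\<dots> \<le> expectation (\<lambda>\<omega>. indicator A \<omega> * exp (occ \<epsilon> c s (s + l) \<omega>))"
        by (rule *(2))
      finally have low: "\<kappa> * exp (- (\<beta> * l)) * prob A \<le> prob (A \<inter> G) + prob A * exp (- ((\<beta> + 1) * T))"
        using up by linarith
      have "exp (- T) \<le> exp (- ln (2 / \<kappa>))"
        using T by simp
      also have "\<dots> = \<kappa> / 2"
        using \<open>\<kappa> > 0\<close> by (simp add: exp_minus)
      finally have "exp (- (\<beta> * T)) * exp (- T) \<le> exp (- (\<beta> * l)) * (\<kappa> / 2)"
        using \<beta> l by (intro mult_mono) auto
      then have "prob A * exp (- ((\<beta> + 1) * T)) \<le> prob A * (exp (- (\<beta> * l)) * (\<kappa> / 2))"
        by (intro mult_left_mono) (simp_all add: algebra_simps flip: exp_add)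
      then have "\<kappa> / 2 * exp (- (\<beta> * l)) * prob A \<le> prob (A \<inter> G)"
        using low by (simp add: algebra_simps)
      then show "\<kappa> / 2 * exp (- ((escape p + \<theta>) * l)) * prob A \<le>
          prob (A \<inter> {\<omega> \<in> space M. occ \<epsilon> (circle_sinsq p) s (s + l) \<omega> \<le> \<delta> * T})"
        by (simp add: \<beta>_def G_def g_def)
    qed (use \<open>\<kappa> > 0\<close> in auto)
  qed
qed

text \<open>The outcome of spending the times \<open>T * w p\<close> near the listed points in turn;
  \<open>r\<close> is the total allowance for occupation elsewhere.\<close>

definition visits :: "real \<Rightarrow> circle list \<Rightarrow> (circle \<Rightarrow> real) \<Rightarrow> real \<Rightarrow> real \<Rightarrow> 'w \<Rightarrow> bool"
  where "visits \<epsilon> ps w r T \<omega> \<longleftrightarrow> (\<forall>c \<eta> K. modulus c \<eta> K \<longrightarrow>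
    \<bar>occ \<epsilon> c 0 (T * (\<Sum>p\<leftarrow>ps. w p)) \<omega> - T * (\<Sum>p\<leftarrow>ps. w p * c p)\<bar>
      \<le> \<eta> * (T * (\<Sum>p\<leftarrow>ps. w p)) + K * r)"

text \<open>The event is required to belong to \<open>F\<close> at the end of the tour, so that a
  further stay can be conditioned on it. The allowance is \<open>\<delta> * T\<close> for each point
  of the list.\<close>

definition visitable :: "real \<Rightarrow> circle list \<Rightarrow> (circle \<Rightarrow> real) \<Rightarrow> real \<Rightarrow> real \<Rightarrow> real \<Rightarrow> real \<Rightarrow> bool"
  where "visitable \<epsilon> ps w \<theta> \<delta> \<kappa> T0 \<longleftrightarrow> 0 < \<kappa> \<and> 0 \<le> T0 \<and> (\<forall>T\<ge>T0. \<exists>E\<in>sets (F (T * (\<Sum>p\<leftarrow>ps. w p))).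
    \<kappa> * exp (- (\<Sum>p\<leftarrow>ps. w p * (escape p + \<theta>)) * T) \<le> prob E \<and>
    (\<forall>\<omega>\<in>E. visits \<epsilon> ps w (real (length ps) * (\<delta> * T)) T \<omega>))"

text \<open>Induction on the list, its head being visited last. The event for the tail is in the
  past of the new stay, so the conditional estimate multiplies the probabilities, while deviations
  and allowances add.\<close>

lemma eventually_visit_in_turn:
  fixes w :: "circle \<Rightarrow> real"
  assumes "set ps \<subseteq> zeros" "\<And>p. p \<in> set ps \<Longrightarrow> 0 \<le> w p \<and> w p \<le> 1" "\<theta> > 0" "\<delta> > 0"
  shows "\<forall>\<^sub>F \<epsilon> in at_right 0. \<exists>\<kappa> T0. visitable \<epsilon> ps w \<theta> \<delta> \<kappa> T0"
  using assms(1,2)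
proof (induction ps)
  case Nil
  have "space M \<in> sets (F 0)"
    using sets.top[of "F 0"] by (simp add: space_F)
  then show ?case
    by (intro always_eventually allI exI[of _ 1]) (auto simp: visitable_def visits_def prob_space occ_def intro!: bexI[of _ "space M"])
next
  case (Cons p ps)
  have p: "p \<in> zeros" "0 \<le> w p" "w p \<le> 1"
    using Cons.prems(1) Cons.prems(2)[of p] by auto
  have "\<forall>\<^sub>F \<epsilon> in at_right 0. \<exists>\<kappa> T0. visitable \<epsilon> ps w \<theta> \<delta> \<kappa> T0"
    by (rule Cons.IH) (use Cons.prems in auto)
  then show ?case
    using eventually_stay[OF p(1) \<open>\<theta> > 0\<close> \<open>\<delta> > 0\<close>] eventually_at_right_less
  proof eventually_elim
    case (elim \<epsilon>)
    obtain \<kappa>1 T1 where E: "visitable \<epsilon> ps w \<theta> \<delta> \<kappa>1 T1"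
      using elim(1) by blast
    obtain \<kappa>2 T2 where \<kappa>2: "\<kappa>2 > 0" and T2: "T2 \<ge> 0" and stay: "\<forall>T\<ge>T2. \<forall>s l :: real. \<forall>A. 0 \<le> s \<longrightarrow> 0 \<le> l \<longrightarrow> l \<le> T \<longrightarrow> A \<in> sets (F s) \<longrightarrow>
      \<kappa>2 * exp (- ((escape p + \<theta>) * l)) * prob A \<le>
        prob (A \<inter> {\<omega> \<in> space M. occ \<epsilon> (circle_sinsq p) s (s + l) \<omega> \<le> \<delta> * T})"
      using elim(2) by (elim exE conjE)
    have \<kappa>1: "\<kappa>1 > 0" "T1 \<ge> 0"
      using E by (simp_all add: visitable_def)
    have "visitable \<epsilon> (p # ps) w \<theta> \<delta> (\<kappa>2 * \<kappa>1) (max T1 T2)"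
      unfolding visitable_def
    proof (intro conjI allI impI)
      fix T :: real
      assume "max T1 T2 \<le> T"
      then have T: "T1 \<le> T" "T2 \<le> T"
        by auto
      define S where "S = (\<Sum>p\<leftarrow>ps. w p)"
      define s where "s = T * S"
      define l where "l = T * w p"
      have "S \<ge> 0"
        unfolding S_def using Cons.prems(2) by (intro sum_list_nonneg) auto
      then have s: "0 \<le> s" and l: "0 \<le> l" "l \<le> T"
        using T \<kappa>1 p mult_left_mono[OF p(3), of T] by (auto simp: s_def l_def)
      have sl: "T * (\<Sum>p\<leftarrow>p # ps. w p) = s + l"
        by (simp add: s_def l_def S_def algebra_simps)
      obtain A where A: "A \<in> sets (F s)" and pA: "\<kappa>1 * exp (- (\<Sum>p\<leftarrow>ps. w p * (escape p + \<theta>)) * T) \<le> prob A"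
        and dev: "\<forall>\<omega>\<in>A. visits \<epsilon> ps w (real (length ps) * (\<delta> * T)) T \<omega>"
        using E[unfolded visitable_def, THEN conjunct2, THEN conjunct2, rule_format, OF T(1)]
        unfolding S_def s_def by (elim bexE conjE)
      define G where "G = {\<omega> \<in> space M. occ \<epsilon> (circle_sinsq p) s (s + l) \<omega> \<le> \<delta> * T}"
      have "{\<omega> \<in> space (F (s + l)). occ \<epsilon> (circle_sinsq p) s (s + l) \<omega> \<le> \<delta> * T} \<in> sets (F (s + l))"
        using occ_measurable[OF continuous_circle_sinsq elim(3) s, of "s + l" p] l(1) by (simp add: borel_measurable_iff_le)
      then have AG: "A \<inter> G \<in> sets (F (s + l))"
        using A sets_F_mono[of s "s + l"] l unfolding G_def space_F by auto
      have "\<kappa>2 * \<kappa>1 * exp (- (\<Sum>p\<leftarrow>p # ps. w p * (escape p + \<theta>)) * T)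
          = \<kappa>2 * exp (- ((escape p + \<theta>) * l)) * (\<kappa>1 * exp (- (\<Sum>p\<leftarrow>ps. w p * (escape p + \<theta>)) * T))"
        by (simp add: l_def algebra_simps flip: exp_add)
      also have "\<dots> \<le> \<kappa>2 * exp (- ((escape p + \<theta>) * l)) * prob A"
        using pA \<kappa>2 by (intro mult_left_mono) auto
      also have "\<dots> \<le> prob (A \<inter> G)"
        unfolding G_def using stay[rule_format, of T s l A] T s l A by simp
      finally have prob: "\<kappa>2 * \<kappa>1 * exp (- (\<Sum>p\<leftarrow>p # ps. w p * (escape p + \<theta>)) * T) \<le> prob (A \<inter> G)" .
      have "\<bar>occ \<epsilon> c 0 (s + l) \<omega> - T * (\<Sum>p\<leftarrow>p # ps. w p * c p)\<bar> \<le> \<eta> * (s + l) + K * (real (length (p # ps)) * (\<delta> * T))"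
        if \<omega>: "\<omega> \<in> A \<inter> G" and mod: "modulus c \<eta> K" for \<omega> c \<eta> K
      proof -
        have \<omega>M: "\<omega> \<in> space M"
          using \<omega> by (simp add: G_def)
        have c: "continuous_on UNIV c" and K: "0 \<le> K"
          using mod by (auto simp: modulus_def)
        have 1: "\<bar>occ \<epsilon> c 0 s \<omega> - T * (\<Sum>p\<leftarrow>ps. w p * c p)\<bar> \<le> \<eta> * s + K * (real (length ps) * (\<delta> * T))"
          using dev \<omega> mod by (simp add: visits_def s_def S_def)
        have "\<bar>occ \<epsilon> c s (s + l) \<omega> - c p * l\<bar> \<le> \<eta> * l + K * occ \<epsilon> (circle_sinsq p) s (s + l) \<omega>"
          by (rule occ_deviation[OF c continuous_circle_sinsq _ elim(3) \<omega>M s l(1)]) (use mod p(1) in \<open>simp add: modulus_def\<close>)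
        moreover have "K * occ \<epsilon> (circle_sinsq p) s (s + l) \<omega> \<le> K * (\<delta> * T)"
          using \<omega> K by (intro mult_left_mono) (auto simp: G_def)
        ultimately have 2: "\<bar>occ \<epsilon> c s (s + l) \<omega> - c p * l\<bar> \<le> \<eta> * l + K * (\<delta> * T)"
          by linarith
        have "occ \<epsilon> c 0 (s + l) \<omega> = occ \<epsilon> c 0 s \<omega> + occ \<epsilon> c s (s + l) \<omega>"
          by (rule occ_combine[OF c elim(3) \<omega>M]) (use s l in auto)
        moreover have "T * (\<Sum>p\<leftarrow>p # ps. w p * c p) = c p * l + T * (\<Sum>p\<leftarrow>ps. w p * c p)"
          by (simp add: l_def algebra_simps)
        moreover have "\<eta> * (s + l) + K * (real (length (p # ps)) * (\<delta> * T))
            = (\<eta> * s + K * (real (length ps) * (\<delta> * T))) + (\<eta> * l + K * (\<delta> * T))"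
          by (simp add: algebra_simps)
        ultimately show ?thesis
          using 1 2 by linarith
      qed
      then show "\<exists>E\<in>sets (F (T * (\<Sum>p\<leftarrow>p # ps. w p))).
        \<kappa>2 * \<kappa>1 * exp (- (\<Sum>p\<leftarrow>p # ps. w p * (escape p + \<theta>)) * T) \<le> prob E \<and>
        (\<forall>\<omega>\<in>E. visits \<epsilon> (p # ps) w (real (length (p # ps)) * (\<delta> * T)) T \<omega>)"
        unfolding sl visits_def by (intro bexI[OF _ AG] conjI prob ballI allI impI)
    qed (use \<kappa>1 \<kappa>2 in auto)
    then show ?case
      by blast
  qed
qed

text \<open>Where the rate is infinite there is nothing to show. Otherwise the measure is a mixture,
  and a tour of its zeros with times proportional to the weights keeps the empirical measure in a
  neighbourhood inside \<open>Op\<close>, at the rate given by the weighted sum of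
  \<open>escape\<close>.\<close>

lemma lower_bound:
  assumes Op: "openin weak_topology Op"
  shows "- (INF \<mu>\<in>Op. rate_function a b \<mu>) \<le>
      Liminf (at_right 0) (\<lambda>\<epsilon>. Liminf at_top (\<lambda>T::real.
        ereal (1 / T) * eln (prob {\<omega>\<in>space M. empirical_measure (X \<epsilon>) T \<omega> \<in> Op})))"
    (is "_ \<le> ?L")
proof -
  have "- ?L \<le> rate_function a b \<mu>" if \<mu>: "\<mu> \<in> Op" for \<mu>
  proof (cases "rate_function a b \<mu> = \<infinity>")
    case False
    have \<mu>P: "\<mu> \<in> circle_probs"
      using \<mu> openin_subset[OF Op] by (auto simp: topspace_weak_topology)
    show ?thesis
    proof (rule mixture_if_rate_finite[OF \<mu>P False], goal_cases)
      case (1 w)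
      note mix = 1(1) and w = mixtureD(1,2)[OF 1(1)] and rate = 1(2)
      define R where "R = (\<Sum>p\<in>zeros. w p * escape p)"
      have w1: "w p \<le> 1" if "p \<in> zeros" for p
        using member_le_sum[OF that _ finite_zeros', of w] w by auto
      obtain ps where ps: "set ps = zeros" "distinct ps"
        using finite_distinct_list[OF finite_zeros'] by blast
      have sum: "(\<Sum>p\<leftarrow>ps. f p) = (\<Sum>p\<in>zeros. f p)" for f :: "circle \<Rightarrow> real"
        using ps by (simp add: sum_list_distinct_conv_sum_set)
      define N where "N = length ps"
      have N: "N > 0"
        using ps zeros_nonempty by (auto simp: N_def)
      have main: "ereal (- R - \<theta>) \<le> ?L" if "\<theta> > 0" for \<theta> :: real
      proof (rule open_neighbourhood[OF Op \<mu> mix], goal_cases)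
        case (1 \<delta>)
        note \<delta> = 1(1) and nbhd = 1(2)
        \<comment> \<open>Each of the \<open>N\<close> stays receives an equal share of the
          allowance \<delta> of the neighbourhood.\<close>
        have \<delta>N: "\<delta> / N > 0"
          using \<delta> N by simp
        have sum_R: "- (\<Sum>p\<in>zeros. w p * (escape p + \<theta>)) = - R - \<theta>"
          using w(2) by (simp add: R_def distrib_left sum.distrib flip: sum_distrib_right)
        have len: "real (length ps) * (\<delta> / N * T) = \<delta> * T" for T
          using N by (simp add: N_def)
        have "\<forall>\<^sub>F \<epsilon> in at_right 0. \<exists>\<kappa> T0. visitable \<epsilon> ps w \<theta> (\<delta> / N) \<kappa> T0"
          by (rule eventually_visit_in_turn[OF _ _ \<open>\<theta> > 0\<close> \<delta>N]) (use ps w w1 in auto)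
        then have "\<forall>\<^sub>F \<epsilon> in at_right 0. ereal (- R - \<theta>) \<le> Liminf at_top (\<lambda>T::real.
          ereal (1 / T) * eln (prob {\<omega>\<in>space M. empirical_measure (X \<epsilon>) T \<omega> \<in> Op}))"
          using eventually_at_right_less
        proof eventually_elim
          case (elim \<epsilon>)
          obtain \<kappa> T0 where E: "visitable \<epsilon> ps w \<theta> (\<delta> / N) \<kappa> T0"
            using elim(1) by blast
          then have "\<kappa> > 0"
            by (simp add: visitable_def)
          show ?case
          proof (rule Liminf_log_probability_ge[OF _ \<open>\<kappa> > 0\<close>])
            fix T :: real
            assume T: "T \<ge> max T0 1"
            then have T0: "T \<ge> T0" "T > 0"
              by auto
            obtain A where A: "A \<in> sets (F T)" and pA: "\<kappa> * exp ((- R - \<theta>) * T) \<le> prob A"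
              and dev: "\<forall>\<omega>\<in>A. visits \<epsilon> ps w (\<delta> * T) T \<omega>"
              using E[unfolded visitable_def sum ps(1) w(2) sum_R len mult_1_right, THEN conjunct2, THEN conjunct2, rule_format, OF T0(1)]
              by (elim bexE conjE)
            have "empirical_measure (X \<epsilon>) T \<omega> \<in> Op" if "\<omega> \<in> A" "\<omega> \<in> space M" for \<omega>
            proof (rule nbhd, unfold near_def, intro conjI allI impI empirical_probability elim(2) that(2) T0(2))
              fix c \<eta> K
              assume mod: "modulus c \<eta> K"
              then have c: "continuous_on UNIV c"
                by (simp add: modulus_def)
              have "\<bar>occ \<epsilon> c 0 T \<omega> - T * (\<Sum>p\<in>zeros. w p * c p)\<bar> \<le> \<eta> * T + K * (\<delta> * T)"
                using dev \<open>\<omega> \<in> A\<close> mod by (simp add: visits_def sum ps(1) w(2))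
              then have "\<bar>occ \<epsilon> c 0 T \<omega> - T * (\<Sum>p\<in>zeros. w p * c p)\<bar> / T \<le> (\<eta> * T + K * (\<delta> * T)) / T"
                using T0(2) by (intro divide_right_mono) auto
              moreover have "\<bar>occ \<epsilon> c 0 T \<omega> - T * (\<Sum>p\<in>zeros. w p * c p)\<bar> / T = \<bar>occ \<epsilon> c 0 T \<omega> / T - (\<Sum>p\<in>zeros. w p * c p)\<bar>"
                unfolding abs_div_pos[OF T0(2)] using T0(2) by (simp add: diff_divide_distrib)
              moreover have "(\<eta> * T + K * (\<delta> * T)) / T = \<eta> + K * \<delta>"
                using T0(2) by (simp add: add_divide_distrib)
              ultimately show "\<bar>integral\<^sup>L (empirical_measure (X \<epsilon>) T \<omega>) c - (\<Sum>p\<in>zeros. w p * c p)\<bar> \<le> \<eta> + K * \<delta>"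
                by (simp add: empirical_integral[OF elim(2) that(2) T0(2) c])
            qed
            then have "A \<subseteq> {\<omega>\<in>space M. empirical_measure (X \<epsilon>) T \<omega> \<in> Op}"
              using sets.sets_into_space[OF A] by (auto simp: space_F)
            then have "prob A \<le> prob {\<omega>\<in>space M. empirical_measure (X \<epsilon>) T \<omega> \<in> Op}"
              by (rule finite_measure_mono[OF _ empirical_event[OF elim(2) T0(2) Op]])
            then show "\<kappa> * exp ((- R - \<theta>) * T) \<le> prob {\<omega>\<in>space M. empirical_measure (X \<epsilon>) T \<omega> \<in> Op}"
              using pA by linarith
          qed
        qed
        then show ?case
          by (rule Liminf_bounded)
      qed
      have "- ?L \<le> ereal R"
      proof (rule ereal_le_epsilon2)
        fix e :: real
        assume "e > 0"
        from main[OF this] have "- ?L \<le> - ereal (- R - e)"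
          by (subst ereal_minus_le_minus)
        then show "- ?L \<le> ereal R + ereal e"
          by (simp add: algebra_simps)
      qed
      then show ?case
        using rate unfolding R_def by (rule order_trans)
    qed
  qed simp
  then have "- ?L \<le> (INF \<mu>\<in>Op. rate_function a b \<mu>)"
    by (rule INF_greatest)
  then show ?thesis
    by (subst ereal_minus_le_minus[symmetric]) simp
qed

end

theorem corollary6p8:
  fixes \<sigma> b a :: "circle \<Rightarrow> real"
    and M :: "'w measure"
    and F :: "real \<Rightarrow> 'w measure"
    and W :: "real \<Rightarrow> 'w \<Rightarrow> real"
    and X :: "real \<Rightarrow> real \<Rightarrow> 'w \<Rightarrow> circle"
    and x :: circle
    and Op Cl :: "circle measure set"
  assumes "C_on 2 UNIV \<sigma>" and "C_on 2 UNIV b"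
    and "\<And>p. a p = (\<sigma> p)\<^sup>2 / 2" and "\<And>p. a p > 0"
    and "\<exists>p. b p > 0" and "\<exists>p. b p < 0"
    and "finite {p. b p = 0}"
    and "\<And>p. b p = 0 \<Longrightarrow> (\<exists>m. zero_of_order b m p) \<or> flat_zero b p"
    and "brownian_motion M F W"
    and "\<And>\<epsilon>. \<epsilon> > 0 \<Longrightarrow> circle_diffusion M F W (\<lambda>p. sqrt \<epsilon> * \<sigma> p) b x (X \<epsilon>)"
    and "openin weak_topology Op" and "closedin weak_topology Cl"
  shows "- (INF \<mu>\<in>Op. rate_function a b \<mu>) \<le>
      Liminf (at_right 0) (\<lambda>\<epsilon>. Liminf at_top (\<lambda>T::real.
        ereal (1 / T) * eln (measure M {\<omega>\<in>space M. empirical_measure (X \<epsilon>) T \<omega> \<in> Op})))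
    \<and> Limsup (at_right 0) (\<lambda>\<epsilon>. Limsup at_top (\<lambda>T::real.
        ereal (1 / T) * eln (measure M {\<omega>\<in>space M. empirical_measure (X \<epsilon>) T \<omega> \<in> Cl})))
      \<le> - (INF \<mu>\<in>Cl. rate_function a b \<mu>)"
proof -
  interpret small_noise \<sigma> b a M F W X x
    by (intro small_noise.intro circle_field.intro small_noise_axioms.intro) (use assms in auto)
  show ?thesis
    by (intro conjI lower_bound upper_bound assms)
qed

end
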